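(* In the setting of the context (reducible case $\rho_2=\mu_q$), for $1\le i\le p$, $1\le k\le r_i$, $1\le h\le\ell_{i,k}$ one has, for $x\in\mathcal S_i^{\pm}$, $$U'_{t_i,k,h}(x)=\sum_{\tilde k=1}^{q-1}\sum_{\tilde h=1}^{m_{\tilde k}}C^{\prime\pm}_{t_{p+1},\tilde k,\tilde h;t_i,k,h}\,U'_{t_{p+1},\tilde k,\tilde h}(x)+\mathrm{hol}(x-t_{p+1})$$ with $$C^{\prime\pm}_{t_{p+1},\tilde k,\tilde h;t_i,k,h}=e^{\pm\pi\sqrt{-1}\lambda_{i,k}}(t_i-t_{p+1})^{2\lambda_{i,k}-\rho_1-\mu_q}\frac{\Gamma(\mu_{\tilde k}+1)\Gamma(\mu_{\tilde k}-\rho_1-\mu_q)}{\Gamma(\mu_{\tilde k}-\rho_1)\Gamma(\mu_{\tilde k}-\mu_q)}\,c_{\infty,\tilde k,\tilde h;t'_i,k,h}\quad(1\le\tilde k\le q-1,\ 1\le\tilde h\le m_{\tilde k}),$$ where the double signs correspond.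
   Context: **System.** Let $t_1,\dots,t_{p+1}\in\mathbb C$ be distinct, no three on a straight line; $T=\mathrm{diag}(t_1I_{n_1},\dots,t_pI_{n_p})$, $n=n_1+\dots+n_p$. Let $A\in M(n;\mathbb C)$, partitioned in blocks $A_{ij}$ like $T$, have diagonal blocks $A_{ii}=\mathrm{diag}(\lambda_{i,1}I_{\ell_{i,1}},\dots,\lambda_{i,r_i}I_{\ell_{i,r_i}})$ ($\lambda_{i,k}$ distinct for fixed $i$), and let $P\in GL(n;\mathbb C)$ be such that $A'=P^{-1}AP=\mathrm{diag}(\mu_1I_{m_1},\dots,\mu_qI_{m_q})$ ($\mu_k$ distinct). Let $\rho_1\in\mathbb C$ and $\rho_2=\mu_q$. Put $$\mathcal A_P=\begin{pmatrix}A&P\\-(A'-\rho_1I_n)(A'-\rho_2I_n)P^{-1}&(\rho_1+\rho_2)I_n-A'\end{pmatrix}.$$ Since $\rho_2=\mu_q$, $\mathcal A_P=\begin{pmatrix}\mathcal A'_P&*\\O&\rho_1I_{m_q}\end{pmatrix}$ with $\mathcal A'_P\in M(2n-m_q;\mathbb C)$. The system considered is $$(xI_{2n-m_q}-\mathcal T')\frac{dU'}{dx}=\mathcal A'_PU',\qquad \mathcal T'=\begin{pmatrix}T&\\&t_{p+1}I_{n-m_q}\end{pmatrix}.$$ **Assumptions.** None of the following is an integer: $\lambda_{i,k}$; $\lambda_{i,k}-\lambda_{i,h}$ ($k\ne h$); $\mu_k$; $\mu_k-\mu_h$ ($k\neq h$); $\lambda_{i,k}-\mu_h$; $\rho_1$;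 $\rho_1-\lambda_{i,k}$; $\rho_1-\mu_k$ ($1\le k\le q$) (all admissible indices). **Sectors.** Arguments $\theta_i=\arg(t_i-t_{p+1})$ are fixed with $\theta_1<\dots<\theta_p<\theta_1+2\pi$, and $\theta_{p+1}$ is a fixed real number with $\theta_p<\theta_{p+1}<\theta_1+2\pi$; $\theta_0=\theta_{p+1}-2\pi$. With $\delta>0$ fixed and sufficiently small, $\mathcal S_i^+=\{\theta_i<\arg(x-t_{p+1})<\min(\theta_{i+1}-\delta,\theta_i+\pi)\}$, $\mathcal S_i^-=\{\max(\theta_{i-1}+\delta,\theta_i-\pi)<\arg(x-t_{p+1})<\theta_i\}$ ($1\le i\le p$). In $\mathcal S_i^\pm$ powers of $x-t_{p+1}$ use this argument; $\arg(x-t_i)\in(\theta_i,\theta_i+\pi)$ in $\mathcal S_i^+$ and $\in(\theta_i-\pi,\theta_i)$ in $\mathcal S_i^-$. Powers of $t_i-t_{p+1}$ use $\arg=\theta_i$. **Local solutions.** $\varepsilon_m(k)$ is the $k$-th unit $m$-vector; $N=2n-m_q$. The following are the unique solutions of the system of the given form (convergent series), continued analytically in the sectors: $U'_{t_i,k,h}(x)=(x-t_i)^{\lambda_{i,k}}\{\varepsilon_{N}(n_1+\dots+n_{i-1}+\ell_{i,1}+\dots+\ell_{i,k-1}+h)+\sum_{m\ge1}G'(m)(x-t_i)^m\}$ ($1\le i\le p$); $U'_{t_{p+1},k,h}(x)=(x-t_{p+1})^{\rho_1+\mu_q-\mu_k}\{\varepsilon_{N}(n+m_1+\dots+m_{k-1}+h)+\sum_{m\ge1}G'(m)(x-t_{p+1})^m\}$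 ($1\le k\le q-1$, $1\le h\le m_k$). $\mathrm{hol}(x-a)$ denotes a vector function holomorphic in a neighbourhood of $x=a$. **Underlying system.** Fix $\eta_0\in\mathbb C$; $t'_i=\eta_0+\frac1{t_i-t_{p+1}}$, $T'=\mathrm{diag}(t'_1I_{n_1},\dots,t'_pI_{n_p})$, $\theta'_i=\arg(t'_i-\eta_0)=-\theta_i$, $\theta'_\infty=-\theta_{p+1}$. The underlying system is $(\zeta I_n-T')\frac{dw}{d\zeta}=(\rho I_n+A)w$. For $\rho=0$ it has the unique solutions $w_{t'_i,k,h}(0;\zeta)=(\zeta-t'_i)^{\lambda_{i,k}}\{\varepsilon_n(n_1+\dots+n_{i-1}+\ell_{i,1}+\dots+\ell_{i,k-1}+h)+O(\zeta-t'_i)\}$ near $t'_i$ and $w_{\infty,k,h}(0;\zeta)=(\zeta-\eta_0)^{\mu_k}\{P\varepsilon_n(m_1+\dots+m_{k-1}+h)+O((\zeta-\eta_0)^{-1})\}$ near $\infty$ ($O$-terms convergent power series). Let $$\check{\mathcal P}'=\mathbb C\setminus\Bigl(\bigcup_{i=1}^p\{\eta_0+(t'_i-\eta_0)s:0\le s\le1\}\cup\{\eta_0+se^{\sqrt{-1}\theta'_\infty}:s\ge0\}\Bigr),$$ with branches $\arg(\zeta-\eta_0)\in(\theta'_\infty,\theta'_\infty+2\pi)$ and, near $t'_i$, $\arg(\zeta-t'_i)\in(\theta'_i-\pi,\theta'_i+\pi)$. The constants $c_{\infty,\tilde k,\tilde h;t'_i,k,h}$ are the connection coefficients of the underlying system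 with $\rho=0$, defined in $\check{\mathcal P}'$ by $w_{t'_i,k,h}(0;\zeta)=\sum_{\tilde k=1}^q\sum_{\tilde h=1}^{m_{\tilde k}}c_{\infty,\tilde k,\tilde h;t'_i,k,h}\,w_{\infty,\tilde k,\tilde h}(0;\zeta)$.
   Formalization: Additionally assumes that ρ₁+μ_q−μ_k is not an integer for 1≤k≤q−1; otherwise Γ(μ_k−ρ₁−μ_q) has a pole or the solutions U'_{t_{p+1},k,h} are not uniquely defined. *)

theory Defs
  imports "HOL-Analysis.Analysis" "Jordan_Normal_Form.Matrix"
begin

section \<open>Arguments, powers, sectors\<close>

text \<open>The argument of \<open>z\<close> lying in \<open>[\<theta>, \<theta> + 2\<pi>)\<close>.\<close>

definition arg_from :: "real \<Rightarrow> complex \<Rightarrow> real" where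
  "arg_from \<theta> z = \<theta> + Arg2pi (cis (- \<theta>) * z)"

lemma arg_from:
  "\<theta> \<le> arg_from \<theta> z" "arg_from \<theta> z < \<theta> + 2 * pi" "is_Arg z (arg_from \<theta> z)"
proof -
  let ?w = "cis (- \<theta>) * z"
  have w: "0 \<le> Arg2pi ?w" "Arg2pi ?w < 2 * pi" "is_Arg ?w (Arg2pi ?w)"
    using Arg2pi[of ?w] by auto
  show "\<theta> \<le> arg_from \<theta> z" "arg_from \<theta> z < \<theta> + 2 * pi"
    using w by (auto simp: arg_from_def)
  have "z = cis \<theta> * ?w"
    by (simp add: cis_mult flip: mult.assoc)
  also have "?w = of_real (cmod z) * cis (Arg2pi ?w)"
    using w(3) by (simp add: is_Arg_def norm_mult cis_conv_exp)
  finally have "z = of_real (cmod z) * (cis \<theta> * cis (Arg2pi ?w))"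
    by (simp add: mult_ac)
  then show "is_Arg z (arg_from \<theta> z)"
    by (simp add: is_Arg_def arg_from_def cis_mult flip: cis_conv_exp of_real_add)
qed

text \<open>The power \<open>z^a\<close> formed with the prescribed argument \<open>\<phi>\<close> of \<open>z\<close>.\<close>

definition cpow_arg :: "complex \<Rightarrow> real \<Rightarrow> complex \<Rightarrow> complex" where
  "cpow_arg z \<phi> a = exp (a * (of_real (ln (cmod z)) + \<i> * of_real \<phi>))"

definition sector :: "complex \<Rightarrow> real \<Rightarrow> real \<Rightarrow> complex set" where
  "sector c lo hi = {c + rcis r \<phi> | r \<phi>. 0 < r \<and> lo < \<phi> \<and> \<phi> < hi}"

definition S_plus :: "complex \<Rightarrow> (nat \<Rightarrow> real) \<Rightarrow> real \<Rightarrow> nat \<Rightarrow> complex set" where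
  "S_plus c \<theta> \<delta> i = sector c (\<theta> i) (min (\<theta> (i + 1) - \<delta>) (\<theta> i + pi))"

definition S_minus :: "complex \<Rightarrow> (nat \<Rightarrow> real) \<Rightarrow> real \<Rightarrow> nat \<Rightarrow> complex set" where
  "S_minus c \<theta> \<delta> i = sector c (max (\<theta> (i - 1) + \<delta>) (\<theta> i - pi)) (\<theta> i)"


section \<open>Block matrices\<close>

text \<open>All block indices are 1-based as in the mathematical text; matrix and vector entries are
  0-based as in the library. \<open>offset s k = s 1 + \<dots> + s (k - 1)\<close>.\<close>

definition offset :: "(nat \<Rightarrow> nat) \<Rightarrow> nat \<Rightarrow> nat" where
  "offset s k = (\<Sum>j = 1..<k. s j)"

text \<open>\<open>diag (c 1 I, \<dots>, c q I)\<close> with blocks of sizes \<open>s 1, \<dots>, s q\<close>.\<close>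

definition scalar_blocks :: "(nat \<Rightarrow> complex) \<Rightarrow> (nat \<Rightarrow> nat) \<Rightarrow> nat \<Rightarrow> complex mat" where
  "scalar_blocks c s q = diag_block_mat (map (\<lambda>k. c k \<cdot>\<^sub>m 1\<^sub>m (s k)) [1..<q + 1])"

definition diag_block_at :: "complex mat \<Rightarrow> nat \<Rightarrow> nat \<Rightarrow> complex mat" where
  "diag_block_at A s d = mat d d (\<lambda>(a, b). A $$ (s + a, s + b))"

definition leading_block :: "complex mat \<Rightarrow> nat \<Rightarrow> complex mat" where
  "leading_block A d = diag_block_at A 0 d"

text \<open>The \<open>k\<close>-th unit vector, \<open>1 \<le> k \<le> d\<close>.\<close>

definition eps :: "nat \<Rightarrow> nat \<Rightarrow> complex vec" where
  "eps d k = unit_vec d (k - 1)"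

text \<open>\<open>ext_matrix n A P Pinv A' \<rho>\<^sub>1 \<rho>\<^sub>2\<close> is the matrix \<open>\<A>\<^sub>P\<close> of size \<open>2n\<close>; \<open>Pinv\<close> and \<open>A'\<close> stand for
  \<open>P\<^sup>-\<^sup>1\<close> and \<open>P\<^sup>-\<^sup>1 A P\<close>. If \<open>\<rho>\<^sub>2\<close> is the last diagonal entry of \<open>A'\<close>, of multiplicity \<open>mq\<close>, the last
  \<open>mq\<close> rows of \<open>\<A>\<^sub>P\<close> are \<open>(O, \<rho>\<^sub>1 I)\<close>, and \<open>red_matrix\<close> is the remaining diagonal block \<open>\<A>'\<^sub>P\<close>.\<close>

definition ext_matrix ::
  "nat \<Rightarrow> complex mat \<Rightarrow> complex mat \<Rightarrow> complex mat \<Rightarrow> complex mat \<Rightarrow> complex \<Rightarrow> complex \<Rightarrow> complex mat" where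
  "ext_matrix n A P Pinv A' \<rho>\<^sub>1 \<rho>\<^sub>2 =
     four_block_mat A P
       (- ((A' - \<rho>\<^sub>1 \<cdot>\<^sub>m 1\<^sub>m n) * (A' - \<rho>\<^sub>2 \<cdot>\<^sub>m 1\<^sub>m n) * Pinv))
       ((\<rho>\<^sub>1 + \<rho>\<^sub>2) \<cdot>\<^sub>m 1\<^sub>m n - A')"

definition red_matrix ::
  "nat \<Rightarrow> nat \<Rightarrow> complex mat \<Rightarrow> complex mat \<Rightarrow> complex mat \<Rightarrow> complex \<Rightarrow> complex \<Rightarrow> complex mat" where
  "red_matrix n mq A P Pinv \<rho>\<^sub>1 \<rho>\<^sub>2 =
     leading_block (ext_matrix n A P Pinv (Pinv * A * P) \<rho>\<^sub>1 \<rho>\<^sub>2) (2 * n - mq)"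

definition red_T :: "nat \<Rightarrow> nat \<Rightarrow> complex mat \<Rightarrow> complex \<Rightarrow> complex mat" where
  "red_T n mq T c =
     four_block_mat T (0\<^sub>m n (n - mq)) (0\<^sub>m (n - mq) n) (c \<cdot>\<^sub>m 1\<^sub>m (n - mq))"


section \<open>Solutions\<close>

text \<open>\<open>U\<close> is a solution of \<open>(x I - T) dU/dx = A U\<close> on \<open>S\<close>. The sets \<open>S\<close> used are open, so \<open>U\<close> is
  holomorphic there.\<close>

definition solves_on ::
  "nat \<Rightarrow> complex mat \<Rightarrow> complex mat \<Rightarrow> complex set \<Rightarrow> (complex \<Rightarrow> complex vec) \<Rightarrow> bool" where
  "solves_on d T A S U \<longleftrightarrow>
     (\<forall>x\<in>S. U x \<in> carrier_vec d \<and>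
        (\<exists>D\<in>carrier_vec d.
           (\<forall>j<d. ((\<lambda>y. vec_index (U y) j) has_field_derivative vec_index D j) (at x)) \<and>
           (x \<cdot>\<^sub>m 1\<^sub>m d - T) *\<^sub>v D = A *\<^sub>v U x))"

text \<open>\<open>U x = pref x (e + \<Sum>\<^sub>m\<^sub>\<ge>\<^sub>1 G(m) (z x)^m)\<close> for the points \<open>x\<close> of \<open>S\<close> at which the local coordinate
  \<open>z x\<close> is small, with a convergent power series.\<close>

definition has_expansion ::
  "nat \<Rightarrow> complex set \<Rightarrow> (complex \<Rightarrow> complex vec) \<Rightarrow> (complex \<Rightarrow> complex) \<Rightarrow> (complex \<Rightarrow> complex)
     \<Rightarrow> complex vec \<Rightarrow> bool" where
  "has_expansion d S U pref z e \<longleftrightarrow>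
     (\<exists>G r. 0 < r \<and> G 0 = e \<and> (\<forall>m. G m \<in> carrier_vec d) \<and>
        (\<forall>j<d. \<forall>w. cmod w < r \<longrightarrow> summable (\<lambda>m. vec_index (G m) j * w ^ m)) \<and>
        (\<forall>x\<in>S. cmod (z x) < r \<longrightarrow>
           U x = pref x \<cdot>\<^sub>v Matrix.vec d (\<lambda>j. \<Sum>m. vec_index (G m) j * z x ^ m)))"

text \<open>The solution on \<open>S\<close> (a union of simply connected domains, each having \<open>a\<close> on its boundary)
  which is the analytic continuation of \<open>(x - a)^\<kappa> (e + O(x - a))\<close>, where
  \<open>arg (x - a)\<close> is taken in \<open>[lo, lo + 2\<pi>)\<close> near \<open>a\<close>.\<close>

definition local_solution ::
  "nat \<Rightarrow> complex mat \<Rightarrow> complex mat \<Rightarrow> complex set \<Rightarrow> complex \<Rightarrow> real \<Rightarrow> complex \<Rightarrow> complex vec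
     \<Rightarrow> (complex \<Rightarrow> complex vec) \<Rightarrow> bool" where
  "local_solution d T A S a lo \<kappa> e U \<longleftrightarrow>
     solves_on d T A S U \<and>
     has_expansion d S U (\<lambda>x. cpow_arg (x - a) (arg_from lo (x - a)) \<kappa>) (\<lambda>x. x - a) e"

text \<open>Likewise for \<open>(\<zeta> - a)^\<kappa> (e + O((\<zeta> - a)^-1))\<close> near infinity, with \<open>arg (\<zeta> - a)\<close> in
  \<open>[lo, lo + 2\<pi>)\<close>; the set \<open>S\<close> must not contain \<open>a\<close>.\<close>

definition local_solution_inf ::
  "nat \<Rightarrow> complex mat \<Rightarrow> complex mat \<Rightarrow> complex set \<Rightarrow> complex \<Rightarrow> real \<Rightarrow> complex \<Rightarrow> complex vec
     \<Rightarrow> (complex \<Rightarrow> complex vec) \<Rightarrow> bool" where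
  "local_solution_inf d T A S a lo \<kappa> e U \<longleftrightarrow>
     solves_on d T A S U \<and>
     has_expansion d S U (\<lambda>x. cpow_arg (x - a) (arg_from lo (x - a)) \<kappa>) (\<lambda>x. inverse (x - a)) e"

definition hol_near :: "nat \<Rightarrow> complex \<Rightarrow> (complex \<Rightarrow> complex vec) \<Rightarrow> bool" where
  "hol_near d a H \<longleftrightarrow>
     (\<forall>x. H x \<in> carrier_vec d) \<and>
     (\<exists>r>0. \<forall>j<d. (\<lambda>x. vec_index (H x) j) holomorphic_on ball a r)"


section \<open>The underlying system\<close>

definition t_und :: "complex \<Rightarrow> complex \<Rightarrow> (nat \<Rightarrow> complex) \<Rightarrow> nat \<Rightarrow> complex" where
  "t_und \<eta>\<^sub>0 c t i = \<eta>\<^sub>0 + 1 / (t i - c)"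

definition cut_plane :: "nat \<Rightarrow> complex \<Rightarrow> (nat \<Rightarrow> complex) \<Rightarrow> real \<Rightarrow> complex set" where
  "cut_plane p \<eta>\<^sub>0 t' \<phi> =
     - ((\<Union>i\<in>{1..p}. closed_segment \<eta>\<^sub>0 (t' i)) \<union> {\<eta>\<^sub>0 + rcis s \<phi> | s. 0 \<le> s})"

end

theory Submission
  imports Defs "HOL-Complex_Analysis.Complex_Analysis"
begin

text \<open>
  In the coordinate \<open>y = (x - t\<^sub>p\<^sub>+\<^sub>1) / (t\<^sub>i - t\<^sub>p\<^sub>+\<^sub>1)\<close> the underlying system at \<open>\<zeta> = \<eta>\<^sub>0 + 1 / (x - t\<^sub>p\<^sub>+\<^sub>1)\<close>
  becomes a system with the singular points \<open>0\<close> and \<open>1\<close> on the boundary of a convex sector. Starting from a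
  solution \<open>w\<close> of it, multiply by \<open>y\<close> to the power \<open>\<rho>\<^sub>1\<close>, apply the Riemann--Liouville integral based at \<open>1\<close> of order
  \<open>- 1 - \<rho>\<^sub>1\<close>, multiply by \<open>y\<close> to the power \<open>\<rho>\<^sub>2 + 1\<close>, and apply the integral of order \<open>1 + \<rho>\<^sub>1\<close>. The result spans, together with
  a linear combination of its derivatives, a solution of the extended system. Each integral maps a germ at
  \<open>1\<close> to a germ at \<open>1\<close> and multiplies the singular term of exponent \<open>\<beta>\<close> at \<open>0\<close> by a quotient of Gamma values, which
  gives the Gamma factors of the connection coefficients; after the first step the part that is regular at \<open>0\<close> vanishes,
  since it satisfies a recursion whose matrix has no integral eigenvalue, and in the second the term of exponent \<open>\<rho>\<^sub>2 - \<mu>\<^sub>q = 0\<close> is itself regular.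
  For exponents outside the range of convergence the integral is replaced by its analytic continuation in the order.
\<close>

section \<open>Integrals depending on a parameter\<close>

text \<open>The integral representation converges only for some exponents, so the differential
  equations of the system are not carried across by manipulating integrals. What survives
  continuation in the order is the effect on germs: at 1 the series coefficients are multiplied by
  Gamma quotients, at 0 the leading coefficients are. A function holomorphic on the convex sector is
  fixed by its germ at 1, so each equation is transported by comparing coefficients at 1, and the
  germs at 0 then supply the connection coefficients. Uniqueness is used twice at the end: the
  constructed solution equals the given one because both start with the same vector at 1, and at 0
  its singular part equals the asserted combination because the leading coefficients agree in the
  rows whose singular point is 0. Both comparisons rest on non-integral exponent differences. The
  obstacle at 0 is that the path ends at 1, out of reach of Taylor series at 0. It is therefore cut
  at a point p near 0, and the piece from p to 1 is analytic in x near 0.\<close>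

lemma norm_integral_le_const:
  fixes g :: "real \<Rightarrow> complex"
  assumes "g integrable_on {a..b}" "a \<le> b" "finite K" "\<And>t. t \<in> {a..b} - K \<Longrightarrow> norm (g t) \<le> C"
  shows "norm (integral {a..b} g) \<le> C * (b - a)"
proof -
  have "norm (integral {a..b} (\<lambda>t. if t \<in> K then 0 else g t)) \<le> integral {a..b} (\<lambda>t. max C 0)"
  proof (rule integral_norm_bound_integral)
    show "(\<lambda>t. if t \<in> K then 0 else g t) integrable_on {a..b}"
      using assms(1) by (rule integrable_spike_finite[OF assms(3), rotated]) auto
  qed (use assms(4) in \<open>force intro: order_trans max.cobounded1 simp: le_max_iff_disj\<close>)+
  also have "\<dots> = max C 0 * (b - a)" using assms by simp
  also have "integral {a..b} (\<lambda>t. if t \<in> K then 0 else g t) = integral {a..b} g"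
    by (rule integral_spike[of K]) (use assms in \<open>auto intro: negligible_finite\<close>)
  finally have *: "norm (integral {a..b} g) \<le> max C 0 * (b - a)" .
  show ?thesis
  proof (cases "a < b")
    case True
    have "{a<..<b} - K \<noteq> {}" using True assms(3) infinite_Ioo[OF True]
      by (metis Diff_eq_empty_iff finite_subset)
    then obtain t where "t \<in> {a..b} - K" by fastforce
    with assms(4)[of t] have "0 \<le> C" using norm_ge_zero order_trans by blast
    with * show ?thesis by (simp add: max_def split: if_splits)
  qed (use assms in auto)
qed

text \<open>Nothing is assumed about continuity at the end points, since the derivative may contain
  factors such as \<open>Ln t\<close> or values of a derivative near a boundary point. Local
  boundedness makes the integrals over shrunken intervals converge uniformly, and a uniform limit of
  holomorphic functions is holomorphic.\<close>

lemma holomorphic_integral_param: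
  fixes f :: "complex \<Rightarrow> real \<Rightarrow> complex"
  assumes U: "open U"
    and d: "\<And>x t. x \<in> U \<Longrightarrow> t \<in> {0<..<1} \<Longrightarrow> ((\<lambda>x. f x t) has_field_derivative f' x t) (at x)"
    and cf': "continuous_on (U \<times> {0<..<1}) (\<lambda>(x,t). f' x t)"
    and int: "\<And>x. x \<in> U \<Longrightarrow> f x integrable_on {0..1}"
    and bd: "\<And>x0. x0 \<in> U \<Longrightarrow> \<exists>e>0. \<exists>C. \<forall>x\<in>ball x0 e. \<forall>t\<in>{0<..<1}. norm (f x t) \<le> C"
  shows "(\<lambda>x. integral {0..1} (f x)) holomorphic_on U"
proof -
  have "(\<lambda>x. integral {0..1} (f x)) field_differentiable at x0" if x0: "x0 \<in> U" for x0
  proof -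
    obtain e1 C where e1: "e1 > 0" "\<And>x t. x\<in>ball x0 e1 \<Longrightarrow> t\<in>{0<..<1} \<Longrightarrow> norm (f x t) \<le> C"
      using bd[OF x0] by blast
    obtain e2 where e2: "e2 > 0" "ball x0 e2 \<subseteq> U" using U x0 openE by blast
    define S where "S = ball x0 (min e1 e2)"
    have SU: "S \<subseteq> U" "S \<subseteq> ball x0 e1" "open S" "x0 \<in> S" "convex S"
      using e1(1) e2 by (auto simp: S_def)
    \<comment> \<open>The shift by 3 keeps \<open>h m\<close> below 1/2, so that the truncated
      interval is non-degenerate for every m.\<close>
    define h where "h = (\<lambda>m::nat. 1 / (real m + 3))"
    have h: "h m > 0" "h m < 1/2" for m by (auto simp: h_def field_simps)
    have "(\<lambda>x. integral {0..1} (f x)) holomorphic_on S"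
    proof (rule holomorphic_uniform_sequence[where f = "\<lambda>m x. integral {h m..1 - h m} (f x)"])
      fix m
      have sub: "{h m..1 - h m} \<subseteq> {0<..<1}" "{h m..1 - h m} \<subseteq> {0..1}" using h[of m] by auto
      show "(\<lambda>x. integral {h m..1 - h m} (f x)) holomorphic_on S"
        unfolding box_real(2)[symmetric]
      proof (rule leibniz_rule_holomorphic)
        show "((\<lambda>x. f x t) has_field_derivative f' x t) (at x within S)"
          if "x \<in> S" "t \<in> cbox (h m) (1 - h m)" for x t
        proof -
          have "x \<in> U" "t \<in> {0<..<1}" using that SU(1) sub(1) by auto
          then show ?thesis by (rule has_field_derivative_at_within[OF d])
        qed
        show "f x integrable_on cbox (h m) (1 - h m)" if "x \<in> S" for x
        proof -
          have "f x integrable_on {0..1}" using that SU(1) int by auto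
          from integrable_on_subinterval[OF this sub(2)] show ?thesis by simp
        qed
        show "continuous_on (S \<times> cbox (h m) (1 - h m)) (\<lambda>(x, t). f' x t)"
          by (rule continuous_on_subset[OF cf']) (use SU sub in auto)
      qed fact
    next
      fix x assume x: "x \<in> S"
      obtain \<delta> where \<delta>: "\<delta> > 0" "cball x \<delta> \<subseteq> S" using SU(3) x open_contains_cball by blast
      have ul: "uniform_limit S (\<lambda>m x. integral {h m..1 - h m} (f x)) (\<lambda>x. integral {0..1} (f x)) sequentially"
      proof (rule uniform_limitI)
        fix e :: real assume e: "e > 0"
        have "(\<lambda>m. 2 * C * h m) \<longlonglongrightarrow> 0" unfolding h_def by real_asymp
        then have ev: "\<forall>\<^sub>F m in sequentially. 2 * C * h m < e" using e by (rule order_tendstoD(2))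
        show "\<forall>\<^sub>F m in sequentially. \<forall>x\<in>S. dist (integral {h m..1 - h m} (f x)) (integral {0..1} (f x)) < e"
          using ev
        proof eventually_elim
          case (elim m)
          show ?case
          proof
            fix x assume x: "x \<in> S"
            have i: "f x integrable_on {0..1}" using int x SU by auto
            have i': "f x integrable_on {a..b}" if "0 \<le> a" "b \<le> 1" for a b
              by (rule integrable_on_subinterval[OF i]) (use that in auto)
            have b: "norm (f x t) \<le> C" if "t \<in> {0<..<1}" for t
              using e1(2)[of x t] that x SU by auto
            have "integral {0..1} (f x) = integral {0..h m} (f x) + integral {h m..1} (f x)"
              using h[of m] i by (intro Henstock_Kurzweil_Integration.integral_combine[symmetric]) auto
            also have "integral {h m..1} (f x) = integral {h m..1 - h m} (f x) + integral {1 - h m..1} (f x)"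
              using h[of m] i' by (intro Henstock_Kurzweil_Integration.integral_combine[symmetric]) auto
            finally have "dist (integral {h m..1 - h m} (f x)) (integral {0..1} (f x))
               = norm (integral {0..h m} (f x) + integral {1 - h m..1} (f x))"
              by (subst dist_commute) (simp add: dist_norm algebra_simps)
            also have "\<dots> \<le> norm (integral {0..h m} (f x)) + norm (integral {1 - h m..1} (f x))"
              by (rule norm_triangle_ineq)
            also have "norm (integral {0..h m} (f x)) \<le> C * (h m - 0)"
            proof (rule norm_integral_le_const[where K = "{0}"])
              show "f x integrable_on {0..h m}" using h[of m] by (intro i') auto
              show "norm (f x t) \<le> C" if "t \<in> {0..h m} - {0}" for t using that h[of m] by (intro b) auto
            qed (use h[of m] in auto)
            also have "norm (integral {1 - h m..1} (f x)) \<le> C * (1 - (1 - h m))"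
            proof (rule norm_integral_le_const[where K = "{1}"])
              show "f x integrable_on {1 - h m..1}" using h[of m] by (intro i') auto
              show "norm (f x t) \<le> C" if "t \<in> {1 - h m..1} - {1}" for t using that h[of m] by (intro b) auto
            qed (use h[of m] in auto)
            finally show "dist (integral {h m..1 - h m} (f x)) (integral {0..1} (f x)) < e"
              using elim by (simp add: algebra_simps)
          qed
        qed
      qed
      show "\<exists>d>0. cball x d \<subseteq> S \<and> uniform_limit (cball x d) (\<lambda>m x. integral {h m..1 - h m} (f x)) (\<lambda>x. integral {0..1} (f x)) sequentially"
      proof (rule exI[of _ \<delta>], intro conjI)
        show "uniform_limit (cball x \<delta>) (\<lambda>m x. integral {h m..1 - h m} (f x)) (\<lambda>x. integral {0..1} (f x)) sequentially"
          by (rule uniform_limit_on_subset) fact+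
      qed fact+
    qed fact
    from holomorphic_on_imp_differentiable_at[OF this SU(3,4)] show ?thesis .
  qed
  then show ?thesis using U by (simp add: holomorphic_on_open field_differentiable_def)
qed

section \<open>Euler's Beta integral for complex parameters\<close>

definition beta_int :: "complex \<Rightarrow> complex \<Rightarrow> complex" where
  "beta_int a b = integral {0..1} (\<lambda>t. of_real (1 - t) powr (a - 1) * of_real t powr (b - 1))"

lemma norm_powr_unit_interval:
  "t \<in> {0<..<1} \<Longrightarrow> Re a > 0 \<Longrightarrow> norm (complex_of_real t powr a) \<le> 1"
  by (subst norm_powr_real_powr) (auto simp: powr_le1)

lemma continuous_beta_kernel:
  assumes "Re a > 1" "Re b > 1"
  shows "continuous_on {0..1} (\<lambda>t. complex_of_real (1 - t) powr (a - 1) * of_real t powr (b - 1))"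
  using assms by (intro continuous_intros) auto

text \<open>Real parts above 1 make the kernel continuous up to both end points and bounded by 1.
  Other exponents are reached later by recursion rather than by improper integrals.\<close>

lemma holomorphic_beta_int:
  assumes "Re a > 1"
  shows "beta_int a holomorphic_on {b. Re b > 1}"
proof -
  have "(\<lambda>b. integral {0..1} (\<lambda>t. of_real (1 - t) powr (a - 1) * of_real t powr (b - 1))) holomorphic_on {b. Re b > 1}"
  proof (rule holomorphic_integral_param[where f' = "\<lambda>b t. of_real (1 - t) powr (a - 1) * (Ln (of_real t) * of_real t powr (b - 1))"])
    show "open {b. Re b > 1}" by (simp add: open_halfspace_Re_gt)
    show "((\<lambda>x. complex_of_real (1 - t) powr (a - 1) * of_real t powr (x - 1)) has_field_derivative
         of_real (1 - t) powr (a - 1) * (Ln (of_real t) * of_real t powr (x - 1))) (at x)"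
      if "t \<in> {0<..<1}" for x t
      proof -
        have "complex_of_real t \<noteq> 0" using that by simp
        then have "((\<lambda>y. complex_of_real t powr y) has_field_derivative Ln (of_real t) * of_real t powr (x - 1)) (at (x - 1))"
          by (rule has_field_derivative_powr_right)
        moreover have "((\<lambda>x. x - 1) has_field_derivative 1) (at x)" by (auto intro!: derivative_eq_intros)
        ultimately have "((\<lambda>x. complex_of_real t powr (x - 1)) has_field_derivative Ln (of_real t) * of_real t powr (x - 1) * 1) (at x)"
          by (rule DERIV_chain2)
        then show ?thesis by (intro DERIV_cmult) simp
      qed
    show "continuous_on ({b. Re b > 1} \<times> {0<..<1}) (\<lambda>(x, t). complex_of_real (1 - t) powr (a - 1) * (Ln (of_real t) * of_real t powr (x - 1)))"
      unfolding case_prod_beta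
      by (intro continuous_intros) (use assms in \<open>auto simp: complex_nonpos_Reals_iff\<close>)
    show "(\<lambda>t. complex_of_real (1 - t) powr (a - 1) * of_real t powr (x - 1)) integrable_on {0..1}"
      if "x \<in> {b. Re b > 1}" for x
      by (rule integrable_continuous_real, rule continuous_beta_kernel) (use that assms in auto)
    show "\<exists>e>0. \<exists>C. \<forall>x\<in>ball x0 e. \<forall>t\<in>{0<..<1}. cmod (complex_of_real (1 - t) powr (a - 1) * complex_of_real t powr (x - 1)) \<le> C"
      if x0: "x0 \<in> {b. Re b > 1}" for x0
    proof -
      have "open {b. Re b > 1}" by (simp add: open_halfspace_Re_gt)
      then obtain e where e: "e > 0" "ball x0 e \<subseteq> {b. Re b > 1}"
        using openE[OF _ x0] by metis
      show ?thesis
      proof (rule exI[of _ e], intro conjI exI[of _ 1] ballI)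
        fix x and t :: real assume xt: "x \<in> ball x0 e" "t \<in> {0<..<1}"
        have "cmod (complex_of_real (1 - t) powr (a - 1)) * cmod (complex_of_real t powr (x - 1)) \<le> 1 * 1"
          using xt e assms by (intro mult_mono norm_powr_unit_interval) auto
        then show "cmod (complex_of_real (1 - t) powr (a - 1) * complex_of_real t powr (x - 1)) \<le> 1"
          by (simp add: norm_mult)
      qed (use e in auto)
    qed
  qed
  then show ?thesis by (simp add: beta_int_def[abs_def])
qed

lemma beta_int_commute:
  assumes "Re a > 1" "Re b > 1"
  shows "beta_int a b = beta_int b a"
proof -
  let ?f = "\<lambda>t. complex_of_real (1 - t) powr (a - 1) * of_real t powr (b - 1)"
  have "(?f has_integral beta_int a b) (cbox 0 1)"
    unfolding beta_int_def box_real
    by (rule integrable_integral, rule integrable_continuous_real, rule continuous_beta_kernel) (use assms in auto)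
  from has_integral_affinity[OF this, of "-1" 1]
  have "((\<lambda>x. ?f (1 - x)) has_integral beta_int a b) ((\<lambda>x. 1 - x) ` {0..1})"
    by (simp add: algebra_simps)
  moreover have "(\<lambda>x. 1 - x) ` {0..1} = {0..1::real}" by auto
  ultimately show ?thesis
    by (auto simp: beta_int_def[of b a] mult.commute dest!: integral_unique)
qed

lemma beta_int_eq_Beta_real:
  assumes "x > 1" "y > 1"
  shows "beta_int (of_real x) (of_real y) = Beta (of_real x) (of_real y)"
proof -
  have "((\<lambda>t. t powr (y - 1) * (1 - t) powr (x - 1)) has_integral Beta y x) {0..1}"
    using assms by (intro has_integral_Beta_real) auto
  then have "((\<lambda>t. complex_of_real (t powr (y - 1) * (1 - t) powr (x - 1))) has_integral of_real (Beta y x)) {0..1}"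
    by (rule has_integral_of_real)
  then have "((\<lambda>t. complex_of_real (1 - t) powr (of_real x - 1) * of_real t powr (of_real y - 1)) has_integral of_real (Beta y x)) {0..1}"
  proof (rule has_integral_eq[rotated])
    fix t :: real assume "t \<in> {0..1}"
    moreover have "complex_of_real x - 1 = of_real (x - 1)" "complex_of_real y - 1 = of_real (y - 1)" by auto
    ultimately show "complex_of_real (t powr (y - 1) * (1 - t) powr (x - 1)) =
      of_real (1 - t) powr (of_real x - 1) * of_real t powr (of_real y - 1)"
      by (simp only: powr_of_real of_real_mult) (simp add: powr_of_real del: of_real_diff)
  qed
  then show ?thesis
    by (auto simp: beta_int_def Beta_complex_of_real Beta_commute[of x] dest!: integral_unique)
qed

lemma holomorphic_eq_on_real_halfline:
  assumes "f holomorphic_on {z. Re z > 1}" "g holomorphic_on {z. Re z > 1}"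
    and "\<And>x. x > 1 \<Longrightarrow> f (of_real x) = g (of_real x)" "Re z > 1"
  shows "f z = g z"
proof -
  have "f z - g z = 0"
  proof (rule analytic_continuation[where f = "\<lambda>z. f z - g z" and S = "{z. Re z > 1}" and U = "of_real ` {1<..}" and \<xi> = "2"])
    show "(2::complex) islimpt complex_of_real ` {1<..}"
    proof (rule islimptI)
      fix T :: "complex set" assume "2 \<in> T" "open T"
      then obtain e where e: "e > 0" "ball 2 e \<subseteq> T" using openE by blast
      have "complex_of_real (2 + e / 2) \<in> T" 
        by (rule subsetD[OF e(2)]) (use e(1) in \<open>simp add: dist_norm\<close>)
      then show "\<exists>y\<in>complex_of_real ` {1<..}. y \<in> T \<and> y \<noteq> 2"
        using e(1) by (intro bexI[of _ "complex_of_real (2 + e / 2)"]) (auto simp: complex_eq_iff)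
    qed
  qed (use assms in \<open>auto intro!: holomorphic_intros simp: open_halfspace_Re_gt convex_halfspace_Re_gt convex_connected\<close>)
  then show ?thesis by simp
qed

lemma Re_pos_not_nonpos_Int: "Re z > 0 \<Longrightarrow> z \<notin> \<int>\<^sub>\<le>\<^sub>0"
  by (auto simp: nonpos_Ints_def)

text \<open>The real case is extended one variable at a time by the identity theorem. Symmetry of
  the integral turns the second extension into holomorphy in the same argument as the first.\<close>

lemma beta_int_eq_Beta:
  assumes "Re a > 1" "Re b > 1"
  shows "beta_int a b = Beta a b"
proof -
  have hol: "(\<lambda>b. Beta a b) holomorphic_on {z. Re z > 1}" if "Re a > 1" for a :: complex
    unfolding Beta_def Gamma_def using that
    by (intro holomorphic_intros) (auto simp: Re_pos_not_nonpos_Int rGamma_eq_zero_iff)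
  have *: "beta_int (of_real x) b = Beta (of_real x) b" if "x > 1" "Re b > 1" for x b
  proof (rule holomorphic_eq_on_real_halfline[where f = "beta_int (of_real x)"])
    show "beta_int (of_real x) (of_real y) = Beta (of_real x) (of_real y)" if "y > 1" for y
      using that \<open>x > 1\<close> by (rule beta_int_eq_Beta_real[rotated])
  qed (use that in \<open>simp_all add: holomorphic_beta_int hol\<close>)
  have "beta_int b a = Beta b a"
  proof (rule holomorphic_eq_on_real_halfline[where f = "beta_int b"])
    show "beta_int b (of_real x) = Beta b (of_real x)" if "x > 1" for x
      using *[OF that assms(2)] beta_int_commute[of b "of_real x"] assms(2) that
      by (simp add: Beta_commute)
  qed (use assms in \<open>simp_all add: holomorphic_beta_int hol\<close>)
  then show ?thesis using assms by (simp add: beta_int_commute Beta_commute)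
qed

section \<open>Separation of exponents\<close>

text \<open>An identity valid inside S near the boundary point a holds in a full neighbourhood of
  each nearby point of S, and can therefore be differentiated there.\<close>

lemma eventually_at_within_open_nhds:
  assumes "open S" "a \<notin> S" "eventually P (at a within S)"
  shows "eventually (\<lambda>x. x \<in> S \<and> eventually P (nhds x)) (at a within S)"
proof -
  obtain U where U: "open U" "a \<in> U" "\<And>x. x \<in> U \<Longrightarrow> x \<noteq> a \<Longrightarrow> x \<in> S \<Longrightarrow> P x"
    using assms(3) unfolding eventually_at_topological by blast
  have "eventually P (nhds x)" if "x \<in> U" "x \<in> S" for x
    using that U assms(1,2) by (intro eventually_nhds[THEN iffD2] exI[of _ "U \<inter> S"]) auto
  then show ?thesis unfolding eventually_at_topological using U(1,2) by blast
qed

lemma eventually_at_within_of_nhds: "eventually P (nhds a) \<Longrightarrow> eventually P (at a within S)"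
  unfolding eventually_at_filter by (auto elim: eventually_mono)

lemma analytic_eventually_0:
  fixes h :: "complex \<Rightarrow> complex"
  assumes "h analytic_on {a}" "a islimpt S" "eventually (\<lambda>x. h x = 0) (at a within S)"
  shows "eventually (\<lambda>x. h x = 0) (nhds a)"
proof -
  obtain e where e: "e > 0" "h holomorphic_on ball a e"
    using assms(1) by (auto simp: analytic_on_def)
  obtain U where U: "open U" "a \<in> U" "\<And>x. x \<in> U \<Longrightarrow> x \<noteq> a \<Longrightarrow> x \<in> S \<Longrightarrow> h x = 0"
    using assms(3) unfolding eventually_at_topological by blast
  have "h x = 0" if "x \<in> ball a e" for x
  proof (rule analytic_continuation[where U = "S \<inter> (U \<inter> ball a e) - {a}", OF e(2) _ _ _ _ _ _ that])
    have "a islimpt (S \<inter> (U \<inter> ball a e))"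
      using U(1,2) e(1) by (intro islimpt_Int_eventually assms eventually_at_in_open') auto
    moreover have "insert a (S \<inter> (U \<inter> ball a e) - {a}) = insert a (S \<inter> (U \<inter> ball a e))" by auto
    ultimately show "a islimpt S \<inter> (U \<inter> ball a e) - {a}"
      by (metis islimpt_insert)
  qed (use e U in auto)
  then show ?thesis using e(1) by (auto simp: eventually_nhds intro!: exI[of _ "ball a e"])
qed

lemma analytic_eventually_differentiable:
  assumes "h analytic_on {a}"
  shows "eventually (\<lambda>x. h field_differentiable at x) (nhds a)"
proof -
  obtain U where "open U" "a \<in> U" "h holomorphic_on U" using assms analytic_at by blast
  then show ?thesis
    unfolding eventually_nhds using holomorphic_on_imp_differentiable_at by blast
qed

lemma fps_mult_nth_lowest:
  assumes "\<And>i. i < p \<Longrightarrow> fps_nth A i = 0" "\<And>i. i < q \<Longrightarrow> fps_nth B i = 0"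
  shows "fps_nth (A * B) (p + q) = fps_nth A p * fps_nth (B :: 'a :: comm_ring_1 fps) q"
proof -
  have "fps_nth (A * B) (p + q) = (\<Sum>i=0..p+q. fps_nth A i * fps_nth B (p + q - i))"
    by (simp add: fps_mult_nth)
  also have "\<dots> = (\<Sum>i\<in>{p}. fps_nth A i * fps_nth B (p + q - i))"
  proof (rule sum.mono_neutral_right)
    show "\<forall>i\<in>{0..p + q} - {p}. fps_nth A i * fps_nth B (p + q - i) = 0"
    proof
      fix i assume "i \<in> {0..p + q} - {p}"
      then have "i < p \<or> p + q - i < q" by auto
      with assms show "fps_nth A i * fps_nth B (p + q - i) = 0" by auto
    qed
  qed auto
  finally show ?thesis by simp
qed

text \<open>Up to the factor x^c the expression is the Wronskian of A and x^c B for the Euler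
  derivative x d/dx. Its lowest coefficient is c plus an integer, times the lowest coefficients of A
  and B, and so cannot cancel for non-integral c.\<close>

lemma fps_bracket_eq_0:
  fixes A B :: "complex fps"
  assumes "c \<notin> \<int>"
    and "fps_const c * A * B + A * (fps_X * fps_deriv B) - fps_X * fps_deriv A * B = 0"
  shows "A = 0 \<or> B = 0"
proof (rule ccontr)
  assume "\<not> ?thesis"
  then have AB: "A \<noteq> 0" "B \<noteq> 0" by auto
  define p q where pq: "p = subdegree A" "q = subdegree B"
  have X: "fps_nth (fps_X * fps_deriv F) i = of_nat i * fps_nth F i" for i and F :: "complex fps"
    by (cases i) auto
  have l: "fps_nth A i = 0" if "i < p" for i using that pq by auto
  have l': "fps_nth B i = 0" if "i < q" for i using that pq by auto
  have "0 = fps_nth (fps_const c * (A * B) + A * (fps_X * fps_deriv B) - (fps_X * fps_deriv A) * B) (p + q)"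
    using assms(2) by (simp add: mult.assoc)
  also have "\<dots> = c * fps_nth (A * B) (p + q) + fps_nth (A * (fps_X * fps_deriv B)) (p + q) - fps_nth ((fps_X * fps_deriv A) * B) (p + q)"
    by simp
  also have "\<dots> = c * (fps_nth A p * fps_nth B q) + fps_nth A p * (of_nat q * fps_nth B q) - of_nat p * fps_nth A p * fps_nth B q"
    by (subst (1 2 3) fps_mult_nth_lowest) (auto simp: X l l')
  also have "\<dots> = (c + of_nat q - of_nat p) * (fps_nth A p * fps_nth B q)"
    by (simp add: algebra_simps)
  finally have "c + of_nat q - of_nat p = 0 \<or> fps_nth A p = 0 \<or> fps_nth B q = 0" by auto
  moreover have "fps_nth A p \<noteq> 0" "fps_nth B q \<noteq> 0" using AB unfolding pq by simp_all
  moreover have "c + of_nat q - of_nat p \<noteq> 0"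
  proof
    assume "c + of_nat q - of_nat p = 0"
    then have "c = of_int (int p - int q)" by (simp add: algebra_simps eq_neg_iff_add_eq_0)
    with assms(1) show False by auto
  qed
  ultimately show False by auto
qed

text \<open>Induction on the number of exponents. The equation and its Euler derivative eliminate
  one term k and leave the same exponents with new coefficient functions \<open>D j\<close>, the
  Wronskians of the terms k and j. Once these vanish, \<open>fps_bracket_eq_0\<close> makes the term
  k or all the others vanish. In the latter case the equation itself consists of the term k
  alone.\<close>

lemma powr_separation:
  fixes \<beta> :: "'i \<Rightarrow> complex" and h :: "'i \<Rightarrow> complex \<Rightarrow> complex"
  assumes S: "open S" "0 islimpt S" "S \<inter> \<real>\<^sub>\<le>\<^sub>0 = {}"
  assumes "finite I" "\<And>i. i \<in> I \<Longrightarrow> h i analytic_on {0}"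
    and "\<And>i j. i \<in> I \<Longrightarrow> j \<in> I \<Longrightarrow> i \<noteq> j \<Longrightarrow> \<beta> i - \<beta> j \<notin> \<int>"
    and "eventually (\<lambda>x. (\<Sum>i\<in>I. x powr \<beta> i * h i x) = 0) (at 0 within S)"
    and "i \<in> I"
  shows "eventually (\<lambda>x. h i x = 0) (nhds 0)"
  using assms(4-)
proof (induction I arbitrary: h i rule: finite_induct)
  case empty
  then show ?case by simp
next
  case (insert k I)
  have S0: "0 \<notin> S" using S(3) by auto
  define D where "D = (\<lambda>j x. h k x * (\<beta> j * h j x + x * deriv (h j) x) - h j x * (\<beta> k * h k x + x * deriv (h k) x))"
  have an: "h j analytic_on {0}" if "j \<in> insert k I" for j using insert.prems that by auto
  have D_an: "D j analytic_on {0}" if "j \<in> I" for j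
    unfolding D_def using an[of j] an[of k] that
    by (intro analytic_on_diff analytic_on_mult analytic_on_add analytic_deriv analytic_on_const analytic_on_ident) simp_all
  have "\<forall>\<^sub>F x in at 0 within S. \<forall>j\<in>insert k I. h j field_differentiable at x"
  proof (rule eventually_ball_finite)
    show "\<forall>j\<in>insert k I. \<forall>\<^sub>F x in at 0 within S. h j field_differentiable at x"
    proof
      fix j assume "j \<in> insert k I"
      from an[OF this] show "\<forall>\<^sub>F x in at 0 within S. h j field_differentiable at x"
        by (intro eventually_at_within_of_nhds analytic_eventually_differentiable)
    qed
  qed (use insert.hyps in auto)
  moreover note eventually_at_within_open_nhds[OF S(1) S0 insert.prems(3)]
  ultimately have ev: "\<forall>\<^sub>F x in at 0 within S. (\<Sum>j\<in>I. x powr \<beta> j * D j x) = 0"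
  proof eventually_elim
    case (elim x)
    have x: "x \<in> S" "x \<notin> \<real>\<^sub>\<le>\<^sub>0" "x \<noteq> 0" using elim S(3) by auto
    define f where "f = (\<lambda>j x. x powr \<beta> j * h j x)"
    have f': "(f j has_field_derivative x powr (\<beta> j - 1) * (\<beta> j * h j x + x * deriv (h j) x)) (at x)"
      if "j \<in> insert k I" for j
    proof -
      have [derivative_intros]: "(h j has_field_derivative deriv (h j) x) (at x)"
        using elim(1) that DERIV_deriv_iff_field_differentiable by blast
      have "(f j has_field_derivative \<beta> j * x powr (\<beta> j - 1) * h j x + deriv (h j) x * x powr \<beta> j) (at x)"
        unfolding f_def using x by (intro DERIV_mult has_field_derivative_powr) (auto intro: derivative_intros)
      moreover have "x powr \<beta> j = x powr (\<beta> j - 1) * x" using x by (simp add: powr_diff)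
      ultimately show ?thesis by (simp add: algebra_simps)
    qed
    have s0: "\<forall>\<^sub>F x in nhds x. (\<Sum>j\<in>insert k I. f j x) = 0" using elim by (simp add: f_def)
    have "((\<lambda>x. \<Sum>j\<in>insert k I. f j x) has_field_derivative (\<Sum>j\<in>insert k I. x powr (\<beta> j - 1) * (\<beta> j * h j x + x * deriv (h j) x))) (at x)"
      by (rule DERIV_sum) (use f' in auto)
    moreover have "((\<lambda>x. \<Sum>j\<in>insert k I. f j x) has_field_derivative 0) (at x)"
      using s0 by (subst DERIV_cong_ev[OF refl s0 refl]) auto
    ultimately have s1: "(\<Sum>j\<in>insert k I. x powr (\<beta> j - 1) * (\<beta> j * h j x + x * deriv (h j) x)) = 0"
      by (rule DERIV_unique)
    have s0': "(\<Sum>j\<in>insert k I. x powr (\<beta> j) * h j x) = 0"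
      using eventually_nhds_x_imp_x[OF s0] by (simp add: f_def)
    define A where "A = (\<Sum>j\<in>I. x powr \<beta> j * h j x)"
    define B where "B = (\<Sum>j\<in>I. x powr \<beta> j * (\<beta> j * h j x + x * deriv (h j) x))"
    have A: "A = - (x powr \<beta> k * h k x)"
      using s0' insert.hyps by (simp add: A_def eq_neg_iff_add_eq_0 add.commute)
    have "(\<Sum>j\<in>insert k I. x powr \<beta> j * (\<beta> j * h j x + x * deriv (h j) x)) = x * 0"
      unfolding s1[symmetric] sum_distrib_left using x by (intro sum.cong) (auto simp: powr_diff)
    then have B: "B = - (x powr \<beta> k * (\<beta> k * h k x + x * deriv (h k) x))"
      using insert.hyps by (simp add: B_def eq_neg_iff_add_eq_0 add.commute)
    have "(\<Sum>j\<in>I. x powr \<beta> j * D j x) = h k x * B - (\<beta> k * h k x + x * deriv (h k) x) * A"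
      unfolding A_def B_def D_def sum_distrib_left sum_subtractf[symmetric]
      by (intro sum.cong) (auto simp: algebra_simps)
    also have "\<dots> = 0" by (simp add: A B)
    finally show ?case .
  qed
  have D0: "\<forall>\<^sub>F x in nhds 0. D j x = 0" if "j \<in> I" for j
    by (rule insert.IH[OF D_an _ ev that]) (use insert.prems(2) in auto)
  obtain H where H: "h j has_fps_expansion H j" if "j \<in> insert k I" for j
  proof
    show "h j has_fps_expansion fps_expansion (h j) 0" if "j \<in> insert k I" for j
      using analytic_at_imp_has_fps_expansion_0[OF an[OF that]] .
  qed
  have alt: "H k = 0 \<or> H j = 0" if j: "j \<in> I" for j
  proof (rule fps_bracket_eq_0)
    show "\<beta> j - \<beta> k \<notin> \<int>" using insert.prems(2)[of j k] insert.hyps j by auto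
    have "D j has_fps_expansion H k * (fps_const (\<beta> j) * H j + fps_X * fps_deriv (H j)) - H j * (fps_const (\<beta> k) * H k + fps_X * fps_deriv (H k))"
      unfolding D_def using H[of j] H[of k] j by (auto intro!: fps_expansion_intros)
    moreover have "D j has_fps_expansion 0"
      using D0[OF j] by (simp add: has_fps_expansion_0_iff)
    ultimately have "H k * (fps_const (\<beta> j) * H j + fps_X * fps_deriv (H j)) - H j * (fps_const (\<beta> k) * H k + fps_X * fps_deriv (H k)) = 0"
      using fps_expansion_unique_complex by blast
    then show "fps_const (\<beta> j - \<beta> k) * H k * H j + H k * (fps_X * fps_deriv (H j)) - fps_X * fps_deriv (H k) * H j = 0"
      by (simp add: algebra_simps flip: fps_const_sub)
  qed
  have zero_iff: "(\<forall>\<^sub>F x in nhds 0. h j x = 0) \<longleftrightarrow> H j = 0" if "j \<in> insert k I" for j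
    using H[OF that] fps_expansion_unique_complex has_fps_expansion_0_iff by metis
  have "H k = 0"
  proof (rule ccontr)
    assume "H k \<noteq> 0"
    then have "\<forall>j\<in>I. \<forall>\<^sub>F x in nhds 0. h j x = 0" using alt zero_iff by auto
    then have "\<forall>\<^sub>F x in nhds 0. \<forall>j\<in>I. h j x = 0" using insert.hyps by (simp add: eventually_ball_finite)
    then have "\<forall>\<^sub>F x in at 0 within S. \<forall>j\<in>I. h j x = 0" by (rule eventually_at_within_of_nhds)
    moreover have "\<forall>\<^sub>F x in at 0 within S. x \<in> S"
      by (auto simp: eventually_at_filter)
    ultimately have "\<forall>\<^sub>F x in at 0 within S. h k x = 0"
      using insert.prems(3) by eventually_elim (use insert.hyps S0 in auto)
    then have "\<forall>\<^sub>F x in nhds 0. h k x = 0"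
      using analytic_eventually_0[OF an S(2)] by blast
    with \<open>H k \<noteq> 0\<close> zero_iff[of k] show False by auto
  qed
  then have hk: "\<forall>\<^sub>F x in nhds 0. h k x = 0" using zero_iff by auto
  have "\<forall>\<^sub>F x in at 0 within S. (\<Sum>j\<in>I. x powr \<beta> j * h j x) = 0"
    using insert.prems(3) eventually_at_within_of_nhds[OF hk]
    by eventually_elim (use insert.hyps in auto)
  then have "i \<in> I \<Longrightarrow> \<forall>\<^sub>F x in nhds 0. h i x = 0"
    by (intro insert.IH) (use insert.prems in auto)
  then show ?case using hk insert.prems(4) by auto
qed

section \<open>The Euler transform on a slit domain\<close>

text \<open>With s = p - u (p - x) this is the integral of (s - x)^(a - 1) f(s) over the segment
  from x to p, that is, Gamma a times the Riemann--Liouville integral of order a based at p. The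
  parametrisation separates the power of the positive real 1 - u from that of p - x, so only the
  latter has a branch.\<close>

definition conv :: "complex \<Rightarrow> (complex \<Rightarrow> complex) \<Rightarrow> complex \<Rightarrow> complex \<Rightarrow> complex" where
  "conv a f p x = (p - x) powr a *
     integral {0..1} (\<lambda>u. of_real (1 - u) powr (a - 1) * f (p - of_real u * (p - x)))"

lemma continuous_on_powr_slit:
  assumes "continuous_on A f" "\<And>z. z \<in> A \<Longrightarrow> f z \<notin> \<real>\<^sub>\<le>\<^sub>0"
  shows "continuous_on A (\<lambda>z. f z powr (c :: complex))"
proof (rule continuous_on_powr_complex)
  show "A \<subseteq> {z. 0 \<le> Re (f z) \<or> Im (f z) \<noteq> 0}"
    using assms(2) by (auto simp: complex_nonpos_Reals_iff)
  show "0 < Re c" if "z \<in> A" "f z = 0" for z using assms(2)[OF that(1)] that(2) by simp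
qed (use assms in auto)

lemma segment_to_closure_in:
  fixes p x :: complex
  assumes "open S" "convex S" "p \<in> closure S" "x \<in> S" "0 < u" "u \<le> 1"
  shows "p - of_real u * (p - x) \<in> S"
  using mem_interior_closure_convex_shrink[of S x p u] assms
  by (simp add: interior_open scaleR_conv_of_real)

lemma continuous_conv_kernel:
  fixes p x :: complex
  assumes "open S" "convex S" "p \<in> closure S" "x \<in> S" "Re a > 1" "continuous_on (insert p S) f"
  shows "continuous_on {0..1} (\<lambda>u. complex_of_real (1 - u) powr (a - 1) * f (p - of_real u * (p - x)))"
proof -
  have "p - of_real u * (p - x) \<in> insert p S" if "u \<in> {0..1}" for u
    using segment_to_closure_in[OF assms(1-4), of u] that by (cases "u = 0") auto
  then have "(\<lambda>u. p - of_real u * (p - x)) ` {0..1} \<subseteq> insert p S" by blast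
  then have "continuous_on {0..1} (\<lambda>u. f (p - of_real u * (p - x)))"
    by (rule continuous_on_compose2[OF assms(6), rotated]) (intro continuous_intros)
  then show ?thesis
    using assms(5) by (intro continuous_intros) auto
qed

text \<open>The base point may lie on the boundary of S, where f is merely continuous. The local
  bounds come from the compact set \<open>M\<close> swept out by the segments from p to a small
  disc.\<close>

lemma conv_holomorphic:
  assumes S: "open S" "convex S" "p \<in> closure S" and a: "Re a > 1"
    and f: "f holomorphic_on S" "continuous_on (insert p S) f"
    and D: "open D" "D \<subseteq> S" "\<And>x. x \<in> D \<Longrightarrow> p - x \<notin> \<real>\<^sub>\<le>\<^sub>0"
  shows "conv a f p holomorphic_on D"
proof -
  have "(\<lambda>x. integral {0..1} (\<lambda>u. complex_of_real (1 - u) powr (a - 1) * f (p - of_real u * (p - x)))) holomorphic_on D"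
  proof (rule holomorphic_integral_param[where f' = "\<lambda>x u. of_real (1 - u) powr (a - 1) * (deriv f (p - of_real u * (p - x)) * of_real u)"])
    fix x and t :: real assume xt: "x \<in> D" "t \<in> {0<..<1}"
    have "p - of_real t * (p - x) \<in> S" using xt D(2) by (intro segment_to_closure_in S) auto
    then have f': "(f has_field_derivative deriv f (p - of_real t * (p - x))) (at (p - of_real t * (p - x)))"
      using f(1) S(1) holomorphic_derivI by blast
    have "((\<lambda>x. p - of_real t * (p - x)) has_field_derivative of_real t) (at x)"
      by (auto intro!: derivative_eq_intros)
    from DERIV_chain2[OF f' this]
    show "((\<lambda>x. of_real (1 - t) powr (a - 1) * f (p - of_real t * (p - x))) has_field_derivative
        of_real (1 - t) powr (a - 1) * (deriv f (p - of_real t * (p - x)) * of_real t)) (at x)"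
      by (rule DERIV_cmult)
  next
    have "continuous_on S (deriv f)"
      using f(1) S(1) holomorphic_deriv holomorphic_on_imp_continuous_on by blast
    then have "continuous_on (D \<times> {0<..<1}) (\<lambda>z. deriv f (p - of_real (snd z) * (p - fst z)))"
      by (rule continuous_on_compose2) (use D(2) in \<open>auto intro!: continuous_intros segment_to_closure_in S\<close>)
    then show "continuous_on (D \<times> {0<..<1}) (\<lambda>(x, t). of_real (1 - t) powr (a - 1) * (deriv f (p - of_real t * (p - x)) * of_real t))"
      unfolding case_prod_beta using a by (intro continuous_intros) auto
  next
    fix x assume "x \<in> D"
    then show "(\<lambda>u. complex_of_real (1 - u) powr (a - 1) * f (p - complex_of_real u * (p - x))) integrable_on {0..1}"
      using D(2) by (intro integrable_continuous_real continuous_conv_kernel[OF S _ a f(2)]) auto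
  next
    fix x0 assume "x0 \<in> D"
    then obtain e where e: "e > 0" "cball x0 e \<subseteq> D" using D(1) open_contains_cball by blast
    define M where "M = (\<lambda>z. p - of_real (snd z) * (p - fst z)) ` (cball x0 e \<times> {0..1::real})"
    have "compact M" unfolding M_def by (intro compact_continuous_image continuous_intros compact_Times) auto
    moreover have "M \<subseteq> insert p S"
    proof
      fix s assume "s \<in> M"
      then obtain x u where xu: "x \<in> cball x0 e" "u \<in> {0..1}" "s = p - of_real u * (p - x)" unfolding M_def by auto
      show "s \<in> insert p S"
      proof (cases "u = 0")
        case False
        then have "p - of_real u * (p - x) \<in> S"
          using xu e(2) D(2) by (intro segment_to_closure_in S) auto
        then show ?thesis using xu(3) by simp
      qed (use xu in simp)
    qed
    ultimately have "compact (f ` M)" by (intro compact_continuous_image continuous_on_subset[OF f(2)])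
    then have "bounded (f ` M)" by (rule compact_imp_bounded)
    then obtain C where "\<forall>y\<in>f ` M. cmod y \<le> C" unfolding bounded_iff ..
    then have C: "\<And>s. s \<in> M \<Longrightarrow> cmod (f s) \<le> C" by blast
    show "\<exists>e>0. \<exists>C. \<forall>x\<in>ball x0 e. \<forall>t\<in>{0<..<1}. cmod (complex_of_real (1 - t) powr (a - 1) * f (p - complex_of_real t * (p - x))) \<le> C"
    proof (rule exI[of _ e], intro conjI exI[of _ C] ballI)
      fix x and t :: real assume xt: "x \<in> ball x0 e" "t \<in> {0<..<1}"
      have "cmod (complex_of_real (1 - t) powr (a - 1)) * cmod (f (p - complex_of_real t * (p - x))) \<le> 1 * C"
      proof (intro mult_mono norm_powr_unit_interval C)
        show "p - complex_of_real t * (p - x) \<in> M"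
          unfolding M_def using xt by (intro image_eqI[of _ _ "(x, t)"]) auto
      qed (use xt a in auto)
      then show "cmod (complex_of_real (1 - t) powr (a - 1) * f (p - complex_of_real t * (p - x))) \<le> C"
        by (simp add: norm_mult)
    qed (use e in auto)
  qed fact
  then have "(\<lambda>x. (p - x) powr a * integral {0..1} (\<lambda>u. complex_of_real (1 - u) powr (a - 1) * f (p - of_real u * (p - x)))) holomorphic_on D"
    using D(3) by (intro holomorphic_intros)
  then show ?thesis by (simp add: conv_def[abs_def])
qed

section \<open>Model integrals of pure powers with a base point inside the sector\<close>

definition phi :: "complex \<Rightarrow> complex \<Rightarrow> complex \<Rightarrow> complex \<Rightarrow> complex" where
  "phi a \<beta> p = conv a (\<lambda>s. s powr \<beta>) p"

text \<open>The base point p lies inside the domain and is later taken so close to 0 that Taylor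
  series at 0 converge along the whole path. Restricting x to Re x < Re p keeps p - x off the branch
  cut.\<close>

locale slit_base =
  fixes S :: "complex set" and p a :: complex
  assumes S: "open S" "convex S" "S \<inter> \<real>\<^sub>\<le>\<^sub>0 = {}" "0 \<in> closure S"
    and p: "p \<in> S" "Re p > 0" and a: "Re a > 1"
begin

definition D where "D = S \<inter> {x. Re x < Re p}"

lemma D: "open D" "convex D" "D \<subseteq> S"
  using S by (auto simp: D_def open_halfspace_Re_lt convex_halfspace_Re_lt intro!: convex_Int open_Int)

lemma D_slit: "x \<in> D \<Longrightarrow> p - x \<notin> \<real>\<^sub>\<le>\<^sub>0" "x \<in> D \<Longrightarrow> x \<notin> \<real>\<^sub>\<le>\<^sub>0" "x \<in> D \<Longrightarrow> x \<noteq> 0" "x \<in> D \<Longrightarrow> x \<noteq> p"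
  using S by (auto simp: D_def complex_nonpos_Reals_iff)

lemma p_slit: "p \<notin> \<real>\<^sub>\<le>\<^sub>0" "p \<noteq> 0" using p by (auto simp: complex_nonpos_Reals_iff)

lemma seg: "x \<in> S \<Longrightarrow> u \<in> {0..1} \<Longrightarrow> p - of_real u * (p - x) \<in> S"
  using segment_to_closure_in[OF S(1,2), of p x u] p closure_subset[of S] by (cases "u = 0") auto

lemma seg_slit:
  assumes "x \<in> S" "u \<in> {0..1}"
  shows "p - of_real u * (p - x) \<notin> \<real>\<^sub>\<le>\<^sub>0" "p - of_real u * (p - x) \<noteq> 0"
  using seg[OF assms] S(3) by auto

lemma eps_p: "0 < e \<Longrightarrow> e \<le> 1 \<Longrightarrow> of_real e * p \<in> S"
  using segment_to_closure_in[OF S(1,2,4) p(1), of e] by simp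

lemma islimpt_0: "0 islimpt S"
  using S(3,4) by (auto simp: closure_def)

text \<open>Both relations are integrations by parts: the exact derivative of (1 - u)^a s(u)^g is
  integrated over [0, 1], with g = \<beta> for the inhomogeneous Euler equation and g = \<beta> + 1
  for the contiguity relation between neighbouring exponents. The boundary term at u = 1 vanishes
  through the factor (1 - u)^a.\<close>

lemma phi_deriv:
  assumes x: "x \<in> D"
  shows "(phi a \<beta> p has_field_derivative ((a + \<beta>) * phi a \<beta> p x - p powr (\<beta> + 1) * (p - x) powr (a - 1)) / x) (at x)"
    (is ?A)
   and "(a + \<beta> + 1) * phi a (\<beta> + 1) p x - (\<beta> + 1) * x * phi a \<beta> p x = (p - x) powr a * p powr (\<beta> + 1)"
    (is ?B)
proof -
  define w where "w = p - x"
  have w: "w \<notin> \<real>\<^sub>\<le>\<^sub>0" "w \<noteq> 0" "x = p - w" using D_slit[OF x] by (auto simp: w_def)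
  have xS: "x \<in> S" using x D by auto
  define s where "s = (\<lambda>u::real. p - of_real u * w)"
  have s: "s u \<notin> \<real>\<^sub>\<le>\<^sub>0" "s u \<noteq> 0" if "u \<in> {0..1}" for u
    using seg_slit[OF xS that] by (auto simp: s_def w_def)
  define k where "k = (\<lambda>u::real. complex_of_real (1 - u) powr (a - 1))"
  have kc[continuous_intros]: "continuous_on X k" if "X \<subseteq> {0..1}" for X unfolding k_def using a that by (intro continuous_intros) auto
  have sc[continuous_intros]: "continuous_on X (\<lambda>u. s u powr g)" if "X \<subseteq> {0..1}" for g X
  proof -
    have "continuous_on X s" unfolding s_def by (intro continuous_intros)
    then show ?thesis using s(1) that by (intro continuous_on_powr_slit) auto
  qed
  define J where "J = (\<lambda>\<beta>. integral {0..1} (\<lambda>u. k u * s u powr \<beta>))"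
  define J' where "J' = integral {0..1} (\<lambda>u. k u * (\<beta> * s u powr (\<beta> - 1) * of_real u))"
  have phi: "phi a \<beta> p x = w powr a * J \<beta>" for \<beta>
    by (simp add: phi_def conv_def J_def w_def s_def k_def)
  have hJ: "((\<lambda>u. k u * s u powr \<beta>) has_integral J \<beta>) {0..1}" for \<beta>
    unfolding J_def by (intro integrable_integral integrable_continuous_real continuous_intros) auto
  have hJ': "((\<lambda>u. k u * (\<beta> * s u powr (\<beta> - 1) * of_real u)) has_integral J') {0..1}"
    unfolding J'_def by (intro integrable_integral integrable_continuous_real continuous_intros) auto
  have ds: "((\<lambda>u. s u powr g) has_vector_derivative (- (g * w * s u powr (g - 1)))) (at u)"
    if "u \<in> {0<..<1}" for u g
  proof -
    have "(s has_vector_derivative (- w)) (at u)"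
      unfolding s_def by (auto intro!: derivative_eq_intros)
    moreover have "((\<lambda>z. z powr g) has_field_derivative (g * s u powr (g - 1))) (at (s u))"
      using s[of u] that by (intro has_field_derivative_powr) auto
    ultimately have "(((\<lambda>z. z powr g) \<circ> s) has_vector_derivative ((- w) * (g * s u powr (g - 1)))) (at u)"
      by (rule field_vector_diff_chain_at)
    then show ?thesis by (simp add: o_def mult_ac)
  qed
  have dk: "((\<lambda>u. complex_of_real (1 - u) powr a) has_vector_derivative (- (a * k u))) (at u)"
    if "u \<in> {0<..<1}" for u
  proof -
    have "((\<lambda>u. complex_of_real (1 - u)) has_vector_derivative (- 1)) (at u)"
      by (auto intro!: derivative_eq_intros simp: of_real_def)
    moreover have "((\<lambda>z. z powr a) has_field_derivative (a * k u)) (at (complex_of_real (1 - u)))"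
      unfolding k_def using that by (intro has_field_derivative_powr) (auto simp: complex_nonpos_Reals_iff)
    ultimately have "(((\<lambda>z. z powr a) \<circ> (\<lambda>u. complex_of_real (1 - u))) has_vector_derivative ((- 1) * (a * k u))) (at u)"
      by (rule field_vector_diff_chain_at)
    then show ?thesis by (simp add: o_def mult_ac)
  qed
  have k1: "complex_of_real (1 - u) powr a = of_real (1 - u) * k u" if "u \<in> {0<..<1}" for u
    using that by (simp add: k_def powr_diff)
  have Q: "((\<lambda>u. - (a * k u) * s u powr g + of_real (1 - u) powr a * (- (g * w * s u powr (g - 1)))) has_integral
       (complex_of_real (1 - 1) powr a * s 1 powr g - complex_of_real (1 - 0) powr a * s 0 powr g)) {0..1}" for g
  proof (rule fundamental_theorem_of_calculus_interior)
    show "continuous_on {0..1} (\<lambda>u. complex_of_real (1 - u) powr a * s u powr g)"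
      using a by (intro continuous_intros) auto
    show "((\<lambda>u. complex_of_real (1 - u) powr a * s u powr g) has_vector_derivative
         (- (a * k u) * s u powr g + of_real (1 - u) powr a * (- (g * w * s u powr (g - 1))))) (at u)"
      if "u \<in> {0<..<1}" for u
      using has_vector_derivative_mult[OF dk[OF that] ds[OF that]] by (simp add: algebra_simps)
  qed auto
  \<comment> \<open>The factor p is chosen because x u - s = - p (1 - u). This rewrites the exact
    derivative through \<open>J \<beta>\<close> and \<open>J'\<close> alone.\<close>
  have "((\<lambda>u. p * (- (a * k u) * s u powr \<beta> + of_real (1 - u) powr a * (- (\<beta> * w * s u powr (\<beta> - 1))))) has_integral
     (- a * x * J \<beta> + x * w * J' - (a + \<beta>) * w * J \<beta>)) {0..1}"
  proof (rule has_integral_spike[rotated 2])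
    show "((\<lambda>u. (-a * x) * (k u * s u powr \<beta>) + (x * w) * (k u * (\<beta> * s u powr (\<beta> - 1) * of_real u)) - ((a + \<beta>) * w) * (k u * s u powr \<beta>)) has_integral
     (- a * x * J \<beta> + x * w * J' - (a + \<beta>) * w * J \<beta>)) {0..1}"
      by (intro has_integral_diff has_integral_add has_integral_mult_right hJ hJ')
    show "p * (- (a * k u) * s u powr \<beta> + of_real (1 - u) powr a * (- (\<beta> * w * s u powr (\<beta> - 1)))) =
      (-a * x) * (k u * s u powr \<beta>) + (x * w) * (k u * (\<beta> * s u powr (\<beta> - 1) * of_real u)) - ((a + \<beta>) * w) * (k u * s u powr \<beta>)"
      if "u \<in> {0..1} - {0, 1}" for u
    proof -
      have "s u powr \<beta> = s u * s u powr (\<beta> - 1)" using s[of u] that by (simp add: powr_diff)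
      moreover have "complex_of_real (1 - u) powr a = of_real (1 - u) * k u" using that by (intro k1) auto
      ultimately show ?thesis unfolding s_def w(3) by (simp only:) (simp add: algebra_simps)
    qed
  qed auto
  moreover have "((\<lambda>u. p * (- (a * k u) * s u powr \<beta> + of_real (1 - u) powr a * (- (\<beta> * w * s u powr (\<beta> - 1))))) has_integral
       p * (- (p powr \<beta>))) {0..1}"
    using has_integral_mult_right[OF Q[of \<beta>], of p] a by (simp add: s_def)
  ultimately have e1: "- a * x * J \<beta> + x * w * J' - (a + \<beta>) * w * J \<beta> = p * (- (p powr \<beta>))"
    by (rule has_integral_unique)
  have "((\<lambda>u. - (a * k u) * s u powr (\<beta> + 1) + of_real (1 - u) powr a * (- ((\<beta> + 1) * w * s u powr (\<beta> + 1 - 1)))) has_integral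
     (- ((a + \<beta> + 1) * J (\<beta> + 1)) + (\<beta> + 1) * x * J \<beta>)) {0..1}"
  proof (rule has_integral_spike[rotated 2])
    show "((\<lambda>u. - ((a + \<beta> + 1) * (k u * s u powr (\<beta> + 1))) + ((\<beta> + 1) * x) * (k u * s u powr \<beta>)) has_integral
       (- ((a + \<beta> + 1) * J (\<beta> + 1)) + (\<beta> + 1) * x * J \<beta>)) {0..1}"
      by (intro has_integral_neg has_integral_add has_integral_mult_right hJ)
    show "- (a * k u) * s u powr (\<beta> + 1) + of_real (1 - u) powr a * (- ((\<beta> + 1) * w * s u powr (\<beta> + 1 - 1))) =
       - ((a + \<beta> + 1) * (k u * s u powr (\<beta> + 1))) + ((\<beta> + 1) * x) * (k u * s u powr \<beta>)"
      if "u \<in> {0..1} - {0, 1}" for u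
    proof -
      have "s u powr (\<beta> + 1) = s u * s u powr \<beta>" using s[of u] that by (simp add: powr_add)
      moreover have "complex_of_real (1 - u) powr a = of_real (1 - u) * k u" using that by (intro k1) auto
      moreover have "\<beta> + 1 - 1 = \<beta>" by simp
      ultimately show ?thesis unfolding s_def w(3) by (simp only:) (simp add: algebra_simps)
    qed
  qed auto
  from has_integral_unique[OF this Q[of "\<beta> + 1"]]
  have e2: "- ((a + \<beta> + 1) * J (\<beta> + 1)) + (\<beta> + 1) * x * J \<beta> = - (p powr (\<beta> + 1))"
    by (simp add: s_def)
  have "(a + \<beta> + 1) * phi a (\<beta> + 1) p x - (\<beta> + 1) * x * phi a \<beta> p x =
     - (w powr a) * (- ((a + \<beta> + 1) * J (\<beta> + 1)) + (\<beta> + 1) * x * J \<beta>)"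
    by (simp add: phi algebra_simps)
  also have "\<dots> = w powr a * p powr (\<beta> + 1)" unfolding e2 by simp
  finally show ?B by (simp add: w_def)
  have "((\<lambda>y. integral (cbox 0 1) (\<lambda>u. k u * (p - of_real u * (p - y)) powr \<beta>)) has_field_derivative
      integral (cbox 0 1) (\<lambda>u. k u * (\<beta> * (p - of_real u * (p - x)) powr (\<beta> - 1) * of_real u))) (at x within D)"
  proof (rule leibniz_rule_field_derivative)
    fix y and u :: real assume yu: "y \<in> D" "u \<in> cbox 0 1"
    then have y: "y \<in> S" using D by auto
    show "((\<lambda>y. k u * (p - of_real u * (p - y)) powr \<beta>) has_field_derivative
        k u * (\<beta> * (p - of_real u * (p - y)) powr (\<beta> - 1) * of_real u)) (at y within D)"
    proof (intro DERIV_cmult)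
      have "((\<lambda>y. p - of_real u * (p - y)) has_field_derivative of_real u) (at y within D)"
        by (auto intro!: derivative_eq_intros)
      moreover have "p - of_real u * (p - y) \<notin> \<real>\<^sub>\<le>\<^sub>0" using seg_slit[OF y, of u] yu by simp
      ultimately show "((\<lambda>y. (p - of_real u * (p - y)) powr \<beta>) has_field_derivative
          \<beta> * (p - of_real u * (p - y)) powr (\<beta> - 1) * of_real u) (at y within D)"
        by (intro DERIV_chain2[OF has_field_derivative_powr])
    qed
  next
    fix y assume y: "y \<in> D"
    then have "y \<in> S" using D by auto
    then have "continuous_on {0..1} (\<lambda>u. (p - of_real u * (p - y)) powr \<beta>)"
      by (intro continuous_on_powr_slit continuous_intros seg_slit)
    then show "(\<lambda>u. k u * (p - of_real u * (p - y)) powr \<beta>) integrable_on cbox 0 1"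
      unfolding box_real by (intro integrable_continuous_real continuous_on_mult kc order_refl)
  next
    have "continuous_on (D \<times> {0..1::real}) (\<lambda>z. (p - of_real (snd z) * (p - fst z)) powr (\<beta> - 1))"
      by (intro continuous_on_powr_slit continuous_intros seg_slit) (use D(3) in auto)
    moreover have "continuous_on (D \<times> {0..1::real}) (\<lambda>z. k (snd z))"
      by (rule continuous_on_compose2[OF kc[OF order_refl]]) (auto intro!: continuous_intros)
    ultimately show "continuous_on (D \<times> cbox 0 1) (\<lambda>(y, u). k u * (\<beta> * (p - of_real u * (p - y)) powr (\<beta> - 1) * of_real u))"
      unfolding case_prod_beta box_real by (intro continuous_on_mult continuous_on_const continuous_on_of_real continuous_on_snd continuous_on_id)
  qed (use x D in auto)
  then have dJ: "((\<lambda>y. integral {0..1} (\<lambda>u. k u * (p - of_real u * (p - y)) powr \<beta>)) has_field_derivative J') (at x)"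
    using at_within_open[OF x D(1)] by (simp add: J'_def s_def w_def)
  have "((\<lambda>y. p - y) has_field_derivative -1) (at x)" by (auto intro!: derivative_eq_intros)
  then have "((\<lambda>y. (p - y) powr a) has_field_derivative (a * (p - x) powr (a - 1)) * - 1) (at x)"
    by (intro DERIV_chain2[OF has_field_derivative_powr] D_slit x)
  then have "((\<lambda>y. (p - y) powr a) has_field_derivative (- (a * w powr (a - 1)))) (at x)"
    by (simp add: w_def)
  from DERIV_mult[OF this dJ]
  have "(phi a \<beta> p has_field_derivative (- (a * w powr (a - 1))) * J \<beta> + J' * w powr a) (at x)"
    unfolding phi_def conv_def[abs_def] k_def J_def s_def w_def .
  moreover have "(- (a * w powr (a - 1))) * J \<beta> + J' * w powr a =
      ((a + \<beta>) * phi a \<beta> p x - p powr (\<beta> + 1) * (p - x) powr (a - 1)) / x"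
  proof -
    define X where "X = w powr (a - 1)"
    have wX: "w powr a = w * X" using w by (simp add: powr_diff X_def)
    have pX: "p powr (\<beta> + 1) = p * p powr \<beta>" using p_slit by (simp add: powr_add)
    have e1': "- a * x * J \<beta> + x * w * J' = p * (- (p powr \<beta>)) + (a + \<beta>) * w * J \<beta>"
      using e1 by (simp only: diff_eq_eq)
    have "x * (- (a * X) * J \<beta> + J' * (w * X)) = X * (- a * x * J \<beta> + x * w * J')"
      by (simp add: algebra_simps)
    also have "\<dots> = (a + \<beta>) * (w * X * J \<beta>) - p * p powr \<beta> * X"
      unfolding e1' by (simp add: algebra_simps)
    finally have "- (a * X) * J \<beta> + J' * (w * X) = ((a + \<beta>) * (w * X * J \<beta>) - p * p powr \<beta> * X) / x"
      using D_slit(3)[OF x] by (simp add: eq_divide_eq mult.commute)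
    then show ?thesis unfolding phi wX pX w_def[symmetric] X_def[symmetric] .
  qed
  ultimately show ?A by simp
qed

end

text \<open>One distance d bounds all the denominators g - j of a power series, and also those of
  every shift g + k.\<close>

lemma nonint_dist:
  fixes g :: complex
  assumes "g \<notin> \<int>"
  shows "\<exists>d>0. \<forall>i. d \<le> cmod (g - of_int i)"
proof -
  have "open (- (\<int> :: complex set))" by (simp add: open_Compl)
  from openE[OF this, of g] obtain d where d: "d > 0" "ball g d \<subseteq> - \<int>" using assms by auto
  have "d \<le> cmod (g - of_int i)" for i
  proof -
    have "of_int i \<notin> ball g d" using d(2) by auto
    then show "d \<le> cmod (g - of_int i)" by (simp add: dist_norm)
  qed
  with d(1) show ?thesis by blast
qed

lemma add_nat_nonint: "(g :: complex) \<notin> \<int> \<Longrightarrow> g + of_nat k \<notin> \<int>"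
  by (metis Ints_diff Ints_of_nat add_diff_cancel_right')

lemma nonint_diff_1: "(g :: complex) \<notin> \<int> \<Longrightarrow> g - 1 \<notin> \<int>"
  by (metis Ints_1 Ints_add diff_add_cancel)

lemma powr_times_of_real: "r > 0 \<Longrightarrow> z \<noteq> 0 \<Longrightarrow> (of_real r * z) powr c = of_real r powr c * z powr (c :: complex)"
  by (simp add: powr_def Ln_times_of_real Ln_of_real exp_add ring_distribs)

text \<open>The value Beta(a, - a - \<beta>), written with \<open>rGamma\<close> so that it is
  defined, and equal to 0, when \<beta> is a natural number.\<close>

definition Kc :: "complex \<Rightarrow> complex \<Rightarrow> complex" where
  "Kc a \<beta> = Gamma a * Gamma (- \<beta> - a) * rGamma (- \<beta>)"

lemma Beta_eq_Kc: "Beta a (- (a + \<beta>)) = Kc a \<beta>"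
proof -
  have 1: "a + - (a + \<beta>) = - \<beta>" by simp
  have 2: "- (a + \<beta>) = - \<beta> - a" by simp
  show ?thesis unfolding Beta_altdef Kc_def 1 unfolding 2 by (rule refl)
qed

lemma Kc_rec:
  assumes "a + \<beta> \<notin> \<int>"
  shows "(a + \<beta> + 1) * Kc a (\<beta> + 1) = (\<beta> + 1) * Kc a \<beta>"
proof -
  have "- \<beta> - a - 1 \<notin> \<int>"
  proof
    assume "- \<beta> - a - 1 \<in> \<int>"
    from Ints_diff[OF Ints_minus[OF this] Ints_1] have "- (- \<beta> - a - 1) - 1 \<in> \<int>" .
    moreover have "- (- \<beta> - a - 1) - 1 = a + \<beta>" by simp
    ultimately show False using assms by metis
  qed
  then have "- \<beta> - a - 1 \<notin> \<int>\<^sub>\<le>\<^sub>0" by auto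
  from Gamma_plus1[OF this] have "Gamma (- \<beta> - a) = (- \<beta> - a - 1) * Gamma (- \<beta> - a - 1)" by simp
  moreover have "rGamma (- \<beta> - 1) = (- \<beta> - 1) * rGamma (- \<beta>)"
    using rGamma_plus1[of "- \<beta> - 1"] by simp
  moreover have "- (\<beta> + 1) - a = - \<beta> - a - 1" "- (\<beta> + 1) = - \<beta> - 1" by simp_all
  ultimately have "Kc a (\<beta> + 1) = Gamma a * Gamma (- \<beta> - a - 1) * ((- \<beta> - 1) * rGamma (- \<beta>))"
    "Kc a \<beta> = Gamma a * ((- \<beta> - a - 1) * Gamma (- \<beta> - a - 1)) * rGamma (- \<beta>)"
    by (simp_all only: Kc_def)
  then show ?thesis by (simp only:) (simp add: algebra_simps)
qed

context slit_base
begin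

definition Ef :: "complex fps" where "Ef = fps_expansion (\<lambda>x. (p - x) powr (a - 1)) 0"

text \<open>The power series solution at 0 of x R' = g R - (p - x)^(a - 1). With g = a + \<beta>,
  its multiple by \<open>p powr (\<beta> + 1)\<close> is a particular solution of the Euler equation
  of \<open>phi\<close>.\<close>

definition Rf :: "complex \<Rightarrow> complex fps" where
  "Rf g = Abs_fps (\<lambda>j. fps_nth Ef j / (g - of_nat j))"

lemma E_hol: "(\<lambda>x. (p - x) powr (a - 1)) holomorphic_on eball 0 (Re p)"
proof (rule holomorphic_on_powr)
  show "p - z \<notin> \<real>\<^sub>\<le>\<^sub>0" if "z \<in> eball 0 (Re p)" for z
  proof -
    have "cmod z < Re p" using that by (simp add: dist_norm)
    with complex_Re_le_cmod[of z] have "Re (p - z) > 0" by simp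
    then show ?thesis by (auto simp: complex_nonpos_Reals_iff)
  qed
qed (auto intro!: holomorphic_intros)

lemma Ef_conv: "fps_conv_radius Ef \<ge> Re p"
  unfolding Ef_def by (rule conv_radius_fps_expansion[OF E_hol])

lemma eval_Ef: "cmod x < Re p \<Longrightarrow> eval_fps Ef x = (p - x) powr (a - 1)"
  unfolding Ef_def by (subst eval_fps_expansion'[OF E_hol]) auto

lemma Ef_summable: "cmod x < Re p \<Longrightarrow> summable (\<lambda>j. cmod (fps_nth Ef j) * cmod x ^ j)"
  using norm_summable_fps[of x Ef] less_le_trans[OF _ Ef_conv, of "ereal (cmod x)"]
  by (simp add: norm_mult norm_power)

lemma Rf_term_bound:
  assumes "d > 0" "\<And>i. d \<le> cmod (g - of_int i)"
  shows "cmod (fps_nth (Rf g) j * x ^ j) \<le> cmod (fps_nth Ef j) * cmod x ^ j / d"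
proof -
  have "cmod (fps_nth (Rf g) j * x ^ j) = cmod (fps_nth Ef j) * cmod x ^ j / cmod (g - of_nat j)"
    by (simp add: Rf_def norm_mult norm_divide norm_power)
  also have "\<dots> \<le> cmod (fps_nth Ef j) * cmod x ^ j / d"
    using assms(2)[of "int j"] assms(1) by (intro divide_left_mono mult_nonneg_nonneg mult_pos_pos) auto
  finally show ?thesis .
qed

lemma Rf_conv:
  assumes "g \<notin> \<int>"
  shows "fps_conv_radius (Rf g) \<ge> Re p"
proof -
  obtain d where d: "d > 0" "\<And>i. d \<le> cmod (g - of_int i)" using nonint_dist[OF assms] by blast
  show ?thesis unfolding fps_conv_radius_def
  proof (rule conv_radius_geI_ex')
    fix r assume r: "0 < r" "ereal r < ereal (Re p)"
    show "summable (\<lambda>n. fps_nth (Rf g) n * complex_of_real r ^ n)"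
    proof (rule summable_comparison_test'[of _ 0])
      show "cmod (fps_nth (Rf g) n * complex_of_real r ^ n) \<le> cmod (fps_nth Ef n) * cmod (complex_of_real r) ^ n / d" for n
        by (rule Rf_term_bound[OF d])
      show "summable (\<lambda>n. cmod (fps_nth Ef n) * cmod (complex_of_real r) ^ n / d)"
        using r by (intro summable_divide Ef_summable) auto
    qed
  qed
qed

lemma Rf_conv_less: "g \<notin> \<int> \<Longrightarrow> cmod x < Re p \<Longrightarrow> ereal (cmod x) < fps_conv_radius (Rf g)"
  by (rule less_le_trans[OF _ Rf_conv]) simp_all

text \<open>The bound depends on g only through its distance from the integers. It is therefore the
  same for all shifts g + k, which permits summation over k.\<close>

lemma Rf_bound:
  assumes "d > 0" "\<And>i. d \<le> cmod (g - of_int i)" "g \<notin> \<int>" "cmod x \<le> Re p / 2"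
  shows "cmod (eval_fps (Rf g) x) \<le> (\<Sum>j. cmod (fps_nth Ef j) * (Re p / 2) ^ j) / d"
proof -
  have s: "summable (\<lambda>j. cmod (fps_nth Ef j) * (Re p / 2) ^ j)"
    using Ef_summable[of "of_real (Re p / 2)"] p by simp
  have le: "cmod (fps_nth (Rf g) j * x ^ j) \<le> cmod (fps_nth Ef j) * (Re p / 2) ^ j / d" for j
    using assms p by (intro order_trans[OF Rf_term_bound[OF assms(1,2)]] divide_right_mono mult_left_mono power_mono) auto
  have s': "summable (\<lambda>j. cmod (fps_nth (Rf g) j * x ^ j))"
    by (rule summable_comparison_test'[of _ 0, OF summable_divide[OF s]]) (use le in auto)
  have "cmod (eval_fps (Rf g) x) \<le> (\<Sum>j. cmod (fps_nth (Rf g) j * x ^ j))"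
    unfolding eval_fps_def by (rule summable_norm[OF s'])
  also have "\<dots> \<le> (\<Sum>j. cmod (fps_nth Ef j) * (Re p / 2) ^ j / d)"
    by (intro suminf_le le s' summable_divide s)
  finally show ?thesis by (simp add: suminf_divide[OF s])
qed

lemma Rf_eq:
  assumes "g \<notin> \<int>" "cmod x < Re p"
  shows "x * eval_fps (fps_deriv (Rf g)) x = g * eval_fps (Rf g) x - (p - x) powr (a - 1)"
proof -
  have g: "g \<noteq> of_nat j" for j using assms(1) by auto
  have "fps_nth (fps_X * fps_deriv (Rf g)) j = fps_nth (fps_const g * Rf g - Ef) j" for j
    using g[of j] by (cases j) (auto simp: Rf_def field_simps)
  then have eq: "fps_X * fps_deriv (Rf g) = fps_const g * Rf g - Ef" by (simp add: fps_eq_iff)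
  have 1: "ereal (cmod x) < fps_conv_radius (Rf g)" by (rule Rf_conv_less[OF assms])
  have 2: "ereal (cmod x) < fps_conv_radius Ef" by (rule less_le_trans[OF _ Ef_conv]) (use assms in simp)
  have 3: "ereal (cmod x) < fps_conv_radius (fps_deriv (Rf g))" by (rule less_le_trans[OF 1 fps_conv_radius_deriv])
  have 4: "ereal (cmod x) < fps_conv_radius (fps_const g * Rf g)"
    by (rule less_le_trans[OF _ fps_conv_radius_mult]) (use 1 in simp)
  have "eval_fps (fps_X * fps_deriv (Rf g)) x = x * eval_fps (fps_deriv (Rf g)) x"
    using 3 by (subst eval_fps_mult) auto
  moreover have "eval_fps (fps_const g * Rf g - Ef) x = g * eval_fps (Rf g) x - (p - x) powr (a - 1)"
    using 1 2 4 by (subst eval_fps_diff) (auto simp: eval_fps_mult eval_Ef[OF assms(2)])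
  ultimately show ?thesis by (simp add: eq)
qed

lemma Rf_deriv:
  assumes "g \<notin> \<int>" "cmod x < Re p"
  shows "(eval_fps (Rf g) has_field_derivative eval_fps (fps_deriv (Rf g)) x) (at x)"
  by (rule has_field_derivative_eval_fps[OF Rf_conv_less[OF assms]])

definition B where "B = S \<inter> ball 0 (Re p)"

lemma B: "open B" "convex B" "B \<subseteq> D" "B \<subseteq> S" "0 islimpt B" "B \<inter> \<real>\<^sub>\<le>\<^sub>0 = {}" "x \<in> B \<Longrightarrow> cmod x < Re p"
proof -
  show "B \<subseteq> D"
  proof
    fix x assume "x \<in> B"
    then have "x \<in> S" "cmod x < Re p" by (auto simp: B_def)
    with complex_Re_le_cmod[of x] show "x \<in> D" by (simp add: D_def)
  qed
  show "0 islimpt B" unfolding B_def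
    using p by (intro islimpt_Int_eventually islimpt_0 eventually_at_in_open') auto
qed (use S in \<open>auto simp: B_def intro: convex_Int\<close>)

definition decomp where
  "decomp \<beta> K \<longleftrightarrow> (\<forall>x\<in>B. phi a \<beta> p x = K * x powr (a + \<beta>) + p powr (\<beta> + 1) * eval_fps (Rf (a + \<beta>)) x)"

text \<open>The homogeneous equation is solved by x^(a + \<beta>): divided by it, the difference
  between \<open>phi\<close> and the particular solution has derivative zero on the convex set
  \<open>B\<close>.\<close>

lemma ex_decomp:
  assumes g: "a + \<beta> \<notin> \<int>"
  shows "\<exists>K. decomp \<beta> K"
proof -
  define g where "g = a + \<beta>"
  define P where "P = p powr (\<beta> + 1)"
  have "\<exists>K. \<forall>x\<in>B. (phi a \<beta> p x - P * eval_fps (Rf g) x) * x powr (- g) = K"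
  proof (rule has_field_derivative_zero_constant)
    fix x assume x: "x \<in> B"
    then have xD: "x \<in> D" "x \<notin> \<real>\<^sub>\<le>\<^sub>0" "x \<noteq> 0" "cmod x < Re p" using B D_slit by auto
    define F where "F = phi a \<beta> p x"
    define R where "R = eval_fps (Rf g) x"
    define R' where "R' = eval_fps (fps_deriv (Rf g)) x"
    define X where "X = x powr (- g - 1)"
    define W where "W = (p - x) powr (a - 1)"
    have "((\<lambda>x. (phi a \<beta> p x - P * eval_fps (Rf g) x) * x powr (- g)) has_field_derivative
        (((a + \<beta>) * phi a \<beta> p x - p powr (\<beta> + 1) * (p - x) powr (a - 1)) / x - P * eval_fps (fps_deriv (Rf g)) x) * x powr (- g)
        + (- g * x powr (- g - 1)) * (phi a \<beta> p x - P * eval_fps (Rf g) x)) (at x)"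
      using g xD by (intro DERIV_mult DERIV_diff DERIV_cmult phi_deriv Rf_deriv has_field_derivative_powr) (auto simp: g_def)
    also have "(((a + \<beta>) * phi a \<beta> p x - p powr (\<beta> + 1) * (p - x) powr (a - 1)) / x - P * eval_fps (fps_deriv (Rf g)) x) * x powr (- g)
        + (- g * x powr (- g - 1)) * (phi a \<beta> p x - P * eval_fps (Rf g) x) = 0"
    proof -
      have xp: "x powr (- g) = x * X" using xD by (simp add: X_def powr_diff)
      have R': "x * R' = g * R - W" using Rf_eq[of g x] g xD by (simp add: g_def R_def R'_def W_def)
      have "((g * F - P * W) / x - P * R') * (x * X) + (- g * X) * (F - P * R)
         = ((g * F - P * W) - P * (x * R')) * X + (- g * X) * (F - P * R)"
        using xD(3) by (simp add: field_simps)
      also have "\<dots> = 0" unfolding R' by (simp add: algebra_simps)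
      finally show ?thesis
        unfolding xp F_def[symmetric] R_def[symmetric] R'_def[symmetric] X_def[symmetric] W_def[symmetric] P_def[symmetric] g_def[symmetric] .
    qed
    finally show "((\<lambda>x. (phi a \<beta> p x - P * eval_fps (Rf g) x) * x powr (- g)) has_field_derivative 0) (at x within B)"
      by (rule has_field_derivative_at_within)
  qed (rule B)
  then obtain K where K: "\<And>x. x \<in> B \<Longrightarrow> (phi a \<beta> p x - P * eval_fps (Rf g) x) * x powr (- g) = K" by blast
  have "decomp \<beta> K"
    unfolding decomp_def g_def[symmetric] P_def[symmetric]
  proof
    fix x assume x: "x \<in> B"
    then have "x \<noteq> 0" using B D_slit by auto
    then have "x powr (- g) * x powr g = 1" by (simp add: powr_minus)
    then have "K * x powr g = phi a \<beta> p x - P * eval_fps (Rf g) x"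
      unfolding K[OF x, symmetric] by (simp add: mult.assoc)
    then show "phi a \<beta> p x = K * x powr g + P * eval_fps (Rf g) x" by simp
  qed
  then show ?thesis by blast
qed

lemma Rf_analytic: "g \<notin> \<int> \<Longrightarrow> eval_fps (Rf g) analytic_on {0}"
  using Rf_conv_less[of g 0] p by (intro analytic_on_eval_fps) (auto simp: zero_ereal_def)

text \<open>Inserting both decompositions into the contiguity relation leaves a constant times x^(a
  + \<beta> + 1) plus an analytic function. These separate because the exponent is not an
  integer.\<close>

lemma decomp_rec:
  assumes g: "a + \<beta> \<notin> \<int>" and K: "decomp \<beta> K" "decomp (\<beta> + 1) K'"
  shows "(a + \<beta> + 1) * K' = (\<beta> + 1) * K"
proof -
  have g1: "a + \<beta> + 1 \<notin> \<int>" using add_nat_nonint[OF g, of 1] by simp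
  \<comment> \<open>Index 0 is the singular term, whose coefficient is constant; index 1 collects
    everything analytic at 0 under the exponent 0.\<close>
  define h where "h = (\<lambda>(i::nat) x::complex. if i = 0 then (a + \<beta> + 1) * K' - (\<beta> + 1) * K else
     (a + \<beta> + 1) * (p powr (\<beta> + 1 + 1) * eval_fps (Rf (a + \<beta> + 1)) x)
     - (\<beta> + 1) * x * (p powr (\<beta> + 1) * eval_fps (Rf (a + \<beta>)) x) - (p - x) powr a * p powr (\<beta> + 1))"
  define e where "e = (\<lambda>i::nat. if i = 0 then a + \<beta> + 1 else 0)"
  have pw: "(\<lambda>x. (p - x) powr a) analytic_on {0}"
    using p_slit by (intro analytic_intros) auto
  have "eventually (\<lambda>x. h 0 x = 0) (nhds 0)"
  proof (rule powr_separation[OF B(1,5,6), where I = "{0,1::nat}" and h = h and \<beta> = e])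
    show "h i analytic_on {0}" if "i \<in> {0,1}" for i
      using that g g1 unfolding h_def
      by (auto intro!: analytic_on_mult analytic_on_add analytic_on_diff Rf_analytic pw)
    show "e i - e j \<notin> \<int>" if "i \<in> {0,1}" "j \<in> {0,1}" "i \<noteq> j" for i j
      using that g1 Ints_minus[of "- a - \<beta> - 1"] by (auto simp: e_def algebra_simps)
    have "(\<Sum>i\<in>{0,1}. x powr e i * h i x) = 0" if x: "x \<in> B" for x
    proof -
      have xD: "x \<in> D" "x \<noteq> 0" using B D_slit x by auto
      note rc = phi_deriv(2)[OF xD(1), of \<beta>]
      have 1: "phi a \<beta> p x = K * x powr (a + \<beta>) + p powr (\<beta> + 1) * eval_fps (Rf (a + \<beta>)) x"
        using K(1) x unfolding decomp_def by blast
      have "phi a (\<beta> + 1) p x = K' * x powr (a + (\<beta> + 1)) + p powr (\<beta> + 1 + 1) * eval_fps (Rf (a + (\<beta> + 1))) x"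
        using K(2) x unfolding decomp_def by blast
      moreover have "a + (\<beta> + 1) = a + \<beta> + 1" by simp
      moreover have "x powr (a + \<beta> + 1) = x * x powr (a + \<beta>)" using xD by (simp add: powr_add)
      ultimately have 2: "phi a (\<beta> + 1) p x = K' * (x * x powr (a + \<beta>)) + p powr (\<beta> + 1 + 1) * eval_fps (Rf (a + \<beta> + 1)) x"
        by simp
      have xg: "x powr (a + \<beta> + 1) = x * x powr (a + \<beta>)" using xD by (simp add: powr_add)
      define X P1 P2 R1 R2 W where d: "X = x powr (a + \<beta>)" "P1 = p powr (\<beta> + 1)" "P2 = p powr (\<beta> + 1 + 1)"
        "R1 = eval_fps (Rf (a + \<beta>)) x" "R2 = eval_fps (Rf (a + \<beta> + 1)) x" "W = (p - x) powr a"
      have "(\<Sum>i\<in>{0,1}. x powr e i * h i x) = x powr e 0 * h 0 x + x powr e 1 * h 1 x" by simp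
      also have "\<dots> = x * X * ((a + \<beta> + 1) * K' - (\<beta> + 1) * K) +
        ((a + \<beta> + 1) * (P2 * R2) - (\<beta> + 1) * x * (P1 * R1) - W * P1)"
        using xD(2) xg by (simp add: h_def e_def d)
      also have "\<dots> = ((a + \<beta> + 1) * (K' * (x * X) + P2 * R2) - (\<beta> + 1) * x * (K * X + P1 * R1)) - W * P1"
        by (simp add: algebra_simps)
      also have "\<dots> = ((a + \<beta> + 1) * phi a (\<beta> + 1) p x - (\<beta> + 1) * x * phi a \<beta> p x) - (p - x) powr a * p powr (\<beta> + 1)"
        unfolding 1 2 d ..
      also have "\<dots> = 0" unfolding rc by simp
      finally show ?thesis .
    qed
    then show "\<forall>\<^sub>F x in at 0 within B. (\<Sum>i\<in>{0,1}. x powr e i * h i x) = 0"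
      by (auto simp: eventually_at_filter)
  qed auto
  then have "h 0 0 = 0" by (rule eventually_nhds_x_imp_x)
  then show ?thesis by (simp add: h_def)
qed


text \<open>When Re (a + \<beta>) < -1 the singular term dominates at 0, so K is the limit of
  \<open>phi\<close> times x^(- a - \<beta>) along the ray through p. By the Euler equation this
  product is, on that ray, the tail of a Beta integral.\<close>

lemma decomp_base:
  assumes K: "decomp \<beta> K" and g: "Re (a + \<beta>) < -1" "a + \<beta> \<notin> \<int>"
  shows "K = Kc a \<beta>"
proof -
  define g where "g = a + \<beta>"
  have b: "Re (- g) > 1" using g by (simp add: g_def)
  define P where "P = p powr (\<beta> + 1)"
  define y where "y = (\<lambda>e::real. phi a \<beta> p (of_real e * p) * (of_real e * p) powr (- g))"
  define k where "k = (\<lambda>t. complex_of_real (1 - t) powr (a - 1) * of_real t powr (- g - 1))"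
  have k: "continuous_on {0..1} k" unfolding k_def using b a by (intro continuous_beta_kernel) auto
  have eD: "of_real e * p \<in> D" if "0 < e" "e < 1" for e
    using eps_p[of e] that p by (auto simp: D_def)
  have dy: "(y has_vector_derivative - k e) (at e)" if e: "0 < e" "e < 1" for e
  proof -
    let ?z = "of_real e * p"
    note z = eD[OF e] D_slit(2)[OF eD[OF e]] D_slit(3)[OF eD[OF e]]
    have "((\<lambda>z. phi a \<beta> p z * z powr (- g)) has_field_derivative
        (((a + \<beta>) * phi a \<beta> p ?z - p powr (\<beta> + 1) * (p - ?z) powr (a - 1)) / ?z) * ?z powr (- g) + (- g * ?z powr (- g - 1)) * phi a \<beta> p ?z) (at ?z)"
      using z by (intro DERIV_mult phi_deriv has_field_derivative_powr)
    moreover have "((\<lambda>e. of_real e * p) has_vector_derivative p) (at e)"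
      by (auto intro!: derivative_eq_intros simp: of_real_def)
    ultimately have "(((\<lambda>z. phi a \<beta> p z * z powr (- g)) \<circ> (\<lambda>e. of_real e * p)) has_vector_derivative
       p * ((((a + \<beta>) * phi a \<beta> p ?z - p powr (\<beta> + 1) * (p - ?z) powr (a - 1)) / ?z) * ?z powr (- g) + (- g * ?z powr (- g - 1)) * phi a \<beta> p ?z)) (at e)"
      by (intro field_vector_diff_chain_at)
    moreover have "p * ((((a + \<beta>) * phi a \<beta> p ?z - p powr (\<beta> + 1) * (p - ?z) powr (a - 1)) / ?z) * ?z powr (- g) + (- g * ?z powr (- g - 1)) * phi a \<beta> p ?z) = - k e"
    proof -
      define F where "F = phi a \<beta> p ?z"
      define X where "X = ?z powr (- g - 1)"
      have zX: "?z powr (- g) = ?z * X" using z by (simp add: X_def powr_diff)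
      have W: "(p - ?z) powr (a - 1) = of_real (1 - e) powr (a - 1) * p powr (a - 1)"
        using powr_times_of_real[of "1 - e" p "a - 1"] e p_slit by (simp add: algebra_simps)
      have X: "X = of_real e powr (- g - 1) * p powr (- g - 1)"
        unfolding X_def using powr_times_of_real[of e p] e p_slit by simp
      have "p * (((g * F - P * (p - ?z) powr (a - 1)) / ?z) * (?z * X) + (- g * X) * F) = - (p * P * (p - ?z) powr (a - 1) * X)"
      proof -
        have dv: "(q / z') * (z' * X) = q * X" if "z' \<noteq> 0" for q z' :: complex using that by simp
        show ?thesis unfolding dv[OF z(3)] by (simp add: algebra_simps)
      qed
      also have "\<dots> = - k e * (p powr 1 * p powr (\<beta> + 1) * p powr (a - 1) * p powr (- g - 1))"
        unfolding W X k_def P_def using p_slit by (simp add: mult_ac)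
      also have "p powr 1 * p powr (\<beta> + 1) * p powr (a - 1) * p powr (- g - 1) = p powr (1 + (\<beta> + 1) + (a - 1) + (- g - 1))"
        by (simp only: powr_add)
      also have "1 + (\<beta> + 1) + (a - 1) + (- g - 1) = 0" by (simp add: g_def)
      also have "- k e * p powr 0 = - k e" using p_slit by simp
      finally show ?thesis
        unfolding zX F_def[symmetric] X_def[symmetric] P_def[symmetric] g_def[symmetric] .
    qed
    ultimately show ?thesis by (simp add: y_def o_def)
  qed
  \<comment> \<open>At e = 1 the path has length zero, and the factor \<open>0 powr a\<close> is
    0.\<close>
  have y1: "y 1 = 0" unfolding y_def phi_def conv_def using a by simp
  have cy: "continuous_on {e..1} y" if e: "0 < e" for e
  proof -
    have "continuous_on (S \<times> cbox 0 1) (\<lambda>(x, u::real). complex_of_real (1 - u) powr (a - 1) * (p - of_real u * (p - x)) powr \<beta>)"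
    proof -
      have "continuous_on (S \<times> cbox 0 1) (\<lambda>z::complex \<times> real. (p - of_real (snd z) * (p - fst z)) powr \<beta>)"
        by (intro continuous_on_powr_slit continuous_intros seg_slit) auto
      moreover have "continuous_on (S \<times> cbox 0 1) (\<lambda>z::complex \<times> real. complex_of_real (1 - snd z) powr (a - 1))"
        by (intro continuous_on_powr_complex continuous_intros) (use a in auto)
      ultimately show ?thesis unfolding case_prod_beta by (rule continuous_on_mult[rotated])
    qed
    from integral_continuous_on_param[OF this]
    have I: "continuous_on S (\<lambda>x. integral {0..1} (\<lambda>u. complex_of_real (1 - u) powr (a - 1) * (p - of_real u * (p - x)) powr \<beta>))"
      by simp
    have m: "continuous_on {e..1} (\<lambda>e. of_real e * p)" by (intro continuous_intros)
    have mS: "(\<lambda>e. of_real e * p) ` {e..1} \<subseteq> S" using e eps_p by auto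
    have "continuous_on {e..1} (\<lambda>e. (of_real (1 - e) powr a * p powr a) *
        integral {0..1} (\<lambda>u. complex_of_real (1 - u) powr (a - 1) * (p - of_real u * (p - of_real e * p)) powr \<beta>))"
      by (intro continuous_on_mult continuous_on_compose2[OF I m mS] continuous_on_powr_complex continuous_intros) (use a in auto)
    moreover have "(of_real (1 - e) powr a * p powr a) = (p - of_real e * p) powr a" if "e \<in> {e..1}" for e
    proof (cases "e = 1")
      case False
      then show ?thesis using powr_times_of_real[of "1 - e" p a] that p_slit by (simp add: algebra_simps)
    qed auto
    ultimately have "continuous_on {e..1} (\<lambda>e. phi a \<beta> p (of_real e * p))"
      unfolding phi_def conv_def by (subst (asm) continuous_on_cong[OF refl]) (auto simp: algebra_simps)
    moreover have "continuous_on {e..1} (\<lambda>e. (of_real e * p) powr (- g))"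
    proof (intro continuous_on_powr_slit m)
      fix e' assume "e' \<in> {e..1}"
      from subsetD[OF mS imageI[OF this]] have "of_real e' * p \<in> S" .
      then show "of_real e' * p \<notin> \<real>\<^sub>\<le>\<^sub>0" using S(3) by blast
    qed
    ultimately show ?thesis unfolding y_def by (rule continuous_on_mult)
  qed
  have yI: "y e = integral {e..1} k" if e: "0 < e" "e < 1" for e
  proof -
    have "((\<lambda>t. - k t) has_integral (y 1 - y e)) {e..1}"
      by (rule fundamental_theorem_of_calculus_interior) (use e cy dy in auto)
    from has_integral_neg[OF this] have "(k has_integral y e) {e..1}" by (simp add: y1)
    then show ?thesis by (rule integral_unique[symmetric])
  qed
  \<comment> \<open>For e up to \<open>e0\<close> the point e p stays in the disc of radius Re p,
    where the series \<open>Rf\<close> converges.\<close>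
  define e0 where "e0 = min (1/2) (Re p / (2 * cmod p))"
  have e0: "0 < e0" "e0 < 1" "e \<le> e0 \<Longrightarrow> e * cmod p < Re p" for e
  proof -
    show "0 < e0" "e0 < 1" using p p_slit by (auto simp: e0_def)
    assume "e \<le> e0"
    then have "e * cmod p \<le> Re p / (2 * cmod p) * cmod p"
      by (intro mult_right_mono) (auto simp: e0_def)
    also have "\<dots> = Re p / 2" using p_slit by simp
    finally show "e * cmod p < Re p" using p by simp
  qed
  \<comment> \<open>By the decomposition \<open>H\<close> vanishes for small e > 0. It is continuous
    at 0, where the factor e^(- g) removes the regular part, so its value there identifies K with
    the full Beta integral.\<close>
  define H where "H = (\<lambda>e::real. integral {e..1} k - (K + P * eval_fps (Rf g) (of_real e * p) * (of_real e powr (- g) * p powr (- g))))"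
  have cR: "continuous_on (ball 0 (Re p)) (eval_fps (Rf g))"
  proof (rule holomorphic_on_imp_continuous_on, rule holomorphic_on_eval_fps)
    show "ball (0::complex) (Re p) \<subseteq> eball 0 (fps_conv_radius (Rf g))"
    proof (rule subsetI)
      fix x :: complex assume "x \<in> ball 0 (Re p)"
      then have "cmod x < Re p" by simp
      with Rf_conv_less[of g x] g(2) show "x \<in> eball 0 (fps_conv_radius (Rf g))"
        by (simp add: g_def in_eball_iff)
    qed
  qed
  have ci: "continuous_on {0..1} (\<lambda>e. integral {e..1} k)"
    by (rule indefinite_integral_continuous_1') (intro integrable_continuous_real k)
  have "continuous_on {0..e0} H"
    unfolding H_def
  proof (intro continuous_on_diff continuous_on_add continuous_on_mult continuous_on_const)
    show "continuous_on {0..e0} (\<lambda>e. integral {e..1} k)"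
      by (rule continuous_on_subset[OF ci]) (use e0 in auto)
    show "continuous_on {0..e0} (\<lambda>e. eval_fps (Rf g) (of_real e * p))"
      by (rule continuous_on_compose2[OF cR]) (use e0 in \<open>auto intro!: continuous_intros simp: norm_mult\<close>)
    show "continuous_on {0..e0} (\<lambda>e. complex_of_real e powr (- g))"
      using b by (intro continuous_on_powr_complex continuous_intros) auto
  qed
  then have t1: "(H \<longlongrightarrow> H 0) (at 0 within {0..e0})" using e0 by (auto simp: continuous_on_def)
  have t2: "(H \<longlongrightarrow> 0) (at 0 within {0..e0})"
  proof (rule tendsto_eventually)
    have "H e = 0" if "e \<in> {0..e0}" "e \<noteq> 0" for e
    proof -
      have e: "0 < e" "e < 1" "e \<le> e0" using that e0 by auto
      have "of_real e * p \<in> B"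
        using eps_p[of e] e e0(3)[of e] by (simp add: B_def norm_mult)
      then have "phi a \<beta> p (of_real e * p) = K * (of_real e * p) powr g + P * eval_fps (Rf g) (of_real e * p)"
        using K unfolding decomp_def g_def P_def by blast
      moreover have "(of_real e * p) powr g * (of_real e * p) powr (- g) = 1"
        using e p_slit by (simp add: powr_minus)
      moreover have "(K * Z + R) * Z' = K * (Z * Z') + R * Z'" for R Z Z' :: complex by (simp add: algebra_simps)
      ultimately have "y e = K + P * eval_fps (Rf g) (of_real e * p) * (of_real e * p) powr (- g)"
        unfolding y_def by (simp only: mult_1_right)
      also have "(of_real e * p) powr (- g) = of_real e powr (- g) * p powr (- g)"
        using e p_slit by (intro powr_times_of_real) auto
      finally have "integral {e..1} k = K + P * eval_fps (Rf g) (of_real e * p) * (of_real e powr (- g) * p powr (- g))"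
        unfolding yI[OF e(1,2)] .
      then show ?thesis unfolding H_def by (simp only: diff_self)
    qed
    then show "\<forall>\<^sub>F e in at 0 within {0..e0}. H e = 0"
      unfolding eventually_at_filter by (intro always_eventually allI impI)
  qed
  have t3: "at 0 within {0..e0} \<noteq> bot" using e0 by (simp add: at_within_Icc_at_right)
  have "H 0 = 0" by (rule tendsto_unique[OF t3 t1 t2])
  moreover have "H 0 = integral {0..1} k - K" unfolding H_def by simp
  ultimately have "K = integral {0..1} k" by simp
  then have "K = beta_int a (- g)" unfolding k_def beta_int_def by assumption
  then have "K = Beta a (- g)" unfolding beta_int_eq_Beta[OF a b] by assumption
  then show ?thesis unfolding g_def Beta_eq_Kc by assumption
qed

end

context slit_base
begin

text \<open>Induction on the strip containing Re (a + \<beta>). The singular coefficient and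
  \<open>Kc\<close> obey the same one-step recursion in \<beta>, in which the factor to be
  cancelled, a + \<beta>, is nonzero.\<close>

lemma decomp_Kc:
  assumes g: "a + \<beta> \<notin> \<int>"
  shows "decomp \<beta> (Kc a \<beta>)"
proof -
  have *: "K = Kc a \<beta>" if "Re (a + \<beta>) < real N - 1" "a + \<beta> \<notin> \<int>" "decomp \<beta> K" for N \<beta> K
    using that
  proof (induction N arbitrary: \<beta> K)
    case 0
    then show ?case using decomp_base by simp
  next
    case (Suc N)
    have g: "a + (\<beta> - 1) \<notin> \<int>" using nonint_diff_1[OF Suc.prems(2)] by (simp only: add_diff_eq not_False_eq_True)
    from ex_decomp[OF g] obtain K' where K': "decomp (\<beta> - 1) K'" ..
    have e: "a + (\<beta> - 1) + 1 = a + \<beta>" "\<beta> - 1 + 1 = \<beta>" by simp_all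
    have "K' = Kc a (\<beta> - 1)"
      by (rule Suc.IH[OF _ g K']) (use Suc.prems(1) in simp)
    moreover have "(a + \<beta>) * K = \<beta> * K'"
      using decomp_rec[OF g K', of K] Suc.prems(3) unfolding e .
    moreover have "(a + \<beta>) * Kc a \<beta> = \<beta> * Kc a (\<beta> - 1)"
      using Kc_rec[OF g] unfolding e .
    ultimately have "(a + \<beta>) * K = (a + \<beta>) * Kc a \<beta>" by (simp only:)
    moreover have "a + \<beta> \<noteq> 0" using Suc.prems(2) by auto
    ultimately show ?case using mult_left_cancel by blast
  qed
  from ex_decomp[OF g] obtain K where K: "decomp \<beta> K" ..
  obtain N where "Re (a + \<beta>) + 1 < real N" using reals_Archimedean2[of "Re (a + \<beta>) + 1"] ..
  then show ?thesis using *[of \<beta> N K] K g by auto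
qed

end

section \<open>Singular and regular part of the integral at 0\<close>

lemma integral_power_series_sums:
  fixes q s :: "real \<Rightarrow> complex" and c :: "nat \<Rightarrow> complex"
  assumes q: "continuous_on {0..1} q" and s: "continuous_on {0..1} s"
    and R: "\<And>u. u \<in> {0..1} \<Longrightarrow> cmod (s u) \<le> R" and c: "summable (\<lambda>k. cmod (c k) * R ^ k)"
  shows "(\<lambda>k. c k * integral {0..1} (\<lambda>u. q u * s u ^ k)) sums integral {0..1} (\<lambda>u. q u * (\<Sum>k. c k * s u ^ k))"
proof -
  have "compact (q ` {0..1})" by (intro compact_continuous_image q compact_Icc)
  then have "bounded (q ` {0..1})" by (rule compact_imp_bounded)
  then obtain C where C: "\<forall>y\<in>q ` {0..1}. cmod y \<le> C" unfolding bounded_iff ..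
  have C0: "0 \<le> C" using C norm_ge_zero[of "q 0"] order_trans[of 0 "cmod (q 0)" C] by simp
  define f where "f = (\<lambda>k u. c k * (q u * s u ^ k))"
  have bd: "cmod (f k u) \<le> C * (cmod (c k) * R ^ k)" if u: "u \<in> {0..1}" for k u
  proof -
    have "cmod (f k u) = cmod (q u) * (cmod (c k) * cmod (s u) ^ k)"
      by (simp add: f_def norm_mult norm_power mult_ac)
    also have "\<dots> \<le> C * (cmod (c k) * R ^ k)"
      using C u R[OF u] C0 by (intro mult_mono power_mono mult_left_mono mult_nonneg_nonneg) auto
    finally show ?thesis .
  qed
  have "uniform_limit {0..1} (\<lambda>n u. \<Sum>k<n. f k u) (\<lambda>u. \<Sum>k. f k u) sequentially"
    by (rule Weierstrass_m_test[OF bd], assumption, intro summable_mult c)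
  then obtain I J where I: "\<And>n. ((\<lambda>u. \<Sum>k<n. f k u) has_integral I n) {0..1}"
    "((\<lambda>u. \<Sum>k. f k u) has_integral J) {0..1}" "I \<longlonglongrightarrow> J"
    by (rule uniform_limit_integral) (auto simp: f_def intro!: continuous_intros q s)
  have hk: "((\<lambda>u. q u * s u ^ k) has_integral integral {0..1} (\<lambda>u. q u * s u ^ k)) {0..1}" for k
    by (intro integrable_integral integrable_continuous_real continuous_intros q s)
  have In: "I n = (\<Sum>k<n. c k * integral {0..1} (\<lambda>u. q u * s u ^ k))" for n
  proof -
    have "((\<lambda>u. \<Sum>k<n. f k u) has_integral (\<Sum>k<n. c k * integral {0..1} (\<lambda>u. q u * s u ^ k))) {0..1}"
      unfolding f_def by (intro has_integral_sum has_integral_mult_right hk) auto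
    with I(1)[of n] show ?thesis by (rule has_integral_unique)
  qed
  have "(\<Sum>k. f k u) = q u * (\<Sum>k. c k * s u ^ k)" if u: "u \<in> {0..1}" for u
  proof -
    have "summable (\<lambda>k. c k * s u ^ k)"
    proof (rule summable_comparison_test'[OF c, of 0])
      show "cmod (c k * s u ^ k) \<le> cmod (c k) * R ^ k" for k
        using R[OF u] by (auto simp: norm_mult norm_power intro!: mult_left_mono power_mono)
    qed
    from suminf_mult[OF this, of "q u"] show ?thesis by (simp add: f_def mult_ac)
  qed
  then have "((\<lambda>u. q u * (\<Sum>k. c k * s u ^ k)) has_integral J) {0..1}"
    using I(2) by (rule has_integral_eq)
  then have J: "J = integral {0..1} (\<lambda>u. q u * (\<Sum>k. c k * s u ^ k))" by (rule integral_unique[symmetric])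
  have "I = (\<lambda>n. \<Sum>k<n. c k * integral {0..1} (\<lambda>u. q u * s u ^ k))" by (rule ext) (rule In)
  with I(3) show ?thesis unfolding sums_def J by (simp only:)
qed

text \<open>Coefficient factors growing at most like Q^k can shrink the radius of convergence by no
  more than the factor Q, so a positive radius stays positive.\<close>

lemma fps_conv_radius_mult_bounded:
  fixes F :: "complex fps"
  assumes "\<And>k. cmod (m k) \<le> M * Q ^ k" "Q > 0" "ereal r \<le> fps_conv_radius F"
  shows "ereal (r / Q) \<le> fps_conv_radius (Abs_fps (\<lambda>k. fps_nth F k * m k))"
  unfolding fps_conv_radius_def
proof (rule conv_radius_geI_ex')
  fix s assume s: "0 < s" "ereal s < ereal (r / Q)"
  then have "Q * s < r" using assms(2) by (simp add: field_simps)
  then have "ereal (norm (of_real (Q * s) :: complex)) < fps_conv_radius F"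
    using s assms(2) by (intro less_le_trans[OF _ assms(3)]) (simp add: norm_mult)
  from norm_summable_fps[OF this]
  have sm: "summable (\<lambda>k. M * (cmod (fps_nth F k) * (Q * s) ^ k))"
    using s assms(2) by (intro summable_mult) (simp add: norm_mult norm_power)
  show "summable (\<lambda>k. fps_nth (Abs_fps (\<lambda>k. fps_nth F k * m k)) k * complex_of_real s ^ k)"
  proof (rule summable_comparison_test'[OF sm, of 0])
    fix k
    have "cmod (fps_nth (Abs_fps (\<lambda>k. fps_nth F k * m k)) k * complex_of_real s ^ k) = cmod (m k) * (cmod (fps_nth F k) * s ^ k)"
      using s by (simp add: norm_mult norm_power mult_ac)
    also have "\<dots> \<le> (M * Q ^ k) * (cmod (fps_nth F k) * s ^ k)"
      using s by (intro mult_right_mono assms(1)) auto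
    finally show "cmod (fps_nth (Abs_fps (\<lambda>k. fps_nth F k * m k)) k * complex_of_real s ^ k) \<le> M * (cmod (fps_nth F k) * (Q * s) ^ k)"
      by (simp add: power_mult_distrib mult_ac)
  qed
qed

text \<open>The ratio of consecutive values is (\<beta> + k + 1) / (a + \<beta> + k + 1), bounded by
  1 + |a| / d as long as the denominators have modulus at least d.\<close>

lemma Kc_bound:
  assumes "a + \<beta> \<notin> \<int>"
  shows "\<exists>Q\<ge>1. \<forall>k. cmod (Kc a (\<beta> + of_nat k)) \<le> cmod (Kc a \<beta>) * Q ^ k"
proof -
  obtain d where d: "d > 0" "\<And>i. d \<le> cmod (a + \<beta> - of_int i)" using nonint_dist[OF assms] by blast
  define Q where "Q = 1 + cmod a / d"
  have Q: "Q \<ge> 1" using d by (simp add: Q_def)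
  have "cmod (Kc a (\<beta> + of_nat k)) \<le> cmod (Kc a \<beta>) * Q ^ k" for k
  proof (induction k)
    case (Suc k)
    let ?b = "\<beta> + of_nat k"
    have n: "a + ?b \<notin> \<int>" using add_nat_nonint[OF assms, of k] by (simp add: add.assoc)
    define z where "z = a + ?b + 1"
    have zd: "d \<le> cmod z" 
    proof -
      have "z = a + \<beta> - of_int (- int (Suc k))" by (simp add: z_def add_ac)
      then show ?thesis using d(2)[of "- int (Suc k)"] by (simp only:)
    qed
    have "z * Kc a (?b + 1) = (?b + 1) * Kc a ?b" unfolding z_def by (rule Kc_rec[OF n])
    then have e: "cmod z * cmod (Kc a (?b + 1)) = cmod (?b + 1) * cmod (Kc a ?b)" by (metis norm_mult)
    have l1: "cmod (?b + 1) \<le> cmod z + cmod a"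
      using norm_triangle_ineq4[of z a] by (simp add: z_def add_ac)
    have l2: "cmod z + cmod a \<le> cmod z * Q"
    proof -
      have "cmod a = d * (cmod a / d)" using d by simp
      also have "\<dots> \<le> cmod z * (cmod a / d)" using d zd by (intro mult_right_mono) auto
      finally show ?thesis by (simp add: Q_def distrib_left)
    qed
    have "cmod z * cmod (Kc a (?b + 1)) \<le> (cmod z * Q) * cmod (Kc a ?b)"
      unfolding e by (rule mult_right_mono[OF order_trans[OF l1 l2]]) simp
    then have "cmod z * cmod (Kc a (?b + 1)) \<le> cmod z * (Q * cmod (Kc a ?b))" by (simp add: mult.assoc)
    then have "cmod (Kc a (?b + 1)) \<le> Q * cmod (Kc a ?b)" 
    proof (rule mult_left_le_imp_le)
      show "0 < cmod z" using zd d(1) by (rule less_le_trans[rotated])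
    qed
    also have "\<dots> \<le> Q * (cmod (Kc a \<beta>) * Q ^ k)" using Suc Q by (intro mult_left_mono) auto
    finally show ?case by (simp add: add_ac mult_ac)
  qed simp
  with Q show ?thesis by blast
qed

context slit_base
begin

text \<open>The Taylor series of h is integrated term by term, each term being a \<open>phi\<close>
  with exponent \<beta> + k. The singular parts sum to x^(a + \<beta>) times a series whose
  coefficients are multiplied by \<open>Kc\<close>; the regular parts converge uniformly on a disc.
  For \<beta> = 0 all the factors \<open>Kc\<close> vanish: a regular integrand produces no term in
  x^a.\<close>

lemma zero_end:
  assumes h: "h holomorphic_on ball 0 \<rho>" "cmod p < \<rho>" and g: "a + \<beta> \<notin> \<int>"
  shows "\<exists>ht kt. ht analytic_on {0} \<and> kt analytic_on {0} \<and> ht 0 = Kc a \<beta> * h 0 \<and> (\<beta> = 0 \<longrightarrow> (\<forall>x. ht x = 0)) \<and>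
    (\<forall>\<^sub>F x in at 0 within S. conv a (\<lambda>s. s powr \<beta> * h s) p x = x powr (a + \<beta>) * ht x + kt x)"
proof -
  define H where "H = fps_expansion h 0"
  define c where "c = fps_nth H"
  have h': "h holomorphic_on eball 0 (ereal \<rho>)" using h by simp
  have Hr: "ereal \<rho> \<le> fps_conv_radius H" unfolding H_def by (rule conv_radius_fps_expansion[OF h'])
  have hs: "(\<lambda>k. c k * s ^ k) sums h s" if s: "cmod s < \<rho>" for s
  proof -
    have "(\<lambda>k. c k * s ^ k) sums eval_fps H s"
      unfolding c_def using s by (intro sums_eval_fps less_le_trans[OF _ Hr]) simp
    also have "eval_fps H s = h (0 + s)" unfolding H_def by (rule eval_fps_expansion'[OF h']) (use s in simp)
    finally show ?thesis by simp
  qed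
  have cp: "summable (\<lambda>k. cmod (c k) * cmod p ^ k)"
    using norm_summable_fps[of p H] less_le_trans[OF _ Hr, of "ereal (cmod p)"] h(2)
    by (simp add: norm_mult norm_power c_def)
  have step1: "(\<lambda>k. c k * phi a (\<beta> + of_nat k) p x) sums conv a (\<lambda>s. s powr \<beta> * h s) p x" if x: "x \<in> B" for x
  proof -
    have xS: "x \<in> S" using B(4) x by auto
    have xp: "cmod x \<le> cmod p" by (rule less_imp_le[OF less_le_trans[OF B(7)[OF x] complex_Re_le_cmod]])
    define s where "s = (\<lambda>u::real. p - of_real u * (p - x))"
    define q where "q = (\<lambda>u::real. complex_of_real (1 - u) powr (a - 1) * s u powr \<beta>)"
    have sc: "continuous_on {0..1} s" unfolding s_def by (intro continuous_intros)
    have ss: "s u \<notin> \<real>\<^sub>\<le>\<^sub>0" "s u \<noteq> 0" if "u \<in> {0..1}" for u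
      using seg_slit[OF xS that] by (auto simp: s_def)
    have qc: "continuous_on {0..1} q"
      unfolding q_def by (intro continuous_on_mult continuous_on_powr_slit[OF sc] ss continuous_on_powr_complex continuous_intros)
        (use a in auto)
    \<comment> \<open>Since |x| is at most |p| on \<open>B\<close>, the whole segment lies in the
      closed disc of radius |p|, inside the disc of convergence of h.\<close>
    have sb: "cmod (s u) \<le> cmod p" if u: "u \<in> {0..1}" for u
    proof -
      have "s u = of_real (1 - u) * p + of_real u * x" by (simp add: s_def algebra_simps)
      then have "cmod (s u) \<le> cmod (of_real (1 - u) * p) + cmod (of_real u * x)" by (metis norm_triangle_ineq)
      also have "\<dots> = (1 - u) * cmod p + u * cmod x" using u by (simp only: norm_mult norm_of_real) simp
      also have "\<dots> \<le> (1 - u) * cmod p + u * cmod p" using u xp by (intro add_left_mono mult_left_mono) auto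
      finally show ?thesis by (simp add: algebra_simps)
    qed
    have 1: "(\<lambda>k. c k * integral {0..1} (\<lambda>u. q u * s u ^ k)) sums integral {0..1} (\<lambda>u. q u * (\<Sum>k. c k * s u ^ k))"
      by (rule integral_power_series_sums[OF qc sc sb cp])
    have 2: "integral {0..1} (\<lambda>u. q u * (\<Sum>k. c k * s u ^ k)) = integral {0..1} (\<lambda>u. complex_of_real (1 - u) powr (a - 1) * (s u powr \<beta> * h (s u)))"
    proof (rule integral_cong)
      fix u :: real assume "u \<in> {0..1}"
      then have "cmod (s u) < \<rho>" using sb h(2) by fastforce
      from sums_unique[OF hs[OF this]] show "q u * (\<Sum>k. c k * s u ^ k) = complex_of_real (1 - u) powr (a - 1) * (s u powr \<beta> * h (s u))"
        by (simp add: q_def)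
    qed
    have 3: "integral {0..1} (\<lambda>u. q u * s u ^ k) = integral {0..1} (\<lambda>u. complex_of_real (1 - u) powr (a - 1) * s u powr (\<beta> + of_nat k))" for k
    proof (rule integral_cong)
      fix u :: real assume "u \<in> {0..1}"
      then have "s u powr (\<beta> + of_nat k) = s u powr \<beta> * s u ^ k" using ss(2) by (simp add: powr_add powr_nat')
      then show "q u * s u ^ k = complex_of_real (1 - u) powr (a - 1) * s u powr (\<beta> + of_nat k)"
        by (simp add: q_def)
    qed
    from sums_mult[OF 1[unfolded 2 3], of "(p - x) powr a"] show ?thesis
      unfolding phi_def conv_def s_def by (simp only: mult_ac)
  qed
  obtain Q where Q: "Q \<ge> 1" "\<And>k. cmod (Kc a (\<beta> + of_nat k)) \<le> cmod (Kc a \<beta>) * Q ^ k"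
    using Kc_bound[OF g] by blast
  define Ht where "Ht = Abs_fps (\<lambda>k. fps_nth H k * Kc a (\<beta> + of_nat k))"
  have Htr: "ereal (\<rho> / Q) \<le> fps_conv_radius Ht"
    unfolding Ht_def by (rule fps_conv_radius_mult_bounded[OF Q(2) _ Hr]) (use Q in simp)
  have \<rho>: "\<rho> > 0" using h(2) norm_ge_zero[of p] by linarith
  have rQ: "\<rho> / Q > 0" using \<rho> Q(1) by simp
  have ht: "eval_fps Ht analytic_on {0}"
    using less_le_trans[OF _ Htr, of 0] rQ by (intro analytic_on_eval_fps) (auto simp: zero_ereal_def)
  obtain d where d: "d > 0" "\<And>i. d \<le> cmod (a + \<beta> - of_int i)" using nonint_dist[OF g] by blast
  \<comment> \<open>Shifting the exponent by k only permutes the integers, so the distance d, and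
    with it \<open>M\<close>, serves every k.\<close>
  define M where "M = (\<Sum>j. cmod (fps_nth Ef j) * (Re p / 2) ^ j) / d"
  define f where "f = (\<lambda>k x. c k * (p powr (\<beta> + of_nat k + 1) * eval_fps (Rf (a + (\<beta> + of_nat k))) x))"
  have gk: "a + (\<beta> + of_nat k) \<notin> \<int>" for k using add_nat_nonint[OF g, of k] by (simp add: add.assoc)
  have fb: "cmod (f k x) \<le> cmod (p powr (\<beta> + 1)) * M * (cmod (c k) * cmod p ^ k)" if x: "cmod x \<le> Re p / 2" for k x
  proof -
    have "cmod (eval_fps (Rf (a + (\<beta> + of_nat k))) x) \<le> M"
      unfolding M_def
    proof (rule Rf_bound[OF d(1) _ gk x])
      show "d \<le> cmod (a + (\<beta> + of_nat k) - of_int i)" for i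
        using d(2)[of "i - int k"] by (simp add: algebra_simps)
    qed
    moreover have "p powr (\<beta> + of_nat k + 1) = p powr (\<beta> + 1) * p ^ k"
      using p_slit(2) powr_add[of p "\<beta> + 1" "of_nat k"] by (simp add: add_ac powr_nat')
    ultimately have "cmod (f k x) \<le> cmod (c k) * (cmod (p powr (\<beta> + 1) * p ^ k) * M)"
      unfolding f_def by (simp only: norm_mult) (intro mult_left_mono, auto)
    then show ?thesis by (simp add: norm_mult norm_power mult_ac)
  qed
  define kt where "kt = (\<lambda>x. \<Sum>k. f k x)"
  have fs: "summable (\<lambda>k. f k x)" if "cmod x \<le> Re p / 2" for x
    by (rule summable_comparison_test'[OF summable_mult[OF cp], of 0]) (rule fb[OF that])
  have "kt holomorphic_on ball 0 (Re p / 2)"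
  proof (rule holomorphic_uniform_sequence[where f = "\<lambda>n x. \<Sum>k<n. f k x"])
    show "(\<lambda>x. \<Sum>k<n. f k x) holomorphic_on ball 0 (Re p / 2)" for n
    proof (intro holomorphic_on_sum)
      fix k
      have "eval_fps (Rf (a + (\<beta> + of_nat k))) holomorphic_on ball 0 (Re p / 2)"
      proof (rule holomorphic_on_eval_fps, rule subsetI)
        fix x :: complex assume "x \<in> ball 0 (Re p / 2)"
        then have "cmod x < Re p" using p(2) by simp
        from Rf_conv_less[OF gk this] show "x \<in> eball 0 (fps_conv_radius (Rf (a + (\<beta> + of_nat k))))"
          by (simp add: in_eball_iff)
      qed
      then show "f k holomorphic_on ball 0 (Re p / 2)" unfolding f_def by (intro holomorphic_on_mult holomorphic_on_const)
    qed
    have ul: "uniform_limit (ball 0 (Re p / 2)) (\<lambda>n x. \<Sum>k<n. f k x) kt sequentially"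
      unfolding kt_def
      by (rule Weierstrass_m_test[OF _ summable_mult[OF cp]]) (rule fb, simp)
    show "\<exists>d>0. cball x d \<subseteq> ball 0 (Re p / 2) \<and> uniform_limit (cball x d) (\<lambda>n x. \<Sum>k<n. f k x) kt sequentially"
      if x: "x \<in> ball 0 (Re p / 2)" for x
    proof -
      obtain e where e: "e > 0" "cball x e \<subseteq> ball 0 (Re p / 2)"
        using bspec[OF open_contains_cball[THEN iffD1, OF open_ball] x] by blast
      show ?thesis by (rule exI[of _ e]) (intro conjI e uniform_limit_on_subset[OF ul])
    qed
  qed auto
  then have kt: "kt analytic_on {0}"
    using p(2) by (intro analytic_at[THEN iffD2] exI[of _ "ball 0 (Re p / 2)"]) auto
  have ev: "conv a (\<lambda>s. s powr \<beta> * h s) p x = x powr (a + \<beta>) * eval_fps Ht x + kt x"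
    if x: "x \<in> B" "cmod x < \<rho> / Q" "cmod x \<le> Re p / 2" for x
  proof -
    have x0: "x \<noteq> 0" using B(6) x(1) by auto
    have "(\<lambda>k. fps_nth Ht k * x ^ k) sums eval_fps Ht x"
      using x(2) by (intro sums_eval_fps less_le_trans[OF _ Htr]) simp
    from sums_mult[OF this, of "x powr (a + \<beta>)"]
    have "(\<lambda>k. x powr (a + \<beta>) * (fps_nth Ht k * x ^ k)) sums (x powr (a + \<beta>) * eval_fps Ht x)" .
    moreover have "(\<lambda>k. f k x) sums kt x" unfolding kt_def by (rule summable_sums[OF fs[OF x(3)]])
    ultimately have s: "(\<lambda>k. x powr (a + \<beta>) * (fps_nth Ht k * x ^ k) + f k x) sums (x powr (a + \<beta>) * eval_fps Ht x + kt x)"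
      by (rule sums_add)
    have "x powr (a + \<beta>) * (fps_nth Ht k * x ^ k) + f k x = c k * phi a (\<beta> + of_nat k) p x" for k
    proof -
      have "phi a (\<beta> + of_nat k) p x = Kc a (\<beta> + of_nat k) * x powr (a + (\<beta> + of_nat k)) + p powr (\<beta> + of_nat k + 1) * eval_fps (Rf (a + (\<beta> + of_nat k))) x"
        using decomp_Kc[OF gk[of k]] x(1) unfolding decomp_def by blast
      moreover have "x powr (a + (\<beta> + of_nat k)) = x powr (a + \<beta>) * x ^ k"
        using x0 powr_add[of x "a + \<beta>" "of_nat k"] by (simp add: add_ac powr_nat')
      ultimately show ?thesis unfolding f_def Ht_def c_def by (simp add: algebra_simps)
    qed
    with s have "(\<lambda>k. c k * phi a (\<beta> + of_nat k) p x) sums (x powr (a + \<beta>) * eval_fps Ht x + kt x)" by simp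
    with step1[OF x(1)] show ?thesis by (rule sums_unique2)
  qed
  have evB: "\<forall>\<^sub>F x in at 0 within S. x \<in> B \<and> cmod x < \<rho> / Q \<and> cmod x \<le> Re p / 2"
  proof -
    define r where "r = min (\<rho> / Q) (Re p / 2)"
    have "r > 0" using rQ p(2) by (simp add: r_def)
    then have "\<forall>\<^sub>F x in at 0 within S. x \<in> S \<and> dist x 0 < r"
      unfolding eventually_at by (intro exI[of _ r]) auto
    then show ?thesis by (rule eventually_mono) (use p(2) in \<open>auto simp: r_def B_def\<close>)
  qed
  show ?thesis
  proof (rule exI[of _ "eval_fps Ht"], rule exI[of _ kt], intro conjI ht kt impI allI)
    show "eval_fps Ht 0 = Kc a \<beta> * h 0"
      using hs[of 0] \<rho> sums_unique[of "\<lambda>k. c k * 0 ^ k" "h 0"] powser_zero[of c]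
      by (simp add: eval_fps_at_0 Ht_def c_def)
    show "eval_fps Ht x = 0" if "\<beta> = 0" for x
    proof -
      have "Kc a (of_nat k) = 0" for k
        by (simp add: Kc_def rGamma_eq_zero_iff)
      then have "Ht = 0" unfolding Ht_def that by (simp add: fps_eq_iff)
      then show ?thesis by simp
    qed
    show "\<forall>\<^sub>F x in at 0 within S. conv a (\<lambda>s. s powr \<beta> * h s) p x = x powr (a + \<beta>) * eval_fps Ht x + kt x"
      using evB by (rule eventually_mono) (use ev in blast)
  qed
qed

end

section \<open>Germs at 1 and at 0, and the integral based at 1\<close>

definition germ1 :: "complex set \<Rightarrow> complex \<Rightarrow> complex fps \<Rightarrow> (complex \<Rightarrow> complex) \<Rightarrow> bool" where
  "germ1 S lam g f \<longleftrightarrow> (\<exists>\<phi>. \<phi> has_fps_expansion g \<and>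
     (\<forall>\<^sub>F x in at 1 within S. f x = (1 - x) powr lam * \<phi> (1 - x)))"

text \<open>Only the leading coefficient \<open>c k\<close> of each singular term is recorded, and
  the analytic remainder is left free: the connection formula is an equality modulo holomorphic
  functions, and the leading coefficients determine the rest.\<close>

definition germ0 :: "complex set \<Rightarrow> 'k set \<Rightarrow> ('k \<Rightarrow> complex) \<Rightarrow> ('k \<Rightarrow> complex) \<Rightarrow> (complex \<Rightarrow> complex) \<Rightarrow> bool" where
  "germ0 S K \<beta> c f \<longleftrightarrow> (\<exists>h r. (\<forall>k\<in>K. h k analytic_on {0} \<and> h k 0 = c k) \<and> r analytic_on {0} \<and>
     (\<forall>\<^sub>F x in at 0 within S. f x = (\<Sum>k\<in>K. x powr \<beta> k * h k x) + r x))"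

text \<open>Action of the normalised Riemann--Liouville integral of order a on (1 - x)^lam times a
  series in 1 - x: the Beta integral applied to each power. The formula makes sense far beyond
  convergence of the integral.\<close>

definition Efps :: "complex \<Rightarrow> complex \<Rightarrow> complex fps \<Rightarrow> complex fps" where
  "Efps a lam g = Abs_fps (\<lambda>k. Gamma (lam + of_nat k + 1) * rGamma (lam + of_nat k + 1 + a) * fps_nth g k)"

lemma conv_has_contour_integral:
  fixes f :: "complex \<Rightarrow> complex"
  assumes c: "continuous_on {0..1} (\<lambda>u. complex_of_real (1 - u) powr (a - 1) * f (p - of_real u * (p - x)))"
    and xp: "x \<noteq> p"
  shows "((\<lambda>s. (s - x) powr (a - 1) * f s) has_contour_integral conv a f p x) (linepath x p)"
proof -
  define w where "w = p - x"
  define J where "J = integral {0..1} (\<lambda>u. complex_of_real (1 - u) powr (a - 1) * f (p - of_real u * w))"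
  have "((\<lambda>u. complex_of_real (1 - u) powr (a - 1) * f (p - of_real u * w)) has_integral J) (cbox 0 1)"
    unfolding J_def box_real by (intro integrable_integral integrable_continuous_real c[folded w_def])
  from has_integral_affinity[OF this, of "-1" 1]
  have "((\<lambda>t. complex_of_real t powr (a - 1) * f (p - of_real (1 - t) * w)) has_integral J) ((\<lambda>x. 1 - x) ` {0..1})"
    by (simp add: algebra_simps)
  moreover have "(\<lambda>x. 1 - x) ` {0..1} = {0..1::real}"
  proof (intro equalityI subsetI)
    fix y :: real assume "y \<in> {0..1}"
    then show "y \<in> (\<lambda>x. 1 - x) ` {0..1}" by (intro image_eqI[of _ _ "1 - y"]) auto
  qed auto
  ultimately have "((\<lambda>t. complex_of_real t powr (a - 1) * f (p - of_real (1 - t) * w)) has_integral J) {0..1}" by simp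
  from has_integral_mult_right[OF this, of "w powr a"]
  have "((\<lambda>t. w powr a * (complex_of_real t powr (a - 1) * f (p - of_real (1 - t) * w))) has_integral w powr a * J) {0..1}" .
  then have "((\<lambda>t. (linepath x p t - x) powr (a - 1) * f (linepath x p t) * (p - x)) has_integral w powr a * J) {0..1}"
  proof (rule has_integral_spike[of "{0}", rotated 2])
    fix t :: real assume "t \<in> {0..1} - {0}"
    then have t: "t > 0" by auto
    have l: "linepath x p t = p - of_real (1 - t) * w"
      by (simp add: linepath_def w_def scaleR_conv_of_real algebra_simps)
    have "linepath x p t - x = of_real t * w" by (simp add: l w_def algebra_simps)
    then have "(linepath x p t - x) powr (a - 1) = of_real t powr (a - 1) * w powr (a - 1)"
      using powr_times_of_real[OF t, of w "a - 1"] xp by (simp add: w_def)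
    moreover have "w powr a = w powr (a - 1) * w" using xp by (simp add: powr_diff w_def)
    ultimately show "(linepath x p t - x) powr (a - 1) * f (linepath x p t) * (p - x) = w powr a * (complex_of_real t powr (a - 1) * f (p - of_real (1 - t) * w))"
      by (simp add: l flip: w_def)
  qed auto
  then show ?thesis
    by (simp add: has_contour_integral_linepath conv_def J_def w_def)
qed

text \<open>Excluding the real axis makes the principal powers of x and of 1 - x both holomorphic on
  S, while 0 and 1 stay on its boundary.\<close>

locale slit =
  fixes S :: "complex set"
  assumes S: "open S" "convex S" "S \<inter> \<real> = {}" "0 \<in> closure S" "1 \<in> closure S"
begin

lemma Im_nz: "x \<in> S \<Longrightarrow> Im x \<noteq> 0"
  using S(3) complex_is_Real_iff by blast

lemma slits: "x \<in> S \<Longrightarrow> x \<notin> \<real>\<^sub>\<le>\<^sub>0" "x \<in> S \<Longrightarrow> 1 - x \<notin> \<real>\<^sub>\<le>\<^sub>0" "x \<in> S \<Longrightarrow> x \<noteq> 0" "x \<in> S \<Longrightarrow> x \<noteq> 1"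
  using Im_nz[of x] by (auto simp: complex_nonpos_Reals_iff)

lemma S_slit: "S \<inter> \<real>\<^sub>\<le>\<^sub>0 = {}" using slits(1) by blast

lemma notin: "0 \<notin> S" "1 \<notin> S" using slits(3,4) by auto

lemma islimpt: "0 islimpt S" "1 islimpt S"
  using S(4,5) notin by (auto simp: closure_def)

text \<open>By convexity the closure of S contains the real segment from 0 to 1, so points of S
  approximate small positive numbers.\<close>

lemma ex_small:
  assumes "\<rho> > 0"
  shows "\<exists>p\<in>S. cmod p < \<rho> \<and> 0 < Re p \<and> Re p \<le> 1"
proof -
  define e where "e = min (\<rho> / 2) (1 / 2)"
  have e: "0 < e" "e \<le> 1/2" "e \<le> \<rho> / 2" using assms by (auto simp: e_def)
  have "convex (closure S)" using S(2) by (rule convex_closure)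
  from convexD[OF this S(4,5), of "1 - e" e] e have "of_real e \<in> closure S" by (simp add: scaleR_conv_of_real)
  then obtain p where p: "p \<in> S" "dist p (of_real e) < e" using e(1) closure_approachable by blast
  then have d: "cmod (p - of_real e) < e" by (simp add: dist_norm)
  have "cmod p \<le> cmod (p - of_real e) + cmod (of_real e)" using norm_triangle_sub by (metis add.commute)
  also have "\<dots> < \<rho>" using d e by simp
  finally have "cmod p < \<rho>" .
  moreover have "\<bar>Re p - e\<bar> < e" using d abs_Re_le_cmod[of "p - of_real e"] by simp
  ultimately show ?thesis using p(1) e(2) by (intro bexI[of _ p]) auto
qed

text \<open>The value 0 at the base point is a normalisation: 1 is not in S, but the integral starts
  there, and a germ of positive exponent tends to 0.\<close>

lemma continuous_insert_1:
  assumes f: "f holomorphic_on S" and l: "(f \<longlongrightarrow> 0) (at 1 within S)"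
  shows "continuous_on (insert 1 S) (f(1 := 0))"
  unfolding continuous_on_def
proof
  fix x assume "x \<in> insert 1 S"
  then consider "x = 1" | "x \<in> S" by blast
  then show "(f(1 := 0) \<longlongrightarrow> (f(1 := 0)) x) (at x within insert 1 S)"
  proof cases
    case 1
    have "at 1 within insert 1 S = at 1 within S" by (simp add: at_within_def)
    moreover have "(f(1 := 0) \<longlongrightarrow> 0) (at 1 within S)"
      by (rule tendsto_cong[THEN iffD1, OF _ l]) (auto simp: eventually_at_filter)
    ultimately show ?thesis using 1 by simp
  next
    case 2
    have "f field_differentiable at x" using f S(1) 2 by (rule holomorphic_on_imp_differentiable_at)
    then have "isCont f x" by (rule field_differentiable_imp_continuous_at)
    then have "(f \<longlongrightarrow> f x) (at x)" by (simp add: isCont_def)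
    moreover have "\<forall>\<^sub>F y in at x. f y = (f(1 := 0)) y"
      using eventually_at_in_open'[OF S(1) 2] by (rule eventually_mono) (use notin in auto)
    ultimately have "(f(1 := 0) \<longlongrightarrow> f x) (at x)" by (rule tendsto_cong[THEN iffD1, rotated])
    then show ?thesis using 2 notin by (auto intro: tendsto_within_subset)
  qed
qed

lemma germ1_tendsto_0:
  assumes "germ1 S lam g f" "Re lam > 0"
  shows "(f \<longlongrightarrow> 0) (at 1 within S)"
proof -
  obtain \<phi> where \<phi>: "\<phi> has_fps_expansion g" "\<forall>\<^sub>F x in at 1 within S. f x = (1 - x) powr lam * \<phi> (1 - x)"
    using assms(1) unfolding germ1_def by blast
  have t: "((\<lambda>x. 1 - x) \<longlongrightarrow> (0::complex)) (at 1 within S)" by (auto intro!: tendsto_eq_intros)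
  have "isCont \<phi> 0" using has_fps_expansion_imp_continuous[OF \<phi>(1)] by simp
  then have 1: "((\<lambda>x. \<phi> (1 - x)) \<longlongrightarrow> \<phi> 0) (at 1 within S)" by (rule isCont_tendsto_compose[OF _ t])
  \<comment> \<open>For complex lam the modulus of the power carries an additional factor involving
    Im lam and the argument of 1 - x, which is bounded because the argument is at most \<pi> in
    modulus.\<close>
  have "((\<lambda>x. cmod (1 - x) powr Re lam * exp (pi * \<bar>Im lam\<bar>)) \<longlongrightarrow> 0 powr Re lam * exp (pi * \<bar>Im lam\<bar>)) (at 1 within S)"
    using assms(2) by (intro tendsto_intros tendsto_powr' tendsto_norm_zero[OF t]) (auto intro: tendsto_norm_zero[OF t])
  then have z: "((\<lambda>x. cmod (1 - x) powr Re lam * exp (pi * \<bar>Im lam\<bar>)) \<longlongrightarrow> 0) (at 1 within S)" using assms(2) by simp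
  have "((\<lambda>x. (1 - x) powr lam) \<longlongrightarrow> 0) (at 1 within S)"
  proof (rule Lim_null_comparison[OF _ z], rule always_eventually, rule allI)
    fix x :: complex
    show "cmod ((1 - x) powr lam) \<le> cmod (1 - x) powr Re lam * exp (pi * \<bar>Im lam\<bar>)"
    proof (cases "x = 1")
      case False
      have "\<bar>Im (Ln (1 - x))\<bar> \<le> pi" using False mpi_less_Im_Ln[of "1 - x"] Im_Ln_le_pi[of "1 - x"] by auto
      then have "- (Im lam * Im (Ln (1 - x))) \<le> \<bar>Im lam\<bar> * pi"
        by (metis abs_ge_minus_self abs_ge_zero abs_mult mult_left_mono order_trans)
      then show ?thesis using False
        by (simp add: powr_def norm_exp_eq_Re Re_Ln mult_ac flip: exp_add)
    qed simp
  qed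
  from tendsto_mult[OF this 1] have "((\<lambda>x. (1 - x) powr lam * \<phi> (1 - x)) \<longlongrightarrow> 0) (at 1 within S)" by simp
  then show ?thesis by (rule tendsto_cong[THEN iffD1, rotated]) (rule eventually_mono[OF \<phi>(2)], simp)
qed

lemma eventually_at_S: "eventually (\<lambda>x. x \<in> S) (at z within S)"
  by (auto simp: eventually_at_filter)

lemma eventually_ball_S: "r > 0 \<Longrightarrow> eventually (\<lambda>x. x \<in> S \<and> dist x z < r) (at z within S)"
  unfolding eventually_at by (intro exI[of _ r]) auto

text \<open>Near 1 the local expansion is valid on the whole segment from 1 to x, and (1 - x)^lam
  splits off because u is a positive real. Each remaining power of u gives a Beta integral.\<close>

lemma conv_germ1:
  assumes f: "germ1 S lam g f" and lam: "Re lam > 0" and a: "Re a > 1"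
  shows "germ1 S (lam + a) (fps_const (Gamma a) * Efps a lam g) (conv a (f(1 := 0)) 1)"
proof -
  obtain \<phi> where \<phi>: "\<phi> has_fps_expansion g" "\<forall>\<^sub>F x in at 1 within S. f x = (1 - x) powr lam * \<phi> (1 - x)"
    using f unfolding germ1_def by blast
  obtain r1 where r1: "r1 > 0" "\<And>w. cmod w < r1 \<Longrightarrow> eval_fps g w = \<phi> w"
    using \<phi>(1) unfolding has_fps_expansion_def eventually_nhds_metric by (auto simp: dist_norm)
  obtain r2 where r2: "r2 > 0" "\<And>x. x \<in> S \<Longrightarrow> x \<noteq> 1 \<Longrightarrow> dist x 1 < r2 \<Longrightarrow> f x = (1 - x) powr lam * \<phi> (1 - x)"
    using \<phi>(2) unfolding eventually_at by blast
  have "fps_conv_radius g > 0" using \<phi>(1) by (simp add: has_fps_expansion_def)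
  then obtain r3 where r3: "0 < ereal r3" "ereal r3 < fps_conv_radius g" using ereal_dense2 by blast
  define r where "r = min r1 (min r2 r3)"
  have r: "r > 0" "r \<le> r1" "r \<le> r2" "r \<le> r3" using r1(1) r2(1) r3(1) by (auto simp: r_def)
  define \<Phi> where "\<Phi> = (\<lambda>w. integral {0..1} (\<lambda>u. (of_real (1 - u) powr (a - 1) * of_real u powr lam) * (\<Sum>k. fps_nth g k * (of_real u * w) ^ k)))"
  have ev: "\<forall>\<^sub>F x in at 1 within S. conv a (f(1 := 0)) 1 x = (1 - x) powr (lam + a) * \<Phi> (1 - x)"
    using eventually_ball_S[OF r(1), of 1]
  proof (rule eventually_mono, elim conjE)
    fix x assume x: "x \<in> S" "dist x 1 < r"
    define w where "w = 1 - x"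
    have w: "w \<noteq> 0" "cmod w < r" using x notin by (auto simp: w_def dist_norm norm_minus_commute)
    have "integral {0..1} (\<lambda>u. complex_of_real (1 - u) powr (a - 1) * (f(1 := 0)) (1 - of_real u * w)) =
       integral {0..1} (\<lambda>u. w powr lam * ((of_real (1 - u) powr (a - 1) * of_real u powr lam) * (\<Sum>k. fps_nth g k * (of_real u * w) ^ k)))"
    proof (rule integral_cong)
      fix u :: real assume u: "u \<in> {0..1}"
      show "complex_of_real (1 - u) powr (a - 1) * (f(1 := 0)) (1 - of_real u * w) = w powr lam * ((of_real (1 - u) powr (a - 1) * of_real u powr lam) * (\<Sum>k. fps_nth g k * (of_real u * w) ^ k))"
      proof (cases "u = 0")
        case False
        then have u0: "0 < u" "u \<le> 1" using u by auto
        have s: "1 - of_real u * w \<in> S" unfolding w_def by (rule segment_to_closure_in[OF S(1,2,5) x(1) u0])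
        have "cmod (of_real u * w) \<le> 1 * cmod w" unfolding norm_mult norm_of_real using u0 by (intro mult_right_mono) auto
        then have uw: "cmod (of_real u * w) < r" using w by simp
        have "f (1 - of_real u * w) = (1 - (1 - of_real u * w)) powr lam * \<phi> (1 - (1 - of_real u * w))"
          by (rule r2(2)[OF s]) (use uw r(3) u0 w in \<open>auto simp: dist_norm\<close>)
        also have "1 - (1 - of_real u * w) = of_real u * w" by simp
        also have "(of_real u * w) powr lam = of_real u powr lam * w powr lam" by (rule powr_times_of_real[OF u0(1) w(1)])
        also have "\<phi> (of_real u * w) = eval_fps g (of_real u * w)" using r1(2) uw r(2) by simp
        finally have "f (1 - of_real u * w) = of_real u powr lam * w powr lam * (\<Sum>k. fps_nth g k * (of_real u * w) ^ k)"
          by (simp only: eval_fps_def)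
        moreover have "1 - of_real u * w \<noteq> 1" using u0 w by simp
        from fun_upd_other[OF this] have "(f(1 := 0)) (1 - of_real u * w) = f (1 - of_real u * w)" .
        ultimately show ?thesis by (simp only: mult_ac)
      qed simp
    qed
    then have "conv a (f(1 := 0)) 1 x = w powr a * (w powr lam * \<Phi> w)"
      unfolding conv_def \<Phi>_def w_def[symmetric] by (simp only: integral_mult_right)
    then show "conv a (f(1 := 0)) 1 x = (1 - x) powr (lam + a) * \<Phi> (1 - x)"
      by (simp only: w_def[symmetric] powr_add mult_ac)
  qed
  have "\<Phi> has_fps_expansion (fps_const (Gamma a) * Efps a lam g)"
  proof (rule has_fps_expansionI)
    have "eventually (\<lambda>w. cmod w < r) (nhds 0)"
      using eventually_nhds_in_open[of "ball (0::complex) r" 0] r(1) by simp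
    then show "\<forall>\<^sub>F w in nhds 0. (\<lambda>n. fps_nth (fps_const (Gamma a) * Efps a lam g) n * w ^ n) sums \<Phi> w"
    proof (rule eventually_mono)
      fix w assume w: "cmod w < r"
      have "ereal (cmod w) < fps_conv_radius g"
        using w r(4) by (intro less_trans[OF _ r3(2)]) simp
      from norm_summable_fps[OF this] have sm: "summable (\<lambda>k. cmod (fps_nth g k) * cmod w ^ k)"
        by (simp add: norm_mult norm_power)
      have "(\<lambda>k. fps_nth g k * integral {0..1} (\<lambda>u. (of_real (1 - u) powr (a - 1) * of_real u powr lam) * (of_real u * w) ^ k)) sums \<Phi> w"
        unfolding \<Phi>_def
      proof (rule integral_power_series_sums[OF _ _ _ sm])
        show "continuous_on {0..1} (\<lambda>u. complex_of_real (1 - u) powr (a - 1) * of_real u powr lam)"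
          using continuous_beta_kernel[of a "lam + 1"] a lam by simp
        show "cmod (of_real u * w) \<le> cmod w" if "u \<in> {0..1}" for u
          unfolding norm_mult norm_of_real using that by (intro mult_left_le_one_le) auto
      qed (intro continuous_intros)
      moreover have "fps_nth g k * integral {0..1} (\<lambda>u. (of_real (1 - u) powr (a - 1) * of_real u powr lam) * (of_real u * w) ^ k)
         = fps_nth (fps_const (Gamma a) * Efps a lam g) k * w ^ k" for k
      proof -
        have "integral {0..1} (\<lambda>u. (complex_of_real (1 - u) powr (a - 1) * of_real u powr lam) * (of_real u * w) ^ k) =
          integral {0..1} (\<lambda>u. w ^ k * (complex_of_real (1 - u) powr (a - 1) * of_real u powr (lam + of_nat k + 1 - 1)))"
        proof (rule integral_spike[of "{0}"])
          fix u :: real assume "u \<in> {0..1} - {0}"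
          then have "complex_of_real u powr (lam + of_nat k + 1 - 1) = of_real u powr lam * of_real u ^ k"
            by (simp add: powr_add powr_nat')
          then show "w ^ k * (complex_of_real (1 - u) powr (a - 1) * of_real u powr (lam + of_nat k + 1 - 1)) =
             (complex_of_real (1 - u) powr (a - 1) * of_real u powr lam) * (of_real u * w) ^ k"
            by (simp only: power_mult_distrib mult_ac)
        qed simp
        also have "\<dots> = w ^ k * beta_int a (lam + of_nat k + 1)"
          unfolding beta_int_def by (rule integral_mult_right)
        also have "beta_int a (lam + of_nat k + 1) = Beta a (lam + of_nat k + 1)"
          using a lam by (intro beta_int_eq_Beta) auto
        also have "\<dots> = Gamma a * Gamma (lam + of_nat k + 1) * rGamma (lam + of_nat k + 1 + a)"
          by (simp only: Beta_altdef add.commute)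
        finally show ?thesis by (simp add: Efps_def mult_ac)
      qed
      ultimately show "(\<lambda>n. fps_nth (fps_const (Gamma a) * Efps a lam g) n * w ^ n) sums \<Phi> w" by (simp only:)
    qed
  qed
  with ev show ?thesis unfolding germ1_def by blast
qed

text \<open>Cauchy's theorem for the triangle x, p, 1. Its vertex 1 lies on the boundary of S, so
  the integrand is continuous on the triangle and holomorphic only in its interior. As x has the
  smallest real part, s - x avoids the branch cut of the power.\<close>

lemma conv_split:
  assumes f: "f holomorphic_on S" "continuous_on (insert 1 S) (f(1 := 0))" and a: "Re a > 1"
    and p: "p \<in> S" "0 < Re p" "Re p \<le> 1" and x: "x \<in> S" "Re x < Re p"
  shows "conv a (f(1 := 0)) 1 x = conv a f p x + contour_integral (linepath p 1) (\<lambda>s. (s - x) powr (a - 1) * (f(1 := 0)) s)"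
proof -
  let ?f = "f(1 := 0)"
  let ?G = "\<lambda>s. (s - x) powr (a - 1) * ?f s"
  let ?T = "convex hull {x, p, 1}"
  have T: "?T \<subseteq> insert 1 S"
  proof
    fix s assume "s \<in> ?T"
    then obtain u v w where s: "0 \<le> u" "0 \<le> v" "0 \<le> w" "u + v + w = 1" "s = u *\<^sub>R x + v *\<^sub>R p + w *\<^sub>R 1"
      unfolding convex_hull_3 by blast
    show "s \<in> insert 1 S"
    proof (cases "w = 1")
      case True
      then have uv: "u = 0" "v = 0" using s(1,2,4) by linarith+
      show ?thesis unfolding s(5) uv True by simp
    next
      case False
      then have uv: "u + v > 0" "1 - w = u + v" using s by auto
      define y where "y = (u / (u + v)) *\<^sub>R x + (v / (u + v)) *\<^sub>R p"
      have "y \<in> S" unfolding y_def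
        by (rule convexD[OF S(2) x(1) p(1)]) (use s uv in \<open>auto simp: add_divide_distrib[symmetric]\<close>)
      then have "1 - of_real (u + v) * (1 - y) \<in> S"
        by (rule segment_to_closure_in[OF S(1,2,5)]) (use s uv in auto)
      moreover have "1 - of_real (u + v) * (1 - y) = s"
      proof -
        have "(u + v) *\<^sub>R y = u *\<^sub>R x + v *\<^sub>R p" unfolding y_def using uv by (simp add: scaleR_add_right)
        then have "s = of_real (u + v) * y + of_real w" using s(5) by (simp add: scaleR_conv_of_real)
        moreover have "complex_of_real w = 1 - of_real (u + v)" using uv(2) by (metis of_real_1 of_real_diff add_diff_cancel_left' diff_diff_eq2)
        ultimately show ?thesis by (simp add: algebra_simps del: of_real_add)
      qed
      ultimately show ?thesis by simp
    qed
  qed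
  have Re_T: "Re x \<le> Re s" if "s \<in> ?T" for s
  proof -
    have "convex {s. Re s \<ge> Re x}" by (rule convex_halfspace_Re_ge)
    then have "?T \<subseteq> {s. Re s \<ge> Re x}" using x p by (intro hull_minimal) auto
    then show ?thesis using that by blast
  qed
  have fc: "continuous_on ?T ?f" using f(2) T continuous_on_subset by blast
  have Gc: "continuous_on ?T ?G"
  proof (intro continuous_on_mult fc continuous_on_powr_complex continuous_intros)
    show "?T \<subseteq> {s. 0 \<le> Re (s - x) \<or> Im (s - x) \<noteq> 0}" using Re_T by auto
  qed (use a in auto)
  \<comment> \<open>An interior point has horizontal neighbours in the triangle. The right one
    excludes s = 1, since S contains no real point; the left one gives the strict inequality of real
    parts.\<close>
  have inT: "s \<in> S \<and> s - x \<notin> \<real>\<^sub>\<le>\<^sub>0" if s: "s \<in> interior ?T" for s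
  proof -
    obtain e where e: "e > 0" "ball s e \<subseteq> ?T" using s unfolding mem_interior by blast
    have "s + of_real (e / 2) \<in> ?T" "s - of_real (e / 2) \<in> ?T"
      using e by (auto intro!: subsetD[OF e(2)] simp: dist_norm)
    then have "s \<noteq> 1" "Re x < Re s"
    proof -
      show "s \<noteq> 1"
      proof
        assume "s = 1"
        with \<open>s + of_real (e / 2) \<in> ?T\<close> T have "1 + complex_of_real (e / 2) \<in> insert 1 S" by blast
        then have "1 + complex_of_real (e / 2) \<in> S" using e(1) by (auto simp: complex_eq_iff)
        then show False using Im_nz by fastforce
      qed
      show "Re x < Re s" using Re_T[OF \<open>s - of_real (e / 2) \<in> ?T\<close>] e(1) by simp
    qed
    moreover have "s \<in> insert 1 S" using s T interior_subset by blast
    ultimately show ?thesis by (auto simp: complex_nonpos_Reals_iff)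
  qed
  have Gh: "?G holomorphic_on interior ?T"
  proof -
    have "f holomorphic_on interior ?T" by (rule holomorphic_on_subset[OF f(1)]) (use inT in blast)
    then have "(\<lambda>s. (s - x) powr (a - 1) * f s) holomorphic_on interior ?T"
      using inT by (intro holomorphic_on_mult holomorphic_on_powr holomorphic_intros) auto
    then show ?thesis by (rule holomorphic_transform) (use inT notin in auto)
  qed
  have ti: "(?G has_contour_integral 0) (linepath x p +++ linepath p 1 +++ linepath 1 x)"
    by (rule Cauchy_theorem_triangle_interior[OF Gc Gh])
  have seg: "closed_segment y z \<subseteq> ?T" if "y \<in> {x, p, 1}" "z \<in> {x, p, 1}" for y z
    using that by (intro closed_segment_subset convex_convex_hull) (auto intro: hull_inc)
  have ci: "?G contour_integrable_on linepath y z" if "y \<in> {x, p, 1}" "z \<in> {x, p, 1}" for y z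
    by (rule contour_integrable_continuous_linepath[OF continuous_on_subset[OF Gc seg[OF that]]])
  have "contour_integral (linepath x p) ?G + (contour_integral (linepath p 1) ?G + contour_integral (linepath 1 x) ?G) = 0"
    using contour_integral_unique[OF ti] ci by (simp add: contour_integral_join)
  moreover have "contour_integral (linepath 1 x) ?G = - contour_integral (linepath x 1) ?G"
    using contour_integral_reverse_linepath[of 1 x ?G] continuous_on_subset[OF Gc seg] by simp
  moreover have "B = D + C" if "D + (C + A) = 0" "A = - B" for A B C D :: complex
  proof -
    have "B - (D + C) = - (D + (C + A))" unfolding that(2) by simp
    then show ?thesis using that(1) by simp
  qed
  ultimately have "contour_integral (linepath x 1) ?G = contour_integral (linepath x p) ?G + contour_integral (linepath p 1) ?G"
    by blast
  moreover have "contour_integral (linepath x 1) ?G = conv a ?f 1 x"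
    by (rule contour_integral_unique, rule conv_has_contour_integral)
       (use continuous_conv_kernel[OF S(1,2,5) x(1) a f(2)] x notin in auto)
  moreover have "contour_integral (linepath x p) ?G = conv a f p x"
  proof -
    have pc: "p \<in> closure S" using p(1) closure_subset by blast
    have "continuous_on (insert p S) f"
      using holomorphic_on_imp_continuous_on[OF f(1)] p(1) by (simp add: insert_absorb)
    from continuous_conv_kernel[OF S(1,2) pc x(1) a this]
    have "((\<lambda>s. (s - x) powr (a - 1) * f s) has_contour_integral conv a f p x) (linepath x p)"
      by (rule conv_has_contour_integral) (use x in auto)
    then have "(?G has_contour_integral conv a f p x) (linepath x p)"
    proof (rule has_contour_integral_eq)
      fix s assume "s \<in> path_image (linepath x p)"
      then have "s \<in> S" using closed_segment_subset[OF x(1) p(1) S(2)] by auto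
      then show "(s - x) powr (a - 1) * f s = (s - x) powr (a - 1) * ?f s" using notin by auto
    qed
    then show ?thesis by (rule contour_integral_unique)
  qed
  ultimately show ?thesis by simp
qed

end

lemma finite_analytic_ball:
  assumes "finite K" "\<And>k. k \<in> K \<Longrightarrow> (h k :: complex \<Rightarrow> complex) analytic_on {0}"
  shows "\<exists>\<rho>>0. \<forall>k\<in>K. h k holomorphic_on ball 0 \<rho>"
  using assms
proof (induction K rule: finite_induct)
  case empty
  show ?case by (intro exI[of _ 1]) auto
next
  case (insert k K)
  from insert.IH insert.prems obtain \<rho> where \<rho>: "\<rho> > 0" "\<forall>k\<in>K. h k holomorphic_on ball 0 \<rho>" by blast
  have "h k analytic_on {0}" using insert.prems by blast
  then obtain e where e: "e > 0" "h k holomorphic_on ball 0 e" unfolding analytic_on_def by blast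
  have b: "ball 0 (min \<rho> e) \<subseteq> ball (0::complex) e" "ball 0 (min \<rho> e) \<subseteq> ball (0::complex) \<rho>" by auto
  have "\<forall>k\<in>insert k K. h k holomorphic_on ball 0 (min \<rho> e)"
  proof
    fix j assume "j \<in> insert k K"
    then consider "j = k" | "j \<in> K" by blast
    then show "h j holomorphic_on ball 0 (min \<rho> e)"
    proof cases
      case 1
      then show ?thesis using holomorphic_on_subset[OF e(2) b(1)] by simp
    next
      case 2
      show ?thesis by (rule holomorphic_on_subset[OF bspec[OF \<rho>(2) 2] b(2)])
    qed
  qed
  then show ?case using \<rho>(1) e(1) by (intro exI[of _ "min \<rho> e"]) simp
qed

lemma conv_cong:
  assumes "\<And>u. u \<in> {0..1} \<Longrightarrow> f (p - of_real u * (p - x)) = g (p - of_real u * (p - x))"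
  shows "conv a f p x = conv a g p x"
  unfolding conv_def by (intro arg_cong2[where f = times] refl integral_cong) (use assms in simp)

lemma conv_sum:
  assumes "finite K" "\<And>k. k \<in> K \<Longrightarrow> continuous_on {0..1} (\<lambda>u. complex_of_real (1 - u) powr (a - 1) * f k (p - of_real u * (p - x)))"
  shows "conv a (\<lambda>s. \<Sum>k\<in>K. f k s) p x = (\<Sum>k\<in>K. conv a (f k) p x)"
proof -
  have "integral {0..1} (\<lambda>u. complex_of_real (1 - u) powr (a - 1) * (\<Sum>k\<in>K. f k (p - of_real u * (p - x))))
     = (\<Sum>k\<in>K. integral {0..1} (\<lambda>u. complex_of_real (1 - u) powr (a - 1) * f k (p - of_real u * (p - x))))"
    unfolding sum_distrib_left
    by (rule Henstock_Kurzweil_Integration.integral_sum[OF assms(1)]) (intro integrable_continuous_real assms(2))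
  then show ?thesis by (simp add: conv_def sum_distrib_left)
qed

lemma germ0_cmult: "germ0 S K \<beta> c f \<Longrightarrow> germ0 S K \<beta> (\<lambda>k. z * c k) (\<lambda>x. z * f x)"
  unfolding germ0_def
proof (elim exE conjE)
  fix h r assume h: "\<forall>k\<in>K. h k analytic_on {0} \<and> h k 0 = c k" "r analytic_on {0}"
    "\<forall>\<^sub>F x in at 0 within S. f x = (\<Sum>k\<in>K. x powr \<beta> k * h k x) + r x"
  show "\<exists>h r. (\<forall>k\<in>K. h k analytic_on {0} \<and> h k 0 = z * c k) \<and> r analytic_on {0} \<and>
     (\<forall>\<^sub>F x in at 0 within S. z * f x = (\<Sum>k\<in>K. x powr \<beta> k * h k x) + r x)"
  proof (rule exI[of _ "\<lambda>k x. z * h k x"], rule exI[of _ "\<lambda>x. z * r x"], intro conjI)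
    show "\<forall>\<^sub>F x in at 0 within S. z * f x = (\<Sum>k\<in>K. x powr \<beta> k * (z * h k x)) + z * r x"
      using h(3) by (rule eventually_mono) (simp add: sum_distrib_left distrib_left mult_ac)
  qed (use h(1,2) in \<open>auto intro: analytic_on_mult analytic_on_const\<close>)
qed

lemma germ1_cmult: "germ1 S lam g f \<Longrightarrow> germ1 S lam (fps_const z * g) (\<lambda>x. z * f x)"
  unfolding germ1_def
proof (elim exE conjE)
  fix \<phi> assume h: "\<phi> has_fps_expansion g" "\<forall>\<^sub>F x in at 1 within S. f x = (1 - x) powr lam * \<phi> (1 - x)"
  show "\<exists>\<phi>. \<phi> has_fps_expansion fps_const z * g \<and> (\<forall>\<^sub>F x in at 1 within S. z * f x = (1 - x) powr lam * \<phi> (1 - x))"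
  proof (rule exI[of _ "\<lambda>x. z * \<phi> x"], intro conjI)
    show "\<forall>\<^sub>F x in at 1 within S. z * f x = (1 - x) powr lam * (z * \<phi> (1 - x))"
      using h(2) by (rule eventually_mono) simp
  qed (intro has_fps_expansion_cmult_left h)
qed

lemma filterlim_one_minus: "filterlim (\<lambda>x. 1 - x) (nhds (0::complex)) (at 1 within S)"
  by (auto intro!: tendsto_eq_intros)

text \<open>Multiplied by w^b, the series \<Phi> is a primitive of w^(b - 1) \<phi>(w). The
  denominators stay away from 0, so the radius of convergence remains positive.\<close>

lemma ode_fps:
  assumes "b \<notin> \<int>" "\<phi> has_fps_expansion (g :: complex fps)"
  shows "\<exists>\<Phi>. \<Phi> has_fps_expansion Abs_fps (\<lambda>k. fps_nth g k / (b + of_nat k)) \<and>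
    (\<forall>\<^sub>F w in nhds 0. b * \<Phi> w + w * deriv \<Phi> w = \<phi> w)"
proof -
  define G where "G = Abs_fps (\<lambda>k. fps_nth g k * (1 / (b + of_nat k)))"
  obtain d where d: "d > 0" "\<And>i. d \<le> cmod (b - of_int i)" using nonint_dist[OF assms(1)] by blast
  have bd: "cmod (1 / (b + of_nat k)) \<le> 1 / d * 1 ^ k" for k
  proof -
    have "d \<le> cmod (b + of_nat k)" using d(2)[of "- int k"] by simp
    then have "inverse (cmod (b + of_nat k)) \<le> inverse d" using d(1) by (intro le_imp_inverse_le)
    then show ?thesis by (simp add: norm_divide inverse_eq_divide)
  qed
  have "fps_conv_radius g > 0" using assms(2) by (simp add: has_fps_expansion_def)
  then obtain r where r: "0 < ereal r" "ereal r < fps_conv_radius g" using ereal_dense2 by blast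
  have "ereal (r / 1) \<le> fps_conv_radius G"
    unfolding G_def by (rule fps_conv_radius_mult_bounded[OF bd]) (use r in auto)
  from less_le_trans[OF _ this, of 0] r(1) have "fps_conv_radius G > 0" by simp
  then have \<Phi>: "eval_fps G has_fps_expansion G" by (rule eval_fps_has_fps_expansion)
  have "(\<lambda>w. b * eval_fps G w + w * deriv (eval_fps G) w) has_fps_expansion (fps_const b * G + fps_X * fps_deriv G)"
    by (intro fps_expansion_intros \<Phi>)
  also have "fps_const b * G + fps_X * fps_deriv G = g"
  proof (rule fps_ext)
    fix k
    have nz: "b + of_nat k \<noteq> 0" using add_nat_nonint[OF assms(1), of k] Ints_0 by metis
    have "fps_nth (fps_const b * G + fps_X * fps_deriv G) k = (b + of_nat k) * fps_nth G k"
      by (cases k) (simp_all add: algebra_simps)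
    also have "\<dots> = fps_nth g k" unfolding G_def using nz by simp
    finally show "fps_nth (fps_const b * G + fps_X * fps_deriv G) k = fps_nth g k" .
  qed
  finally have "(\<lambda>w. b * eval_fps G w + w * deriv (eval_fps G) w) has_fps_expansion g" .
  then have "\<forall>\<^sub>F w in nhds 0. b * eval_fps G w + w * deriv (eval_fps G) w = \<phi> w"
    using assms(2) unfolding has_fps_expansion_def by (auto elim: eventually_elim2)
  moreover have "G = Abs_fps (\<lambda>k. fps_nth g k / (b + of_nat k))" by (simp add: G_def)
  ultimately show ?thesis using \<Phi> by metis
qed

lemma has_fps_expansion_imp_analytic_0: "f has_fps_expansion F \<Longrightarrow> f analytic_on {0 :: complex}"
  using has_fps_expansion_imp_holomorphic analytic_at by metis

context slit
begin

text \<open>For |x| < Re p the difference s - x stays in the right half plane while s runs from p to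
  1, so the integrand depends holomorphically on x in a full neighbourhood of 0.\<close>

lemma contour_part_analytic:
  assumes f: "continuous_on (insert 1 S) f" and p: "p \<in> S" "0 < Re p" "Re p \<le> 1"
  shows "(\<lambda>x. contour_integral (linepath p 1) (\<lambda>s. (s - x) powr (a - 1) * f s)) analytic_on {0}"
proof -
  define l where "l = (\<lambda>t::real. linepath p 1 t)"
  have lS: "l t \<in> insert 1 S" if "t \<in> {0..1}" for t
  proof (cases "t = 1")
    case False
    have "1 - of_real (1 - t) * (1 - p) \<in> S"
      by (rule segment_to_closure_in[OF S(1,2,5) p(1)]) (use that False in auto)
    moreover have "1 - of_real (1 - t) * (1 - p) = l t"
      by (simp add: l_def linepath_def scaleR_conv_of_real algebra_simps)
    ultimately show ?thesis by simp
  qed (simp add: l_def linepath_def)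
  have lRe: "Re p \<le> Re (l t)" if "t \<in> {0..1}" for t
  proof -
    have "t * Re p \<le> t * 1" using that p(3) by (intro mult_left_mono) auto
    then show ?thesis by (simp add: l_def linepath_def algebra_simps)
  qed
  have lc: "continuous_on {0..1} l" unfolding l_def by (rule continuous_on_linepath)
  have flc: "continuous_on {0..1} (\<lambda>t. f (l t))"
    by (rule continuous_on_compose2[OF f lc]) (use lS in blast)
  define G where "G = (\<lambda>x t. (l t - x) powr (a - 1) * f (l t) * (1 - p))"
  have sl: "l t - x \<notin> \<real>\<^sub>\<le>\<^sub>0" if "x \<in> ball (0::complex) (Re p)" "t \<in> {0..1}" for x t
  proof -
    have "Re x < Re p" using that(1) complex_Re_le_cmod[of x] by simp
    then have "Re (l t - x) > 0" using lRe[OF that(2)] by simp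
    then show ?thesis by (auto simp: complex_nonpos_Reals_iff)
  qed
  have Gc: "continuous_on {0..1} (G x)" if "x \<in> ball (0::complex) (Re p)" for x
    unfolding G_def by (intro continuous_on_mult continuous_on_powr_slit continuous_on_diff lc flc continuous_on_const sl that)
  have eq: "contour_integral (linepath p 1) (\<lambda>s. (s - x) powr (a - 1) * f s) = integral (cbox 0 1) (G x)"
    if "x \<in> ball (0::complex) (Re p)" for x
  proof (rule contour_integral_unique)
    have "(G x has_integral integral (cbox 0 1) (G x)) {0..1}"
      unfolding box_real by (intro integrable_integral integrable_continuous_real Gc that)
    then show "((\<lambda>s. (s - x) powr (a - 1) * f s) has_contour_integral integral (cbox 0 1) (G x)) (linepath p 1)"
      by (simp add: has_contour_integral_linepath G_def l_def)
  qed
  have "(\<lambda>x. integral (cbox 0 1) (G x)) holomorphic_on ball (0::complex) (Re p)"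
  proof (rule leibniz_rule_holomorphic)
    fix x :: complex and t :: real assume xt: "x \<in> ball (0::complex) (Re p)" "t \<in> cbox 0 1"
    have "((\<lambda>x. l t - x) has_field_derivative -1) (at x within ball (0::complex) (Re p))" by (auto intro!: derivative_eq_intros)
    moreover have "((\<lambda>z. z powr (a - 1)) has_field_derivative ((a - 1) * (l t - x) powr (a - 1 - 1))) (at (l t - x))"
      by (rule has_field_derivative_powr, rule sl) (use xt in auto)
    ultimately have "((\<lambda>x. (l t - x) powr (a - 1)) has_field_derivative ((a - 1) * (l t - x) powr (a - 1 - 1)) * -1) (at x within ball (0::complex) (Re p))"
      by (rule DERIV_chain2[rotated])
    then show "((\<lambda>x. G x t) has_field_derivative ((a - 1) * (l t - x) powr (a - 1 - 1)) * -1 * f (l t) * (1 - p)) (at x within ball (0::complex) (Re p))"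
      unfolding G_def by (intro DERIV_cmult_right)
  next
    show "G x integrable_on cbox 0 1" if "x \<in> ball (0::complex) (Re p)" for x
      unfolding box_real by (intro integrable_continuous_real Gc that)
    have c1: "continuous_on (ball (0::complex) (Re p) \<times> {0..1}) (\<lambda>z. l (snd z))"
      by (rule continuous_on_compose2[OF lc continuous_on_snd[OF continuous_on_id]]) auto
    have c2: "continuous_on (ball (0::complex) (Re p) \<times> {0..1}) (\<lambda>z. f (l (snd z)))"
      by (rule continuous_on_compose2[OF flc continuous_on_snd[OF continuous_on_id]]) auto
    show "continuous_on (ball (0::complex) (Re p) \<times> cbox 0 1) (\<lambda>(x, t). ((a - 1) * (l t - x) powr (a - 1 - 1)) * -1 * f (l t) * (1 - p))"
      unfolding case_prod_beta box_real
      by (intro continuous_on_mult continuous_on_const continuous_on_powr_slit continuous_on_diff c1 c2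
          continuous_on_fst continuous_on_id sl) auto
  qed simp
  then have "(\<lambda>x. contour_integral (linepath p 1) (\<lambda>s. (s - x) powr (a - 1) * f s)) holomorphic_on ball (0::complex) (Re p)"
    by (rule holomorphic_transform) (simp add: eq)
  then show ?thesis using p(2) by (intro analytic_at[THEN iffD2] exI[of _ "ball (0::complex) (Re p)"]) auto
qed

text \<open>The base point is moved from 1 to a point p inside the common disc of convergence. The
  integral from x to p is a sum of integrals covered by \<open>zero_end\<close>, and the remaining
  path contributes only an analytic function.\<close>

lemma conv_germ0:
  assumes f: "f holomorphic_on S" "continuous_on (insert 1 S) (f(1 := 0))" and a: "Re a > 1" "a \<notin> \<int>"
    and g: "germ0 S K \<beta> c f" "finite K" "\<And>k. k \<in> K \<Longrightarrow> \<beta> k + a \<notin> \<int>"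
  shows "germ0 S K (\<lambda>k. \<beta> k + a) (\<lambda>k. Kc a (\<beta> k) * c k) (conv a (f(1 := 0)) 1)"
proof -
  obtain h r where h: "\<And>k. k \<in> K \<Longrightarrow> h k analytic_on {0}" "\<And>k. k \<in> K \<Longrightarrow> h k 0 = c k" "r analytic_on {0}"
    "\<forall>\<^sub>F x in at 0 within S. f x = (\<Sum>k\<in>K. x powr \<beta> k * h k x) + r x"
    using g(1) unfolding germ0_def by blast
  obtain \<rho>1 where \<rho>1: "\<rho>1 > 0" "\<forall>k\<in>K. h k holomorphic_on ball 0 \<rho>1"
    using finite_analytic_ball[of K h, OF g(2) h(1)] by blast
  obtain \<rho>2 where \<rho>2: "\<rho>2 > 0" "r holomorphic_on ball 0 \<rho>2" using h(3) unfolding analytic_on_def by blast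
  obtain \<rho>3 where \<rho>3: "\<rho>3 > 0" "\<And>x. x \<in> S \<Longrightarrow> x \<noteq> 0 \<Longrightarrow> dist x 0 < \<rho>3 \<Longrightarrow> f x = (\<Sum>k\<in>K. x powr \<beta> k * h k x) + r x"
    using h(4) unfolding eventually_at by blast
  define \<rho> where "\<rho> = min \<rho>1 (min \<rho>2 \<rho>3)"
  have \<rho>: "\<rho> > 0" "ball 0 \<rho> \<subseteq> ball (0::complex) \<rho>1" "ball 0 \<rho> \<subseteq> ball (0::complex) \<rho>2" "\<rho> \<le> \<rho>3"
    using \<rho>1(1) \<rho>2(1) \<rho>3(1) by (auto simp: \<rho>_def)
  have hh: "h k holomorphic_on ball 0 \<rho>" if "k \<in> K" for k using \<rho>1(2) that holomorphic_on_subset \<rho>(2) by blast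
  have rh: "r holomorphic_on ball 0 \<rho>" using \<rho>2(2) holomorphic_on_subset \<rho>(3) by blast
  obtain p where p: "p \<in> S" "cmod p < \<rho>" "0 < Re p" "Re p \<le> 1" using ex_small[OF \<rho>(1)] by blast
  interpret sb: slit_base S p a
    by unfold_locales (use S S_slit p a in auto)
  \<comment> \<open>The part of S on which all local series converge; being convex, it contains the
    segment from p to each of its points.\<close>
  define T where "T = S \<inter> ball 0 \<rho>"
  have T: "open T" "convex T" "p \<in> T" "T \<subseteq> S" "T \<subseteq> ball 0 \<rho>" using S p by (auto simp: T_def intro: convex_Int)
  define Z where "Z = (\<lambda>k ht kt. ht analytic_on {0} \<and> kt analytic_on {0} \<and> ht 0 = Kc a (\<beta> k) * c k \<and>
    (\<forall>\<^sub>F x in at 0 within S. conv a (\<lambda>s. s powr \<beta> k * h k s) p x = x powr (a + \<beta> k) * ht x + kt x))"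
  have "\<exists>ht kt. Z k ht kt" if k: "k \<in> K" for k
  proof -
    have "a + \<beta> k \<notin> \<int>" using g(3)[OF k] by (simp add: add.commute)
    from sb.zero_end[OF hh[OF k] p(2) this, unfolded h(2)[OF k]] obtain ht kt where
      "ht analytic_on {0}" "kt analytic_on {0}" "ht 0 = Kc a (\<beta> k) * c k"
      "\<forall>\<^sub>F x in at 0 within S. conv a (\<lambda>s. s powr \<beta> k * h k s) p x = x powr (a + \<beta> k) * ht x + kt x"
      by (elim exE conjE)
    then have "Z k ht kt" unfolding Z_def by (intro conjI)
    then show ?thesis by blast
  qed
  then obtain ht kt where Z: "\<And>k. k \<in> K \<Longrightarrow> Z k (ht k) (kt k)" by metis
  have hk: "\<And>k. k \<in> K \<Longrightarrow> ht k analytic_on {0}" "\<And>k. k \<in> K \<Longrightarrow> kt k analytic_on {0}"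
    "\<And>k. k \<in> K \<Longrightarrow> ht k 0 = Kc a (\<beta> k) * c k"
    "\<And>k. k \<in> K \<Longrightarrow> \<forall>\<^sub>F x in at 0 within S. conv a (\<lambda>s. s powr \<beta> k * h k s) p x = x powr (a + \<beta> k) * ht k x + kt k x"
    using Z unfolding Z_def by simp_all
  have "a + 0 \<notin> \<int>" using a(2) by simp
  from sb.zero_end[OF rh p(2) this] obtain h0 kr where k0: "kr analytic_on {0}" "\<forall>x. h0 x = 0"
    "\<forall>\<^sub>F x in at 0 within S. conv a (\<lambda>s. s powr 0 * r s) p x = x powr (a + 0) * h0 x + kr x"
    by (elim exE conjE) simp
  have kr: "kr analytic_on {0}" "\<forall>\<^sub>F x in at 0 within S. conv a (\<lambda>s. s powr 0 * r s) p x = kr x"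
    using k0 by simp_all
  define J where "J = (\<lambda>x. contour_integral (linepath p 1) (\<lambda>s. (s - x) powr (a - 1) * (f(1 := 0)) s))"
  have J: "J analytic_on {0}" unfolding J_def by (rule contour_part_analytic[OF f(2) p(1,3,4)])
  have cT: "continuous_on (insert p T) (\<lambda>s. s powr b * H s)" if "H holomorphic_on ball 0 \<rho>" for b H
  proof -
    have "continuous_on T H" using holomorphic_on_imp_continuous_on[OF that] T(5) continuous_on_subset by blast
    then have "continuous_on T (\<lambda>s. s powr b * H s)"
      by (intro continuous_on_mult continuous_on_powr_slit continuous_on_id) (use T(4) slits in auto)
    then show ?thesis using T(3) by (simp add: insert_absorb)
  qed
  have pT: "p \<in> closure T" using T(3) closure_subset by blast
  have kc: "continuous_on {0..1} (\<lambda>u. complex_of_real (1 - u) powr (a - 1) * ((p - of_real u * (p - x)) powr b * H (p - of_real u * (p - x))))"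
    if "H holomorphic_on ball 0 \<rho>" "x \<in> T" for b H x
    by (rule continuous_conv_kernel[OF T(1,2) pT that(2) a(1) cT[OF that(1)]])
  have sum_lin: "conv a f p x = (\<Sum>k\<in>K. conv a (\<lambda>s. s powr \<beta> k * h k s) p x) + conv a (\<lambda>s. s powr 0 * r s) p x" if x: "x \<in> T" for x
  proof -
    \<comment> \<open>The analytic part of f enters as the extra term \<open>None\<close> with
      exponent 0, so that one linearity argument covers all terms.\<close>
    define F where "F = (\<lambda>i. case i of None \<Rightarrow> (\<lambda>s. s powr 0 * r s) | Some k \<Rightarrow> (\<lambda>s. s powr \<beta> k * h k s))"
    have fin: "finite (insert None (Some ` K))" using g(2) by simp
    have sum: "(\<Sum>i\<in>insert None (Some ` K). G i) = (\<Sum>k\<in>K. G (Some k)) + G None" for G :: "'a option \<Rightarrow> complex"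
      using g(2) by (simp add: sum.reindex add.commute)
    have "conv a f p x = conv a (\<lambda>s. \<Sum>i\<in>insert None (Some ` K). F i s) p x"
    proof (rule conv_cong)
      fix u :: real assume u: "u \<in> {0..1}"
      have s: "p - of_real u * (p - x) \<in> T"
        using segment_to_closure_in[OF T(1,2) pT x, of u] u T(3) by (cases "u = 0") auto
      have "f (p - of_real u * (p - x)) = (\<Sum>k\<in>K. (p - of_real u * (p - x)) powr \<beta> k * h k (p - of_real u * (p - x))) + r (p - of_real u * (p - x))"
      proof (rule \<rho>3(2))
        show "p - of_real u * (p - x) \<in> S" using s T(4) by blast
        then show "p - of_real u * (p - x) \<noteq> 0" by (rule slits(3))
        have "p - of_real u * (p - x) \<in> ball 0 \<rho>" using s T(5) by blast
        then have "cmod (p - of_real u * (p - x)) < \<rho>" by (simp only: mem_ball_0)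
        then show "dist (p - of_real u * (p - x)) 0 < \<rho>3" unfolding dist_norm diff_zero using \<rho>(4) by linarith
      qed
      moreover have "p - of_real u * (p - x) \<noteq> 0" using s T(4) slits by blast
      ultimately show "f (p - of_real u * (p - x)) = (\<Sum>i\<in>insert None (Some ` K). F i (p - of_real u * (p - x)))"
        unfolding sum by (simp add: F_def)
    qed
    also have "\<dots> = (\<Sum>i\<in>insert None (Some ` K). conv a (F i) p x)"
    proof (rule conv_sum[OF fin])
      fix i assume "i \<in> insert None (Some ` K)"
      then consider "i = None" | k where "k \<in> K" "i = Some k" by blast
      then show "continuous_on {0..1} (\<lambda>u. complex_of_real (1 - u) powr (a - 1) * F i (p - of_real u * (p - x)))"
      proof cases
        case 1
        then show ?thesis using kc[OF rh x, of 0] by (simp only: F_def option.case)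
      next
        case (2 k)
        then show ?thesis using kc[OF hh[OF 2(1)] x, of "\<beta> k"] by (simp only: F_def option.case)
      qed
    qed
    finally show ?thesis unfolding sum by (simp add: F_def)
  qed
  have evT: "\<forall>\<^sub>F x in at 0 within S. x \<in> T \<and> Re x < Re p"
  proof -
    have "\<forall>\<^sub>F x in at 0 within S. x \<in> S \<and> dist x 0 < min \<rho> (Re p)" by (rule eventually_ball_S) (use \<rho>(1) p(3) in simp)
    then show ?thesis
    proof (rule eventually_mono, elim conjE)
      fix x assume "x \<in> S" "dist x 0 < min \<rho> (Re p)"
      then show "x \<in> T \<and> Re x < Re p" using complex_Re_le_cmod[of x] by (auto simp: T_def)
    qed
  qed
  have evk: "\<forall>\<^sub>F x in at 0 within S. \<forall>k\<in>K. conv a (\<lambda>s. s powr \<beta> k * h k s) p x = x powr (a + \<beta> k) * ht k x + kt k x"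
    using g(2) hk(4) by (intro eventually_ball_finite) auto
  have "\<forall>\<^sub>F x in at 0 within S. conv a (f(1 := 0)) 1 x = (\<Sum>k\<in>K. x powr (\<beta> k + a) * ht k x) + ((\<Sum>k\<in>K. kt k x) + kr x + J x)"
    using evT evk kr(2)
  proof eventually_elim
    case (elim x)
    have xS: "x \<in> S" using elim T(4) by auto
    have "conv a (f(1 := 0)) 1 x = conv a f p x + J x"
      unfolding J_def using elim by (intro conv_split f a p xS) auto
    also have "conv a f p x = (\<Sum>k\<in>K. conv a (\<lambda>s. s powr \<beta> k * h k s) p x) + kr x"
      using sum_lin[of x] elim by simp
    also have "(\<Sum>k\<in>K. conv a (\<lambda>s. s powr \<beta> k * h k s) p x) = (\<Sum>k\<in>K. x powr (\<beta> k + a) * ht k x + kt k x)"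
      using elim by (intro sum.cong) (auto simp: add.commute)
    finally show ?case by (simp only: sum.distrib add.assoc)
  qed
  moreover have "(\<lambda>x. (\<Sum>k\<in>K. kt k x) + kr x + J x) analytic_on {0}"
    by (intro analytic_on_add analytic_on_sum hk(2) kr(1) J)
  ultimately show ?thesis unfolding germ0_def using hk(1,3)
    by (intro exI[of _ ht] exI[of _ "\<lambda>x. (\<Sum>k\<in>K. kt k x) + kr x + J x"]) auto
qed

lemma Euler_base:
  assumes f: "f holomorphic_on S" "germ1 S lam g f" "germ0 S K \<beta> c f" and K: "finite K"
    and lam: "Re lam > 0" and a: "Re a > 1" "a \<notin> \<int>" and b: "\<And>k. k \<in> K \<Longrightarrow> \<beta> k + a \<notin> \<int>"
  shows "\<exists>F. F holomorphic_on S \<and> germ1 S (lam + a) (Efps a lam g) F \<and>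
    germ0 S K (\<lambda>k. \<beta> k + a) (\<lambda>k. Gamma (- \<beta> k - a) * rGamma (- \<beta> k) * c k) F"
proof -
  have cf: "continuous_on (insert 1 S) (f(1 := 0))"
    by (rule continuous_insert_1[OF f(1) germ1_tendsto_0[OF f(2) lam]])
  let ?C = "conv a (f(1 := 0)) 1"
  have "f(1 := 0) holomorphic_on S" by (rule holomorphic_transform[OF f(1)]) (use notin in auto)
  then have "?C holomorphic_on S"
    by (intro conv_holomorphic[OF S(1,2,5) a(1) _ cf S(1)] slits) auto
  then have 1: "(\<lambda>x. inverse (Gamma a) * ?C x) holomorphic_on S" by (intro holomorphic_intros)
  have G: "Gamma a \<noteq> 0" using Re_pos_not_nonpos_Int[of a] a(1) by (simp add: Gamma_eq_zero_iff)
  have "germ1 S (lam + a) (fps_const (inverse (Gamma a)) * (fps_const (Gamma a) * Efps a lam g)) (\<lambda>x. inverse (Gamma a) * ?C x)"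
    by (rule germ1_cmult[OF conv_germ1[OF f(2) lam a(1)]])
  moreover have "fps_const (inverse (Gamma a)) * (fps_const (Gamma a) * Efps a lam g) = Efps a lam g"
    using G by (simp flip: mult.assoc)
  ultimately have 2: "germ1 S (lam + a) (Efps a lam g) (\<lambda>x. inverse (Gamma a) * ?C x)" by simp
  have "germ0 S K (\<lambda>k. \<beta> k + a) (\<lambda>k. inverse (Gamma a) * (Kc a (\<beta> k) * c k)) (\<lambda>x. inverse (Gamma a) * ?C x)"
    by (rule germ0_cmult[OF conv_germ0[OF f(1) cf a f(3) K b]])
  moreover have "(\<lambda>k. inverse (Gamma a) * (Kc a (\<beta> k) * c k)) = (\<lambda>k. Gamma (- \<beta> k - a) * rGamma (- \<beta> k) * c k)"
    using G by (auto simp: Kc_def fun_eq_iff)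
  ultimately have 3: "germ0 S K (\<lambda>k. \<beta> k + a) (\<lambda>k. Gamma (- \<beta> k - a) * rGamma (- \<beta> k) * c k) (\<lambda>x. inverse (Gamma a) * ?C x)" by simp
  from 1 2 3 show ?thesis by blast
qed

end

section \<open>Continuation of the transform in exponent and order\<close>

context slit
begin

lemma germ1_deriv:
  assumes "germ1 S lam g f"
  shows "germ1 S (lam - 1) (Abs_fps (\<lambda>k. - (lam + of_nat k) * fps_nth g k)) (deriv f)"
proof -
  obtain \<phi> where \<phi>: "\<phi> has_fps_expansion g" "\<forall>\<^sub>F x in at 1 within S. f x = (1 - x) powr lam * \<phi> (1 - x)"
    using assms unfolding germ1_def by blast
  define \<psi> where "\<psi> = (\<lambda>w. - (lam * \<phi> w + w * deriv \<phi> w))"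
  have "\<psi> has_fps_expansion - (fps_const lam * g + fps_X * fps_deriv g)"
    unfolding \<psi>_def by (intro fps_expansion_intros \<phi>)
  also have "- (fps_const lam * g + fps_X * fps_deriv g) = Abs_fps (\<lambda>k. - (lam + of_nat k) * fps_nth g k)"
  proof (rule fps_ext)
    fix k show "fps_nth (- (fps_const lam * g + fps_X * fps_deriv g)) k = fps_nth (Abs_fps (\<lambda>k. - (lam + of_nat k) * fps_nth g k)) k"
      by (cases k) (simp_all add: algebra_simps)
  qed
  finally have 1: "\<psi> has_fps_expansion Abs_fps (\<lambda>k. - (lam + of_nat k) * fps_nth g k)" .
  have d: "\<forall>\<^sub>F x in at 1 within S. \<phi> field_differentiable at (1 - x)"
    by (rule eventually_compose_filterlim[OF analytic_eventually_differentiable[OF has_fps_expansion_imp_analytic_0[OF \<phi>(1)]] filterlim_one_minus])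
  have "\<forall>\<^sub>F x in at 1 within S. deriv f x = (1 - x) powr (lam - 1) * \<psi> (1 - x)"
    using eventually_at_within_open_nhds[OF S(1) notin(2) \<phi>(2)] d
  proof eventually_elim
    case (elim x)
    then have x: "x \<in> S" and ev: "\<forall>\<^sub>F y in nhds x. f y = (1 - y) powr lam * \<phi> (1 - y)" by auto
    have m: "((\<lambda>y. 1 - y) has_field_derivative -1) (at x)" by (auto intro!: derivative_eq_intros)
    have "(\<phi> has_field_derivative deriv \<phi> (1 - x)) (at (1 - x))"
      using elim(2) by (simp only: DERIV_deriv_iff_field_differentiable)
    from DERIV_mult[OF DERIV_chain2[OF has_field_derivative_powr[OF slits(2)[OF x], of lam] m] DERIV_chain2[OF this m]]
    have "((\<lambda>y. (1 - y) powr lam * \<phi> (1 - y)) has_field_derivative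
       lam * (1 - x) powr (lam - 1) * - 1 * \<phi> (1 - x) + deriv \<phi> (1 - x) * - 1 * (1 - x) powr lam) (at x)" .
    moreover have "(1 - x) powr lam = (1 - x) powr (lam - 1) * (1 - x)"
      using slits(4)[OF x] by (simp add: powr_diff)
    ultimately have "((\<lambda>y. (1 - y) powr lam * \<phi> (1 - y)) has_field_derivative (1 - x) powr (lam - 1) * \<psi> (1 - x)) (at x)"
      by (simp add: \<psi>_def algebra_simps)
    then show ?case using deriv_cong_ev[OF ev refl] by (simp only: DERIV_imp_deriv)
  qed
  with 1 show ?thesis unfolding germ1_def by blast
qed

lemma powr_times_deriv:
  fixes x b :: complex
  assumes "x \<notin> \<real>\<^sub>\<le>\<^sub>0" "h field_differentiable at x"
  shows "((\<lambda>x. x powr b * h x) has_field_derivative x powr (b - 1) * (b * h x + x * deriv h x)) (at x)"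
proof -
  have "(h has_field_derivative deriv h x) (at x)"
    using assms(2) by (simp only: DERIV_deriv_iff_field_differentiable)
  from DERIV_mult[OF has_field_derivative_powr[OF assms(1), of b] this]
  have "((\<lambda>x. x powr b * h x) has_field_derivative b * x powr (b - 1) * h x + deriv h x * x powr b) (at x)" .
  moreover have "x powr b = x powr (b - 1) * x" using assms(1) by (auto simp: powr_diff)
  ultimately show ?thesis by (simp add: algebra_simps)
qed

lemma germ0_deriv:
  assumes "germ0 S K \<beta> c f" "finite K"
  shows "germ0 S K (\<lambda>k. \<beta> k - 1) (\<lambda>k. \<beta> k * c k) (deriv f)"
proof -
  obtain h r where h: "\<And>k. k \<in> K \<Longrightarrow> h k analytic_on {0}" "\<And>k. k \<in> K \<Longrightarrow> h k 0 = c k" "r analytic_on {0}"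
    "\<forall>\<^sub>F x in at 0 within S. f x = (\<Sum>k\<in>K. x powr \<beta> k * h k x) + r x"
    using assms(1) unfolding germ0_def by blast
  have d: "\<forall>\<^sub>F x in at 0 within S. \<forall>k\<in>K. h k field_differentiable at x"
    using assms(2) h(1) by (intro eventually_ball_finite ballI eventually_at_within_of_nhds analytic_eventually_differentiable) auto
  have d': "\<forall>\<^sub>F x in at 0 within S. r field_differentiable at x"
    by (intro eventually_at_within_of_nhds analytic_eventually_differentiable h(3))
  define H where "H = (\<lambda>k x. \<beta> k * h k x + x * deriv (h k) x)"
  have "\<forall>\<^sub>F x in at 0 within S. deriv f x = (\<Sum>k\<in>K. x powr (\<beta> k - 1) * H k x) + deriv r x"
    using eventually_at_within_open_nhds[OF S(1) notin(1) h(4)] d d'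
  proof eventually_elim
    case (elim x)
    then have x: "x \<in> S" and ev: "\<forall>\<^sub>F y in nhds x. f y = (\<Sum>k\<in>K. y powr \<beta> k * h k y) + r y" by auto
    have "((\<lambda>y. (\<Sum>k\<in>K. y powr \<beta> k * h k y) + r y) has_field_derivative (\<Sum>k\<in>K. x powr (\<beta> k - 1) * H k x) + deriv r x) (at x)"
      unfolding H_def
    proof (intro DERIV_add DERIV_sum powr_times_deriv slits(1) x)
      show "h k field_differentiable at x" if "k \<in> K" for k using elim(2) that by blast
      show "(r has_field_derivative deriv r x) (at x)" using elim(3) by (simp only: DERIV_deriv_iff_field_differentiable)
    qed
    then show ?case using deriv_cong_ev[OF ev refl] by (simp only: DERIV_imp_deriv)
  qed
  moreover have "H k analytic_on {0}" if "k \<in> K" for k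
    unfolding H_def using h(1)[OF that] by (intro analytic_on_add analytic_on_mult analytic_on_const analytic_on_ident analytic_deriv) simp_all
  moreover have "H k 0 = \<beta> k * c k" if "k \<in> K" for k using h(2)[OF that] by (simp add: H_def)
  moreover have "deriv r analytic_on {0}" by (rule analytic_deriv[OF h(3)])
  ultimately show ?thesis unfolding germ0_def
    by (intro exI[of _ H] exI[of _ "deriv r"]) auto
qed

text \<open>The constant of integration is fixed at 1, where the primitive must be a pure germ of
  exponent lam + 1. At 0 the resulting constant disappears into the analytic part. The divisions by
  lam + 1 + k and \<beta> k + 1 are possible by non-integrality.\<close>

lemma ex_primitive:
  assumes f: "f holomorphic_on S" "germ1 S lam g f" "germ0 S K \<beta> c f" and K: "finite K"
    and lam: "lam \<notin> \<int>" and b: "\<And>k. k \<in> K \<Longrightarrow> \<beta> k \<notin> \<int>"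
  shows "\<exists>P. P holomorphic_on S \<and> (\<forall>x\<in>S. deriv P x = f x) \<and>
    germ1 S (lam + 1) (Abs_fps (\<lambda>k. - (fps_nth g k / (lam + 1 + of_nat k)))) P \<and>
    germ0 S K (\<lambda>k. \<beta> k + 1) (\<lambda>k. c k / (\<beta> k + 1)) P"
proof -
  have int1: "z + 1 \<notin> \<int>" if "z \<notin> \<int>" for z :: complex using add_nat_nonint[OF that, of 1] by simp
  obtain P0 where "\<And>x. x \<in> S \<Longrightarrow> (P0 has_field_derivative f x) (at x within S)"
    using holomorphic_convex_primitive'[OF S(2,1) f(1)] by blast
  then have P0: "(P0 has_field_derivative f x) (at x)" if "x \<in> S" for x
    using that at_within_open[OF that S(1)] by metis
  obtain \<phi> where \<phi>: "\<phi> has_fps_expansion g" "\<forall>\<^sub>F x in at 1 within S. f x = (1 - x) powr lam * \<phi> (1 - x)"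
    using f(2) unfolding germ1_def by blast
  obtain \<Phi> where \<Phi>: "\<Phi> has_fps_expansion Abs_fps (\<lambda>k. fps_nth g k / (lam + 1 + of_nat k))"
    "\<forall>\<^sub>F w in nhds 0. (lam + 1) * \<Phi> w + w * deriv \<Phi> w = \<phi> w"
    using ode_fps[OF int1[OF lam] \<phi>(1)] by blast
  have "\<forall>\<^sub>F x in at 1 within S. f x = (1 - x) powr lam * \<phi> (1 - x) \<and> \<Phi> field_differentiable at (1 - x) \<and>
      (lam + 1) * \<Phi> (1 - x) + (1 - x) * deriv \<Phi> (1 - x) = \<phi> (1 - x)"
    by (intro eventually_conj \<phi>(2) eventually_compose_filterlim[OF \<Phi>(2) filterlim_one_minus]
        eventually_compose_filterlim[OF analytic_eventually_differentiable[OF has_fps_expansion_imp_analytic_0[OF \<Phi>(1)]] filterlim_one_minus])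
  then obtain r1 where r1: "r1 > 0" "\<And>x. x \<in> S \<Longrightarrow> x \<noteq> 1 \<Longrightarrow> dist x 1 < r1 \<Longrightarrow>
      f x = (1 - x) powr lam * \<phi> (1 - x) \<and> \<Phi> field_differentiable at (1 - x) \<and>
      (lam + 1) * \<Phi> (1 - x) + (1 - x) * deriv \<Phi> (1 - x) = \<phi> (1 - x)"
    unfolding eventually_at by blast
  have "\<exists>C. \<forall>x\<in>S \<inter> ball 1 r1. P0 x + (1 - x) powr (lam + 1) * \<Phi> (1 - x) = C"
  proof (rule has_field_derivative_zero_constant)
    show "convex (S \<inter> ball 1 r1)" using S(2) by (intro convex_Int) auto
    fix x assume x: "x \<in> S \<inter> ball 1 r1"
    then have xS: "x \<in> S" by blast
    have h: "f x = (1 - x) powr lam * \<phi> (1 - x)" "\<Phi> field_differentiable at (1 - x)"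
      "(lam + 1) * \<Phi> (1 - x) + (1 - x) * deriv \<Phi> (1 - x) = \<phi> (1 - x)"
      using r1(2)[OF xS slits(4)[OF xS]] x by (simp_all add: dist_commute)
    have m: "((\<lambda>y. 1 - y) has_field_derivative -1) (at x)" by (auto intro!: derivative_eq_intros)
    have "((\<lambda>x. P0 x + (1 - x) powr (lam + 1) * \<Phi> (1 - x)) has_field_derivative
       f x + (1 - x) powr (lam + 1 - 1) * ((lam + 1) * \<Phi> (1 - x) + (1 - x) * deriv \<Phi> (1 - x)) * -1) (at x)"
      by (intro DERIV_add P0 xS DERIV_chain2[OF powr_times_deriv[OF slits(2)[OF xS] h(2)] m])
    then have "((\<lambda>x. P0 x + (1 - x) powr (lam + 1) * \<Phi> (1 - x)) has_field_derivative 0) (at x)"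
      unfolding h(3) by (simp add: h(1))
    then show "((\<lambda>x. P0 x + (1 - x) powr (lam + 1) * \<Phi> (1 - x)) has_field_derivative 0) (at x within S \<inter> ball 1 r1)"
      by (rule has_field_derivative_at_within)
  qed
  then obtain C where C: "\<And>x. x \<in> S \<Longrightarrow> dist x 1 < r1 \<Longrightarrow> P0 x + (1 - x) powr (lam + 1) * \<Phi> (1 - x) = C"
    by (auto simp: dist_commute)
  define P where "P = (\<lambda>x. P0 x - C)"
  have P: "(P has_field_derivative f x) (at x)" if "x \<in> S" for x
    unfolding P_def using DERIV_diff[OF P0[OF that] DERIV_const[of C]] by simp
  have Ph: "P holomorphic_on S" using P S(1) by (auto simp: holomorphic_on_open)
  have "\<forall>\<^sub>F x in at 1 within S. P x = (1 - x) powr (lam + 1) * (- \<Phi> (1 - x))"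
    using eventually_ball_S[OF r1(1)]
  proof (rule eventually_mono)
    fix x assume "x \<in> S \<and> dist x 1 < r1"
    then have e: "C = P0 x + (1 - x) powr (lam + 1) * \<Phi> (1 - x)" using C by simp
    show "P x = (1 - x) powr (lam + 1) * (- \<Phi> (1 - x))" unfolding P_def e by simp
  qed
  moreover have "(\<lambda>w. - \<Phi> w) has_fps_expansion - Abs_fps (\<lambda>k. fps_nth g k / (lam + 1 + of_nat k))"
    by (intro fps_expansion_intros \<Phi>)
  moreover have "- Abs_fps (\<lambda>k. fps_nth g k / (lam + 1 + of_nat k)) = Abs_fps (\<lambda>k. - (fps_nth g k / (lam + 1 + of_nat k)))"
    by (rule fps_ext) simp
  ultimately have g1: "germ1 S (lam + 1) (Abs_fps (\<lambda>k. - (fps_nth g k / (lam + 1 + of_nat k)))) P"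
    unfolding germ1_def by (intro exI[of _ "\<lambda>w. - \<Phi> w"]) simp
  obtain h r where h: "\<And>k. k \<in> K \<Longrightarrow> h k analytic_on {0}" "\<And>k. k \<in> K \<Longrightarrow> h k 0 = c k" "r analytic_on {0}"
    "\<forall>\<^sub>F x in at 0 within S. f x = (\<Sum>k\<in>K. x powr \<beta> k * h k x) + r x"
    using f(3) unfolding germ0_def by blast
  have "\<exists>H. H analytic_on {0} \<and> (\<forall>\<^sub>F w in nhds 0. (\<beta> k + 1) * H w + w * deriv H w = h k w)" if "k \<in> K" for k
    using ode_fps[OF int1[OF b[OF that]] analytic_at_imp_has_fps_expansion_0[OF h(1)[OF that]]]
      has_fps_expansion_imp_analytic_0 by blast
  then obtain H where H: "\<And>k. k \<in> K \<Longrightarrow> H k analytic_on {0}"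
    "\<And>k. k \<in> K \<Longrightarrow> \<forall>\<^sub>F w in nhds 0. (\<beta> k + 1) * H k w + w * deriv (H k) w = h k w" by metis
  obtain e where e: "e > 0" "r holomorphic_on ball 0 e" using h(3) unfolding analytic_on_def by blast
  obtain R0 where "\<And>x. x \<in> ball 0 e \<Longrightarrow> (R0 has_field_derivative r x) (at x within ball 0 e)"
    using holomorphic_convex_primitive'[OF convex_ball open_ball e(2)] by blast
  then have R0: "(R0 has_field_derivative r x) (at x)" if "x \<in> ball 0 e" for x
    using that at_within_open[OF that open_ball] by metis
  have "R0 holomorphic_on ball 0 e" unfolding holomorphic_on_open[OF open_ball] using R0 by blast
  then have R0a: "R0 analytic_on {0}"
    using e(1) by (intro analytic_at[THEN iffD2] exI[of _ "ball 0 e"]) simp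
  have "\<forall>\<^sub>F x in at 0 within S. f x = (\<Sum>k\<in>K. x powr \<beta> k * h k x) + r x \<and>
      (\<forall>k\<in>K. H k field_differentiable at x) \<and> (\<forall>k\<in>K. (\<beta> k + 1) * H k x + x * deriv (H k) x = h k x)"
    using K by (intro eventually_conj h(4) eventually_ball_finite ballI eventually_at_within_of_nhds analytic_eventually_differentiable H)
  then obtain r2 where r2: "r2 > 0" "\<And>x. x \<in> S \<Longrightarrow> x \<noteq> 0 \<Longrightarrow> dist x 0 < r2 \<Longrightarrow>
      f x = (\<Sum>k\<in>K. x powr \<beta> k * h k x) + r x \<and>
      (\<forall>k\<in>K. H k field_differentiable at x) \<and> (\<forall>k\<in>K. (\<beta> k + 1) * H k x + x * deriv (H k) x = h k x)"
    unfolding eventually_at by blast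
  define r3 where "r3 = min r2 e"
  have r3: "r3 > 0" "r3 \<le> r2" "r3 \<le> e" using r2(1) e(1) by (auto simp: r3_def)
  have "\<exists>C. \<forall>x\<in>S \<inter> ball 0 r3. P x - ((\<Sum>k\<in>K. x powr (\<beta> k + 1) * H k x) + R0 x) = C"
  proof (rule has_field_derivative_zero_constant)
    show "convex (S \<inter> ball 0 r3)" using S(2) by (intro convex_Int) auto
    fix x assume x: "x \<in> S \<inter> ball 0 r3"
    then have xS: "x \<in> S" and xe: "x \<in> ball 0 e" "dist x 0 < r2" using r3 by (auto simp: dist_norm)
    note hh = r2(2)[OF xS slits(3)[OF xS] xe(2)]
    have "((\<lambda>x. P x - ((\<Sum>k\<in>K. x powr (\<beta> k + 1) * H k x) + R0 x)) has_field_derivative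
       f x - ((\<Sum>k\<in>K. x powr (\<beta> k + 1 - 1) * ((\<beta> k + 1) * H k x + x * deriv (H k) x)) + r x)) (at x)"
      by (intro DERIV_add DERIV_diff DERIV_sum P xS R0 xe powr_times_deriv slits) (use hh in blast)
    also have "(\<Sum>k\<in>K. x powr (\<beta> k + 1 - 1) * ((\<beta> k + 1) * H k x + x * deriv (H k) x)) = (\<Sum>k\<in>K. x powr \<beta> k * h k x)"
      using hh by (intro sum.cong) auto
    also have "f x - ((\<Sum>k\<in>K. x powr \<beta> k * h k x) + r x) = 0" using hh by simp
    finally show "((\<lambda>x. P x - ((\<Sum>k\<in>K. x powr (\<beta> k + 1) * H k x) + R0 x)) has_field_derivative 0) (at x within S \<inter> ball 0 r3)"
      by (rule has_field_derivative_at_within)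
  qed
  then obtain C' where C': "\<And>x. x \<in> S \<Longrightarrow> dist x 0 < r3 \<Longrightarrow> P x - ((\<Sum>k\<in>K. x powr (\<beta> k + 1) * H k x) + R0 x) = C'"
    by (auto simp: dist_norm)
  have "\<forall>\<^sub>F x in at 0 within S. P x = (\<Sum>k\<in>K. x powr (\<beta> k + 1) * H k x) + (R0 x + C')"
    using eventually_ball_S[OF r3(1)]
  proof (rule eventually_mono)
    fix x assume "x \<in> S \<and> dist x 0 < r3"
    then have e: "C' = P x - ((\<Sum>k\<in>K. x powr (\<beta> k + 1) * H k x) + R0 x)" using C' by simp
    show "P x = (\<Sum>k\<in>K. x powr (\<beta> k + 1) * H k x) + (R0 x + C')" unfolding e by simp
  qed
  moreover have "(\<lambda>x. R0 x + C') analytic_on {0}" by (intro analytic_on_add R0a analytic_on_const)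
  moreover have "H k 0 = c k / (\<beta> k + 1)" if k: "k \<in> K" for k
  proof -
    have "(\<beta> k + 1) * H k 0 = c k" using eventually_nhds_x_imp_x[OF H(2)[OF k]] h(2)[OF k] by simp
    moreover have "\<beta> k + 1 \<noteq> 0" using int1[OF b[OF k]] Ints_0 by metis
    ultimately show ?thesis by (simp add: eq_divide_eq mult.commute)
  qed
  ultimately have "germ0 S K (\<lambda>k. \<beta> k + 1) (\<lambda>k. c k / (\<beta> k + 1)) P"
    unfolding germ0_def using H(1) by (intro exI[of _ H] exI[of _ "\<lambda>x. R0 x + C'"]) auto
  moreover have "\<forall>x\<in>S. deriv P x = f x" using P DERIV_imp_deriv by blast
  ultimately show ?thesis using Ph g1 by blast
qed

lemma germ1_cong: "germ1 S lam g f \<Longrightarrow> (\<And>x. x \<in> S \<Longrightarrow> f x = f' x) \<Longrightarrow> germ1 S lam g f'"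
  unfolding germ1_def
proof (elim exE conjE)
  fix \<phi> assume h: "\<And>x. x \<in> S \<Longrightarrow> f x = f' x" "\<phi> has_fps_expansion g" "\<forall>\<^sub>F x in at 1 within S. f x = (1 - x) powr lam * \<phi> (1 - x)"
  have "\<forall>\<^sub>F x in at 1 within S. f' x = (1 - x) powr lam * \<phi> (1 - x)"
    using eventually_at_S h(3) by eventually_elim (simp add: h(1))
  with h(2) show "\<exists>\<phi>. \<phi> has_fps_expansion g \<and> (\<forall>\<^sub>F x in at 1 within S. f' x = (1 - x) powr lam * \<phi> (1 - x))" by blast
qed

lemma germ0_cong: "germ0 S K \<beta> c f \<Longrightarrow> (\<And>x. x \<in> S \<Longrightarrow> f x = f' x) \<Longrightarrow> germ0 S K \<beta> c f'"
  unfolding germ0_def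
proof (elim exE conjE)
  fix h r assume h: "\<And>x. x \<in> S \<Longrightarrow> f x = f' x" "\<forall>k\<in>K. h k analytic_on {0} \<and> h k 0 = c k" "r analytic_on {0}"
    "\<forall>\<^sub>F x in at 0 within S. f x = (\<Sum>k\<in>K. x powr \<beta> k * h k x) + r x"
  have "\<forall>\<^sub>F x in at 0 within S. f' x = (\<Sum>k\<in>K. x powr \<beta> k * h k x) + r x"
    using eventually_at_S h(4) by eventually_elim (simp add: h(1))
  with h(2,3) show "\<exists>h r. (\<forall>k\<in>K. h k analytic_on {0} \<and> h k 0 = c k) \<and> r analytic_on {0} \<and>
     (\<forall>\<^sub>F x in at 0 within S. f' x = (\<Sum>k\<in>K. x powr \<beta> k * h k x) + r x)" by blast
qed

lemma nonint_not_nonpos: "z \<notin> \<int> \<Longrightarrow> (z :: complex) \<notin> \<int>\<^sub>\<le>\<^sub>0" by auto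

text \<open>The factor by which the normalised transform of order a multiplies the leading
  coefficient of exponent b at 0; \<open>Kc a b\<close> is Gamma a times it.\<close>

definition Gq :: "complex \<Rightarrow> complex \<Rightarrow> complex" where
  "Gq a b = Gamma (- b - a) * rGamma (- b)"

text \<open>The first identity matches a primitive taken before the transform with a derivative
  taken after it; the second matches lowering the order by a derivative.\<close>

lemma Gq_rec:
  assumes "b + a \<notin> \<int>"
  shows "(b + 1 + a) * Gq a (b + 1) = (b + 1) * Gq a b" "- ((b + a + 1) * Gq (a + 1) b) = Gq a b"
proof -
  have n: "- b - a - 1 \<notin> \<int>"
  proof
    assume "- b - a - 1 \<in> \<int>"
    from Ints_diff[OF Ints_minus[OF this] Ints_1] have "- (- b - a - 1) - 1 \<in> \<int>" .
    moreover have "- (- b - a - 1) - 1 = b + a" by simp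
    ultimately show False using assms by metis
  qed
  define G where "G = Gamma (- b - a - 1)"
  have G: "Gamma (- b - a) = (- b - a - 1) * G"
    using Gamma_plus1[OF nonint_not_nonpos[OF n]] by (simp add: G_def)
  define Q where "Q = rGamma (- b)"
  have Q: "rGamma (- b - 1) = (- b - 1) * Q" using rGamma_plus1[of "- b - 1"] by (simp add: Q_def)
  have 1: "Gq a b = (- b - a - 1) * G * Q" unfolding Gq_def G Q_def ..
  have e: "- (b + 1) = - b - 1" "- b - 1 - a = - b - a - 1" "- b - (a + 1) = - b - a - 1" by simp_all
  have 2: "Gq a (b + 1) = G * ((- b - 1) * Q)" unfolding Gq_def e G_def Q by (rule refl)
  have 3: "Gq (a + 1) b = G * Q" unfolding Gq_def e G_def Q_def by (rule refl)
  show "(b + 1 + a) * Gq a (b + 1) = (b + 1) * Gq a b" unfolding 1 2 by (simp add: algebra_simps)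
  show "- ((b + a + 1) * Gq (a + 1) b) = Gq a b" unfolding 1 3 by (simp add: algebra_simps)
qed

text \<open>Induction on the number of steps until Re lam becomes positive. A primitive raises all
  exponents by one, and the derivative of its transform has the germs required of the transform of
  f.\<close>

lemma Euler_raise_lam:
  assumes "f holomorphic_on S" "germ1 S lam g f" "germ0 S K \<beta> c f" "finite K"
    "Re a > 1" "a \<notin> \<int>" "lam \<notin> \<int>" "lam + a \<notin> \<int>" "\<And>k. k \<in> K \<Longrightarrow> \<beta> k \<notin> \<int>" "\<And>k. k \<in> K \<Longrightarrow> \<beta> k + a \<notin> \<int>"
    "Re lam + real N > 0"
  shows "\<exists>F. F holomorphic_on S \<and> germ1 S (lam + a) (Efps a lam g) F \<and> germ0 S K (\<lambda>k. \<beta> k + a) (\<lambda>k. Gq a (\<beta> k) * c k) F"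
  using assms
proof (induction N arbitrary: f lam g \<beta> c)
  case 0
  have "\<exists>F. F holomorphic_on S \<and> germ1 S (lam + a) (Efps a lam g) F \<and>
    germ0 S K (\<lambda>k. \<beta> k + a) (\<lambda>k. Gamma (- \<beta> k - a) * rGamma (- \<beta> k) * c k) F"
    by (rule Euler_base) (use 0 in simp_all)
  then show ?case by (simp only: Gq_def)
next
  case (Suc N)
  have int1: "z + 1 \<notin> \<int>" if "z \<notin> \<int>" for z :: complex using add_nat_nonint[OF that, of 1] by simp
  define g' where "g' = Abs_fps (\<lambda>k. - (fps_nth g k / (lam + 1 + of_nat k)))"
  obtain P where P: "P holomorphic_on S" "\<forall>x\<in>S. deriv P x = f x" "germ1 S (lam + 1) g' P"
    "germ0 S K (\<lambda>k. \<beta> k + 1) (\<lambda>k. c k / (\<beta> k + 1)) P"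
    using ex_primitive[OF Suc.prems(1-4,7,9)] unfolding g'_def by blast
  have n1: "lam + 1 + a \<notin> \<int>" using int1[OF Suc.prems(8)] by (simp add: add_ac)
  have n2: "\<beta> k + 1 + a \<notin> \<int>" if "k \<in> K" for k using int1[OF Suc.prems(10)[OF that]] by (simp add: add_ac)
  have rl: "Re (lam + 1) + real N > 0" using Suc.prems(11) by simp
  obtain F where F: "F holomorphic_on S" "germ1 S (lam + 1 + a) (Efps a (lam + 1) g') F"
    "germ0 S K (\<lambda>k. \<beta> k + 1 + a) (\<lambda>k. Gq a (\<beta> k + 1) * (c k / (\<beta> k + 1))) F"
    using Suc.IH[OF P(1,3,4) Suc.prems(4,5,6) int1[OF Suc.prems(7)] n1 int1[OF Suc.prems(9)] n2 rl] by blast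
  have "germ1 S (lam + 1 + a - 1) (Abs_fps (\<lambda>k. - (lam + 1 + a + of_nat k) * fps_nth (Efps a (lam + 1) g') k)) (deriv F)"
    by (rule germ1_deriv[OF F(2)])
  moreover have "Abs_fps (\<lambda>k. - (lam + 1 + a + of_nat k) * fps_nth (Efps a (lam + 1) g') k) = Efps a lam g"
  proof (rule fps_ext)
    fix k
    define z where "z = lam + of_nat k + 1"
    have z1: "z \<notin> \<int>" using add_nat_nonint[OF Suc.prems(7), of "Suc k"] by (simp add: z_def add_ac)
    have z2: "z \<noteq> 0" using z1 Ints_0 by metis
    note z = z1 z2
    have e: "lam + 1 + a + of_nat k = z + a" "lam + 1 + of_nat k + 1 = z + 1" "lam + 1 + of_nat k = z" "lam + of_nat k + 1 = z"
      by (simp_all add: z_def)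
    have ea: "z + 1 + a = z + a + 1" by simp
    have gen: "- y * (A * R * - (q / w)) = (y * R) * (A / w) * q" for y A R q w :: complex by simp
    have "fps_nth (Abs_fps (\<lambda>k. - (lam + 1 + a + of_nat k) * fps_nth (Efps a (lam + 1) g') k)) k =
      - (z + a) * (Gamma (z + 1) * rGamma (z + 1 + a) * - (fps_nth g k / z))"
      unfolding Efps_def g'_def fps_nth_Abs_fps e ..
    also have "\<dots> = ((z + a) * rGamma (z + a + 1)) * (Gamma (z + 1) / z) * fps_nth g k"
      unfolding ea by (rule gen)
    also have "(z + a) * rGamma (z + a + 1) = rGamma (z + a)" by (rule rGamma_plus1)
    also have "Gamma (z + 1) / z = Gamma z" using Gamma_plus1[OF nonint_not_nonpos[OF z(1)]] z(2) by simp
    finally show "fps_nth (Abs_fps (\<lambda>k. - (lam + 1 + a + of_nat k) * fps_nth (Efps a (lam + 1) g') k)) k = fps_nth (Efps a lam g) k"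
      unfolding Efps_def fps_nth_Abs_fps e by (simp only: mult_ac)
  qed
  ultimately have 1: "germ1 S (lam + a) (Efps a lam g) (deriv F)" by simp
  have "germ0 S K (\<lambda>k. \<beta> k + 1 + a - 1) (\<lambda>k. (\<beta> k + 1 + a) * (Gq a (\<beta> k + 1) * (c k / (\<beta> k + 1)))) (deriv F)"
    by (rule germ0_deriv[OF F(3) Suc.prems(4)])
  moreover have "(\<beta> k + 1 + a) * (Gq a (\<beta> k + 1) * (c k / (\<beta> k + 1))) = Gq a (\<beta> k) * c k" if k: "k \<in> K" for k
  proof -
    have nz: "\<beta> k + 1 \<noteq> 0" using int1[OF Suc.prems(9)[OF k]] Ints_0 by metis
    have "(\<beta> k + 1 + a) * (Gq a (\<beta> k + 1) * (c k / (\<beta> k + 1))) = ((\<beta> k + 1) * Gq a (\<beta> k)) * (c k / (\<beta> k + 1))"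
      unfolding Gq_rec(1)[OF Suc.prems(10)[OF k], symmetric] by (simp only: mult.assoc)
    then show ?thesis using nz by simp
  qed
  ultimately have "germ0 S K (\<lambda>k. \<beta> k + a) (\<lambda>k. Gq a (\<beta> k) * c k) (deriv F)"
    unfolding germ0_def by (simp add: add_ac cong: conj_cong ball_cong)
  moreover have "deriv F holomorphic_on S" using F(1) S(1) by (rule holomorphic_deriv)
  ultimately show ?case using 1 by blast
qed

text \<open>Orders with small real part are reached by differentiation: the transform of order a is
  minus the derivative of that of order a + 1, the sign arising because the variable is the lower
  limit of the integral.\<close>

theorem Euler_transform:
  assumes "f holomorphic_on S" "germ1 S lam g f" "germ0 S K \<beta> c f" "finite K"
    "a \<notin> \<int>" "lam \<notin> \<int>" "lam + a \<notin> \<int>" "\<And>k. k \<in> K \<Longrightarrow> \<beta> k \<notin> \<int>" "\<And>k. k \<in> K \<Longrightarrow> \<beta> k + a \<notin> \<int>"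
  shows "\<exists>F. F holomorphic_on S \<and> germ1 S (lam + a) (Efps a lam g) F \<and> germ0 S K (\<lambda>k. \<beta> k + a) (\<lambda>k. Gq a (\<beta> k) * c k) F"
proof -
  have *: "\<exists>F. F holomorphic_on S \<and> germ1 S (lam + a) (Efps a lam g) F \<and> germ0 S K (\<lambda>k. \<beta> k + a) (\<lambda>k. Gq a (\<beta> k) * c k) F"
    if "Re a + real M > 1" "a \<notin> \<int>" "lam + a \<notin> \<int>" "\<And>k. k \<in> K \<Longrightarrow> \<beta> k + a \<notin> \<int>" for M a
    using that
  proof (induction M arbitrary: a)
    case 0
    obtain N where "- Re lam < real N" using reals_Archimedean2[of "- Re lam"] ..
    then have "Re lam + real N > 0" by simp
    then show ?case using 0 by (intro Euler_raise_lam[OF assms(1-4)] assms(6,8)) simp_all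
  next
    case (Suc M)
    have int1: "z + 1 \<notin> \<int>" if "z \<notin> \<int>" for z :: complex using add_nat_nonint[OF that, of 1] by simp
    have n1: "lam + (a + 1) \<notin> \<int>" using int1[OF Suc.prems(3)] by (simp add: add_ac)
    have n2: "\<beta> k + (a + 1) \<notin> \<int>" if "k \<in> K" for k using int1[OF Suc.prems(4)[OF that]] by (simp add: add_ac)
    have ra: "Re (a + 1) + real M > 1" using Suc.prems(1) by simp
    obtain F where F: "F holomorphic_on S" "germ1 S (lam + (a + 1)) (Efps (a + 1) lam g) F"
      "germ0 S K (\<lambda>k. \<beta> k + (a + 1)) (\<lambda>k. Gq (a + 1) (\<beta> k) * c k) F"
      using Suc.IH[OF ra int1[OF Suc.prems(2)] n1 n2] by blast
    let ?F = "\<lambda>x. (- 1) * deriv F x"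
    have "germ1 S (lam + (a + 1) - 1) (fps_const (- 1) * Abs_fps (\<lambda>k. - (lam + (a + 1) + of_nat k) * fps_nth (Efps (a + 1) lam g) k)) ?F"
      by (intro germ1_cmult germ1_deriv F(2))
    moreover have "fps_const (- 1) * Abs_fps (\<lambda>k. - (lam + (a + 1) + of_nat k) * fps_nth (Efps (a + 1) lam g) k) = Efps a lam g"
    proof (rule fps_ext)
      fix k
      define z where "z = lam + of_nat k + 1 + a"
      have e: "lam + (a + 1) + of_nat k = z" "lam + of_nat k + 1 + (a + 1) = z + 1" "lam + of_nat k + 1 + a = z" by (simp_all add: z_def)
      have "fps_nth (fps_const (- 1) * Abs_fps (\<lambda>k. - (lam + (a + 1) + of_nat k) * fps_nth (Efps (a + 1) lam g) k)) k =
         - 1 * (- z * (Gamma (lam + of_nat k + 1) * rGamma (z + 1) * fps_nth g k))"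
        unfolding fps_mult_left_const_nth fps_nth_Abs_fps Efps_def e ..
      also have "\<dots> = Gamma (lam + of_nat k + 1) * (z * rGamma (z + 1)) * fps_nth g k" by simp
      also have "z * rGamma (z + 1) = rGamma z" by (rule rGamma_plus1)
      finally show "fps_nth (fps_const (- 1) * Abs_fps (\<lambda>k. - (lam + (a + 1) + of_nat k) * fps_nth (Efps (a + 1) lam g) k)) k = fps_nth (Efps a lam g) k"
        unfolding Efps_def fps_nth_Abs_fps e .
    qed
    ultimately have 1: "germ1 S (lam + a) (Efps a lam g) ?F" by simp
    have "germ0 S K (\<lambda>k. \<beta> k + (a + 1) - 1) (\<lambda>k. - 1 * ((\<beta> k + (a + 1)) * (Gq (a + 1) (\<beta> k) * c k))) ?F"
      by (intro germ0_cmult germ0_deriv F(3) assms(4))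
    moreover have "- 1 * ((\<beta> k + (a + 1)) * (Gq (a + 1) (\<beta> k) * c k)) = Gq a (\<beta> k) * c k" if k: "k \<in> K" for k
      unfolding Gq_rec(2)[OF Suc.prems(4)[OF k], symmetric] by (simp add: algebra_simps)
    ultimately have "germ0 S K (\<lambda>k. \<beta> k + a) (\<lambda>k. Gq a (\<beta> k) * c k) ?F"
      unfolding germ0_def by (simp add: add_ac cong: conj_cong ball_cong)
    moreover have "?F holomorphic_on S" using F(1) S(1) by (intro holomorphic_intros holomorphic_deriv)
    ultimately show ?case using 1 by blast
  qed
  obtain M where "1 - Re a < real M" using reals_Archimedean2[of "1 - Re a"] ..
  then have "Re a + real M > 1" by simp
  then show ?thesis using * assms by blast
qed

end

section \<open>Germs at the two end points\<close>

text \<open>Induction on the coefficient index m. Where t j is nonzero, the coefficient m is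
  determined by those of index m - 1. Where t j = 0, the block is diagonal and the other rows
  already vanish at index m, so (\<kappa> + m - M j j) times the coefficient is 0; it can survive
  only at a resonance, which \<open>lead\<close> excludes.\<close>

lemma okubo_fps:
  fixes G :: "nat \<Rightarrow> complex fps"
  assumes eq: "\<And>j. j < N \<Longrightarrow> (fps_X + fps_const (t j)) * (fps_const \<kappa> * G j + fps_X * fps_deriv (G j)) =
      fps_X * (\<Sum>l<N. fps_const (M j l) * G l)"
    and \<kappa>: "\<kappa> \<notin> \<int>"
    and off: "\<And>j l. j < N \<Longrightarrow> l < N \<Longrightarrow> t j = 0 \<Longrightarrow> t l = 0 \<Longrightarrow> l \<noteq> j \<Longrightarrow> M j l = 0"
    and lead: "\<And>j m. j < N \<Longrightarrow> t j = 0 \<Longrightarrow> fps_nth (G j) m = 0 \<or> \<kappa> + of_nat m \<noteq> M j j"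
    and j: "j < N"
  shows "G j = 0"
proof -
  have c: "t j * ((\<kappa> + of_nat m) * fps_nth (G j) m) + (if m = 0 then 0 else (\<kappa> + of_nat (m - 1)) * fps_nth (G j) (m - 1))
     = (if m = 0 then 0 else (\<Sum>l<N. M j l * fps_nth (G l) (m - 1)))" if "j < N" for j m
  proof -
    define H where "H = fps_const \<kappa> * G j + fps_X * fps_deriv (G j)"
    have H: "fps_nth H m = (\<kappa> + of_nat m) * fps_nth (G j) m" for m
      unfolding H_def by (cases m) (simp_all add: algebra_simps)
    have "fps_nth ((fps_X + fps_const (t j)) * H) m = (if m = 0 then 0 else fps_nth H (m - 1)) + t j * fps_nth H m"
      by (simp add: distrib_right)
    moreover have "fps_nth (fps_X * (\<Sum>l<N. fps_const (M j l) * G l)) m = (if m = 0 then 0 else (\<Sum>l<N. M j l * fps_nth (G l) (m - 1)))"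
      by (simp add: fps_sum_nth)
    ultimately show ?thesis using eq[OF that] unfolding H_def[symmetric] H by (simp add: add.commute)
  qed
  have nz: "\<kappa> + of_nat m \<noteq> 0" for m using add_nat_nonint[OF \<kappa>, of m] Ints_0 by metis
  have step: "fps_nth (G j) m = 0" if prev: "\<And>l. l < N \<Longrightarrow> m \<noteq> 0 \<Longrightarrow> fps_nth (G l) (m - 1) = 0" and j: "j < N" for j m
  proof -
    have off0: "fps_nth (G l) m = 0" if l: "l < N" "t l \<noteq> 0" for l
    proof -
      have "t l * ((\<kappa> + of_nat m) * fps_nth (G l) m) = 0" using c[OF l(1), of m] prev l(1) by (cases "m = 0") simp_all
      with l(2) nz[of m] show ?thesis by simp
    qed
    show ?thesis
    proof (cases "t j = 0")
      case True
      \<comment> \<open>For t j = 0 the equation of index m involves only coefficients of index m -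
        1; the coefficient m is found in the next one.\<close>
      have "(\<kappa> + of_nat m) * fps_nth (G j) m = (\<Sum>l<N. M j l * fps_nth (G l) m)" using c[OF j, of "Suc m"] True by simp
      also have "\<dots> = (\<Sum>l\<in>{j}. M j l * fps_nth (G l) m)"
      proof (rule sum.mono_neutral_right)
        show "\<forall>l\<in>{..<N} - {j}. M j l * fps_nth (G l) m = 0"
        proof
          fix l assume l: "l \<in> {..<N} - {j}"
          show "M j l * fps_nth (G l) m = 0" using off0[of l] off[OF j, of l] True l by (cases "t l = 0") auto
        qed
      qed (use j in auto)
      finally have "(\<kappa> + of_nat m) * fps_nth (G j) m = M j j * fps_nth (G j) m" by simp
      then show ?thesis using lead[OF j True, of m] by auto
    qed (use off0 j in blast)
  qed
  have "\<forall>j<N. fps_nth (G j) m = 0" for m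
  proof (induction m)
    case 0
    show ?case using step[of 0] by blast
  next
    case (Suc m)
    show ?case using step[of "Suc m"] Suc by simp
  qed
  then show ?thesis using j by (simp add: fps_eq_iff)
qed

context slit
begin

lemma has_fps_expansion_one_minus_powr:
  "\<exists>G. (\<lambda>w. (1 - w) powr b) has_fps_expansion G \<and> fps_nth G 0 = (1 :: complex)"
proof -
  have "(\<lambda>w. (1 - w) powr b) analytic_on {0 :: complex}" by (intro analytic_intros) auto
  from analytic_at_imp_has_fps_expansion_0[OF this] obtain G where G: "(\<lambda>w. (1 - w) powr b) has_fps_expansion G" by blast
  have "fps_nth G 0 = 1" using fps_nth_fps_expansion[OF G, of 0] by simp
  with G show ?thesis by blast
qed

lemma germ1_unique:
  assumes "germ1 S lam g f" "germ1 S lam g' f'" "\<forall>\<^sub>F x in at 1 within S. f x = f' x"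
  shows "g = g'"
proof -
  obtain \<phi> where p: "\<phi> has_fps_expansion g" "\<forall>\<^sub>F x in at 1 within S. f x = (1 - x) powr lam * \<phi> (1 - x)"
    using assms(1) unfolding germ1_def by blast
  obtain \<psi> where q: "\<psi> has_fps_expansion g'" "\<forall>\<^sub>F x in at 1 within S. f' x = (1 - x) powr lam * \<psi> (1 - x)"
    using assms(2) unfolding germ1_def by blast
  have e: "\<forall>\<^sub>F x in at 1 within S. \<phi> (1 - x) - \<psi> (1 - x) = 0"
    using p(2) q(2) assms(3) eventually_at_S
  proof eventually_elim
    case (elim x)
    have "(1 - x) powr lam * \<phi> (1 - x) = (1 - x) powr lam * \<psi> (1 - x)" using elim by metis
    then show ?case using slits(4)[OF elim(4)] by simp
  qed
  have "\<phi> analytic_on {0}" "\<psi> analytic_on {0}" using p(1) q(1) by (auto intro: has_fps_expansion_imp_analytic_0)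
  then have d: "(\<lambda>w. \<phi> w - \<psi> w) analytic_on {0}" by (rule analytic_on_diff)
  have "(\<lambda>x. 1 - x) analytic_on {1 :: complex}" by (intro analytic_intros)
  moreover have "(\<lambda>w. \<phi> w - \<psi> w) analytic_on ((\<lambda>x. 1 - x) ` {1})" using d by simp
  ultimately have "((\<lambda>w. \<phi> w - \<psi> w) \<circ> (\<lambda>x. 1 - x)) analytic_on {1}" by (rule analytic_on_compose)
  then have "\<forall>\<^sub>F x in nhds 1. ((\<lambda>w. \<phi> w - \<psi> w) \<circ> (\<lambda>x. 1 - x)) x = 0"
    by (rule analytic_eventually_0[OF _ islimpt(2)]) (use e in simp)
  moreover have "filterlim (\<lambda>w. 1 - w) (nhds 1) (nhds (0::complex))"
    using tendsto_diff[OF tendsto_const[of "1::complex" "nhds 0"] filterlim_ident[of "nhds 0"]] by simp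
  ultimately have "\<forall>\<^sub>F w in nhds 0. ((\<lambda>w. \<phi> w - \<psi> w) \<circ> (\<lambda>x. 1 - x)) (1 - w) = 0"
    by (rule eventually_compose_filterlim)
  then have "\<forall>\<^sub>F w in nhds 0. \<phi> w - \<psi> w = 0" by simp
  then have "(\<lambda>w. \<phi> w - \<psi> w) has_fps_expansion 0" by (simp add: has_fps_expansion_0_iff)
  moreover have "(\<lambda>w. \<phi> w - \<psi> w) has_fps_expansion g - g'" by (intro fps_expansion_intros p q)
  ultimately have "g - g' = 0" by (rule fps_expansion_unique_complex[rotated])
  then show ?thesis by simp
qed

lemma germ1_mult:
  assumes "\<psi> has_fps_expansion h" "germ1 S lam g f" "\<And>x. x \<in> S \<Longrightarrow> f' x = \<psi> (1 - x) * f x"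
  shows "germ1 S lam (h * g) f'"
proof -
  obtain \<phi> where p: "\<phi> has_fps_expansion g" "\<forall>\<^sub>F x in at 1 within S. f x = (1 - x) powr lam * \<phi> (1 - x)"
    using assms(2) unfolding germ1_def by blast
  have "\<forall>\<^sub>F x in at 1 within S. f' x = (1 - x) powr lam * (\<psi> (1 - x) * \<phi> (1 - x))"
    using p(2) eventually_at_S by eventually_elim (simp add: assms(3))
  moreover have "(\<lambda>w. \<psi> w * \<phi> w) has_fps_expansion h * g" by (intro fps_expansion_intros p assms)
  ultimately show ?thesis unfolding germ1_def by blast
qed

lemma germ1_mult_x:
  assumes "germ1 S lam g f"
  shows "germ1 S lam ((1 - fps_X) * g) (\<lambda>x. x * f x)"
  by (rule germ1_mult[OF _ assms, of "\<lambda>w. 1 - w"]) (auto intro!: fps_expansion_intros)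

text \<open>The exponent of a germ is fixed only modulo integers. Lowering it brings a function and
  its derivative to a common exponent.\<close>

lemma germ1_shift:
  assumes "germ1 S lam g f"
  shows "germ1 S (lam - 1) (fps_X * g) f"
proof -
  obtain \<phi> where p: "\<phi> has_fps_expansion g" "\<forall>\<^sub>F x in at 1 within S. f x = (1 - x) powr lam * \<phi> (1 - x)"
    using assms unfolding germ1_def by blast
  have "\<forall>\<^sub>F x in at 1 within S. f x = (1 - x) powr (lam - 1) * ((1 - x) * \<phi> (1 - x))"
    using p(2) eventually_at_S by eventually_elim (simp add: powr_diff slits(4))
  moreover have "(\<lambda>w. w * \<phi> w) has_fps_expansion fps_X * g" by (intro fps_expansion_intros p)
  ultimately show ?thesis unfolding germ1_def by blast
qed

lemma germ1_add:
  assumes "germ1 S lam g f" "germ1 S lam g' f'"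
  shows "germ1 S lam (g + g') (\<lambda>x. f x + f' x)"
proof -
  obtain \<phi> where p: "\<phi> has_fps_expansion g" "\<forall>\<^sub>F x in at 1 within S. f x = (1 - x) powr lam * \<phi> (1 - x)"
    using assms(1) unfolding germ1_def by blast
  obtain \<psi> where q: "\<psi> has_fps_expansion g'" "\<forall>\<^sub>F x in at 1 within S. f' x = (1 - x) powr lam * \<psi> (1 - x)"
    using assms(2) unfolding germ1_def by blast
  have "\<forall>\<^sub>F x in at 1 within S. f x + f' x = (1 - x) powr lam * (\<phi> (1 - x) + \<psi> (1 - x))"
    using p(2) q(2) by eventually_elim (simp add: distrib_left)
  moreover have "(\<lambda>w. \<phi> w + \<psi> w) has_fps_expansion g + g'" by (intro fps_expansion_intros p q)
  ultimately show ?thesis unfolding germ1_def by blast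
qed

lemma germ1_zero: "germ1 S lam 0 (\<lambda>x. 0)"
  unfolding germ1_def by (intro exI[of _ "\<lambda>w. 0"]) simp

lemma germ1_sum:
  assumes "\<And>l. l \<in> L \<Longrightarrow> germ1 S lam (g l) (f l)"
  shows "germ1 S lam (\<Sum>l\<in>L. g l) (\<lambda>x. \<Sum>l\<in>L. f l x)"
  using assms by (induction L rule: infinite_finite_induct) (auto intro: germ1_zero germ1_add)

section \<open>Transport of differential equations by germs at 1\<close>

lemma holomorphic_eq_from_1:
  assumes "f holomorphic_on S" "g holomorphic_on S" "\<forall>\<^sub>F x in at 1 within S. f x = g x" "x \<in> S"
  shows "f x = g x"
proof -
  obtain e where e: "e > 0" "\<And>x. x \<in> S \<Longrightarrow> x \<noteq> 1 \<Longrightarrow> dist x 1 < e \<Longrightarrow> f x = g x"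
    using assms(3) unfolding eventually_at by blast
  obtain y where y: "y \<in> S" "dist y 1 < e" using S(5) e(1) closure_approachable by blast
  have o: "open (S \<inter> ball 1 e)" using S(1) by auto
  have y': "y \<in> S \<inter> ball 1 e" using y by (simp add: dist_commute)
  have "f x - g x = 0"
  proof (rule analytic_continuation[where f = "\<lambda>x. f x - g x" and S = S and U = "S \<inter> ball 1 e" and \<xi> = y])
    show "y islimpt S \<inter> ball 1 e" by (intro interior_limit_point) (unfold interior_open[OF o], rule y')
    show "f z - g z = 0" if "z \<in> S \<inter> ball 1 e" for z using e(2)[of z] that notin by (auto simp: dist_commute)
  qed (use assms S y in \<open>auto intro!: holomorphic_intros convex_connected\<close>)
  then show ?thesis by simp
qed

text \<open>F is the transform of f as far as the germs at 1 can tell. Unlike the integral, the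
  relation is algebraic in the coefficients, and so it is available for every order and
  exponent.\<close>

definition Epair where
  "Epair a lam f F \<longleftrightarrow> (\<exists>g. germ1 S lam g f \<and> germ1 S (lam + a) (Efps a lam g) F)"

lemma Epair_cong:
  assumes "Epair a lam f F" "\<And>x. x \<in> S \<Longrightarrow> f x = f' x" "\<And>x. x \<in> S \<Longrightarrow> F x = F' x"
  shows "Epair a lam f' F'"
proof -
  obtain g where g: "germ1 S lam g f" "germ1 S (lam + a) (Efps a lam g) F" using assms(1) unfolding Epair_def by blast
  have "germ1 S lam g f'" by (rule germ1_cong[OF g(1)]) (use assms(2) in simp)
  moreover have "germ1 S (lam + a) (Efps a lam g) F'" by (rule germ1_cong[OF g(2)]) (use assms(3) in simp)
  ultimately show ?thesis unfolding Epair_def by (intro exI[of _ g] conjI)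
qed

lemma Efps_add: "Efps a lam (g + h) = Efps a lam g + Efps a lam h"
  by (rule fps_ext) (simp add: Efps_def distrib_left)

lemma Efps_const: "Efps a lam (fps_const z * g) = fps_const z * Efps a lam g"
  by (rule fps_ext) (simp add: Efps_def)

lemma Efps_zero: "Efps a lam 0 = 0"
  by (rule fps_ext) (simp add: Efps_def)

lemma Epair_add:
  assumes "Epair a lam f F" "Epair a lam f' F'"
  shows "Epair a lam (\<lambda>x. f x + f' x) (\<lambda>x. F x + F' x)"
proof -
  obtain g where g: "germ1 S lam g f" "germ1 S (lam + a) (Efps a lam g) F" using assms(1) unfolding Epair_def by blast
  obtain g' where g': "germ1 S lam g' f'" "germ1 S (lam + a) (Efps a lam g') F'" using assms(2) unfolding Epair_def by blast
  show ?thesis unfolding Epair_def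
    by (intro exI[of _ "g + g'"] conjI) (unfold Efps_add, intro germ1_add g g', intro germ1_add g g')
qed

lemma Epair_cmult:
  assumes "Epair a lam f F"
  shows "Epair a lam (\<lambda>x. z * f x) (\<lambda>x. z * F x)"
  using assms germ1_cmult Efps_const unfolding Epair_def by metis

lemma Epair_zero: "Epair a lam (\<lambda>x. 0) (\<lambda>x. 0)"
  using germ1_zero Efps_zero unfolding Epair_def by metis

lemma Epair_sum:
  assumes "\<And>l. l \<in> L \<Longrightarrow> Epair a lam (f l) (F l)"
  shows "Epair a lam (\<lambda>x. \<Sum>l\<in>L. f l x) (\<lambda>x. \<Sum>l\<in>L. F l x)"
  using assms by (induction L rule: infinite_finite_induct) (auto intro: Epair_zero Epair_add)

lemma Epair_shift:
  assumes "Epair a lam f F"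
  shows "Epair a (lam - 1) f F"
proof -
  obtain g where g: "germ1 S lam g f" "germ1 S (lam + a) (Efps a lam g) F" using assms unfolding Epair_def by blast
  have "Efps a (lam - 1) (fps_X * g) = fps_X * Efps a lam g"
  proof (rule fps_ext)
    fix k show "fps_nth (Efps a (lam - 1) (fps_X * g)) k = fps_nth (fps_X * Efps a lam g) k"
    proof (cases k)
      case (Suc m)
      have e: "lam - 1 + of_nat (Suc m) + 1 = lam + of_nat m + 1" "lam - 1 + of_nat (Suc m) + 1 + a = lam + of_nat m + 1 + a" by simp_all
      show ?thesis unfolding Suc Efps_def fps_nth_Abs_fps e by simp
    qed (simp add: Efps_def)
  qed
  moreover have "lam + a - 1 = lam - 1 + a" by simp
  ultimately show ?thesis using germ1_shift[OF g(1)] germ1_shift[OF g(2)] unfolding Epair_def by metis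
qed

lemma Epair_deriv:
  assumes "Epair a lam f F" "lam \<notin> \<int>"
  shows "Epair a (lam - 1) (deriv f) (deriv F)"
proof -
  obtain g where g: "germ1 S lam g f" "germ1 S (lam + a) (Efps a lam g) F" using assms unfolding Epair_def by blast
  define d where "d = Abs_fps (\<lambda>k. - (lam + of_nat k) * fps_nth g k)"
  have "Abs_fps (\<lambda>k. - (lam + a + of_nat k) * fps_nth (Efps a lam g) k) = Efps a (lam - 1) d"
  proof (rule fps_ext)
    fix k
    define z where "z = lam + of_nat k"
    have z1: "z \<notin> \<int>" using add_nat_nonint[OF assms(2)] by (simp add: z_def)
    have e: "lam + a + of_nat k = z + a" "lam + of_nat k + 1 = z + 1" "lam - 1 + of_nat k + 1 = z" "lam + of_nat k = z"
      by (simp_all add: z_def)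
    have ea: "z + 1 + a = z + a + 1" by simp
    have "fps_nth (Abs_fps (\<lambda>k. - (lam + a + of_nat k) * fps_nth (Efps a lam g) k)) k =
       - (z + a) * (Gamma (z + 1) * rGamma (z + a + 1) * fps_nth g k)"
      unfolding Efps_def fps_nth_Abs_fps e ea ..
    also have "\<dots> = - Gamma (z + 1) * ((z + a) * rGamma (z + a + 1)) * fps_nth g k" proof -
      have "- y * (A * R * q) = - A * (y * R) * q" for y A R q :: complex by simp
      then show ?thesis .
    qed
    also have "(z + a) * rGamma (z + a + 1) = rGamma (z + a)" by (rule rGamma_plus1)
    also have "Gamma (z + 1) = z * Gamma z" by (rule Gamma_plus1[OF nonint_not_nonpos[OF z1]])
    also have "- (z * Gamma z) * rGamma (z + a) * fps_nth g k = Gamma z * rGamma (z + a) * (- z * fps_nth g k)"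
      by (simp add: mult_ac)
    finally show "fps_nth (Abs_fps (\<lambda>k. - (lam + a + of_nat k) * fps_nth (Efps a lam g) k)) k = fps_nth (Efps a (lam - 1) d) k"
      unfolding Efps_def d_def fps_nth_Abs_fps e .
  qed
  moreover have "lam + a - 1 = lam - 1 + a" by simp
  ultimately show ?thesis using germ1_deriv[OF g(1), folded d_def] germ1_deriv[OF g(2)] unfolding Epair_def by metis
qed

text \<open>The counterpart of I^a (s f) = x I^a f + a I^(a+1) f for the integral I^a of order a
  from x to 1, with f = X' and I^(a+1) X' = - I^a X. Multiplication by x is thus compatible with the
  transform of a derivative, and the equations below are arranged accordingly.\<close>

lemma Epair_mult_x:
  assumes Y: "Epair a lam (deriv X) Y" and X: "germ1 S (lam + 1) gX X" and lam: "lam \<notin> \<int>"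
  shows "Epair a lam (\<lambda>x. x * deriv X x + a * X x) (\<lambda>x. x * Y x)"
proof -
  obtain g where g: "germ1 S lam g (deriv X)" "germ1 S (lam + a) (Efps a lam g) Y" using Y unfolding Epair_def by blast
  have "germ1 S (lam + 1 - 1) (Abs_fps (\<lambda>k. - (lam + 1 + of_nat k) * fps_nth gX k)) (deriv X)" by (rule germ1_deriv[OF X])
  then have "germ1 S lam (Abs_fps (\<lambda>k. - (lam + 1 + of_nat k) * fps_nth gX k)) (deriv X)" by simp
  \<comment> \<open>The series of the derivative, known from the pair, must be the termwise
    derivative of the series of X; this links the coefficients of \<open>g\<close> and
    \<open>gX\<close>.\<close>
  from germ1_unique[OF g(1) this] have gd: "g = Abs_fps (\<lambda>k. - (lam + 1 + of_nat k) * fps_nth gX k)" by simp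
  have "germ1 S (lam + 1 - 1) (fps_X * gX) X" by (rule germ1_shift[OF X])
  then have "germ1 S lam (fps_X * gX) X" by simp
  then have 1: "germ1 S lam ((1 - fps_X) * g + fps_const a * (fps_X * gX)) (\<lambda>x. x * deriv X x + a * X x)"
    by (intro germ1_add germ1_mult_x g germ1_cmult)
  have "Efps a lam ((1 - fps_X) * g + fps_const a * (fps_X * gX)) = (1 - fps_X) * Efps a lam g"
  proof (rule fps_ext)
    fix k
    show "fps_nth (Efps a lam ((1 - fps_X) * g + fps_const a * (fps_X * gX))) k = fps_nth ((1 - fps_X) * Efps a lam g) k"
    proof (cases k)
      case 0
      then show ?thesis by (simp add: Efps_def algebra_simps)
    next
      case (Suc m)
      define z where "z = lam + of_nat m + 1"
      have z1: "z \<notin> \<int>" using add_nat_nonint[OF lam, of "Suc m"] by (simp add: z_def add_ac)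
      have e: "lam + of_nat (Suc m) + 1 = z + 1" "lam + of_nat m + 1 = z" "lam + 1 + of_nat m = z" by (simp_all add: z_def)
      have ea: "z + 1 + a = z + a + 1" by simp
      define R where "R = rGamma (z + a + 1)"
      define G where "G = Gamma z"
      have Gz: "Gamma (z + 1) = z * G" unfolding G_def by (rule Gamma_plus1[OF nonint_not_nonpos[OF z1]])
      have Rz: "rGamma (z + a) = (z + a) * R" unfolding R_def by (rule rGamma_plus1[symmetric])
      have gm: "fps_nth g m = - z * fps_nth gX m" unfolding gd fps_nth_Abs_fps e ..
      have "fps_nth (Efps a lam ((1 - fps_X) * g + fps_const a * (fps_X * gX))) k = z * G * R * (fps_nth g (Suc m) - fps_nth g m + a * fps_nth gX m)"
        unfolding Efps_def fps_nth_Abs_fps Suc e ea Gz R_def[symmetric] by (simp add: left_diff_distrib)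
      also have "\<dots> = z * G * R * fps_nth g (Suc m) - G * ((z + a) * R) * fps_nth g m"
        unfolding gm by (simp add: algebra_simps)
      also have "\<dots> = fps_nth ((1 - fps_X) * Efps a lam g) k"
        unfolding Efps_def Suc Rz[symmetric]
        by (simp only: left_diff_distrib fps_sub_nth mult_1_left fps_X_mult_nth fps_nth_Abs_fps e ea Gz G_def[symmetric] R_def[symmetric] nat.distinct if_False diff_Suc_1 mult.assoc)
      finally show ?thesis .
    qed
  qed
  with 1 germ1_mult_x[OF g(2)] show ?thesis unfolding Epair_def by metis
qed

lemma Epair_unique:
  assumes "Epair a lam f F" "Epair a lam f' F'" "\<And>x. x \<in> S \<Longrightarrow> f x = f' x"
    "F holomorphic_on S" "F' holomorphic_on S" "x \<in> S"
  shows "F x = F' x"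
proof -
  obtain g where g: "germ1 S lam g f" "germ1 S (lam + a) (Efps a lam g) F" using assms(1) unfolding Epair_def by blast
  obtain g' where g': "germ1 S lam g' f'" "germ1 S (lam + a) (Efps a lam g') F'" using assms(2) unfolding Epair_def by blast
  have "\<forall>\<^sub>F x in at 1 within S. f x = f' x" using eventually_at_S by (rule eventually_mono) (rule assms(3))
  from germ1_unique[OF g(1) g'(1) this] have eq: "g = g'" .
  have "germ1 S (lam + a) (Efps a lam g + fps_const (- 1) * Efps a lam g') (\<lambda>x. F x + - 1 * F' x)"
    by (intro germ1_add germ1_cmult g g')
  then have "germ1 S (lam + a) 0 (\<lambda>x. F x + - 1 * F' x)" unfolding eq by (simp add: fps_const_neg[symmetric] del: fps_const_neg)
  then obtain \<phi> where \<phi>: "\<phi> has_fps_expansion 0" "\<forall>\<^sub>F x in at 1 within S. F x + - 1 * F' x = (1 - x) powr (lam + a) * \<phi> (1 - x)"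
    unfolding germ1_def by blast
  have "\<forall>\<^sub>F w in nhds 0. \<phi> w = 0" using \<phi>(1) by (simp add: has_fps_expansion_0_iff)
  from eventually_compose_filterlim[OF this filterlim_one_minus] have "\<forall>\<^sub>F x in at 1 within S. \<phi> (1 - x) = 0" .
  with \<phi>(2) have "\<forall>\<^sub>F x in at 1 within S. F x = F' x" by eventually_elim simp
  then show ?thesis by (rule holomorphic_eq_from_1[OF assms(4,5) _ assms(6)])
qed

text \<open>In the variable 1 - x the system takes the form of \<open>okubo_fps\<close> with t j = T
  j - 1. A solution whose germ avoids every resonance has zero germ at 1, hence vanishes on
  S.\<close>

lemma okubo_germ1:
  fixes N :: nat and U :: "nat \<Rightarrow> complex \<Rightarrow> complex" and M :: "nat \<Rightarrow> nat \<Rightarrow> complex" and T :: "nat \<Rightarrow> complex" and G :: "nat \<Rightarrow> complex fps"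
  assumes hol: "\<And>j. j < N \<Longrightarrow> U j holomorphic_on S"
    and g: "\<And>j. j < N \<Longrightarrow> germ1 S lam (G j) (U j)"
    and ode: "\<And>j x. j < N \<Longrightarrow> x \<in> S \<Longrightarrow> (x - T j) * deriv (U j) x = (\<Sum>l<N. M j l * U l x)"
    and lam: "lam \<notin> \<int>"
    and off: "\<And>j l. j < N \<Longrightarrow> l < N \<Longrightarrow> T j = 1 \<Longrightarrow> T l = 1 \<Longrightarrow> l \<noteq> j \<Longrightarrow> M j l = 0"
    and lead: "\<And>j m. j < N \<Longrightarrow> T j = 1 \<Longrightarrow> fps_nth (G j) m = 0 \<or> lam + of_nat m \<noteq> M j j"
    and j: "j < N" and x: "x \<in> S"
  shows "U j x = 0"
proof -
  have "G j = 0"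
  proof (rule okubo_fps[where N = N and t = "\<lambda>j. T j - 1" and \<kappa> = lam and M = M])
    fix j assume j: "j < N"
    define D where "D = Abs_fps (\<lambda>k. - (lam + of_nat k) * fps_nth (G j) k)"
    have D: "D = - (fps_const lam * G j + fps_X * fps_deriv (G j))"
    proof (rule fps_ext)
      fix k show "fps_nth D k = fps_nth (- (fps_const lam * G j + fps_X * fps_deriv (G j))) k"
        unfolding D_def by (cases k) (simp_all add: algebra_simps)
    qed
    have 1: "germ1 S (lam - 1) ((fps_const (1 - T j) - fps_X) * D) (\<lambda>x. (x - T j) * deriv (U j) x)"
    proof (rule germ1_mult)
      show "germ1 S (lam - 1) D (deriv (U j))" unfolding D_def by (rule germ1_deriv[OF g[OF j]])
      show "(\<lambda>w. (1 - T j) - w) has_fps_expansion fps_const (1 - T j) - fps_X" by (intro fps_expansion_intros)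
    qed simp
    have 2: "germ1 S (lam - 1) (fps_X * (\<Sum>l<N. fps_const (M j l) * G l)) (\<lambda>x. \<Sum>l<N. M j l * U l x)"
      by (intro germ1_shift germ1_sum germ1_cmult g) simp
    have "\<forall>\<^sub>F x in at 1 within S. (x - T j) * deriv (U j) x = (\<Sum>l<N. M j l * U l x)"
      using eventually_at_S by (rule eventually_mono) (rule ode[OF j])
    from germ1_unique[OF 1 2 this] have "(fps_const (1 - T j) - fps_X) * D = fps_X * (\<Sum>l<N. fps_const (M j l) * G l)" .
    moreover have "(fps_const (1 - T j) - fps_X) * D = (fps_X + fps_const (T j - 1)) * (fps_const lam * G j + fps_X * fps_deriv (G j))"
    proof -
      have "fps_const (T j - 1) = - fps_const (1 - T j)" by simp
      then have "fps_X + fps_const (T j - 1) = - (fps_const (1 - T j) - fps_X)" by (simp only:) simp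
      then show ?thesis unfolding D by (simp only: minus_mult_minus minus_mult_right[symmetric] minus_mult_left[symmetric])
    qed
    ultimately show "(fps_X + fps_const (T j - 1)) * (fps_const lam * G j + fps_X * fps_deriv (G j)) = fps_X * (\<Sum>l<N. fps_const (M j l) * G l)"
      by simp
  qed (use lam off lead j in auto)
  with g[OF j] obtain \<phi> where \<phi>: "\<phi> has_fps_expansion 0" "\<forall>\<^sub>F x in at 1 within S. U j x = (1 - x) powr lam * \<phi> (1 - x)"
    unfolding germ1_def by auto
  have "\<forall>\<^sub>F w in nhds 0. \<phi> w = 0" using \<phi>(1) by (simp add: has_fps_expansion_0_iff)
  from eventually_compose_filterlim[OF this filterlim_one_minus] have "\<forall>\<^sub>F x in at 1 within S. \<phi> (1 - x) = 0" .
  with \<phi>(2) have "\<forall>\<^sub>F x in at 1 within S. U j x = 0" by eventually_elim simp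
  then show ?thesis by (intro holomorphic_eq_from_1[OF hol[OF j] _ _ x]) auto
qed

end

section \<open>Coefficient functions of the powers at 0\<close>

context slit
begin

text \<open>\<phi> is the coefficient function of x^(\<beta> i) in some expansion of f. Tracking a
  single index makes the relation linear and stable under analytic factors and the Euler derivative,
  so that a differential equation for f passes to each coefficient function by
  \<open>powr_separation\<close>.\<close>

definition component where
  "component I \<beta> i \<phi> f \<longleftrightarrow> (\<exists>h. (\<forall>i\<in>I. h i analytic_on {0}) \<and> h i = \<phi> \<and>
     (\<forall>\<^sub>F x in at 0 within S. f x = (\<Sum>i\<in>I. x powr \<beta> i * h i x)))"

lemma componentI:
  assumes "\<And>i. i \<in> I \<Longrightarrow> h i analytic_on {0}" "h i = \<phi>"
    "\<forall>\<^sub>F x in at 0 within S. f x = (\<Sum>i\<in>I. x powr \<beta> i * h i x)"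
  shows "component I \<beta> i \<phi> f"
  unfolding component_def using assms by (intro exI[of _ h] conjI) auto

lemma component_add:
  assumes "component I \<beta> i \<phi> f" "component I \<beta> i \<psi> g"
  shows "component I \<beta> i (\<lambda>x. \<phi> x + \<psi> x) (\<lambda>x. f x + g x)"
proof -
  obtain h where h: "\<forall>i\<in>I. h i analytic_on {0}" "h i = \<phi>" "\<forall>\<^sub>F x in at 0 within S. f x = (\<Sum>i\<in>I. x powr \<beta> i * h i x)"
    using assms(1) unfolding component_def by blast
  obtain h' where h': "\<forall>i\<in>I. h' i analytic_on {0}" "h' i = \<psi>" "\<forall>\<^sub>F x in at 0 within S. g x = (\<Sum>i\<in>I. x powr \<beta> i * h' i x)"
    using assms(2) unfolding component_def by blast
  show ?thesis
  proof (rule componentI[where h = "\<lambda>i x. h i x + h' i x"])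
    show "\<forall>\<^sub>F x in at 0 within S. f x + g x = (\<Sum>i\<in>I. x powr \<beta> i * (h i x + h' i x))"
      using h(3) h'(3) by eventually_elim (simp add: distrib_left sum.distrib)
  qed (use h h' in \<open>auto intro!: analytic_on_add\<close>)
qed

lemma component_mult:
  assumes "component I \<beta> i \<phi> f" "\<psi> analytic_on {0}"
  shows "component I \<beta> i (\<lambda>x. \<psi> x * \<phi> x) (\<lambda>x. \<psi> x * f x)"
proof -
  obtain h where h: "\<forall>i\<in>I. h i analytic_on {0}" "h i = \<phi>" "\<forall>\<^sub>F x in at 0 within S. f x = (\<Sum>i\<in>I. x powr \<beta> i * h i x)"
    using assms(1) unfolding component_def by blast
  show ?thesis
  proof (rule componentI[where h = "\<lambda>i x. \<psi> x * h i x"])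
    show "\<forall>\<^sub>F x in at 0 within S. \<psi> x * f x = (\<Sum>i\<in>I. x powr \<beta> i * (\<psi> x * h i x))"
      using h(3) by eventually_elim (simp add: sum_distrib_left mult_ac)
  qed (use h assms(2) in \<open>auto intro!: analytic_on_mult\<close>)
qed

lemma component_zero: "component I \<beta> i (\<lambda>x. 0) (\<lambda>x. 0)"
  by (rule componentI[where h = "\<lambda>i x. 0"]) auto

lemma component_sum:
  assumes "\<And>l. l \<in> L \<Longrightarrow> component I \<beta> i (\<phi> l) (f l)"
  shows "component I \<beta> i (\<lambda>x. \<Sum>l\<in>L. \<phi> l x) (\<lambda>x. \<Sum>l\<in>L. f l x)"
  using assms by (induction L rule: infinite_finite_induct) (auto intro: component_zero component_add)

lemma component_cmult: "component I \<beta> i \<phi> f \<Longrightarrow> component I \<beta> i (\<lambda>x. z * \<phi> x) (\<lambda>x. z * f x)"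
  by (rule component_mult) simp_all

lemma component_theta:
  assumes "component I \<beta> i \<phi> f" "finite I"
  shows "component I \<beta> i (\<lambda>x. \<beta> i * \<phi> x + x * deriv \<phi> x) (\<lambda>x. x * deriv f x)"
proof -
  obtain h where h: "\<forall>i\<in>I. h i analytic_on {0}" "h i = \<phi>" "\<forall>\<^sub>F x in at 0 within S. f x = (\<Sum>i\<in>I. x powr \<beta> i * h i x)"
    using assms(1) unfolding component_def by blast
  have d: "\<forall>\<^sub>F x in at 0 within S. \<forall>i\<in>I. h i field_differentiable at x"
    using assms(2) h(1) by (intro eventually_ball_finite ballI eventually_at_within_of_nhds analytic_eventually_differentiable) auto
  show ?thesis
  proof (rule componentI[where h = "\<lambda>i x. \<beta> i * h i x + x * deriv (h i) x"])
    show "\<forall>\<^sub>F x in at 0 within S. x * deriv f x = (\<Sum>i\<in>I. x powr \<beta> i * (\<beta> i * h i x + x * deriv (h i) x))"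
      using eventually_at_within_open_nhds[OF S(1) notin(1) h(3)] d
    proof eventually_elim
      case (elim x)
      then have x: "x \<in> S" and ev: "\<forall>\<^sub>F y in nhds x. f y = (\<Sum>i\<in>I. y powr \<beta> i * h i y)" by auto
      have "((\<lambda>y. \<Sum>i\<in>I. y powr \<beta> i * h i y) has_field_derivative (\<Sum>i\<in>I. x powr (\<beta> i - 1) * (\<beta> i * h i x + x * deriv (h i) x))) (at x)"
        using elim(2) by (intro DERIV_sum powr_times_deriv slits(1) x) auto
      then have e: "deriv f x = (\<Sum>i\<in>I. x powr (\<beta> i - 1) * (\<beta> i * h i x + x * deriv (h i) x))"
        using deriv_cong_ev[OF ev refl] by (simp only: DERIV_imp_deriv)
      have "x * x powr (\<beta> i - 1) = x powr \<beta> i" for i using slits(3)[OF x] by (simp add: powr_diff)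
      then show ?case unfolding e by (simp add: sum_distrib_left mult.assoc[symmetric])
    qed
    show "(\<lambda>x. \<beta> i * h i x + x * deriv (h i) x) analytic_on {0}" if "i \<in> I" for i
      using h(1) that by (intro analytic_on_add analytic_on_mult analytic_on_const analytic_on_ident analytic_deriv) simp_all
  qed (simp add: h(2))
qed

lemma component_eq_0:
  assumes "component I \<beta> i \<phi> f" "finite I" "i \<in> I" "\<And>x. x \<in> S \<Longrightarrow> f x = 0"
    "\<And>i j. i \<in> I \<Longrightarrow> j \<in> I \<Longrightarrow> i \<noteq> j \<Longrightarrow> \<beta> i - \<beta> j \<notin> \<int>"
  shows "\<forall>\<^sub>F x in nhds 0. \<phi> x = 0"
proof -
  obtain h where h: "\<forall>i\<in>I. h i analytic_on {0}" "h i = \<phi>" "\<forall>\<^sub>F x in at 0 within S. f x = (\<Sum>i\<in>I. x powr \<beta> i * h i x)"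
    using assms(1) unfolding component_def by blast
  have "\<forall>\<^sub>F x in at 0 within S. (\<Sum>i\<in>I. x powr \<beta> i * h i x) = 0"
    using h(3) eventually_at_S by eventually_elim (simp add: assms(4))
  from powr_separation[OF S(1) islimpt(1) S_slit assms(2) _ assms(5) this assms(3)] h show ?thesis by auto
qed

text \<open>The analytic remainder is treated as one more term, with exponent 0.\<close>

definition with0 :: "('i \<Rightarrow> complex) \<Rightarrow> 'i option \<Rightarrow> complex" where
  "with0 \<beta> i = (case i of None \<Rightarrow> 0 | Some k \<Rightarrow> \<beta> k)"

lemma with0_distinct:
  assumes "\<And>k. k \<in> K \<Longrightarrow> \<beta> k \<notin> \<int>" "\<And>k k'. k \<in> K \<Longrightarrow> k' \<in> K \<Longrightarrow> k \<noteq> k' \<Longrightarrow> \<beta> k - \<beta> k' \<notin> \<int>"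
    and ij: "i \<in> insert None (Some ` K)" "j \<in> insert None (Some ` K)" "i \<noteq> j"
  shows "with0 \<beta> i - with0 \<beta> j \<notin> \<int>"
proof (cases i; cases j)
  fix a b assume ab: "i = Some a" "j = Some b"
  then have "a \<in> K" "b \<in> K" "a \<noteq> b" using ij by (simp_all add: image_iff)
  then show ?thesis using assms(2) by (simp add: ab with0_def)
qed (use ij assms(1) in \<open>simp_all add: with0_def image_iff minus_in_Ints_iff\<close>)

lemma sum_with0:
  assumes "finite K" "x \<noteq> 0"
  shows "(\<Sum>i\<in>insert None (Some ` K). x powr with0 \<beta> i * h i x) = (\<Sum>k\<in>K. x powr \<beta> k * h (Some k) x) + (h None x :: complex)"
  using assms by (simp add: with0_def sum.reindex add.commute)

lemma germ0_component:
  assumes "germ0 S K \<beta> c f" "finite K"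
  shows "\<exists>h r. (\<forall>k\<in>K. h k analytic_on {0} \<and> h k 0 = c k \<and> component (insert None (Some ` K)) (with0 \<beta>) (Some k) (h k) f) \<and>
    r analytic_on {0} \<and> (\<forall>\<^sub>F x in at 0 within S. f x = (\<Sum>k\<in>K. x powr \<beta> k * h k x) + r x) \<and>
    component (insert None (Some ` K)) (with0 \<beta>) None r f"
proof -
  obtain h r where h: "\<And>k. k \<in> K \<Longrightarrow> h k analytic_on {0}" "\<And>k. k \<in> K \<Longrightarrow> h k 0 = c k" "r analytic_on {0}"
    "\<forall>\<^sub>F x in at 0 within S. f x = (\<Sum>k\<in>K. x powr \<beta> k * h k x) + r x"
    using assms(1) unfolding germ0_def by blast
  define H where "H = (\<lambda>i. case i of None \<Rightarrow> r | Some k \<Rightarrow> h k)"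
  have H: "\<forall>\<^sub>F x in at 0 within S. f x = (\<Sum>i\<in>insert None (Some ` K). x powr with0 \<beta> i * H i x)"
    using h(4) eventually_at_S by eventually_elim (simp add: sum_with0[OF assms(2)] slits(3) H_def)
  have an: "H i analytic_on {0}" if "i \<in> insert None (Some ` K)" for i using that h by (auto simp: H_def)
  have "component (insert None (Some ` K)) (with0 \<beta>) None r f"
    by (rule componentI[where h = H, OF an _ H]) (simp_all add: H_def)
  moreover have "component (insert None (Some ` K)) (with0 \<beta>) (Some k) (h k) f" for k
    by (rule componentI[where h = H, OF an _ H]) (simp_all add: H_def)
  ultimately show ?thesis using h by (intro exI[of _ h] exI[of _ r]) simp
qed

lemma germ0_add:
  assumes "germ0 S K \<beta> c f" "germ0 S K \<beta> c' f'"
  shows "germ0 S K \<beta> (\<lambda>k. c k + c' k) (\<lambda>x. f x + f' x)"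
proof -
  obtain h r where h: "\<And>k. k \<in> K \<Longrightarrow> h k analytic_on {0}" "\<And>k. k \<in> K \<Longrightarrow> h k 0 = c k" "r analytic_on {0}"
    "\<forall>\<^sub>F x in at 0 within S. f x = (\<Sum>k\<in>K. x powr \<beta> k * h k x) + r x"
    using assms(1) unfolding germ0_def by blast
  obtain h' r' where h': "\<And>k. k \<in> K \<Longrightarrow> h' k analytic_on {0}" "\<And>k. k \<in> K \<Longrightarrow> h' k 0 = c' k" "r' analytic_on {0}"
    "\<forall>\<^sub>F x in at 0 within S. f' x = (\<Sum>k\<in>K. x powr \<beta> k * h' k x) + r' x"
    using assms(2) unfolding germ0_def by blast
  have "\<forall>\<^sub>F x in at 0 within S. f x + f' x = (\<Sum>k\<in>K. x powr \<beta> k * (h k x + h' k x)) + (r x + r' x)"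
    using h(4) h'(4) by eventually_elim (simp add: distrib_left sum.distrib)
  moreover have "(\<lambda>x. h k x + h' k x) analytic_on {0}" if "k \<in> K" for k using h(1) h'(1) that by (intro analytic_on_add) auto
  moreover have "(\<lambda>x. r x + r' x) analytic_on {0}" using h(3) h'(3) by (rule analytic_on_add)
  ultimately show ?thesis unfolding germ0_def using h(2) h'(2)
    by (intro exI[of _ "\<lambda>k x. h k x + h' k x"] exI[of _ "\<lambda>x. r x + r' x"]) auto
qed

lemma germ0_zero: "germ0 S K \<beta> (\<lambda>k. 0) (\<lambda>x. 0)"
  unfolding germ0_def by (intro exI[of _ "\<lambda>k x. 0"] exI[of _ "\<lambda>x. 0"]) simp

lemma germ0_sum:
  assumes "\<And>l. l \<in> L \<Longrightarrow> germ0 S K \<beta> (c l) (f l)"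
  shows "germ0 S K \<beta> (\<lambda>k. \<Sum>l\<in>L. c l k) (\<lambda>x. \<Sum>l\<in>L. f l x)"
  using assms by (induction L rule: infinite_finite_induct) (auto intro: germ0_zero germ0_add)

lemma germ0_lead_cong: "germ0 S K \<beta> c f \<Longrightarrow> (\<And>k. k \<in> K \<Longrightarrow> c k = c' k) \<Longrightarrow> germ0 S K \<beta> c' f"
  unfolding germ0_def by simp

text \<open>Terms of different integral shift are brought to a common list of exponents by absorbing
  a factor x, which makes their leading coefficients zero.\<close>

lemma germ0_lower:
  assumes "germ0 S K (\<lambda>k. \<beta> k + 1) c f"
  shows "germ0 S K \<beta> (\<lambda>k. 0) f"
proof -
  obtain h r where h: "\<And>k. k \<in> K \<Longrightarrow> h k analytic_on {0}" "\<And>k. k \<in> K \<Longrightarrow> h k 0 = c k" "r analytic_on {0}"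
    "\<forall>\<^sub>F x in at 0 within S. f x = (\<Sum>k\<in>K. x powr (\<beta> k + 1) * h k x) + r x"
    using assms(1) unfolding germ0_def by blast
  have "\<forall>\<^sub>F x in at 0 within S. f x = (\<Sum>k\<in>K. x powr \<beta> k * (x * h k x)) + r x"
    using h(4) eventually_at_S by eventually_elim (simp add: powr_add slits(3) mult_ac)
  moreover have "(\<lambda>x. x * h k x) analytic_on {0}" if "k \<in> K" for k using h(1) that by (intro analytic_on_mult analytic_on_ident) auto
  ultimately show ?thesis unfolding germ0_def using h(3)
    by (intro exI[of _ "\<lambda>k x. x * h k x"] exI[of _ r]) auto
qed

lemma germ0_theta_lower:
  assumes "germ0 S K (\<lambda>k. \<beta> k + 1) c f" "finite K"
  shows "germ0 S K \<beta> (\<lambda>k. 0) (\<lambda>x. x * deriv f x)"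
proof -
  have "germ0 S K (\<lambda>k. \<beta> k + 1 - 1) (\<lambda>k. (\<beta> k + 1) * c k) (deriv f)" by (rule germ0_deriv[OF assms])
  then have "germ0 S K \<beta> (\<lambda>k. (\<beta> k + 1) * c k) (deriv f)" by simp
  then obtain h r where h: "\<And>k. k \<in> K \<Longrightarrow> h k analytic_on {0}" "r analytic_on {0}"
    "\<forall>\<^sub>F x in at 0 within S. deriv f x = (\<Sum>k\<in>K. x powr \<beta> k * h k x) + r x"
    unfolding germ0_def by blast
  have "\<forall>\<^sub>F x in at 0 within S. x * deriv f x = (\<Sum>k\<in>K. x powr \<beta> k * (x * h k x)) + x * r x"
    using h(3) by eventually_elim (simp add: distrib_left sum_distrib_left mult_ac)
  moreover have "(\<lambda>x. x * h k x) analytic_on {0}" if "k \<in> K" for k using h(1) that by (intro analytic_on_mult analytic_on_ident) auto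
  moreover have "(\<lambda>x. x * r x) analytic_on {0}" using h(2) by (intro analytic_on_mult analytic_on_ident)
  ultimately show ?thesis unfolding germ0_def
    by (intro exI[of _ "\<lambda>k x. x * h k x"] exI[of _ "\<lambda>x. x * r x"]) auto
qed

text \<open>Each singular coefficient function satisfies the formal system with exponent e k. In the
  rows with T j = 0 its value at 0 vanishes by \<open>lead\<close> and later resonances are excluded
  by \<open>diag\<close>, so \<open>okubo_fps\<close> annihilates it and only the analytic part is
  left.\<close>

lemma okubo_germ0:
  fixes N :: nat and D :: "nat \<Rightarrow> complex \<Rightarrow> complex" and M :: "nat \<Rightarrow> nat \<Rightarrow> complex" and T :: "nat \<Rightarrow> complex"
  assumes K: "finite K"
    and g: "\<And>j. j < N \<Longrightarrow> germ0 S K e (d j) (D j)"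
    and ode: "\<And>j x. j < N \<Longrightarrow> x \<in> S \<Longrightarrow> (x - T j) * deriv (D j) x = (\<Sum>l<N. M j l * D l x)"
    and e: "\<And>k. k \<in> K \<Longrightarrow> e k \<notin> \<int>" "\<And>k k'. k \<in> K \<Longrightarrow> k' \<in> K \<Longrightarrow> k \<noteq> k' \<Longrightarrow> e k - e k' \<notin> \<int>"
    and off: "\<And>j l. j < N \<Longrightarrow> l < N \<Longrightarrow> T j = 0 \<Longrightarrow> T l = 0 \<Longrightarrow> l \<noteq> j \<Longrightarrow> M j l = 0"
    and lead: "\<And>j k. j < N \<Longrightarrow> T j = 0 \<Longrightarrow> k \<in> K \<Longrightarrow> d j k = 0"
    and diag: "\<And>j k m. j < N \<Longrightarrow> T j = 0 \<Longrightarrow> k \<in> K \<Longrightarrow> e k + of_nat (Suc m) \<noteq> M j j"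
    and j: "j < N"
  shows "\<exists>r. r analytic_on {0} \<and> (\<forall>\<^sub>F x in at 0 within S. D j x = r x)"
proof -
  define I where "I = insert None (Some ` K)"
  define Q where "Q = (\<lambda>j h r. (\<forall>k\<in>K. h k analytic_on {0} \<and> h k 0 = d j k \<and> component I (with0 e) (Some k) (h k) (D j)) \<and> r analytic_on {0} \<and>
    (\<forall>\<^sub>F x in at 0 within S. D j x = (\<Sum>k\<in>K. x powr e k * h k x) + r x) \<and> component I (with0 e) None r (D j))"
  have "\<exists>h r. Q j h r" if "j < N" for j
    unfolding Q_def I_def by (rule germ0_component[OF g[OF that] K])
  then obtain h r where hr: "\<And>j. j < N \<Longrightarrow> Q j (h j) (r j)" by metis
  have h: "\<And>j k. j < N \<Longrightarrow> k \<in> K \<Longrightarrow> h j k analytic_on {0}" "\<And>j k. j < N \<Longrightarrow> k \<in> K \<Longrightarrow> h j k 0 = d j k"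
    "\<And>j k. j < N \<Longrightarrow> k \<in> K \<Longrightarrow> component I (with0 e) (Some k) (h j k) (D j)"
    "\<And>j. j < N \<Longrightarrow> r j analytic_on {0}"
    "\<And>j. j < N \<Longrightarrow> \<forall>\<^sub>F x in at 0 within S. D j x = (\<Sum>k\<in>K. x powr e k * h j k x) + r j x"
    using hr unfolding Q_def by simp_all
  have fI: "finite I" using K by (simp add: I_def)
  have "\<forall>\<^sub>F x in nhds 0. h j k x = 0" if k: "k \<in> K" for k
  proof -
    define G where "G = (\<lambda>j. fps_expansion (h j k) 0)"
    have G: "h j k has_fps_expansion G j" if "j < N" for j
      unfolding G_def by (rule analytic_at_imp_has_fps_expansion_0[OF h(1)[OF that k]])
    have "G j = 0"
    proof (rule okubo_fps[where N = N and t = "\<lambda>j. - T j" and \<kappa> = "e k" and M = M])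
      fix j assume j: "j < N"
      define \<Theta> where "\<Theta> = (\<lambda>x. e k * h j k x + x * deriv (h j k) x)"
      have 1: "component I (with0 e) (Some k) \<Theta> (\<lambda>x. x * deriv (D j) x)"
        using component_theta[OF h(3)[OF j k] fI] by (simp add: with0_def \<Theta>_def)
      have "component I (with0 e) (Some k) (\<lambda>x. (x - T j) * \<Theta> x + (- x) * (\<Sum>l<N. M j l * h l k x))
          (\<lambda>x. (x - T j) * (x * deriv (D j) x) + (- x) * (\<Sum>l<N. M j l * D l x))"
        by (intro component_add component_mult component_sum component_cmult 1 h(3) k analytic_intros) auto
      then have ev: "\<forall>\<^sub>F x in nhds 0. (x - T j) * \<Theta> x + (- x) * (\<Sum>l<N. M j l * h l k x) = 0"
      proof (rule component_eq_0[OF _ fI])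
        show "Some k \<in> I" using k by (simp add: I_def)
        show "(x - T j) * (x * deriv (D j) x) + (- x) * (\<Sum>l<N. M j l * D l x) = 0" if "x \<in> S" for x
          using ode[OF j that] by (simp add: mult.left_commute[of _ x])
      qed (unfold I_def, rule with0_distinct, use e in auto)
      have 2: "(\<lambda>x. (x - T j) * \<Theta> x + (- x) * (\<Sum>l<N. M j l * h l k x)) has_fps_expansion
         (fps_X - fps_const (T j)) * (fps_const (e k) * G j + fps_X * fps_deriv (G j)) + (- fps_X) * (\<Sum>l<N. fps_const (M j l) * G l)"
        unfolding \<Theta>_def by (intro fps_expansion_intros G j) auto
      from iffD1[OF has_fps_expansion_cong[OF ev refl] 2]
      have "(fps_X - fps_const (T j)) * (fps_const (e k) * G j + fps_X * fps_deriv (G j)) + (- fps_X) * (\<Sum>l<N. fps_const (M j l) * G l) = 0"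
        by (rule fps_expansion_unique_complex) simp
      then have 3: "(fps_X - fps_const (T j)) * (fps_const (e k) * G j + fps_X * fps_deriv (G j)) = fps_X * (\<Sum>l<N. fps_const (M j l) * G l)" by simp
      have 4: "fps_X + fps_const (- T j) = fps_X - fps_const (T j)" by (simp add: fps_const_neg[symmetric] del: fps_const_neg)
      show "(fps_X + fps_const (- T j)) * (fps_const (e k) * G j + fps_X * fps_deriv (G j)) = fps_X * (\<Sum>l<N. fps_const (M j l) * G l)"
        unfolding 4 by (rule 3)
    next
      fix j m assume j: "j < N" "- T j = 0"
      show "fps_nth (G j) m = 0 \<or> e k + of_nat m \<noteq> M j j"
      proof (cases m)
        case 0
        have "fps_nth (G j) 0 = h j k 0" using fps_nth_fps_expansion[OF G[OF j(1)], of 0] by simp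
        with 0 show ?thesis using h(2)[OF j(1) k] lead[of j k] j k by simp
      next
        case (Suc m')
        then show ?thesis using diag[of j k m'] j k by simp
      qed
    qed (use e(1)[OF k] off j in auto)
    with G[OF j] show ?thesis by (simp add: has_fps_expansion_0_iff)
  qed
  then have "\<forall>\<^sub>F x in at 0 within S. \<forall>k\<in>K. h j k x = 0"
    using K by (intro eventually_ball_finite ballI eventually_at_within_of_nhds) auto
  with h(5)[OF j] have "\<forall>\<^sub>F x in at 0 within S. D j x = r j x" by eventually_elim simp
  with h(4)[OF j] show ?thesis by blast
qed

end

section \<open>The system in the normalised coordinate\<close>

text \<open>The underlying system in the normalised coordinate, here called x. Row j is singular at
  1 / \<kappa> j, so the rows with \<kappa> j = 1 belong to the point 1. Infinity of the underlying
  system lies at 0, whence the exponents - \<mu> k. The rows of \<open>Pi\<close> are left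
  eigenvectors of \<open>a\<close> with eigenvalues \<open>mh\<close>.\<close>

locale okubo = slit +
  fixes n nv q :: nat and a P Pi :: "nat \<Rightarrow> nat \<Rightarrow> complex" and mh \<kappa> \<mu> :: "nat \<Rightarrow> complex"
    and \<rho>1 \<rho>2 lam :: complex and w :: "nat \<Rightarrow> complex \<Rightarrow> complex" and gw :: "nat \<Rightarrow> complex fps"
    and cc :: "nat \<Rightarrow> nat \<Rightarrow> complex"
  assumes PPi: "\<And>i j. i < n \<Longrightarrow> j < n \<Longrightarrow> (\<Sum>m<n. P i m * Pi m j) = (if i = j then 1 else 0)"
    and Pia: "\<And>i j. i < n \<Longrightarrow> j < n \<Longrightarrow> (\<Sum>m<n. Pi i m * a m j) = mh i * Pi i j"
    and mh_nonint: "\<And>i. i < n \<Longrightarrow> mh i \<notin> \<int>"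
    and mh_last: "\<And>i. nv \<le> i \<Longrightarrow> i < n \<Longrightarrow> mh i = \<rho>2"
    and nv: "nv \<le> n" and q: "1 \<le> q" and rho2: "\<rho>2 = \<mu> q"
    and \<kappa>: "\<And>i. i < n \<Longrightarrow> \<kappa> i \<noteq> 0"
    and lam: "lam \<notin> \<int>" "lam - \<rho>1 \<notin> \<int>" and rho1: "\<rho>1 \<notin> \<int>"
    and mu: "\<And>k. k \<in> {1..q} \<Longrightarrow> \<mu> k \<notin> \<int>" "\<And>k. k \<in> {1..q} \<Longrightarrow> \<rho>1 - \<mu> k \<notin> \<int>"
      "\<And>k k'. k \<in> {1..q} \<Longrightarrow> k' \<in> {1..q} \<Longrightarrow> k \<noteq> k' \<Longrightarrow> \<mu> k - \<mu> k' \<notin> \<int>"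
      "\<And>k. k \<in> {1..<q} \<Longrightarrow> \<rho>1 + \<rho>2 - \<mu> k \<notin> \<int>"
    and w_hol: "\<And>j. j < n \<Longrightarrow> w j holomorphic_on S"
    and w_germ1: "\<And>j. j < n \<Longrightarrow> germ1 S lam (gw j) (w j)"
    and w_germ0: "\<And>j. j < n \<Longrightarrow> \<exists>h. (\<forall>k\<in>{1..q}. h k analytic_on {0} \<and> h k 0 = cc j k) \<and>
        (\<forall>\<^sub>F x in at 0 within S. w j x = (\<Sum>k\<in>{1..q}. x powr (- \<mu> k) * h k x))"
    and w_ode: "\<And>j x. j < n \<Longrightarrow> x \<in> S \<Longrightarrow> (\<Sum>l<n. a j l * w l x) + x * deriv (w j) x = \<kappa> j * x * (x * deriv (w j) x)"
begin

lemma deriv_at: "f holomorphic_on S \<Longrightarrow> x \<in> S \<Longrightarrow> (f has_field_derivative deriv f x) (at x)"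
  by (rule holomorphic_derivI[OF _ S(1)])

lemma powr_theta:
  assumes "f holomorphic_on S" "x \<in> S"
  shows "x * deriv (\<lambda>x. x powr b * f x) x = x powr b * (b * f x + x * deriv f x)"
proof -
  have "f field_differentiable at x" using assms S(1) holomorphic_on_imp_differentiable_at by blast
  from powr_times_deriv[OF slits(1)[OF assms(2)] this, of b]
  have "deriv (\<lambda>x. x powr b * f x) x = x powr (b - 1) * (b * f x + x * deriv f x)" by (rule DERIV_imp_deriv)
  moreover have "x * x powr (b - 1) = x powr b" using slits(3)[OF assms(2)] by (simp add: powr_diff)
  ultimately show ?thesis by (simp add: mult.assoc[symmetric])
qed

lemma holomorphic_powr_times: "f holomorphic_on S \<Longrightarrow> (\<lambda>x. x powr b * f x) holomorphic_on S"
  using slits(1) by (intro holomorphic_on_mult holomorphic_on_powr holomorphic_on_ident) auto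

text \<open>Near 1 the factor x^b is analytic with value 1, so exponent and leading coefficient are
  preserved.\<close>

lemma germ1_powr:
  assumes "germ1 S s g f"
  shows "\<exists>g'. germ1 S s g' (\<lambda>x. x powr b * f x) \<and> fps_nth g' 0 = fps_nth g 0"
proof -
  obtain G where G: "(\<lambda>w. (1 - w) powr b) has_fps_expansion G" "fps_nth G 0 = 1" using has_fps_expansion_one_minus_powr by blast
  have "germ1 S s (G * g) (\<lambda>x. x powr b * f x)" by (rule germ1_mult[OF G(1) assms]) simp
  then show ?thesis using G(2) by (intro exI[of _ "G * g"]) simp
qed

text \<open>The two transforms have the orders - a0 and a0, so that the exponent at 1 returns to
  lam.\<close>

definition "a0 = 1 + \<rho>1"

lemma nonint: "a0 \<notin> \<int>" "- a0 \<notin> \<int>" "lam - a0 \<notin> \<int>" "\<And>k. k \<in> {1..q} \<Longrightarrow> - 1 - \<mu> k \<notin> \<int>"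
proof -
  show a: "a0 \<notin> \<int>" using rho1 Ints_diff[OF _ Ints_1, of a0] by (auto simp: a0_def)
  then show "- a0 \<notin> \<int>" by (simp add: minus_in_Ints_iff)
  show "lam - a0 \<notin> \<int>" using lam(2) Ints_add[OF _ Ints_1, of "lam - a0"] by (auto simp: a0_def algebra_simps)
  show "- 1 - \<mu> k \<notin> \<int>" if "k \<in> {1..q}" for k
    using mu(1)[OF that] Ints_add[OF _ Ints_1, of "- 1 - \<mu> k"] by (auto simp: minus_in_Ints_iff)
qed

text \<open>The transform is known through its germs only. Choosing one function and one series for
  each row turns the existence statement into a vector that can be differentiated and
  summed.\<close>

definition "F1_spec j F g1 \<longleftrightarrow> F holomorphic_on S \<and> germ1 S lam g1 (\<lambda>x. x powr \<rho>1 * w j x) \<and> fps_nth g1 0 = fps_nth (gw j) 0 \<and>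
    germ1 S (lam + - a0) (Efps (- a0) lam g1) F \<and>
    germ0 S {1..q} (\<lambda>k. - 1 - \<mu> k) (\<lambda>k. Gq (- a0) (\<rho>1 - \<mu> k) * cc j k) F"

definition "F1 j = (SOME F. \<exists>g1. F1_spec j F g1)"
definition "G1 j = (SOME g1. F1_spec j (F1 j) g1)"

lemma F1:
  assumes j: "j < n"
  shows "F1 j holomorphic_on S" "germ1 S lam (G1 j) (\<lambda>x. x powr \<rho>1 * w j x)" "fps_nth (G1 j) 0 = fps_nth (gw j) 0"
    "germ1 S (lam + - a0) (Efps (- a0) lam (G1 j)) (F1 j)"
    "germ0 S {1..q} (\<lambda>k. - 1 - \<mu> k) (\<lambda>k. Gq (- a0) (\<rho>1 - \<mu> k) * cc j k) (F1 j)"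
proof -
  have "\<exists>F g1. F1_spec j F g1"
  proof -
    obtain g1 where g1: "germ1 S lam g1 (\<lambda>x. x powr \<rho>1 * w j x)" "fps_nth g1 0 = fps_nth (gw j) 0"
      using germ1_powr[OF w_germ1[OF j]] by blast
    obtain h where h: "\<forall>k\<in>{1..q}. h k analytic_on {0} \<and> h k 0 = cc j k" "\<forall>\<^sub>F x in at 0 within S. w j x = (\<Sum>k\<in>{1..q}. x powr (- \<mu> k) * h k x)"
      using w_germ0[OF j] by blast
    have "\<forall>\<^sub>F x in at 0 within S. x powr \<rho>1 * w j x = (\<Sum>k\<in>{1..q}. x powr (\<rho>1 - \<mu> k) * h k x) + 0"
      using h(2)
    proof eventually_elim
      case (elim x)
      have "x powr (\<rho>1 - \<mu> k) = x powr \<rho>1 * x powr (- \<mu> k)" for k by (simp flip: powr_add)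
      then show ?case unfolding elim by (simp add: sum_distrib_left mult.assoc)
    qed
    then have g0: "germ0 S {1..q} (\<lambda>k. \<rho>1 - \<mu> k) (cc j) (\<lambda>x. x powr \<rho>1 * w j x)"
      unfolding germ0_def using h(1) by (intro exI[of _ h] exI[of _ "\<lambda>x. 0"]) simp
    have e: "\<rho>1 - \<mu> k + - a0 = - 1 - \<mu> k" for k by (simp add: a0_def)
    have "lam + - a0 \<notin> \<int>" using nonint(3) by simp
    from Euler_transform[OF holomorphic_powr_times[OF w_hol[OF j]] g1(1) g0 _ nonint(2) lam(1) this, unfolded e, OF _ mu(2) nonint(4)]
    obtain F where "F holomorphic_on S" "germ1 S (lam + - a0) (Efps (- a0) lam g1) F"
      "germ0 S {1..q} (\<lambda>k. - 1 - \<mu> k) (\<lambda>k. Gq (- a0) (\<rho>1 - \<mu> k) * cc j k) F" by auto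
    with g1 have "F1_spec j F g1" unfolding F1_spec_def by (intro conjI)
    then show ?thesis by (intro exI)
  qed
  from someI_ex[OF this, folded F1_def] have "\<exists>g1. F1_spec j (F1 j) g1" .
  from someI_ex[OF this, folded G1_def] have "F1_spec j (F1 j) (G1 j)" .
  note spec = this[unfolded F1_spec_def]
  show "F1 j holomorphic_on S" by (rule spec[THEN conjunct1])
  note spec = spec[THEN conjunct2]
  show "germ1 S lam (G1 j) (\<lambda>x. x powr \<rho>1 * w j x)" by (rule spec[THEN conjunct1])
  note spec = spec[THEN conjunct2]
  show "fps_nth (G1 j) 0 = fps_nth (gw j) 0" by (rule spec[THEN conjunct1])
  note spec = spec[THEN conjunct2]
  show "germ1 S (lam + - a0) (Efps (- a0) lam (G1 j)) (F1 j)" by (rule spec[THEN conjunct1])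
  show "germ0 S {1..q} (\<lambda>k. - 1 - \<mu> k) (\<lambda>k. Gq (- a0) (\<rho>1 - \<mu> k) * cc j k) (F1 j)" by (rule spec[THEN conjunct2])
qed

text \<open>Write D for x d/dx. The function f = x^\<rho>1 w satisfies the equation of w with D -
  \<rho>1 in place of D. Since D F1 corresponds to (D - a0) f and a0 = 1 + \<rho>1, this operator
  becomes D + 1 on the left; on the right \<open>Epair_mult_x\<close> carries the factor x across
  and yields D + 1 + a0.\<close>

lemma F1_ode:
  assumes j: "j < n" and x: "x \<in> S"
  shows "(\<Sum>l<n. a j l * F1 l x) + (x * deriv (F1 j) x + F1 j x) = \<kappa> j * (x * (x * deriv (F1 j) x + (1 + a0) * F1 j x))"
proof -
  define f where "f = (\<lambda>j x. x powr \<rho>1 * w j x)"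
  have g: "germ1 S lam (G1 j) (f j)" if "j < n" for j unfolding f_def by (rule F1(2)[OF that])
  have fh: "f j holomorphic_on S" if "j < n" for j unfolding f_def by (intro holomorphic_powr_times w_hol that)
  have lam1: "lam - 1 \<notin> \<int>" by (rule nonint_diff_1[OF lam(1)])
  have p: "Epair (- a0) lam (f j) (F1 j)" if "j < n" for j unfolding Epair_def using g[OF that] F1(4)[OF that] by (intro exI conjI)
  have pth: "Epair (- a0) (lam - 1) (\<lambda>x. x * deriv (f j) x + - a0 * f j x) (\<lambda>x. x * deriv (F1 j) x)" if "j < n" for j
    by (rule Epair_mult_x[OF Epair_deriv[OF p[OF that] lam(1)] _ lam1]) (use g[OF that] in simp)
  have L: "Epair (- a0) (lam - 1) (\<lambda>x. (\<Sum>l<n. a j l * f l x) + ((x * deriv (f j) x + - a0 * f j x) + f j x))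
     (\<lambda>x. (\<Sum>l<n. a j l * F1 l x) + (x * deriv (F1 j) x + F1 j x))"
    by (intro Epair_add Epair_sum Epair_cmult Epair_shift p pth j) auto
  have dx: "deriv (\<lambda>x. x * f j x) x = f j x + x * deriv (f j) x" if "x \<in> S" for x
    using DERIV_mult[OF DERIV_ident deriv_at[OF fh[OF j] that]] by (simp add: DERIV_imp_deriv add.commute mult.commute)
  \<comment> \<open>A factor x can be carried across only in front of the transform of a derivative;
    here that derivative is the one of x f, and its partner is (x d/dx + 1 + a0) F1.\<close>
  have 1: "Epair (- a0) (lam - 1) (deriv (\<lambda>x. x * f j x)) (\<lambda>x. x * deriv (F1 j) x + (1 + a0) * F1 j x)"
    by (rule Epair_cong[OF Epair_add[OF pth[OF j] Epair_cmult[OF Epair_shift[OF p[OF j]], of "1 + a0"]]])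
      (simp_all add: dx algebra_simps)
  have "germ1 S (lam - 1 + 1) ((1 - fps_X) * G1 j) (\<lambda>x. x * f j x)" using germ1_mult_x[OF g[OF j]] by simp
  from Epair_cmult[OF Epair_mult_x[OF 1 this lam1], of "\<kappa> j"]
  have R: "Epair (- a0) (lam - 1) (\<lambda>x. \<kappa> j * (x * deriv (\<lambda>x. x * f j x) x + - a0 * (x * f j x)))
     (\<lambda>x. \<kappa> j * (x * (x * deriv (F1 j) x + (1 + a0) * F1 j x)))" .
  show ?thesis
  proof (rule Epair_unique[OF L R _ _ _ x])
    fix x assume x: "x \<in> S"
    have th: "x * deriv (f j) x = x powr \<rho>1 * (\<rho>1 * w j x + x * deriv (w j) x)" unfolding f_def by (rule powr_theta[OF w_hol[OF j] x])
    define D where "D = x * deriv (w j) x"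
    have "(\<Sum>l<n. a j l * f l x) + ((x * deriv (f j) x + - a0 * f j x) + f j x) = x powr \<rho>1 * ((\<Sum>l<n. a j l * w l x) + D)"
      unfolding th D_def[symmetric] by (simp add: f_def a0_def algebra_simps sum_distrib_left)
    also have "\<dots> = \<kappa> j * (x * (x powr \<rho>1 * D))" using w_ode[OF j x] by (simp add: D_def)
    also have "x powr \<rho>1 * D = x * deriv (f j) x - \<rho>1 * f j x" unfolding th D_def[symmetric] by (simp add: f_def algebra_simps)
    also have "\<kappa> j * (x * (x * deriv (f j) x - \<rho>1 * f j x)) = \<kappa> j * (x * deriv (\<lambda>x. x * f j x) x + - a0 * (x * f j x))"
      unfolding dx[OF x] by (simp add: a0_def algebra_simps)
    finally show "(\<Sum>l<n. a j l * f l x) + ((x * deriv (f j) x + - a0 * f j x) + f j x) = \<kappa> j * (x * deriv (\<lambda>x. x * f j x) x + - a0 * (x * f j x))" .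
  next
    show "(\<lambda>x. (\<Sum>l<n. a j l * F1 l x) + (x * deriv (F1 j) x + F1 j x)) holomorphic_on S"
      by (intro holomorphic_intros F1(1)[OF j] F1(1) j S(1)) auto
    show "(\<lambda>x. \<kappa> j * (x * (x * deriv (F1 j) x + (1 + a0) * F1 j x))) holomorphic_on S"
      by (intro holomorphic_intros F1(1)[OF j] F1(1) j S(1))
  qed
qed

lemma proj_a:
  assumes "i < n"
  shows "(\<Sum>j<n. Pi i j * (\<Sum>l<n. a j l * X l)) = mh i * (\<Sum>l<n. Pi i l * X l)"
proof -
  have "(\<Sum>j<n. Pi i j * (\<Sum>l<n. a j l * X l)) = (\<Sum>l<n. (\<Sum>j<n. Pi i j * a j l) * X l)"
    unfolding sum_distrib_left sum_distrib_right by (subst sum.swap) (simp add: mult.assoc)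
  also have "\<dots> = (\<Sum>l<n. mh i * Pi i l * X l)" using Pia[OF assms] by simp
  finally show ?thesis by (simp add: sum_distrib_left mult.assoc)
qed

lemma proj_PPi:
  assumes "i < n"
  shows "(\<Sum>j<n. P i j * (\<Sum>l<n. Pi j l * X l)) = X i"
proof -
  have "(\<Sum>j<n. P i j * (\<Sum>l<n. Pi j l * X l)) = (\<Sum>l<n. (\<Sum>j<n. P i j * Pi j l) * X l)"
    unfolding sum_distrib_left sum_distrib_right by (subst sum.swap) (simp add: mult.assoc)
  also have "\<dots> = (\<Sum>l<n. (if i = l then 1 else 0) * X l)" using PPi[OF assms] by simp
  also have "\<dots> = (\<Sum>l<n. if i = l then X l else 0)" by (intro sum.cong) auto
  finally show ?thesis using assms by simp
qed

text \<open>Projected onto the left eigenvectors, the matrix acting on the coefficients of index m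
  becomes the scalar mh + m + 1, which is nonzero because mh is not an integer. The invertibility of
  P gives back the components.\<close>

lemma recurrence_zero:
  fixes c :: "nat \<Rightarrow> nat \<Rightarrow> complex" and b :: "nat \<Rightarrow> nat \<Rightarrow> complex"
  assumes rec: "\<And>j m. j < n \<Longrightarrow> (\<Sum>l<n. a j l * c l m) + (of_nat m + 1) * c j m = (if m = 0 then 0 else b j m * c j (m - 1))"
  shows "\<forall>j<n. c j m = 0"
proof (induction m rule: less_induct)
  case (less m)
  have E: "(\<Sum>l<n. a j l * c l m) + (of_nat m + 1) * c j m = 0" if "j < n" for j
    using rec[OF that, of m] less[of "m - 1"] that by (cases "m = 0") auto
  show ?case
  proof (intro allI impI)
    fix i assume i: "i < n"
    have z: "(\<Sum>l<n. Pi j l * c l m) = 0" if j: "j < n" for j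
    proof -
      define s where "s = (\<Sum>l<n. Pi j l * c l m)"
      define X where "X = (\<lambda>i. \<Sum>l<n. a i l * c l m)"
      define Y where "Y = (\<lambda>i. c i m)"
      have pa: "(\<Sum>i<n. Pi j i * X i) = mh j * s" unfolding s_def X_def by (rule proj_a[OF j])
      have "0 = (\<Sum>i<n. Pi j i * (X i + (of_nat m + 1) * Y i))" using E by (simp add: X_def Y_def)
      also have "\<dots> = (\<Sum>i<n. Pi j i * X i) + (of_nat m + 1) * (\<Sum>i<n. Pi j i * Y i)"
        by (simp add: distrib_left sum.distrib sum_distrib_left mult_ac)
      also have "\<dots> = (mh j + of_nat (Suc m)) * s" unfolding pa by (simp add: s_def Y_def distrib_right)
      finally have "(mh j + of_nat (Suc m)) * s = 0" by simp
      moreover have "mh j + of_nat (Suc m) \<noteq> 0"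
        using add_nat_nonint[OF mh_nonint[OF j], of "Suc m"] Ints_0 by metis
      ultimately show ?thesis by (simp add: s_def)
    qed
    show "c i m = 0" using proj_PPi[OF i, of "\<lambda>l. c l m"] z by simp
  qed
qed

text \<open>The analytic remainder must be shown to vanish, because multiplication by x^(\<rho>2 +
  1) would turn it into a further singular term. By separation it satisfies the equation of F1 on
  its own, which gives the recursion.\<close>

lemma F1_singular:
  assumes j: "j < n"
  shows "\<exists>h. (\<forall>k\<in>{1..q}. h k analytic_on {0} \<and> h k 0 = Gq (- a0) (\<rho>1 - \<mu> k) * cc j k) \<and>
    (\<forall>\<^sub>F x in at 0 within S. F1 j x = (\<Sum>k\<in>{1..q}. x powr (- 1 - \<mu> k) * h k x))"
proof -
  define I where "I = insert None (Some ` {1..q})"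
  define \<beta> where "\<beta> = (\<lambda>k. - 1 - \<mu> k)"
  define Q where "Q = (\<lambda>j h r. (\<forall>k\<in>{1..q}. h k analytic_on {0} \<and> h k 0 = Gq (- a0) (\<rho>1 - \<mu> k) * cc j k \<and>
      component I (with0 \<beta>) (Some k) (h k) (F1 j)) \<and> r analytic_on {0} \<and>
    (\<forall>\<^sub>F x in at 0 within S. F1 j x = (\<Sum>k\<in>{1..q}. x powr \<beta> k * h k x) + r x) \<and> component I (with0 \<beta>) None r (F1 j))"
  have "\<exists>h r. Q j h r" if "j < n" for j
    unfolding Q_def I_def \<beta>_def by (rule germ0_component[OF F1(5)[OF that] finite_atLeastAtMost])
  then obtain h r where "\<And>j. j < n \<Longrightarrow> Q j (h j) (r j)" by metis
  then have h: "\<And>j. j < n \<Longrightarrow> \<forall>k\<in>{1..q}. h j k analytic_on {0} \<and> h j k 0 = Gq (- a0) (\<rho>1 - \<mu> k) * cc j k"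
    "\<And>j. j < n \<Longrightarrow> r j analytic_on {0}"
    "\<And>j. j < n \<Longrightarrow> \<forall>\<^sub>F x in at 0 within S. F1 j x = (\<Sum>k\<in>{1..q}. x powr \<beta> k * h j k x) + r j x"
    "\<And>j. j < n \<Longrightarrow> component I (with0 \<beta>) None (r j) (F1 j)" unfolding Q_def by simp_all
  define R where "R = (\<lambda>j. fps_expansion (r j) 0)"
  have R: "r j has_fps_expansion R j" if "j < n" for j
    unfolding R_def by (rule analytic_at_imp_has_fps_expansion_0[OF h(2)[OF that]])
  have fI: "finite I" by (simp add: I_def)
  have rec: "(\<Sum>l<n. a j l * fps_nth (R l) m) + (of_nat m + 1) * fps_nth (R j) m =
     (if m = 0 then 0 else \<kappa> j * (of_nat m + a0) * fps_nth (R j) (m - 1))" if j: "j < n" for j m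
  proof -
    have th: "component I (with0 \<beta>) None (\<lambda>x. x * deriv (r j) x) (\<lambda>x. x * deriv (F1 j) x)"
      using component_theta[OF h(4)[OF j] fI] by (simp add: with0_def)
    define f1 where "f1 = (\<lambda>x. \<Sum>l<n. a j l * F1 l x)"
    define p1 where "p1 = (\<lambda>x. \<Sum>l<n. a j l * r l x)"
    define f2 where "f2 = (\<lambda>x. x * deriv (F1 j) x)"
    define p2 where "p2 = (\<lambda>x. x * deriv (r j) x)"
    have "component I (with0 \<beta>) None (\<lambda>x. a j l * r l x) (\<lambda>x. a j l * F1 l x)" if "l < n" for l
      by (rule component_cmult[OF h(4)[OF that]])
    then have c1: "component I (with0 \<beta>) None p1 f1"
      unfolding p1_def f1_def by (intro component_sum) simp
    note th = th[folded p2_def f2_def]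
    have c2: "component I (with0 \<beta>) None (\<lambda>x. p2 x + r j x) (\<lambda>x. f2 x + F1 j x)" by (rule component_add[OF th h(4)[OF j]])
    have c3: "component I (with0 \<beta>) None (\<lambda>x. (1 + a0) * r j x) (\<lambda>x. (1 + a0) * F1 j x)" by (rule component_cmult[OF h(4)[OF j]])
    have c4: "component I (with0 \<beta>) None (\<lambda>x. p2 x + (1 + a0) * r j x) (\<lambda>x. f2 x + (1 + a0) * F1 j x)" by (rule component_add[OF th c3])
    have c5: "component I (with0 \<beta>) None (\<lambda>x. x * (p2 x + (1 + a0) * r j x)) (\<lambda>x. x * (f2 x + (1 + a0) * F1 j x))"
    proof -
      have id: "(\<lambda>x::complex. x) analytic_on {0}" by (rule analytic_on_ident)
      from component_mult[OF c4 id] show ?thesis .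
    qed
    have c6: "component I (with0 \<beta>) None (\<lambda>x. - \<kappa> j * (x * (p2 x + (1 + a0) * r j x))) (\<lambda>x. - \<kappa> j * (x * (f2 x + (1 + a0) * F1 j x)))"
      by (rule component_cmult[OF c5])
    have c7: "component I (with0 \<beta>) None (\<lambda>x. p1 x + (p2 x + r j x)) (\<lambda>x. f1 x + (f2 x + F1 j x))" by (rule component_add[OF c1 c2])
    have "component I (with0 \<beta>) None
       (\<lambda>x. (p1 x + (p2 x + r j x)) + - \<kappa> j * (x * (p2 x + (1 + a0) * r j x)))
       (\<lambda>x. (f1 x + (f2 x + F1 j x)) + - \<kappa> j * (x * (f2 x + (1 + a0) * F1 j x)))" by (rule component_add[OF c7 c6])
    note this[unfolded p1_def p2_def f1_def f2_def]
    then have ev: "\<forall>\<^sub>F x in nhds 0. ((\<Sum>l<n. a j l * r l x) + (x * deriv (r j) x + r j x)) + - \<kappa> j * (x * (x * deriv (r j) x + (1 + a0) * r j x)) = 0"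
    proof (rule component_eq_0[OF _ fI])
      show "None \<in> I" by (simp add: I_def)
      show "((\<Sum>l<n. a j l * F1 l x) + (x * deriv (F1 j) x + F1 j x)) + - \<kappa> j * (x * (x * deriv (F1 j) x + (1 + a0) * F1 j x)) = 0" if "x \<in> S" for x
        unfolding F1_ode[OF j that] by simp
      show "with0 \<beta> i - with0 \<beta> i' \<notin> \<int>" if "i \<in> I" "i' \<in> I" "i \<noteq> i'" for i i'
      proof (rule with0_distinct[OF _ _ that[unfolded I_def]])
        show "\<beta> k \<notin> \<int>" if "k \<in> {1..q}" for k unfolding \<beta>_def by (rule nonint(4)[OF that])
        show "\<beta> k - \<beta> k' \<notin> \<int>" if "k \<in> {1..q}" "k' \<in> {1..q}" "k \<noteq> k'" for k k'
          using mu(3)[of k' k] that by (simp add: \<beta>_def)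
      qed
    qed
    have "(\<lambda>x. ((\<Sum>l<n. a j l * r l x) + (x * deriv (r j) x + r j x)) + - \<kappa> j * (x * (x * deriv (r j) x + (1 + a0) * r j x))) has_fps_expansion
      ((\<Sum>l<n. fps_const (a j l) * R l) + (fps_X * fps_deriv (R j) + R j)) + fps_const (- \<kappa> j) * (fps_X * (fps_X * fps_deriv (R j) + fps_const (1 + a0) * R j))"
      by (intro fps_expansion_intros R j) auto
    from iffD1[OF has_fps_expansion_cong[OF ev refl] this]
    have "((\<Sum>l<n. fps_const (a j l) * R l) + (fps_X * fps_deriv (R j) + R j)) + fps_const (- \<kappa> j) * (fps_X * (fps_X * fps_deriv (R j) + fps_const (1 + a0) * R j)) = 0"
      by (rule fps_expansion_unique_complex) simp
    then have "fps_nth (((\<Sum>l<n. fps_const (a j l) * R l) + (fps_X * fps_deriv (R j) + R j)) + fps_const (- \<kappa> j) * (fps_X * (fps_X * fps_deriv (R j) + fps_const (1 + a0) * R j))) m = 0"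
      by simp
    moreover have "fps_nth (fps_X * fps_deriv (R j)) m = of_nat m * fps_nth (R j) m" for m by (cases m) simp_all
    ultimately have "(\<Sum>l<n. a j l * fps_nth (R l) m) + (of_nat m * fps_nth (R j) m + fps_nth (R j) m) +
       - \<kappa> j * (if m = 0 then 0 else of_nat (m - 1) * fps_nth (R j) (m - 1) + (1 + a0) * fps_nth (R j) (m - 1)) = 0"
      by (simp only: fps_add_nth fps_sum_nth fps_mult_left_const_nth fps_X_mult_nth)
    then show ?thesis by (cases m) (simp_all add: algebra_simps)
  qed
  have zero: "\<forall>j<n. fps_nth (R j) m = 0" for m
    by (rule recurrence_zero[where c = "\<lambda>j m. fps_nth (R j) m" and b = "\<lambda>j m. \<kappa> j * (of_nat m + a0)"]) (rule rec)
  have "R j = 0" using zero j by (simp add: fps_eq_iff)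
  then have rz: "\<forall>\<^sub>F x in nhds 0. r j x = 0" using R[OF j] by (simp only: has_fps_expansion_0_iff)
  have rz': "\<forall>\<^sub>F x in at 0 within S. r j x = 0" by (rule eventually_at_within_of_nhds[OF rz])
  have "\<forall>\<^sub>F x in at 0 within S. F1 j x = (\<Sum>k\<in>{1..q}. x powr \<beta> k * h j k x)"
    using h(3)[OF j] rz'
  proof eventually_elim
    case (elim x)
    show ?case unfolding elim(1) elim(2) by (rule add_0_right)
  qed
  with h(1)[OF j] have "(\<forall>k\<in>{1..q}. h j k analytic_on {0} \<and> h j k 0 = Gq (- a0) (\<rho>1 - \<mu> k) * cc j k) \<and>
    (\<forall>\<^sub>F x in at 0 within S. F1 j x = (\<Sum>k\<in>{1..q}. x powr \<beta> k * h j k x))" by (rule conjI)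
  then show ?thesis unfolding \<beta>_def by (rule exI[of _ "h j"])
qed

end

lemma sum_lessThan_add: "(\<Sum>l<n + k. f l) = (\<Sum>l<n. f l) + (\<Sum>l<k. f (n + l :: nat) :: complex)"
  by (induction k) (simp_all add: add.assoc)

section \<open>Second transform and the extended system\<close>

context okubo
begin

definition "f2 j = (\<lambda>x. x powr (\<rho>2 + 1) * F1 j x)"

definition "F2_spec j F g2 \<longleftrightarrow> F holomorphic_on S \<and> germ1 S (lam + - a0) g2 (f2 j) \<and>
    fps_nth g2 0 = Gamma (lam + 1) * rGamma (lam + 1 + - a0) * fps_nth (gw j) 0 \<and>
    germ1 S (lam + - a0 + a0) (Efps a0 (lam + - a0) g2) F \<and>
    germ0 S {1..<q} (\<lambda>k. (\<rho>1 + \<rho>2 - \<mu> k) + 1) (\<lambda>k. Gq a0 (\<rho>2 - \<mu> k) * (Gq (- a0) (\<rho>1 - \<mu> k) * cc j k)) F"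

definition "F2 j = (SOME F. \<exists>g2. F2_spec j F g2)"
definition "G2 j = (SOME g2. F2_spec j (F2 j) g2)"

lemma f2_germ0:
  assumes j: "j < n"
  shows "germ0 S {1..<q} (\<lambda>k. \<rho>2 - \<mu> k) (\<lambda>k. Gq (- a0) (\<rho>1 - \<mu> k) * cc j k) (f2 j)"
proof -
  obtain h where h: "\<forall>k\<in>{1..q}. h k analytic_on {0} \<and> h k 0 = Gq (- a0) (\<rho>1 - \<mu> k) * cc j k"
    "\<forall>\<^sub>F x in at 0 within S. F1 j x = (\<Sum>k\<in>{1..q}. x powr (- 1 - \<mu> k) * h k x)"
    using F1_singular[OF j] by (elim exE conjE)
  have "\<forall>\<^sub>F x in at 0 within S. f2 j x = (\<Sum>k\<in>{1..<q}. x powr (\<rho>2 - \<mu> k) * h k x) + h q x"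
    using h(2) eventually_at_S
  proof eventually_elim
    case (elim x)
    have e: "x powr (\<rho>2 + 1) * x powr (- 1 - \<mu> k) = x powr (\<rho>2 - \<mu> k)" for k by (simp flip: powr_add)
    have "{1..q} = insert q {1..<q}" using q by auto
    then have "(\<Sum>k\<in>{1..q}. x powr (\<rho>2 - \<mu> k) * h k x) = x powr (\<rho>2 - \<mu> q) * h q x + (\<Sum>k\<in>{1..<q}. x powr (\<rho>2 - \<mu> k) * h k x)" by simp
    moreover have "x powr (\<rho>2 - \<mu> q) = 1" using slits(3)[OF elim(2)] by (simp add: rho2)
    moreover have "f2 j x = (\<Sum>k\<in>{1..q}. x powr (\<rho>2 - \<mu> k) * h k x)"
      unfolding f2_def elim(1) sum_distrib_left mult.assoc[symmetric] e ..
    ultimately show ?case by (simp add: add.commute)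
  qed
  then show ?thesis unfolding germ0_def using h(1) q
    by (intro exI[of _ h] exI[of _ "h q"]) simp
qed

lemma F2:
  assumes j: "j < n"
  shows "F2 j holomorphic_on S" "germ1 S (lam + - a0) (G2 j) (f2 j)"
    "fps_nth (G2 j) 0 = Gamma (lam + 1) * rGamma (lam + 1 + - a0) * fps_nth (gw j) 0"
    "germ1 S (lam + - a0 + a0) (Efps a0 (lam + - a0) (G2 j)) (F2 j)"
    "germ0 S {1..<q} (\<lambda>k. (\<rho>1 + \<rho>2 - \<mu> k) + 1) (\<lambda>k. Gq a0 (\<rho>2 - \<mu> k) * (Gq (- a0) (\<rho>1 - \<mu> k) * cc j k)) (F2 j)"
proof -
  obtain g2 where g2: "germ1 S (lam + - a0) g2 (f2 j)" "fps_nth g2 0 = fps_nth (Efps (- a0) lam (G1 j)) 0"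
    using germ1_powr[OF F1(4)[OF j], of "\<rho>2 + 1", folded f2_def] by (elim exE conjE)
  have lead: "fps_nth g2 0 = Gamma (lam + 1) * rGamma (lam + 1 + - a0) * fps_nth (gw j) 0"
    unfolding g2(2) by (simp add: Efps_def F1(3)[OF j])
  have e: "\<rho>2 - \<mu> k + a0 = \<rho>1 + \<rho>2 - \<mu> k + 1" for k by (simp add: a0_def)
  have "\<exists>F. F holomorphic_on S \<and> germ1 S (lam + - a0 + a0) (Efps a0 (lam + - a0) g2) F \<and>
    germ0 S {1..<q} (\<lambda>k. \<rho>2 - \<mu> k + a0) (\<lambda>k. Gq a0 (\<rho>2 - \<mu> k) * (Gq (- a0) (\<rho>1 - \<mu> k) * cc j k)) F"
  proof (rule Euler_transform[OF _ g2(1) f2_germ0[OF j] finite_atLeastLessThan nonint(1)])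
    show "f2 j holomorphic_on S" unfolding f2_def by (rule holomorphic_powr_times[OF F1(1)[OF j]])
    show "lam + - a0 \<notin> \<int>" "lam + - a0 + a0 \<notin> \<int>" using nonint(3) lam(1) by simp_all
    show "\<rho>2 - \<mu> k \<notin> \<int>" if "k \<in> {1..<q}" for k unfolding rho2 using mu(3)[of q k] that by simp
    show "\<rho>2 - \<mu> k + a0 \<notin> \<int>" if "k \<in> {1..<q}" for k
      unfolding e using add_nat_nonint[OF mu(4)[OF that], of 1] by simp
  qed
  then obtain F where F: "F holomorphic_on S" "germ1 S (lam + - a0 + a0) (Efps a0 (lam + - a0) g2) F"
    "germ0 S {1..<q} (\<lambda>k. \<rho>2 - \<mu> k + a0) (\<lambda>k. Gq a0 (\<rho>2 - \<mu> k) * (Gq (- a0) (\<rho>1 - \<mu> k) * cc j k)) F" by (elim exE conjE)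
  have "F2_spec j F g2" unfolding F2_spec_def using F(1) g2(1) lead F(2) F(3)[unfolded e] by (intro conjI)
  then have "\<exists>g2. F2_spec j F g2" by (rule exI)
  then have "\<exists>F g2. F2_spec j F g2" by (rule exI[of _ F])
  from someI_ex[OF this, folded F2_def] have "\<exists>g1. F2_spec j (F2 j) g1" .
  from someI_ex[OF this, folded G2_def] have "F2_spec j (F2 j) (G2 j)" .
  note spec = this[unfolded F2_spec_def]
  show "F2 j holomorphic_on S" by (rule spec[THEN conjunct1])
  note spec = spec[THEN conjunct2]
  show "germ1 S (lam + - a0) (G2 j) (f2 j)" by (rule spec[THEN conjunct1])
  note spec = spec[THEN conjunct2]
  show "fps_nth (G2 j) 0 = Gamma (lam + 1) * rGamma (lam + 1 + - a0) * fps_nth (gw j) 0" by (rule spec[THEN conjunct1])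
  note spec = spec[THEN conjunct2]
  show "germ1 S (lam + - a0 + a0) (Efps a0 (lam + - a0) (G2 j)) (F2 j)" by (rule spec[THEN conjunct1])
  show "germ0 S {1..<q} (\<lambda>k. (\<rho>1 + \<rho>2 - \<mu> k) + 1) (\<lambda>k. Gq a0 (\<rho>2 - \<mu> k) * (Gq (- a0) (\<rho>1 - \<mu> k) * cc j k)) (F2 j)"
    by (rule spec[THEN conjunct2])
qed

lemma F2_deriv: "j < n \<Longrightarrow> deriv (F2 j) holomorphic_on S"
  by (rule holomorphic_deriv[OF F2(1) S(1)])

text \<open>With D = x d/dx the left side is \<kappa> j (D - \<rho>1) (D - \<rho>2) F2 and the right
  side is the derivative of (a + D - 1 - \<rho>1 - \<rho>2) F2. The equation for f2 contains a bare
  factor x, which the transform does not respect. Differentiating once turns x v into (D + 1) v and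
  removes the obstacle, at the price of a second order equation.\<close>

lemma F2_ode:
  assumes j: "j < n" and x: "x \<in> S"
  shows "\<kappa> j * (x * (deriv (F2 j) x + x * deriv (deriv (F2 j)) x - \<rho>2 * deriv (F2 j) x) - \<rho>1 * (x * deriv (F2 j) x - \<rho>2 * F2 j x)) =
    (\<Sum>l<n. a j l * deriv (F2 l) x) + x * deriv (deriv (F2 j)) x - (\<rho>1 + \<rho>2) * deriv (F2 j) x"
proof -
  define lam2 where "lam2 = lam + - a0"
  have l2: "lam2 \<notin> \<int>" using nonint(3) by (simp add: lam2_def)
  have l21: "lam2 - 1 \<notin> \<int>" by (rule nonint_diff_1[OF l2])
  have l22: "lam2 - 1 - 1 \<notin> \<int>" by (rule nonint_diff_1[OF l21])
  have f2h: "f2 j holomorphic_on S" if "j < n" for j unfolding f2_def by (rule holomorphic_powr_times[OF F1(1)[OF that]])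
  have p: "Epair a0 lam2 (f2 j) (F2 j)" if "j < n" for j
    unfolding Epair_def lam2_def by (rule exI[of _ "G2 j"], rule conjI[OF F2(2)[OF that] F2(4)[OF that]])
  have g2: "germ1 S (lam2 - 1 + 1) (G2 j) (f2 j)" if "j < n" for j using F2(2)[OF that] by (simp add: lam2_def)
  have pth: "Epair a0 (lam2 - 1) (\<lambda>x. x * deriv (f2 j) x + a0 * f2 j x) (\<lambda>x. x * deriv (F2 j) x)"
    by (rule Epair_mult_x[OF Epair_deriv[OF p[OF j] l2] g2[OF j] l21])
  \<comment> \<open>\<open>v\<close> is (D + a0 - \<rho>2) f2 with D = x d/dx, and its partner
    \<open>V\<close> is (D - \<rho>2) F2. Because a0 - \<rho>1 = 1, the derivative of x v is (D + a0
    - \<rho>1) v, whose partner is (D - \<rho>1) V.\<close>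
  define v where "v = (\<lambda>x. (x * deriv (f2 j) x + a0 * f2 j x) + - \<rho>2 * f2 j x)"
  define V where "V = (\<lambda>x. x * deriv (F2 j) x + - \<rho>2 * F2 j x)"
  have pv: "Epair a0 (lam2 - 1) v V" unfolding v_def V_def
    by (rule Epair_add[OF pth Epair_cmult[OF Epair_shift[OF p[OF j]]]])
  obtain gv where gv: "germ1 S (lam2 - 1) gv v" using pv unfolding Epair_def by (elim exE conjE)
  then have gv': "germ1 S (lam2 - 1 - 1 + 1) gv v" by simp
  have pvth: "Epair a0 (lam2 - 1 - 1) (\<lambda>x. x * deriv v x + a0 * v x) (\<lambda>x. x * deriv V x)"
    by (rule Epair_mult_x[OF Epair_deriv[OF pv l21] gv' l22])
  have L: "Epair a0 (lam2 - 1 - 1) (\<lambda>x. \<kappa> j * ((x * deriv v x + a0 * v x) + - \<rho>1 * v x)) (\<lambda>x. \<kappa> j * (x * deriv V x + - \<rho>1 * V x))"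
    by (rule Epair_cmult[OF Epair_add[OF pvth Epair_cmult[OF Epair_shift[OF pv]]]])
  define Z where "Z = (\<lambda>x. (\<Sum>l<n. a j l * f2 l x) + ((x * deriv (f2 j) x + a0 * f2 j x) + - (a0 + \<rho>2) * f2 j x))"
  define ZZ where "ZZ = (\<lambda>x. (\<Sum>l<n. a j l * F2 l x) + (x * deriv (F2 j) x + - (a0 + \<rho>2) * F2 j x))"
  have ps: "Epair a0 (lam2 - 1) (\<lambda>x. \<Sum>l<n. a j l * f2 l x) (\<lambda>x. \<Sum>l<n. a j l * F2 l x)"
    by (rule Epair_sum, rule Epair_cmult, rule Epair_shift, rule p, simp)
  have pZ: "Epair a0 (lam2 - 1) Z ZZ" unfolding Z_def ZZ_def
    by (rule Epair_add[OF ps Epair_add[OF pth Epair_cmult[OF Epair_shift[OF p[OF j]]]]])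
  have R: "Epair a0 (lam2 - 1 - 1) (deriv Z) (deriv ZZ)" by (rule Epair_deriv[OF pZ l21])
  have dh: "deriv (f2 j) holomorphic_on S" by (rule holomorphic_deriv[OF f2h[OF j] S(1)])
  have vh: "v holomorphic_on S" unfolding v_def by (intro holomorphic_intros f2h[OF j] dh)
  have Vh: "V holomorphic_on S" unfolding V_def by (intro holomorphic_intros F2(1)[OF j] F2_deriv[OF j])
  have sh: "(\<lambda>x. \<Sum>l<n. a j l * f2 l x) holomorphic_on S"
    by (rule holomorphic_on_sum, rule holomorphic_on_mult[OF holomorphic_on_const f2h], simp)
  have Sh: "(\<lambda>x. \<Sum>l<n. a j l * F2 l x) holomorphic_on S"
    by (rule holomorphic_on_sum, rule holomorphic_on_mult[OF holomorphic_on_const F2(1)], simp)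
  have Zh: "Z holomorphic_on S" unfolding Z_def by (intro holomorphic_on_add[OF sh] holomorphic_intros f2h[OF j] dh)
  have ZZh: "ZZ holomorphic_on S" unfolding ZZ_def by (intro holomorphic_on_add[OF Sh] holomorphic_intros F2(1)[OF j] F2_deriv[OF j])
  have Zv: "Z y = \<kappa> j * (y * v y)" if y: "y \<in> S" for y
  proof -
    define X where "X = y powr (\<rho>2 + 1)"
    define D where "D = y * deriv (F1 j) y"
    have th: "y * deriv (f2 j) y = X * ((\<rho>2 + 1) * F1 j y + D)" unfolding f2_def X_def D_def by (rule powr_theta[OF F1(1)[OF j] y])
    have f: "f2 l y = X * F1 l y" for l by (simp add: f2_def X_def)
    define A where "A = (\<Sum>l<n. a j l * F1 l y)"
    have "(\<Sum>l<n. a j l * f2 l y) = (\<Sum>l<n. X * (a j l * F1 l y))"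
    proof (rule sum.cong[OF refl])
      fix l show "a j l * f2 l y = X * (a j l * F1 l y)" unfolding f by (rule mult.left_commute)
    qed
    then have s': "(\<Sum>l<n. a j l * f2 l y) = X * A" unfolding A_def sum_distrib_left .
    have o: "A + (D + F1 j y) = \<kappa> j * (y * (D + (1 + a0) * F1 j y))" unfolding A_def D_def by (rule F1_ode[OF j y])
    have "Z y = X * (A + (D + F1 j y))" unfolding Z_def th s' f[of j] by (simp add: algebra_simps)
    also have "\<dots> = \<kappa> j * (y * v y)" unfolding o v_def th f[of j] by (simp add: algebra_simps)
    finally show ?thesis .
  qed
  have fe: "\<kappa> j * ((y * deriv v y + a0 * v y) + - \<rho>1 * v y) = deriv Z y" if y: "y \<in> S" for y
  proof -
    have "deriv Z y = deriv (\<lambda>y. \<kappa> j * (y * v y)) y"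
      by (rule complex_derivative_transform_within_open[OF Zh _ S(1) y Zv]) (intro holomorphic_intros vh)
    also have "\<dots> = \<kappa> j * (v y + y * deriv v y)"
      by (rule DERIV_imp_deriv, rule DERIV_cong[OF DERIV_cmult[OF DERIV_mult[OF DERIV_ident deriv_at[OF vh y]]]]) simp
    finally show ?thesis by (simp add: a0_def algebra_simps)
  qed
  have main: "\<kappa> j * (x * deriv V x + - \<rho>1 * V x) = deriv ZZ x"
  proof (rule Epair_unique[OF L R _ _ _ x])
    show "\<kappa> j * ((y * deriv v y + a0 * v y) + - \<rho>1 * v y) = deriv Z y" if "y \<in> S" for y by (rule fe[OF that])
    show "(\<lambda>x. \<kappa> j * (x * deriv V x + - \<rho>1 * V x)) holomorphic_on S"
      by (intro holomorphic_on_mult holomorphic_on_add holomorphic_on_const holomorphic_on_ident Vh holomorphic_deriv[OF Vh S(1)])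
    show "deriv ZZ holomorphic_on S" by (rule holomorphic_deriv[OF ZZh S(1)])
  qed
  have dV: "deriv V x = deriv (F2 j) x + x * deriv (deriv (F2 j)) x - \<rho>2 * deriv (F2 j) x"
    unfolding V_def
    by (rule DERIV_imp_deriv, rule DERIV_cong[OF DERIV_add[OF DERIV_mult[OF DERIV_ident deriv_at[OF F2_deriv[OF j] x]]
       DERIV_cmult[OF deriv_at[OF F2(1)[OF j] x]]]]) simp
  have dS: "((\<lambda>x. \<Sum>l<n. a j l * F2 l x) has_field_derivative (\<Sum>l<n. a j l * deriv (F2 l) x)) (at x)"
    by (rule DERIV_sum, rule DERIV_cmult, rule deriv_at[OF F2(1) x], simp)
  have dZ: "deriv ZZ x = (\<Sum>l<n. a j l * deriv (F2 l) x) + (deriv (F2 j) x + x * deriv (deriv (F2 j)) x - (a0 + \<rho>2) * deriv (F2 j) x)"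
    unfolding ZZ_def
    by (rule DERIV_imp_deriv, rule DERIV_cong[OF DERIV_add[OF dS DERIV_add[OF DERIV_mult[OF DERIV_ident deriv_at[OF F2_deriv[OF j] x]]
       DERIV_cmult[OF deriv_at[OF F2(1)[OF j] x]]]]]) (simp add: algebra_simps)
  show ?thesis using main[unfolded dV dZ] by (simp add: V_def a0_def algebra_simps)
qed

text \<open>Solved from the upper rows of the extended system with upper part \<kappa> F2: the
  vector P^(-1) ((\<kappa> x - 1) F2' - a \<kappa> F2), in which P^(-1) a is replaced by
  \<open>mh\<close> P^(-1).\<close>

definition "v j = (\<lambda>x. x * (\<Sum>l<n. Pi j l * (\<kappa> l * deriv (F2 l) x)) + (- 1 * (\<Sum>l<n. Pi j l * deriv (F2 l) x) +
   - mh j * (\<Sum>l<n. Pi j l * (\<kappa> l * F2 l x))))"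

lemma sum_hol: "(\<And>l. l < n \<Longrightarrow> X l holomorphic_on S) \<Longrightarrow> (\<lambda>x. \<Sum>l<n. b l * (d l * X l x)) holomorphic_on S"
  by (rule holomorphic_on_sum, rule holomorphic_on_mult[OF holomorphic_on_const holomorphic_on_mult[OF holomorphic_on_const]], simp)

lemma sum_hol': "(\<And>l. l < n \<Longrightarrow> X l holomorphic_on S) \<Longrightarrow> (\<lambda>x. \<Sum>l<n. b l * X l x) holomorphic_on S"
  by (rule holomorphic_on_sum, rule holomorphic_on_mult[OF holomorphic_on_const], simp)

lemma v_hol: "v j holomorphic_on S"
  unfolding v_def by (intro holomorphic_on_add holomorphic_on_mult holomorphic_on_ident holomorphic_on_const sum_hol sum_hol' F2(1) F2_deriv)

lemma F2_germ1: "j < n \<Longrightarrow> germ1 S lam (Efps a0 (lam + - a0) (G2 j)) (F2 j)"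
  using F2(4)[of j] by simp

text \<open>The derivatives of F2 have exponent lam - 1; the part without a derivative is shifted
  down to it.\<close>

lemma v_germ1: "\<exists>g. germ1 S (lam - 1) g (v j)"
proof -
  define Gd where "Gd = (\<lambda>l. Abs_fps (\<lambda>k. - (lam + of_nat k) * fps_nth (Efps a0 (lam + - a0) (G2 l)) k))"
  have d: "germ1 S (lam - 1) (Gd l) (deriv (F2 l))" if "l < n" for l unfolding Gd_def by (rule germ1_deriv[OF F2_germ1[OF that]])
  have e: "germ1 S (lam - 1) (fps_X * Efps a0 (lam + - a0) (G2 l)) (F2 l)" if "l < n" for l by (rule germ1_shift[OF F2_germ1[OF that]])
  have 1: "germ1 S (lam - 1) (\<Sum>l<n. fps_const (Pi j l) * (fps_const (\<kappa> l) * Gd l)) (\<lambda>x. \<Sum>l<n. Pi j l * (\<kappa> l * deriv (F2 l) x))"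
    by (rule germ1_sum, rule germ1_cmult[OF germ1_cmult[OF d]], simp)
  have 2: "germ1 S (lam - 1) (\<Sum>l<n. fps_const (Pi j l) * Gd l) (\<lambda>x. \<Sum>l<n. Pi j l * deriv (F2 l) x)"
    by (rule germ1_sum, rule germ1_cmult[OF d], simp)
  have 3: "germ1 S (lam - 1) (\<Sum>l<n. fps_const (Pi j l) * (fps_const (\<kappa> l) * (fps_X * Efps a0 (lam + - a0) (G2 l)))) (\<lambda>x. \<Sum>l<n. Pi j l * (\<kappa> l * F2 l x))"
    by (rule germ1_sum, rule germ1_cmult[OF germ1_cmult[OF e]], simp)
  show ?thesis unfolding v_def
    by (rule exI, rule germ1_add[OF germ1_mult_x[OF 1] germ1_add[OF germ1_cmult[OF 2] germ1_cmult[OF 3]]])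
qed

lemma sum_lin: "(\<Sum>j<n. p j * (Y j + x * Z j - r * W j)) = (\<Sum>j<n. p j * Y j) + x * (\<Sum>j<n. p j * Z j) - r * (\<Sum>j<n. p j * W j)"
  for x r :: complex
  by (simp add: algebra_simps sum.distrib sum_subtractf sum_distrib_left)

lemma sum_lin_theta: "(\<Sum>j<n. p j * (b j * (x * (Y j + x * Z j - r * Y j) - s * (x * Y j - r * W j)))) =
    x * ((\<Sum>j<n. p j * (b j * Y j)) + x * (\<Sum>j<n. p j * (b j * Z j)) - r * (\<Sum>j<n. p j * (b j * Y j)))
    - s * (x * (\<Sum>j<n. p j * (b j * Y j)) - r * (\<Sum>j<n. p j * (b j * W j)))"
  for x r s :: complex
  by (simp add: algebra_simps sum.distrib sum_subtractf sum_distrib_left)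

text \<open>Projection onto the left eigenvector j turns the matrix a in the second order equation
  of F2 into the scalar \<open>mh j\<close>. The outcome is exactly the lower row of the extended
  system.\<close>

lemma v_ode:
  assumes j: "j < n" and x: "x \<in> S"
  shows "x * deriv (v j) x = - (mh j - \<rho>1) * (mh j - \<rho>2) * (\<Sum>l<n. Pi j l * (\<kappa> l * F2 l x)) + (\<rho>1 + \<rho>2 - mh j) * v j x"
proof -
  define A where "A = (\<Sum>l<n. Pi j l * (\<kappa> l * F2 l x))"
  define B where "B = (\<Sum>l<n. Pi j l * (\<kappa> l * deriv (F2 l) x))"
  define C where "C = (\<Sum>l<n. Pi j l * (\<kappa> l * deriv (deriv (F2 l)) x))"
  define D where "D = (\<Sum>l<n. Pi j l * deriv (F2 l) x)"
  define E where "E = (\<Sum>l<n. Pi j l * deriv (deriv (F2 l)) x)"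
  have "(\<Sum>i<n. Pi j i * (\<kappa> i * (x * (deriv (F2 i) x + x * deriv (deriv (F2 i)) x - \<rho>2 * deriv (F2 i) x) - \<rho>1 * (x * deriv (F2 i) x - \<rho>2 * F2 i x)))) =
    (\<Sum>i<n. Pi j i * ((\<Sum>l<n. a i l * deriv (F2 l) x) + x * deriv (deriv (F2 i)) x - (\<rho>1 + \<rho>2) * deriv (F2 i) x))"
    by (rule sum.cong[OF refl]) (simp only: F2_ode[OF _ x] lessThan_iff)
  then have eq: "x * (B + x * C - \<rho>2 * B) - \<rho>1 * (x * B - \<rho>2 * A) = mh j * D + x * E - (\<rho>1 + \<rho>2) * D"
    unfolding sum_lin sum_lin_theta proj_a[OF j] A_def B_def C_def D_def E_def .
  have dA: "((\<lambda>x. \<Sum>l<n. Pi j l * (\<kappa> l * F2 l x)) has_field_derivative B) (at x)"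
    unfolding B_def by (rule DERIV_sum, rule DERIV_cmult, rule DERIV_cmult, rule deriv_at[OF F2(1) x], simp)
  have dB: "((\<lambda>x. \<Sum>l<n. Pi j l * (\<kappa> l * deriv (F2 l) x)) has_field_derivative C) (at x)"
    unfolding C_def by (rule DERIV_sum, rule DERIV_cmult, rule DERIV_cmult, rule deriv_at[OF F2_deriv x], simp)
  have dD: "((\<lambda>x. \<Sum>l<n. Pi j l * deriv (F2 l) x) has_field_derivative E) (at x)"
    unfolding E_def by (rule DERIV_sum, rule DERIV_cmult, rule deriv_at[OF F2_deriv x], simp)
  have dv: "deriv (v j) x = B + x * C - E - mh j * B"
    unfolding v_def by (rule DERIV_imp_deriv, rule DERIV_cong[OF DERIV_add[OF DERIV_mult[OF DERIV_ident dB] DERIV_add[OF DERIV_cmult[OF dD] DERIV_cmult[OF dA]]]])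
      (simp add: B_def)
  have vx: "v j x = x * B - D - mh j * A" by (simp add: v_def A_def B_def D_def)
  have "x * (B + x * C - E - mh j * B) - (- (mh j - \<rho>1) * (mh j - \<rho>2) * A + (\<rho>1 + \<rho>2 - mh j) * (x * B - D - mh j * A)) =
     (x * (B + x * C - \<rho>2 * B) - \<rho>1 * (x * B - \<rho>2 * A)) - (mh j * D + x * E - (\<rho>1 + \<rho>2) * D)"
    by (simp add: algebra_simps)
  then show ?thesis unfolding dv vx A_def[symmetric] eq by simp
qed

text \<open>For mh j = \<rho>2 the row reduces to x v' = \<rho>1 v, whose solutions are regular at
  1, whereas the germ of v there has the non-integral exponent lam - 1. This is how the solution
  comes to live in the reduced system.\<close>

lemma v_zero:
  assumes "nv \<le> j" "j < n" "x \<in> S"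
  shows "v j x = 0"
proof -
  obtain g where g: "germ1 S (lam - 1) g (v j)" using v_germ1[of j] by (elim exE)
  show ?thesis
  \<comment> \<open>The scalar equation is read as a system with one row, whose singular point 0
    differs from 1.\<close>
  proof (rule okubo_germ1[where U = "\<lambda>_. v j" and N = "Suc 0" and lam = "lam - 1" and T = "\<lambda>_. 0" and M = "\<lambda>_ _. \<rho>1" and G = "\<lambda>_. g" and j = 0])
    show "lam - 1 \<notin> \<int>" by (rule nonint_diff_1[OF lam(1)])
    show "(x - 0) * deriv (v j) x = (\<Sum>l<Suc 0. \<rho>1 * v j x)" if "x \<in> S" for x
      using v_ode[OF assms(2) that] mh_last[OF assms(1,2)] by simp
  qed (use v_hol g assms(3) in simp_all)
qed

text \<open>The definition of v multiplied by P. The sum may stop at nv because the remaining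
  components vanish.\<close>

lemma v_upper:
  assumes j: "j < n" and x: "x \<in> S"
  shows "(x - 1 / \<kappa> j) * (\<kappa> j * deriv (F2 j) x) = (\<Sum>l<n. a j l * (\<kappa> l * F2 l x)) + (\<Sum>l<nv. P j l * v l x)"
proof -
  have "(\<Sum>l<nv. P j l * v l x) = (\<Sum>l<n. P j l * v l x)"
    by (rule sum.mono_neutral_left) (use nv v_zero[OF _ _ x] in auto)
  also have "\<dots> = (\<Sum>l<n. P j l * (x * (\<Sum>i<n. Pi l i * (\<kappa> i * deriv (F2 i) x)) + (- 1 * (\<Sum>i<n. Pi l i * deriv (F2 i) x) +
       - 1 * (\<Sum>i<n. Pi l i * (\<Sum>m<n. a i m * (\<kappa> m * F2 m x))))))"
    by (rule sum.cong[OF refl]) (simp add: v_def proj_a)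
  also have "\<dots> = x * (\<Sum>l<n. P j l * (\<Sum>i<n. Pi l i * (\<kappa> i * deriv (F2 i) x))) + (- 1 * (\<Sum>l<n. P j l * (\<Sum>i<n. Pi l i * deriv (F2 i) x)) +
       - 1 * (\<Sum>l<n. P j l * (\<Sum>i<n. Pi l i * (\<Sum>m<n. a i m * (\<kappa> m * F2 m x)))))"
    by (simp only: distrib_left sum.distrib mult.left_commute[of _ x] mult.left_commute[of _ "- 1"] sum_distrib_left[symmetric])
  also have "\<dots> = x * (\<kappa> j * deriv (F2 j) x) - deriv (F2 j) x - (\<Sum>m<n. a j m * (\<kappa> m * F2 m x))"
    unfolding proj_PPi[OF j] by simp
  finally show ?thesis using \<kappa>[OF j] by (simp add: algebra_simps)
qed

definition "T j = (if j < n then 1 / \<kappa> j else 0)"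

definition "M j l = (if j < n then (if l < n then a j l else P j (l - n))
   else if l < n then - (mh (j - n) - \<rho>1) * (mh (j - n) - \<rho>2) * Pi (j - n) l
   else if l = j then \<rho>1 + \<rho>2 - mh (j - n) else 0)"

text \<open>The factor \<kappa> j turns (\<kappa> j x - 1) F2' into (x - 1 / \<kappa> j) times the
  derivative of the component, the form of the extended system.\<close>

definition "U j = (if j < n then (\<lambda>x. \<kappa> j * F2 j x) else v (j - n))"

definition "Gfac k = Gamma (\<mu> k + 1) * Gamma (\<mu> k - \<rho>1 - \<rho>2) * rGamma (\<mu> k - \<rho>1) * rGamma (\<mu> k - \<rho>2)"

lemma U_hol: "j < n + nv \<Longrightarrow> U j holomorphic_on S"
  unfolding U_def using F2(1)[of j] v_hol by (cases "j < n") (auto intro!: holomorphic_intros)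

lemma U_ode:
  assumes "j < n + nv" "x \<in> S"
  shows "(x - T j) * deriv (U j) x = (\<Sum>l<n + nv. M j l * U l x)"
proof (cases "j < n")
  case True
  have "deriv (U j) x = \<kappa> j * deriv (F2 j) x"
    using True by (simp add: U_def DERIV_imp_deriv[OF DERIV_cmult[OF deriv_at[OF F2(1)[OF True] assms(2)]]])
  then show ?thesis using v_upper[OF True assms(2)] True by (simp add: sum_lessThan_add T_def M_def U_def)
next
  case False
  have "(\<Sum>l<nv. M j (n + l) * U (n + l) x) = (\<Sum>l<nv. if l = j - n then (\<rho>1 + \<rho>2 - mh (j - n)) * v (j - n) x else 0)"
    by (rule sum.cong[OF refl]) (use False in \<open>auto simp: M_def U_def\<close>)
  also have "\<dots> = (\<rho>1 + \<rho>2 - mh (j - n)) * v (j - n) x" proof -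
    have "j - n < nv" using assms(1) False by simp
    then show ?thesis by simp
  qed
  finally have 2: "(\<Sum>l<nv. M j (n + l) * U (n + l) x) = (\<rho>1 + \<rho>2 - mh (j - n)) * v (j - n) x" .
  have 1: "(\<Sum>l<n. M j l * U l x) = - (mh (j - n) - \<rho>1) * (mh (j - n) - \<rho>2) * (\<Sum>l<n. Pi (j - n) l * (\<kappa> l * F2 l x))"
    unfolding sum_distrib_left by (rule sum.cong[OF refl]) (use False in \<open>simp add: M_def U_def mult.assoc\<close>)
  have "j - n < n" using assms(1) False nv by simp
  from v_ode[OF this assms(2)] show ?thesis unfolding sum_lessThan_add 1 2 using False by (simp add: T_def U_def)
qed

text \<open>The two transforms have opposite orders, so their Gamma quotients cancel on the leading
  coefficient and the starting vector of w is recovered. The germ is written with exponent lam - 1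
  and a factor X to match the lower components.\<close>

lemma U_germ1_lead:
  assumes j: "j < n"
  shows "germ1 S (lam - 1) (fps_const (\<kappa> j) * (fps_X * Efps a0 (lam + - a0) (G2 j))) (U j)"
    "fps_nth (Efps a0 (lam + - a0) (G2 j)) 0 = fps_nth (gw j) 0"
proof -
  show "germ1 S (lam - 1) (fps_const (\<kappa> j) * (fps_X * Efps a0 (lam + - a0) (G2 j))) (U j)"
    using germ1_cmult[OF germ1_shift[OF F2_germ1[OF j]]] j by (simp add: U_def)
  define z where "z = lam + 1 - a0"
  have "z = lam - a0 + of_nat 1" by (simp add: z_def)
  then have z: "z \<notin> \<int>" using add_nat_nonint[OF nonint(3), of 1] by (simp only: not_False_eq_True)
  have l: "lam + 1 \<notin> \<int>" using add_nat_nonint[OF lam(1), of 1] by simp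
  have 1: "Gamma z * rGamma z = 1" using nonint_not_nonpos[OF z] by (simp add: rGamma_inverse_Gamma Gamma_eq_zero_iff)
  have 2: "Gamma (lam + 1) * rGamma (lam + 1) = 1" using nonint_not_nonpos[OF l] by (simp add: rGamma_inverse_Gamma Gamma_eq_zero_iff)
  have e: "lam + - a0 + 1 = z" "lam + 1 + - a0 = z" "z + a0 = lam + 1" by (simp_all add: z_def)
  have "fps_nth (Efps a0 (lam + - a0) (G2 j)) 0 = Gamma (lam + - a0 + 1) * rGamma (lam + - a0 + 1 + a0) * fps_nth (G2 j) 0"
    by (simp add: Efps_def)
  also have "\<dots> = (Gamma z * rGamma z) * (Gamma (lam + 1) * rGamma (lam + 1)) * fps_nth (gw j) 0"
    unfolding F2(3)[OF j] e by (simp only: mult_ac)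
  finally show "fps_nth (Efps a0 (lam + - a0) (G2 j)) 0 = fps_nth (gw j) 0" unfolding 1 2 by simp
qed

lemma U_germ0_upper:
  assumes j: "j < n"
  shows "germ0 S {1..<q} (\<lambda>k. \<rho>1 + \<rho>2 - \<mu> k) (\<lambda>k. 0) (U j)"
  using germ0_cmult[OF germ0_lower[OF F2(5)[OF j]], of "\<kappa> j"] j by (simp add: U_def)

text \<open>The first factor comes from differentiating the term of exponent \<rho>1 + \<rho>2 -
  \<mu> k + 1 in - F2', the other two from the transforms. The functional equation of Gamma absorbs
  the first one.\<close>

lemma Gq_Gfac:
  assumes "k \<in> {1..<q}"
  shows "- ((\<rho>1 + \<rho>2 - \<mu> k) + 1) * (Gq a0 (\<rho>2 - \<mu> k) * Gq (- a0) (\<rho>1 - \<mu> k)) = Gfac k"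
proof -
  define z where "z = \<mu> k - \<rho>1 - \<rho>2 - 1"
  have "- (\<rho>1 + \<rho>2 - \<mu> k) \<notin> \<int>" using mu(4)[OF assms] by (simp only: minus_in_Ints_iff not_False_eq_True)
  then have "\<mu> k - \<rho>1 - \<rho>2 \<notin> \<int>" by (simp add: algebra_simps)
  then have z: "z \<notin> \<int>" unfolding z_def by (rule nonint_diff_1)
  have "Gamma (z + 1) = z * Gamma z" by (rule Gamma_plus1[OF nonint_not_nonpos[OF z]])
  then have 1: "z * Gamma z = Gamma (\<mu> k - \<rho>1 - \<rho>2)" by (simp add: z_def)
  have e: "\<mu> k - \<rho>2 - a0 = z" "\<mu> k - \<rho>1 - - a0 = \<mu> k + 1" "- (\<rho>2 - \<mu> k) = \<mu> k - \<rho>2" "- (\<rho>1 - \<mu> k) = \<mu> k - \<rho>1"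
    "- ((\<rho>1 + \<rho>2 - \<mu> k) + 1) = z" by (simp_all add: z_def a0_def)
  have "- ((\<rho>1 + \<rho>2 - \<mu> k) + 1) * (Gq a0 (\<rho>2 - \<mu> k) * Gq (- a0) (\<rho>1 - \<mu> k)) =
     (z * Gamma z) * (rGamma (\<mu> k - \<rho>2) * (Gamma (\<mu> k + 1) * rGamma (\<mu> k - \<rho>1)))"
    unfolding Gq_def e by (simp only: mult_ac)
  then show ?thesis unfolding 1 Gfac_def by (simp only: mult_ac)
qed

text \<open>Of the three parts of v only - P^(-1) F2' reaches the exponent \<rho>1 + \<rho>2 - \<mu>
  k; the parts with x F2' and with F2 start one power higher and contribute 0.\<close>

lemma U_germ0_lower:
  assumes j: "j < n"
  shows "germ0 S {1..<q} (\<lambda>k. \<rho>1 + \<rho>2 - \<mu> k) (\<lambda>k. Gfac k * (\<Sum>l<n. Pi j l * cc l k)) (v j)"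
proof -
  define e where "e = (\<lambda>k. \<rho>1 + \<rho>2 - \<mu> k)"
  define d where "d = (\<lambda>l k. Gq a0 (\<rho>2 - \<mu> k) * (Gq (- a0) (\<rho>1 - \<mu> k) * cc l k))"
  have g: "germ0 S {1..<q} (\<lambda>k. e k + 1) (d l) (F2 l)" if "l < n" for l unfolding e_def d_def by (rule F2(5)[OF that])
  have 3: "germ0 S {1..<q} e (\<lambda>k. \<Sum>l<n. Pi j l * (\<kappa> l * 0)) (\<lambda>x. \<Sum>l<n. Pi j l * (\<kappa> l * F2 l x))"
    by (rule germ0_sum, rule germ0_cmult[OF germ0_cmult[OF germ0_lower[OF g]]], simp)
  have 1: "germ0 S {1..<q} e (\<lambda>k. \<Sum>l<n. Pi j l * (\<kappa> l * 0)) (\<lambda>x. \<Sum>l<n. Pi j l * (\<kappa> l * (x * deriv (F2 l) x)))"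
    by (rule germ0_sum, rule germ0_cmult[OF germ0_cmult[OF germ0_theta_lower[OF g finite_atLeastLessThan]]], simp)
  have dg: "germ0 S {1..<q} e (\<lambda>k. (e k + 1) * d l k) (deriv (F2 l))" if "l < n" for l
    using germ0_deriv[OF g[OF that] finite_atLeastLessThan] by simp
  have 2: "germ0 S {1..<q} e (\<lambda>k. \<Sum>l<n. Pi j l * ((e k + 1) * d l k)) (\<lambda>x. \<Sum>l<n. Pi j l * deriv (F2 l) x)"
    by (rule germ0_sum, rule germ0_cmult[OF dg], simp)
  have "germ0 S {1..<q} e (\<lambda>k. (\<Sum>l<n. Pi j l * (\<kappa> l * 0)) + (- 1 * (\<Sum>l<n. Pi j l * ((e k + 1) * d l k)) + - mh j * (\<Sum>l<n. Pi j l * (\<kappa> l * 0))))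
      (\<lambda>x. (\<Sum>l<n. Pi j l * (\<kappa> l * (x * deriv (F2 l) x))) + (- 1 * (\<Sum>l<n. Pi j l * deriv (F2 l) x) + - mh j * (\<Sum>l<n. Pi j l * (\<kappa> l * F2 l x))))"
    by (rule germ0_add[OF 1 germ0_add[OF germ0_cmult[OF 2] germ0_cmult[OF 3]]])
  then have "germ0 S {1..<q} e (\<lambda>k. (\<Sum>l<n. Pi j l * (\<kappa> l * 0)) + (- 1 * (\<Sum>l<n. Pi j l * ((e k + 1) * d l k)) + - mh j * (\<Sum>l<n. Pi j l * (\<kappa> l * 0)))) (v j)"
    by (rule germ0_cong) (simp add: v_def sum_distrib_left mult_ac)
  then show ?thesis unfolding e_def[symmetric]
  proof (rule germ0_lead_cong)
    fix k assume k: "k \<in> {1..<q}"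
    have "- 1 * (\<Sum>l<n. Pi j l * ((e k + 1) * d l k)) = (- ((\<rho>1 + \<rho>2 - \<mu> k) + 1) * (Gq a0 (\<rho>2 - \<mu> k) * Gq (- a0) (\<rho>1 - \<mu> k))) * (\<Sum>l<n. Pi j l * cc l k)"
      unfolding sum_distrib_left by (rule sum.cong[OF refl]) (simp only: d_def e_def mult_minus_left mult_minus_right mult_1_left mult_ac)
    also have "\<dots> = Gfac k * (\<Sum>l<n. Pi j l * cc l k)" unfolding Gq_Gfac[OF k] ..
    finally show "(\<Sum>l<n. Pi j l * (\<kappa> l * 0)) + (- 1 * (\<Sum>l<n. Pi j l * ((e k + 1) * d l k)) + - mh j * (\<Sum>l<n. Pi j l * (\<kappa> l * 0))) =
       Gfac k * (\<Sum>l<n. Pi j l * cc l k)" by simp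
  qed
qed

text \<open>W is the prescribed solution and Y the asserted combination. The constructed U equals W,
  since their difference has no admissible leading term at 1, and U - Y is analytic at 0, since the
  leading coefficients agree in the rows with singular point 0. Non-resonance takes care of all
  higher coefficients.\<close>

theorem connection:
  fixes W Y :: "nat \<Rightarrow> complex \<Rightarrow> complex"
  assumes W: "\<And>j. j < n + nv \<Longrightarrow> W j holomorphic_on S" "\<And>j. j < n + nv \<Longrightarrow> germ1 S lam (GW j) (W j)"
    "\<And>j x. j < n + nv \<Longrightarrow> x \<in> S \<Longrightarrow> (x - T j) * deriv (W j) x = (\<Sum>l<n + nv. M j l * W l x)"
    "\<And>j. j < n \<Longrightarrow> \<kappa> j = 1 \<Longrightarrow> fps_nth (GW j) 0 = fps_nth (gw j) 0"
    and a: "\<And>j l. j < n \<Longrightarrow> l < n \<Longrightarrow> \<kappa> j = 1 \<Longrightarrow> \<kappa> l = 1 \<Longrightarrow> l \<noteq> j \<Longrightarrow> a j l = 0"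
      "\<And>j. j < n \<Longrightarrow> \<kappa> j = 1 \<Longrightarrow> a j j = lam \<or> lam - a j j \<notin> \<int>"
    and mh_mu: "\<And>j k. j < n \<Longrightarrow> k \<in> {1..q} \<Longrightarrow> mh j = \<mu> k \<or> mh j - \<mu> k \<notin> \<int>"
    and Y: "\<And>j. j < n + nv \<Longrightarrow> Y j holomorphic_on S" "\<And>j. j < n + nv \<Longrightarrow> germ0 S {1..<q} (\<lambda>k. \<rho>1 + \<rho>2 - \<mu> k) (dY j) (Y j)"
    "\<And>j x. j < n + nv \<Longrightarrow> x \<in> S \<Longrightarrow> (x - T j) * deriv (Y j) x = (\<Sum>l<n + nv. M j l * Y l x)"
    "\<And>j k. j < nv \<Longrightarrow> k \<in> {1..<q} \<Longrightarrow> dY (n + j) k = Gfac k * (\<Sum>l<n. Pi j l * cc l k)"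
    and j: "j < n + nv"
  shows "\<exists>r. r analytic_on {0} \<and> (\<forall>\<^sub>F x in at 0 within S. W j x - Y j x = r x)"
proof -
  have ode: "(x - T j) * deriv (\<lambda>x. X j x + - 1 * X' j x) x = (\<Sum>l<n + nv. M j l * (X l x + - 1 * X' l x))"
    if "j < n + nv" "x \<in> S" "\<And>j. j < n + nv \<Longrightarrow> X j holomorphic_on S" "\<And>j. j < n + nv \<Longrightarrow> X' j holomorphic_on S"
      "\<And>j x. j < n + nv \<Longrightarrow> x \<in> S \<Longrightarrow> (x - T j) * deriv (X j) x = (\<Sum>l<n + nv. M j l * X l x)"
      "\<And>j x. j < n + nv \<Longrightarrow> x \<in> S \<Longrightarrow> (x - T j) * deriv (X' j) x = (\<Sum>l<n + nv. M j l * X' l x)" for X X' j x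
  proof -
    have d: "deriv (\<lambda>x. X j x + - 1 * X' j x) x = deriv (X j) x + - 1 * deriv (X' j) x"
      by (rule DERIV_imp_deriv[OF DERIV_add[OF deriv_at[OF that(3)[OF that(1)] that(2)] DERIV_cmult[OF deriv_at[OF that(4)[OF that(1)] that(2)]]]])
    have "(x - T j) * (deriv (X j) x + - 1 * deriv (X' j) x) = (x - T j) * deriv (X j) x - (x - T j) * deriv (X' j) x"
      by (simp add: algebra_simps)
    also have "\<dots> = (\<Sum>l<n + nv. M j l * X l x) - (\<Sum>l<n + nv. M j l * X' l x)"
      by (simp only: that(5)[OF that(1,2)] that(6)[OF that(1,2)])
    finally show ?thesis unfolding d by (simp add: sum_subtractf[symmetric] right_diff_distrib)
  qed
  \<comment> \<open>In the lower rows the mere existence of a germ suffices: the singular point of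
    these rows is 0, so no condition is imposed on their coefficients at 1.\<close>
  define gU where "gU = (\<lambda>j. if j < n then fps_const (\<kappa> j) * (fps_X * Efps a0 (lam + - a0) (G2 j)) else (SOME g. germ1 S (lam - 1) g (v (j - n))))"
  have gU: "germ1 S (lam - 1) (gU j) (U j)" if "j < n + nv" for j
  proof (cases "j < n")
    case True
    then show ?thesis using U_germ1_lead(1) by (simp add: gU_def)
  next
    case False
    then show ?thesis using someI_ex[OF v_germ1] by (simp add: gU_def U_def)
  qed
  have UW: "U j x + - 1 * W j x = 0" if jx: "j < n + nv" "x \<in> S" for j x
  proof (rule okubo_germ1[where U = "\<lambda>j x. U j x + - 1 * W j x" and N = "n + nv" and lam = "lam - 1" and T = T and M = M
        and G = "\<lambda>j. gU j + fps_const (- 1) * (fps_X * GW j)"])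
    show "(\<lambda>x. U j x + - 1 * W j x) holomorphic_on S" if "j < n + nv" for j
      by (rule holomorphic_on_add[OF U_hol[OF that] holomorphic_on_mult[OF holomorphic_on_const W(1)[OF that]]])
    show "germ1 S (lam - 1) (gU j + fps_const (- 1) * (fps_X * GW j)) (\<lambda>x. U j x + - 1 * W j x)" if "j < n + nv" for j
      by (rule germ1_add[OF gU[OF that] germ1_cmult[OF germ1_shift[OF W(2)[OF that]]]])
    show "(x - T j) * deriv (\<lambda>x. U j x + - 1 * W j x) x = (\<Sum>l<n + nv. M j l * (U l x + - 1 * W l x))" if "j < n + nv" "x \<in> S" for j x
      by (rule ode[OF that U_hol W(1) U_ode W(3)])
    show "lam - 1 \<notin> \<int>" by (rule nonint_diff_1[OF lam(1)])
    have T1: "j < n \<and> \<kappa> j = 1" if "T j = 1" for j using that by (auto simp: T_def split: if_splits)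
    show "M j l = 0" if "T j = 1" "T l = 1" "l \<noteq> j" for j l using a(1)[of j l] T1[OF that(1)] T1[OF that(2)] that(3) by (simp add: M_def)
    show "fps_nth (gU j + fps_const (- 1) * (fps_X * GW j)) m = 0 \<or> lam - 1 + of_nat m \<noteq> M j j" if "T j = 1" for j m
    proof -
      have j: "j < n" "\<kappa> j = 1" using T1[OF that] by auto
      \<comment> \<open>With exponent lam - 1 the coefficient of index 0 vanishes through the factor
        X and that of index 1 by equality of the starting vectors; from index 2 on, lam - 1 + m
        differs from the diagonal entry.\<close>
      consider "m = 0" | "m = 1" | m' where "m = Suc (Suc m')" by (metis One_nat_def not0_implies_Suc)
      then show ?thesis
      proof cases
        case 2
        then show ?thesis using j W(4)[OF j] U_germ1_lead(2)[OF j(1)] by (simp add: gU_def)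
      next
        case (3 m')
        have "lam - 1 + of_nat m \<noteq> a j j"
        proof
          assume h: "lam - 1 + of_nat m = a j j"
          then have "lam - a j j = - of_nat (Suc m')" by (simp add: 3 algebra_simps)
          moreover have "- of_nat (Suc m') \<in> (\<int> :: complex set)" by (intro Ints_minus Ints_of_nat)
          ultimately have "a j j = lam" using a(2)[OF j] by metis
          then have "of_nat (Suc m') = (0 :: complex)" using h by (simp add: 3)
          then show False by (simp only: of_nat_eq_0_iff nat.distinct)
        qed
        then show ?thesis using j by (simp add: M_def)
      qed (simp add: gU_def j)
    qed
  qed (use jx in auto)
  define d where "d = (\<lambda>j k. if j < n then 0 else Gfac k * (\<Sum>l<n. Pi (j - n) l * cc l k))"
  have g0: "germ0 S {1..<q} (\<lambda>k. \<rho>1 + \<rho>2 - \<mu> k) (d j) (U j)" if "j < n + nv" for j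
  proof (cases "j < n")
    case True
    then show ?thesis using U_germ0_upper[OF True] by (simp add: d_def)
  next
    case False
    then have "j - n < n" using that nv by simp
    from U_germ0_lower[OF this] show ?thesis using False by (simp add: d_def U_def)
  qed
  have "\<exists>r. r analytic_on {0} \<and> (\<forall>\<^sub>F x in at 0 within S. U j x + - 1 * Y j x = r x)"
  proof (rule okubo_germ0[where N = "n + nv" and K = "{1..<q}" and e = "\<lambda>k. \<rho>1 + \<rho>2 - \<mu> k" and T = T and M = M
        and d = "\<lambda>j k. d j k + - 1 * dY j k" and D = "\<lambda>j x. U j x + - 1 * Y j x"])
    show "germ0 S {1..<q} (\<lambda>k. \<rho>1 + \<rho>2 - \<mu> k) (\<lambda>k. d j k + - 1 * dY j k) (\<lambda>x. U j x + - 1 * Y j x)" if "j < n + nv" for j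
      by (rule germ0_add[OF g0[OF that] germ0_cmult[OF Y(2)[OF that]]])
    show "(x - T j) * deriv (\<lambda>x. U j x + - 1 * Y j x) x = (\<Sum>l<n + nv. M j l * (U l x + - 1 * Y l x))" if "j < n + nv" "x \<in> S" for j x
      by (rule ode[OF that U_hol Y(1) U_ode Y(3)])
    show "\<rho>1 + \<rho>2 - \<mu> k \<notin> \<int>" if "k \<in> {1..<q}" for k by (rule mu(4)[OF that])
    show "\<rho>1 + \<rho>2 - \<mu> k - (\<rho>1 + \<rho>2 - \<mu> k') \<notin> \<int>" if "k \<in> {1..<q}" "k' \<in> {1..<q}" "k \<noteq> k'" for k k'
      using mu(3)[of k' k] that by simp
    have T0: "\<not> j < n" if "T j = 0" for j using that \<kappa>[of j] by (auto simp: T_def)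
    show "M j l = 0" if "T j = 0" "T l = 0" "l \<noteq> j" for j l using T0[OF that(1)] T0[OF that(2)] that(3) by (simp add: M_def)
    show "d j k + - 1 * dY j k = 0" if "j < n + nv" "T j = 0" "k \<in> {1..<q}" for j k
      using Y(4)[of "j - n" k] T0[OF that(2)] that(1,3) by (simp add: d_def)
    show "\<rho>1 + \<rho>2 - \<mu> k + of_nat (Suc m) \<noteq> M j j" if "j < n + nv" "T j = 0" "k \<in> {1..<q}" for j k m
    proof
      have j: "\<not> j < n" "j - n < n" using T0[OF that(2)] that(1) nv by auto
      assume h: "\<rho>1 + \<rho>2 - \<mu> k + of_nat (Suc m) = M j j"
      then have "\<rho>1 + \<rho>2 - \<mu> k + of_nat (Suc m) = \<rho>1 + \<rho>2 - mh (j - n)" using j by (simp only: M_def if_False if_True simp_thms)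
      \<comment> \<open>An integral difference of these exponents forces them to be equal, and then
        a positive integer would be 0.\<close>
      then have e: "mh (j - n) - \<mu> k = - of_nat (Suc m)" by (simp add: algebra_simps)
      moreover have "- of_nat (Suc m) \<in> (\<int> :: complex set)" by (intro Ints_minus Ints_of_nat)
      moreover have "k \<in> {1..q}" using that(3) by simp
      ultimately have "mh (j - n) = \<mu> k" using mh_mu[OF j(2)] by metis
      then have "- of_nat (Suc m) = (0 :: complex)" using e by simp
      then show False by (simp only: neg_equal_0_iff_equal of_nat_eq_0_iff nat.distinct)
    qed
  qed (use j in auto)
  then obtain r where r: "r analytic_on {0}" "\<forall>\<^sub>F x in at 0 within S. U j x + - 1 * Y j x = r x" by (elim exE conjE)
  have "\<forall>\<^sub>F x in at 0 within S. W j x - Y j x = r x"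
    using r(2) eventually_at_S by eventually_elim (use UW[OF j] in \<open>simp add: eq_neg_iff_add_eq_0[symmetric]\<close>)
  with r(1) show ?thesis by blast
qed

end

section \<open>Block matrices, arguments and sectors\<close>

lemma offset_Suc: "1 \<le> k \<Longrightarrow> offset s (Suc k) = offset s k + s k"
  by (simp add: offset_def)

lemma offset_mono: "1 \<le> k \<Longrightarrow> k < k' \<Longrightarrow> offset s k + s k \<le> offset s k'"
proof (induction k')
  case (Suc k')
  then show ?case by (cases "k = k'") (auto simp: offset_Suc)
qed simp

lemma offset_total: "offset s (Suc q) = (\<Sum>k = 1..q. s k)"
  unfolding offset_def by (rule sum.cong) auto

lemma offset_le_total: "k \<in> {1..q} \<Longrightarrow> offset s k + s k \<le> (\<Sum>k = 1..q. s k)"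
  using offset_mono[of k "Suc q" s] by (simp add: offset_total)

text \<open>The inverse of \<open>offset\<close>: the 1-based number of the block containing the
  0-based index x. It is unique because the index intervals of the blocks are disjoint.\<close>

definition blk :: "(nat \<Rightarrow> nat) \<Rightarrow> nat \<Rightarrow> nat" where
  "blk s x = (SOME k. 1 \<le> k \<and> offset s k \<le> x \<and> x < offset s k + s k)"

lemma blk_eqI:
  assumes "1 \<le> k" "offset s k \<le> x" "x < offset s k + s k"
  shows "blk s x = k"
  unfolding blk_def
proof (rule some_equality)
  fix k' assume k': "1 \<le> k' \<and> offset s k' \<le> x \<and> x < offset s k' + s k'"
  show "k' = k"
  proof (rule ccontr)
    assume "k' \<noteq> k"
    then consider "k < k'" | "k' < k" by linarith
    then show False using offset_mono[of k k' s] offset_mono[of k' k s] assms k' by cases linarith+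
  qed
qed (use assms in simp)

lemma blk_bounds:
  assumes "x < (\<Sum>k = 1..q. s k)"
  shows "blk s x \<in> {1..q}" "offset s (blk s x) \<le> x" "x < offset s (blk s x) + s (blk s x)"
proof -
  have "\<exists>k\<in>{1..q}. offset s k \<le> x \<and> x < offset s k + s k"
    using assms
  proof (induction q)
    case (Suc q)
    show ?case
    proof (cases "x < (\<Sum>k = 1..q. s k)")
      case True
      from Suc.IH[OF this] show ?thesis by auto
    next
      case False
      then show ?thesis using Suc.prems by (intro bexI[of _ "Suc q"]) (auto simp: offset_total)
    qed
  qed simp
  then obtain k where k: "k \<in> {1..q}" "offset s k \<le> x" "x < offset s k + s k" by blast
  then have "blk s x = k" by (intro blk_eqI) auto
  with k show "blk s x \<in> {1..q}" "offset s (blk s x) \<le> x" "x < offset s (blk s x) + s (blk s x)" by auto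
qed

lemma dim_scalar_diag:
  "dim_row (diag_block_mat (map (\<lambda>k. c k \<cdot>\<^sub>m 1\<^sub>m (s k)) [a..<b])) = (\<Sum>k = a..<b. s k)"
  "dim_col (diag_block_mat (map (\<lambda>k. c k \<cdot>\<^sub>m 1\<^sub>m (s k)) [a..<b])) = (\<Sum>k = a..<b. s k)"
  by (simp_all add: dim_diag_block_mat comp_def sum_list_distinct_conv_sum_set)

text \<open>The induction peels off the first block, hence a range that starts at an arbitrary a
  instead of 1.\<close>

lemma diag_block_index:
  fixes c :: "nat \<Rightarrow> complex"
  assumes "a \<le> k" "k < b" "h < s k" "x = (\<Sum>j = a..<k. s j) + h" "y < (\<Sum>j = a..<b. s j)"
  shows "diag_block_mat (map (\<lambda>k. c k \<cdot>\<^sub>m 1\<^sub>m (s k)) [a..<b]) $$ (x, y) = (if x = y then c k else 0)"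
  using assms
proof (induction "b - a" arbitrary: a x y)
  case (Suc d)
  have ab: "a < b" using Suc.prems by simp
  define D where "D = diag_block_mat (map (\<lambda>k. c k \<cdot>\<^sub>m 1\<^sub>m (s k)) [Suc a..<b])"
  have dD: "dim_row D = (\<Sum>k = Suc a..<b. s k)" "dim_col D = (\<Sum>k = Suc a..<b. s k)" unfolding D_def by (rule dim_scalar_diag)+
  have tot: "(\<Sum>j = a..<b. s j) = s a + (\<Sum>j = Suc a..<b. s j)" using ab by (rule sum.atLeast_Suc_lessThan)
  have x: "x < (\<Sum>j = a..<b. s j)"
  proof -
    have "x < (\<Sum>j = a..<Suc k. s j)" using Suc.prems by simp
    also have "\<dots> \<le> (\<Sum>j = a..<b. s j)" by (rule sum_mono2) (use Suc.prems in auto)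
    finally show ?thesis .
  qed
  have e: "diag_block_mat (map (\<lambda>k. c k \<cdot>\<^sub>m 1\<^sub>m (s k)) [a..<b]) = four_block_mat (c a \<cdot>\<^sub>m 1\<^sub>m (s a)) (0\<^sub>m (s a) (dim_col D)) (0\<^sub>m (dim_row D) (s a)) D"
    using ab by (simp add: upt_conv_Cons Let_def D_def)
  have idx: "diag_block_mat (map (\<lambda>k. c k \<cdot>\<^sub>m 1\<^sub>m (s k)) [a..<b]) $$ (x, y) =
     (if x < s a then if y < s a then (c a \<cdot>\<^sub>m 1\<^sub>m (s a)) $$ (x, y) else 0\<^sub>m (s a) (dim_col D) $$ (x, y - s a)
      else if y < s a then 0\<^sub>m (dim_row D) (s a) $$ (x - s a, y) else D $$ (x - s a, y - s a))"
    unfolding e by (subst index_mat_four_block) (use x Suc.prems(5) in \<open>simp_all add: dD tot\<close>)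
  show ?case
  proof (cases "k = a")
    case True
    then have "x < s a" using Suc.prems by simp
    then show ?thesis unfolding idx using True Suc.prems(5) by (auto simp: dD tot)
  next
    case False
    then have ak: "a < k" using Suc.prems by simp
    have xs: "x = s a + ((\<Sum>j = Suc a..<k. s j) + h)" using Suc.prems(4) sum.atLeast_Suc_lessThan[OF ak, of s] by simp
    show ?thesis
    proof (cases "y < s a")
      case True
      then show ?thesis unfolding idx using xs x by (auto simp: dD tot)
    next
      case y: False
      have "D $$ (x - s a, y - s a) = (if x - s a = y - s a then c k else 0)"
        unfolding D_def by (rule Suc.hyps(1)) (use Suc.hyps(2) Suc.prems ak xs y in \<open>auto simp: tot\<close>)
      then show ?thesis unfolding idx using xs y by auto
    qed
  qed
qed simp

lemma scalar_blocks_carrier: "scalar_blocks c s q \<in> carrier_mat (\<Sum>k = 1..q. s k) (\<Sum>k = 1..q. s k)"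
proof -
  have "(\<Sum>k = 1..<q + 1. s k) = (\<Sum>k = 1..q. s k)" by (rule sum.cong) auto
  then show ?thesis unfolding scalar_blocks_def by (intro carrier_matI) (simp_all only: dim_scalar_diag)
qed

lemma scalar_blocks_index:
  assumes "x < (\<Sum>k = 1..q. s k)" "y < (\<Sum>k = 1..q. s k)"
  shows "scalar_blocks c s q $$ (x, y) = (if x = y then c (blk s x) else 0)"
proof -
  have e: "(\<Sum>k = 1..<q + 1. s k) = (\<Sum>k = 1..q. s k)" by (rule sum.cong) auto
  note b = blk_bounds[OF assms(1)]
  show ?thesis unfolding scalar_blocks_def
    by (rule diag_block_index[where h = "x - offset s (blk s x)"]) (use b assms(2) e in \<open>auto simp: offset_def\<close>)
qed

lemma mult_index:
  assumes "A \<in> carrier_mat n n" "B \<in> carrier_mat n n" "i < n" "j < n"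
  shows "(A * B) $$ (i, j) = (\<Sum>k<n. A $$ (i, k) * (B $$ (k, j) :: complex))"
  using assms by (simp add: scalar_prod_def atLeast0LessThan)

lemma diag_mult_index:
  assumes "A \<in> carrier_mat n n" "B \<in> carrier_mat n n" "i < n" "j < n" "\<And>k. k < n \<Longrightarrow> k \<noteq> i \<Longrightarrow> A $$ (i, k) = 0"
  shows "(A * B) $$ (i, j) = A $$ (i, i) * (B $$ (i, j) :: complex)"
proof -
  have "(\<Sum>k<n. A $$ (i, k) * B $$ (k, j)) = (\<Sum>k\<in>{i}. A $$ (i, k) * B $$ (k, j))"
    by (rule sum.mono_neutral_right) (use assms in auto)
  then show ?thesis using mult_index[OF assms(1-4)] by simp
qed

lemma solves_on_component:
  assumes "solves_on d T A S U" "T \<in> carrier_mat d d" "A \<in> carrier_mat d d"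
    "\<And>i j. i < d \<Longrightarrow> j < d \<Longrightarrow> i \<noteq> j \<Longrightarrow> T $$ (i, j) = 0" "x \<in> S" "j < d"
  shows "((\<lambda>y. vec_index (U y) j) has_field_derivative deriv (\<lambda>y. vec_index (U y) j) x) (at x)"
    "(x - T $$ (j, j)) * deriv (\<lambda>y. vec_index (U y) j) x = (\<Sum>l<d. A $$ (j, l) * vec_index (U x) l)"
proof -
  obtain D where U: "U x \<in> carrier_vec d" and D: "D \<in> carrier_vec d"
    "\<And>j. j < d \<Longrightarrow> ((\<lambda>y. vec_index (U y) j) has_field_derivative vec_index D j) (at x)" "(x \<cdot>\<^sub>m 1\<^sub>m d - T) *\<^sub>v D = A *\<^sub>v U x"
    using assms(1,5) unfolding solves_on_def by blast
  have d: "deriv (\<lambda>y. vec_index (U y) j) x = vec_index D j" using D(2)[OF assms(6)] by (rule DERIV_imp_deriv)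
  then show "((\<lambda>y. vec_index (U y) j) has_field_derivative deriv (\<lambda>y. vec_index (U y) j) x) (at x)" using D(2)[OF assms(6)] by simp
  have "vec_index ((x \<cdot>\<^sub>m 1\<^sub>m d - T) *\<^sub>v D) j = (\<Sum>l<d. (x \<cdot>\<^sub>m 1\<^sub>m d - T) $$ (j, l) * vec_index D l)"
    using assms D(1) by (simp add: scalar_prod_def atLeast0LessThan)
  also have "\<dots> = (\<Sum>l\<in>{j}. (x \<cdot>\<^sub>m 1\<^sub>m d - T) $$ (j, l) * vec_index D l)"
    by (rule sum.mono_neutral_right) (use assms in auto)
  also have "\<dots> = (x - T $$ (j, j)) * vec_index D j" using assms by simp
  finally have 1: "vec_index ((x \<cdot>\<^sub>m 1\<^sub>m d - T) *\<^sub>v D) j = (x - T $$ (j, j)) * vec_index D j" .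
  have "vec_index (A *\<^sub>v U x) j = (\<Sum>l<d. A $$ (j, l) * vec_index (U x) l)"
    using assms U by (simp add: scalar_prod_def atLeast0LessThan)
  with 1 D(3) d show "(x - T $$ (j, j)) * deriv (\<lambda>y. vec_index (U y) j) x = (\<Sum>l<d. A $$ (j, l) * vec_index (U x) l)" by simp
qed

lemma has_expansion_component:
  assumes "has_expansion d S U pref z e" "j < d"
  shows "\<exists>\<phi> g r. \<phi> has_fps_expansion g \<and> fps_nth g 0 = vec_index e j \<and> 0 < r \<and>
    (\<forall>x\<in>S. cmod (z x) < r \<longrightarrow> vec_index (U x) j = pref x * \<phi> (z x))"
proof -
  obtain G r where G: "0 < r" "G 0 = e" "\<forall>j<d. \<forall>w. cmod w < r \<longrightarrow> summable (\<lambda>m. vec_index (G m) j * w ^ m)"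
    "\<forall>x\<in>S. cmod (z x) < r \<longrightarrow> U x = pref x \<cdot>\<^sub>v Matrix.vec d (\<lambda>j. \<Sum>m. vec_index (G m) j * z x ^ m)"
    using assms(1) unfolding has_expansion_def by blast
  define g where "g = Abs_fps (\<lambda>m. vec_index (G m) j)"
  have "summable (\<lambda>m. fps_nth g m * (complex_of_real (r / 2)) ^ m)" using G(1,3) assms(2) by (simp add: g_def)
  from conv_radius_geI[OF this] have "ereal (r / 2) \<le> fps_conv_radius g" using G(1) by (simp add: fps_conv_radius_def)
  moreover have "0 < ereal (r / 2)" using G(1) by simp
  ultimately have "0 < fps_conv_radius g" by (rule order.strict_trans2[rotated])
  then have "eval_fps g has_fps_expansion g" by (simp add: has_fps_expansion_def)
  moreover have "fps_nth g 0 = vec_index e j" using G(2) by (simp add: g_def)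
  moreover have "vec_index (U x) j = pref x * eval_fps g (z x)" if "x \<in> S" "cmod (z x) < r" for x
    using G(4) that assms(2) by (simp add: eval_fps_def g_def)
  ultimately show ?thesis using G(1) by (intro exI[of _ "eval_fps g"] exI[of _ g] exI[of _ r]) simp
qed

section \<open>Prescribed arguments, principal branches and sectors\<close>

lemma Ln_cart: "z \<noteq> 0 \<Longrightarrow> Ln z = of_real (ln (cmod z)) + \<i> * of_real (Arg z)"
  by (rule complex_eqI) (simp_all add: Re_Ln Arg_def)

text \<open>Splitting off a fixed factor u with its fixed argument leaves a principal power of y.
  All prescribed branches are reduced in this way to \<open>powr\<close> on the normalised
  sector.\<close>

lemma cpow_arg_mult:
  assumes "u \<noteq> 0" "y \<noteq> 0"
  shows "cpow_arg (u * y) (\<theta> + Arg y) a = exp (a * (of_real (ln (cmod u)) + \<i> * of_real \<theta>)) * y powr a"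
  using assms by (simp add: cpow_arg_def powr_def Ln_cart norm_mult ln_mult exp_add[symmetric] algebra_simps)

lemma is_Arg_mult:
  assumes "is_Arg z \<phi>" "is_Arg w \<psi>"
  shows "is_Arg (z * w) (\<phi> + \<psi>)"
proof -
  have "z * w = (of_real (cmod z) * exp (\<i> * of_real \<phi>)) * (of_real (cmod w) * exp (\<i> * of_real \<psi>))"
    by (rule arg_cong2[of _ _ _ _ times]) (use assms in \<open>simp_all only: is_Arg_def\<close>)
  also have "\<dots> = of_real (cmod (z * w)) * exp (\<i> * of_real (\<phi> + \<psi>))"
    by (simp add: norm_mult distrib_left exp_add mult_ac)
  finally show ?thesis unfolding is_Arg_def .
qed

lemma is_Arg_Arg: "z \<noteq> 0 \<Longrightarrow> is_Arg z (Arg z)"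
  using Arg_eq[of z] by (simp add: is_Arg_def)

lemma is_Arg_inverse:
  assumes "is_Arg z \<phi>"
  shows "is_Arg (inverse z) (- \<phi>)"
proof -
  have "inverse z = inverse (of_real (cmod z) * exp (\<i> * of_real \<phi>))"
    by (rule arg_cong[of _ _ inverse]) (use assms in \<open>simp only: is_Arg_def\<close>)
  also have "\<dots> = of_real (cmod (inverse z)) * exp (\<i> * of_real (- \<phi>))" by (simp add: norm_inverse exp_minus)
  finally show ?thesis unfolding is_Arg_def .
qed

lemma arg_from_eqI:
  assumes "is_Arg z \<phi>" "z \<noteq> 0" "lo \<le> \<phi>" "\<phi> < lo + 2 * pi"
  shows "arg_from lo z = \<phi>"
  by (rule is_Arg_eqI[OF arg_from(3) assms(1) _ assms(2)]) (use arg_from(1,2)[of lo z] assms in linarith)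

text \<open>The points with argument between 0 and \<sigma> \<beta>, where \<sigma> = 1 or -1
  selects the side of the positive axis. The description by two half planes gives openness and
  convexity at once, and agrees with the polar one as long as \<beta> is at most \<pi>.\<close>

definition wedge :: "real \<Rightarrow> real \<Rightarrow> complex set" where
  "wedge \<sigma> \<beta> = {y. 0 < \<sigma> * Im y \<and> \<sigma> * Im (cis (- (\<sigma> * \<beta>)) * y) < 0}"

lemma convex_Im_half: "convex {y. 0 < b * Im (w * y)}"
proof -
  have "linear (\<lambda>y. b * Im (w * y))" by (rule linearI) (simp_all add: algebra_simps)
  from convex_linear_vimage[OF this, of "{0<..}"] show ?thesis by (simp add: vimage_def)
qed

lemma wedge_alt: "wedge \<sigma> \<beta> = {y. 0 < \<sigma> * Im (1 * y)} \<inter> {y. 0 < - \<sigma> * Im (cis (- (\<sigma> * \<beta>)) * y)}"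
  by (auto simp: wedge_def)

lemma wedge_iff:
  assumes s: "\<sigma> = 1 \<or> \<sigma> = -1" and b: "0 < \<beta>" "\<beta> \<le> pi"
  shows "y \<in> wedge \<sigma> \<beta> \<longleftrightarrow> (\<exists>r \<psi>. 0 < r \<and> 0 < \<psi> \<and> \<psi> < \<beta> \<and> y = rcis r (\<sigma> * \<psi>))"
proof
  assume "\<exists>r \<psi>. 0 < r \<and> 0 < \<psi> \<and> \<psi> < \<beta> \<and> y = rcis r (\<sigma> * \<psi>)"
  then obtain r \<psi> where y: "0 < r" "0 < \<psi>" "\<psi> < \<beta>" "y = rcis r (\<sigma> * \<psi>)" by blast
  have e: "cis (- (\<sigma> * \<beta>)) * y = rcis r (\<sigma> * (\<psi> - \<beta>))" by (simp add: y(4) rcis_def cis_mult algebra_simps)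
  have i1: "Im (cis (- (\<sigma> * \<beta>)) * y) = r * sin (\<sigma> * (\<psi> - \<beta>))" unfolding e by (rule Im_rcis)
  have i2: "Im y = r * sin (\<sigma> * \<psi>)" unfolding y(4) by (rule Im_rcis)
  have sn: "0 < sin \<psi>" "0 < sin (\<beta> - \<psi>)" using y b by (auto intro: sin_gt_zero)
  have sn': "sin (\<psi> - \<beta>) = - sin (\<beta> - \<psi>)" by (metis minus_diff_eq sin_minus)
  have "0 < r * sin \<psi>" "0 < r * sin (\<beta> - \<psi>)" using sn y(1) by simp_all
  then show "y \<in> wedge \<sigma> \<beta>" unfolding wedge_def mem_Collect_eq i1 i2 using s sn' by (elim disjE) simp_all
next
  assume w: "y \<in> wedge \<sigma> \<beta>"
  define \<psi> where "\<psi> = \<sigma> * Arg y"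
  have y0: "y \<noteq> 0" using w by (auto simp: wedge_def)
  have A: "Arg y = \<sigma> * \<psi>" using s by (auto simp: \<psi>_def)
  have yr: "y = rcis (cmod y) (\<sigma> * \<psi>)" using rcis_cmod_Arg[of y] A by simp
  have "- pi < Arg y" "Arg y \<le> pi" using Arg_bounded[of y] by auto
  have im: "Im y = cmod y * sin (Arg y)" by (subst yr) (simp add: A)
  have "0 < \<sigma> * (cmod y * sin (Arg y))" using w im by (simp add: wedge_def)
  then have sn: "0 < sin \<psi>" using s y0 by (auto simp: \<psi>_def mult_less_0_iff zero_less_mult_iff)
  have p: "0 < \<psi>"
  proof (rule ccontr)
    assume "\<not> 0 < \<psi>"
    then have "0 \<le> sin (- \<psi>)" using s \<open>- pi < Arg y\<close> \<open>Arg y \<le> pi\<close> by (intro sin_ge_zero) (auto simp: \<psi>_def)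
    with sn show False by simp
  qed
  have pp: "\<psi> \<le> pi" using s \<open>- pi < Arg y\<close> \<open>Arg y \<le> pi\<close> by (auto simp: \<psi>_def)
  have e: "cis (- (\<sigma> * \<beta>)) * y = rcis (cmod y) (\<sigma> * (\<psi> - \<beta>))" by (subst yr) (simp add: rcis_def cis_mult algebra_simps)
  have i1: "Im (cis (- (\<sigma> * \<beta>)) * y) = cmod y * sin (\<sigma> * (\<psi> - \<beta>))" unfolding e by (rule Im_rcis)
  have "\<sigma> * (cmod y * sin (\<sigma> * (\<psi> - \<beta>))) < 0" using w unfolding wedge_def mem_Collect_eq i1 by (elim conjE)
  moreover have "\<sigma> * sin (\<sigma> * (\<psi> - \<beta>)) = sin (\<psi> - \<beta>)" using s by (metis (no_types, opaque_lifting) mult_1 mult_minus1 minus_minus sin_minus)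
  ultimately have "cmod y * sin (\<psi> - \<beta>) < 0" by (metis mult.left_commute)
  then have "sin (\<psi> - \<beta>) < 0" using y0 by (simp add: mult_less_0_iff)
  then have "\<psi> < \<beta>" using sin_ge_zero[of "\<psi> - \<beta>"] pp b by linarith
  with p y0 yr show "\<exists>r \<psi>. 0 < r \<and> 0 < \<psi> \<and> \<psi> < \<beta> \<and> y = rcis r (\<sigma> * \<psi>)" by (intro exI[of _ "cmod y"] exI[of _ \<psi>]) simp
qed

lemma wedge_slit:
  assumes s: "\<sigma> = 1 \<or> \<sigma> = -1" and b: "0 < \<beta>" "\<beta> \<le> pi"
  shows "slit (wedge \<sigma> \<beta>)"
proof
  have "open {y. 0 < b * Im (w * y)}" for b w by (intro open_Collect_less continuous_intros)
  then show "open (wedge \<sigma> \<beta>)" unfolding wedge_alt by blast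
  show "convex (wedge \<sigma> \<beta>)" unfolding wedge_alt by (intro convex_Int convex_Im_half)
  show "wedge \<sigma> \<beta> \<inter> \<real> = {}" by (auto simp: wedge_def elim!: Reals_cases)
  show "0 \<in> closure (wedge \<sigma> \<beta>)"
    unfolding closure_approachable
  proof (intro allI impI)
    fix e :: real assume e: "0 < e"
    have "rcis (e / 2) (\<sigma> * (\<beta> / 2)) \<in> wedge \<sigma> \<beta>" unfolding wedge_iff[OF assms] using e b by (intro exI[of _ "e / 2"] exI[of _ "\<beta> / 2"]) simp
    moreover have "dist (rcis (e / 2) (\<sigma> * (\<beta> / 2))) 0 < e" using e by simp
    ultimately show "\<exists>y\<in>wedge \<sigma> \<beta>. dist y 0 < e" by blast
  qed
  show "1 \<in> closure (wedge \<sigma> \<beta>)"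
  proof (rule Lim_in_closed_set[OF closed_closure _ _])
    show "\<forall>\<^sub>F \<psi> in at_right 0. rcis 1 (\<sigma> * \<psi>) \<in> closure (wedge \<sigma> \<beta>)"
      using eventually_at_right_less[of 0] eventually_at_right_real[OF b(1)]
    proof eventually_elim
      case (elim \<psi>)
      then have "rcis 1 (\<sigma> * \<psi>) \<in> wedge \<sigma> \<beta>" unfolding wedge_iff[OF assms] by (intro exI[of _ 1] exI[of _ \<psi>]) simp
      then show ?case using closure_subset by blast
    qed
    have "((\<lambda>\<psi>. rcis 1 (\<sigma> * \<psi>)) \<longlongrightarrow> rcis 1 (\<sigma> * 0)) (at_right 0)"
      unfolding rcis_def cis_conv_exp by (intro tendsto_intros)
    then show "((\<lambda>\<psi>. rcis 1 (\<sigma> * \<psi>)) \<longlongrightarrow> 1) (at_right 0)" by simp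
  qed simp
qed

lemma Arg_rcis_wedge:
  assumes "\<sigma> = 1 \<or> \<sigma> = -1" "0 < r" "0 < \<psi>" "\<psi> < pi"
  shows "Arg (rcis r (\<sigma> * \<psi>)) = \<sigma> * \<psi>"
  using assms by (intro Arg_unique[of r]) (auto simp: rcis_def cis_conv_exp)

text \<open>In the triangle 0, 1, y the arguments of y and 1 - y have opposite signs and differ by
  less than \<pi>, as the sign of the imaginary part of y times the conjugate of 1 - y shows. The
  last bound puts the local coordinate of the underlying solution on its prescribed branch.\<close>

lemma Arg_one_minus:
  assumes s: "\<sigma> = 1 \<or> \<sigma> = -1" and y: "0 < \<sigma> * Im y"
  shows "0 < - \<sigma> * Arg (1 - y)" "- \<sigma> * Arg (1 - y) < pi" "\<bar>Arg (1 - y) - Arg y\<bar> < pi"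
proof -
  have y0: "y \<noteq> 0" "1 - y \<noteq> 0" using y by auto
  have p: "0 < - \<sigma> * Arg w \<and> - \<sigma> * Arg w < pi" if "0 < - \<sigma> * Im w" for w
    using s that Arg_lt_pi[of w] Arg_neg_iff[of w] Arg_bounded[of w] by auto
  have p': "0 < \<sigma> * Arg w \<and> \<sigma> * Arg w < pi" if "0 < \<sigma> * Im w" for w
    using s that Arg_lt_pi[of w] Arg_neg_iff[of w] Arg_bounded[of w] by auto
  have 1: "0 < - \<sigma> * Arg (1 - y)" "- \<sigma> * Arg (1 - y) < pi" using p[of "1 - y"] y by auto
  then show "0 < - \<sigma> * Arg (1 - y)" "- \<sigma> * Arg (1 - y) < pi" by auto
  define D where "D = \<sigma> * (Arg y - Arg (1 - y))"
  have D: "0 < D" "D < 2 * pi" using 1 p'[OF y] by (auto simp: D_def algebra_simps)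
  have "y * cnj (1 - y) = rcis (cmod y) (Arg y) * cnj (rcis (cmod (1 - y)) (Arg (1 - y)))" by (simp only: rcis_cmod_Arg)
  also have "\<dots> = rcis (cmod y * cmod (1 - y)) (Arg y - Arg (1 - y))"
    by (simp add: rcis_def cis_cnj cis_mult mult_ac)
  finally have "Im (y * cnj (1 - y)) = cmod y * cmod (1 - y) * sin (Arg y - Arg (1 - y))" by simp
  moreover have "Im (y * cnj (1 - y)) = Im y" by (simp add: algebra_simps)
  ultimately have "0 < \<sigma> * (cmod y * cmod (1 - y) * sin (Arg y - Arg (1 - y)))" using y by simp
  also have "\<dots> = cmod y * cmod (1 - y) * sin D" using s by (auto simp: D_def) (metis minus_diff_eq mult_minus_right sin_minus)
  finally have "0 < (cmod y * cmod (1 - y)) * sin D" .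
  moreover have "0 < cmod y * cmod (1 - y)" using y0 by (intro mult_pos_pos) simp_all
  ultimately have "0 < sin D" by (rule zero_less_mult_pos)
  then have "D < pi" using sin_le_zero[of D] D by linarith
  then show "\<bar>Arg (1 - y) - Arg y\<bar> < pi" using s D(1) by (auto simp: D_def abs_if)
qed

context slit
begin

text \<open>\<open>ch\<close> expresses the local coordinate of the given solution through 1 - x. It
  may be nonlinear: for the underlying solution it is (1 - y) / (\<tau> y). The extra power of x is
  analytic at 1 with value 1, so the leading coefficient only acquires the factor b.\<close>

lemma germ1_of_expansion:
  assumes \<phi>: "\<phi> has_fps_expansion g" and r: "0 < r" and ch: "ch analytic_on {0}" "ch 0 = 0"
    and f: "\<And>x. x \<in> S \<Longrightarrow> cmod (ch (1 - x)) < r \<Longrightarrow> f x = (1 - x) powr lam * (b * (x powr e * \<phi> (ch (1 - x))))"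
  shows "\<exists>g'. germ1 S lam g' f \<and> fps_nth g' 0 = b * fps_nth g 0"
proof -
  define \<psi> where "\<psi> = (\<lambda>u. b * ((1 - u) powr e * \<phi> (ch u)))"
  have "\<phi> analytic_on (ch ` {0})" using has_fps_expansion_imp_analytic_0[OF \<phi>] ch(2) by simp
  from analytic_on_compose[OF ch(1) this] have c: "(\<lambda>u. \<phi> (ch u)) analytic_on {0}" by (simp add: o_def)
  have "(\<lambda>u. (1 - u) powr e) analytic_on {0 :: complex}" by (intro analytic_intros) auto
  then have "\<psi> analytic_on {0}" unfolding \<psi>_def by (intro analytic_on_mult analytic_on_const c)
  from analytic_at_imp_has_fps_expansion_0[OF this] obtain g' where g': "\<psi> has_fps_expansion g'" by blast
  have "fps_nth g' 0 = \<psi> 0" using fps_nth_fps_expansion[OF g', of 0] by simp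
  also have "\<dots> = b * fps_nth g 0" using fps_nth_fps_expansion[OF \<phi>, of 0] ch(2) by (simp add: \<psi>_def)
  finally have l: "fps_nth g' 0 = b * fps_nth g 0" .
  have "isCont ch 0" using analytic_at_imp_isCont[OF ch(1)] .
  then have "ch \<midarrow>0\<rightarrow> 0" using ch(2) by (simp add: isCont_def)
  then have "((\<lambda>x. ch (1 - x)) \<longlongrightarrow> 0) (at 1 within S)"
    using isCont_tendsto_compose[OF \<open>isCont ch 0\<close> filterlim_one_minus] ch(2) by simp
  from tendstoD[OF this r] have "\<forall>\<^sub>F x in at 1 within S. cmod (ch (1 - x)) < r" by simp
  then have "\<forall>\<^sub>F x in at 1 within S. f x = (1 - x) powr lam * \<psi> (1 - x)"
    using eventually_at_S by eventually_elim (simp add: f \<psi>_def)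
  with g' have "germ1 S lam g' f" unfolding germ1_def by (intro exI conjI)
  with l show ?thesis by blast
qed

lemma expansion_scale_analytic:
  assumes "\<phi> has_fps_expansion g"
  shows "(\<lambda>y. \<phi> (\<tau> * y)) analytic_on {0}"
proof -
  have "\<phi> analytic_on ((\<lambda>y. \<tau> * y) ` {0})" using has_fps_expansion_imp_analytic_0[OF assms] by simp
  moreover have "(\<lambda>y. \<tau> * y) analytic_on {0}" by (intro analytic_intros)
  ultimately show ?thesis using analytic_on_compose[of "\<lambda>y. \<tau> * y" "{0}" \<phi>] by (simp add: o_def)
qed

text \<open>Solutions sharing an exponent are merged into one singular term, whose leading
  coefficient is the sum over h. Here \<tau> rescales the local coordinate and b k collects the
  constant left by the prescribed branch.\<close>

lemma germ0_of_expansions: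
  fixes m :: "'k \<Rightarrow> nat"
  assumes K: "finite K"
    and ex: "\<And>k h. k \<in> K \<Longrightarrow> h \<in> {1..m k} \<Longrightarrow> \<exists>\<phi> g r. \<phi> has_fps_expansion g \<and> fps_nth g 0 = d k h \<and> 0 < r \<and>
      (\<forall>y\<in>S. cmod (\<tau> * y) < r \<longrightarrow> V k h y = y powr e k * (b k * \<phi> (\<tau> * y)))"
  shows "\<exists>H. (\<forall>k\<in>K. H k analytic_on {0} \<and> H k 0 = (\<Sum>h = 1..m k. x k h * (b k * d k h))) \<and>
    (\<forall>\<^sub>F y in at 0 within S. (\<Sum>k\<in>K. \<Sum>h = 1..m k. x k h * V k h y) = (\<Sum>k\<in>K. y powr e k * H k y))"
proof -
  have "\<exists>\<phi>. \<phi> analytic_on {0} \<and> \<phi> 0 = d k h \<and> (\<forall>\<^sub>F y in at 0 within S. V k h y = y powr e k * (b k * \<phi> y))"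
    if kh: "k \<in> K" "h \<in> {1..m k}" for k h
  proof -
    obtain \<phi> g r where p: "\<phi> has_fps_expansion g" "fps_nth g 0 = d k h" "0 < r"
      "\<And>y. y \<in> S \<Longrightarrow> cmod (\<tau> * y) < r \<Longrightarrow> V k h y = y powr e k * (b k * \<phi> (\<tau> * y))" using ex[OF kh] by blast
    have "((\<lambda>y. \<tau> * y) \<longlongrightarrow> \<tau> * 0) (at 0 within S)" by (intro tendsto_intros)
    then have "((\<lambda>y. \<tau> * y) \<longlongrightarrow> 0) (at 0 within S)" by simp
    from tendstoD[OF this p(3)] have "\<forall>\<^sub>F y in at 0 within S. cmod (\<tau> * y) < r" by simp
    then have "\<forall>\<^sub>F y in at 0 within S. V k h y = y powr e k * (b k * \<phi> (\<tau> * y))"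
      using eventually_at_S by eventually_elim (rule p(4))
    moreover have "\<phi> (\<tau> * 0) = d k h" using fps_nth_fps_expansion[OF p(1), of 0] p(2) by simp
    ultimately show ?thesis using expansion_scale_analytic[OF p(1), of \<tau>] by (intro exI[of _ "\<lambda>y. \<phi> (\<tau> * y)"]) simp
  qed
  then obtain \<phi> where p: "\<And>k h. k \<in> K \<Longrightarrow> h \<in> {1..m k} \<Longrightarrow> \<phi> k h analytic_on {0} \<and> \<phi> k h 0 = d k h \<and>
      (\<forall>\<^sub>F y in at 0 within S. V k h y = y powr e k * (b k * \<phi> k h y))" by metis
  define H where "H = (\<lambda>k y. \<Sum>h = 1..m k. x k h * (b k * \<phi> k h y))"
  have "\<forall>\<^sub>F y in at 0 within S. \<forall>k\<in>K. \<forall>h\<in>{1..m k}. V k h y = y powr e k * (b k * \<phi> k h y)"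
    using K p by (intro eventually_ball_finite ballI finite_atLeastAtMost) auto
  then have "\<forall>\<^sub>F y in at 0 within S. (\<Sum>k\<in>K. \<Sum>h = 1..m k. x k h * V k h y) = (\<Sum>k\<in>K. y powr e k * H k y)"
  proof eventually_elim
    case (elim y)
    show ?case unfolding H_def sum_distrib_left by (intro sum.cong refl) (use elim in \<open>simp add: mult_ac\<close>)
  qed
  moreover have "H k analytic_on {0}" if "k \<in> K" for k
    unfolding H_def using p that by (intro analytic_on_sum analytic_on_mult analytic_on_const) auto
  moreover have "H k 0 = (\<Sum>h = 1..m k. x k h * (b k * d k h))" if "k \<in> K" for k
    unfolding H_def using p that by (intro sum.cong refl) auto
  ultimately show ?thesis by (intro exI[of _ H]) simp
qed

end

lemma cpow_arg_times:
  assumes "z \<noteq> 0" "w \<noteq> 0"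
  shows "cpow_arg (z * w) (\<phi> + \<psi>) a = cpow_arg z \<phi> a * cpow_arg w \<psi> a"
  using assms by (simp add: cpow_arg_def norm_mult ln_mult exp_add[symmetric] algebra_simps)

text \<open>Division by \<tau> = t_i - t_(p+1) rotates the ray through t_i to the positive axis and
  sends t_i to 1.\<close>

lemma sector_wedge_plus:
  assumes ta: "is_Arg \<tau> \<theta>" and t0: "\<tau> \<noteq> 0" and b: "0 < \<beta>" "\<beta> \<le> pi"
  shows "sector c \<theta> (\<theta> + \<beta>) = (\<lambda>y. c + \<tau> * y) ` wedge 1 \<beta>"
proof -
  have t: "\<tau> = rcis (cmod \<tau>) \<theta>" using ta by (simp add: is_Arg_def rcis_def cis_conv_exp)
  have m: "\<tau> * rcis r \<psi> = rcis (cmod \<tau> * r) (\<theta> + \<psi>)" for r \<psi> by (subst t) (rule rcis_mult)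
  show ?thesis
  proof (intro equalityI subsetI)
    fix x assume "x \<in> sector c \<theta> (\<theta> + \<beta>)"
    then obtain r \<phi> where x: "x = c + rcis r \<phi>" "0 < r" "\<theta> < \<phi>" "\<phi> < \<theta> + \<beta>" unfolding sector_def by blast
    have "rcis (r / cmod \<tau>) (1 * (\<phi> - \<theta>)) \<in> wedge 1 \<beta>"
      unfolding wedge_iff[OF disjI1[OF refl] b] using x t0 by (intro exI[of _ "r / cmod \<tau>"] exI[of _ "\<phi> - \<theta>"]) simp
    moreover have "x = c + \<tau> * rcis (r / cmod \<tau>) (1 * (\<phi> - \<theta>))" unfolding m x(1) using t0 by simp
    ultimately show "x \<in> (\<lambda>y. c + \<tau> * y) ` wedge 1 \<beta>" by blast
  next
    fix x assume "x \<in> (\<lambda>y. c + \<tau> * y) ` wedge 1 \<beta>"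
    then obtain y where y: "y \<in> wedge 1 \<beta>" "x = c + \<tau> * y" by blast
    from y(1)[unfolded wedge_iff[OF disjI1[OF refl] b]] obtain r \<psi> where r: "0 < r" "0 < \<psi>" "\<psi> < \<beta>" "y = rcis r (1 * \<psi>)" by blast
    have x: "x = c + \<tau> * rcis r (1 * \<psi>)" "0 < r" "0 < \<psi>" "\<psi> < \<beta>" using y(2) r by simp_all
    have "x = c + rcis (cmod \<tau> * r) (\<theta> + \<psi>)" unfolding x(1) m by simp
    moreover have "0 < cmod \<tau> * r" using x t0 by simp
    ultimately show "x \<in> sector c \<theta> (\<theta> + \<beta>)" unfolding sector_def using x(3,4) by force
  qed
qed

lemma sector_wedge_minus:
  assumes ta: "is_Arg \<tau> \<theta>" and t0: "\<tau> \<noteq> 0" and b: "0 < \<beta>" "\<beta> \<le> pi"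
  shows "sector c (\<theta> - \<beta>) \<theta> = (\<lambda>y. c + \<tau> * y) ` wedge (- 1) \<beta>"
proof -
  have t: "\<tau> = rcis (cmod \<tau>) \<theta>" using ta by (simp add: is_Arg_def rcis_def cis_conv_exp)
  have m: "\<tau> * rcis r \<psi> = rcis (cmod \<tau> * r) (\<theta> + \<psi>)" for r \<psi> by (subst t) (rule rcis_mult)
  show ?thesis
  proof (intro equalityI subsetI)
    fix x assume "x \<in> sector c (\<theta> - \<beta>) \<theta>"
    then obtain r \<phi> where x: "x = c + rcis r \<phi>" "0 < r" "\<theta> - \<beta> < \<phi>" "\<phi> < \<theta>" unfolding sector_def by blast
    have "rcis (r / cmod \<tau>) (- 1 * (\<theta> - \<phi>)) \<in> wedge (- 1) \<beta>"
      unfolding wedge_iff[OF disjI2[OF refl] b] using x t0 by (intro exI[of _ "r / cmod \<tau>"] exI[of _ "\<theta> - \<phi>"]) simp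
    moreover have "x = c + \<tau> * rcis (r / cmod \<tau>) (- 1 * (\<theta> - \<phi>))" unfolding m x(1) using t0 by simp
    ultimately show "x \<in> (\<lambda>y. c + \<tau> * y) ` wedge (- 1) \<beta>" by blast
  next
    fix x assume "x \<in> (\<lambda>y. c + \<tau> * y) ` wedge (- 1) \<beta>"
    then obtain y where y: "y \<in> wedge (- 1) \<beta>" "x = c + \<tau> * y" by blast
    from y(1)[unfolded wedge_iff[OF disjI2[OF refl] b]] obtain r \<psi> where r: "0 < r" "0 < \<psi>" "\<psi> < \<beta>" "y = rcis r (- 1 * \<psi>)" by blast
    have x: "x = c + \<tau> * rcis r (- 1 * \<psi>)" "0 < r" "0 < \<psi>" "\<psi> < \<beta>" using y(2) r by simp_all
    have "x = c + rcis (cmod \<tau> * r) (\<theta> - \<psi>)" unfolding x(1) m by simp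
    moreover have "0 < cmod \<tau> * r" using x t0 by simp
    ultimately show "x \<in> sector c (\<theta> - \<beta>) \<theta>" unfolding sector_def using x(3,4) by force
  qed
qed

section \<open>Connection coefficients in the two sectors at \<open>t i\<close>\<close>

theorem theorem7p12:
  fixes p q n N :: nat
    and t :: "nat \<Rightarrow> complex" and nn r m :: "nat \<Rightarrow> nat" and l :: "nat \<Rightarrow> nat \<Rightarrow> nat"
    and lam :: "nat \<Rightarrow> nat \<Rightarrow> complex" and mu :: "nat \<Rightarrow> complex"
    and A P Pinv T TT AA T' :: "complex mat"
    and rho1 rho2 eta0 :: complex
    and \<theta> :: "nat \<Rightarrow> real" and \<delta> :: real
    and S_all Pcut :: "complex set"
    and Ut wt :: "nat \<Rightarrow> nat \<Rightarrow> nat \<Rightarrow> complex \<Rightarrow> complex vec"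
    and Up winf :: "nat \<Rightarrow> nat \<Rightarrow> complex \<Rightarrow> complex vec"
    and c :: "nat \<Rightarrow> nat \<Rightarrow> nat \<Rightarrow> nat \<Rightarrow> nat \<Rightarrow> complex"
    and C :: "real \<Rightarrow> nat \<Rightarrow> nat \<Rightarrow> nat \<Rightarrow> nat \<Rightarrow> nat \<Rightarrow> complex"
    and i k h :: nat
  assumes
    (* the singular points *)
        p: "1 \<le> p"
    and t_inj: "inj_on t {1..p + 1}"
    and t_noncollinear:
      "\<And>a b d. a \<in> {1..p + 1} \<Longrightarrow> b \<in> {1..p + 1} \<Longrightarrow> d \<in> {1..p + 1} \<Longrightarrow>
         a \<noteq> b \<Longrightarrow> a \<noteq> d \<Longrightarrow> b \<noteq> d \<Longrightarrow> \<not> collinear {t a, t b, t d}"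
    (* the matrices T, A, P *)
    and nn_pos: "\<And>i. i \<in> {1..p} \<Longrightarrow> 1 \<le> nn i"
    and n: "n = (\<Sum>i = 1..p. nn i)"
    and r_pos: "\<And>i. i \<in> {1..p} \<Longrightarrow> 1 \<le> r i"
    and l_pos: "\<And>i k. i \<in> {1..p} \<Longrightarrow> k \<in> {1..r i} \<Longrightarrow> 1 \<le> l i k"
    and l_sum: "\<And>i. i \<in> {1..p} \<Longrightarrow> (\<Sum>k = 1..r i. l i k) = nn i"
    and lam_inj: "\<And>i. i \<in> {1..p} \<Longrightarrow> inj_on (lam i) {1..r i}"
    and A: "A \<in> carrier_mat n n"
    and A_diag: "\<And>i. i \<in> {1..p} \<Longrightarrow>
          diag_block_at A (offset nn i) (nn i) = scalar_blocks (lam i) (l i) (r i)"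
    and q: "1 \<le> q"
    and m_pos: "\<And>k. k \<in> {1..q} \<Longrightarrow> 1 \<le> m k"
    and m_sum: "(\<Sum>k = 1..q. m k) = n"
    and mu_inj: "inj_on mu {1..q}"
    and P: "P \<in> carrier_mat n n"
    and Pinv: "Pinv \<in> carrier_mat n n" "inverts_mat P Pinv" "inverts_mat Pinv P"
    and A_conj: "Pinv * A * P = scalar_blocks mu m q"
    and rho2: "rho2 = mu q"
    and N: "N = 2 * n - m q"
    and T: "T = scalar_blocks t nn p"
    and TT: "TT = red_T n (m q) T (t (p + 1))"
    and AA: "AA = red_matrix n (m q) A P Pinv rho1 rho2"
    (* non-integrality *)
    and lam_nonint: "\<And>i k. i \<in> {1..p} \<Longrightarrow> k \<in> {1..r i} \<Longrightarrow> lam i k \<notin> \<int>"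
    and lam_diff: "\<And>i k h. i \<in> {1..p} \<Longrightarrow> k \<in> {1..r i} \<Longrightarrow> h \<in> {1..r i} \<Longrightarrow> k \<noteq> h \<Longrightarrow>
          lam i k - lam i h \<notin> \<int>"
    and mu_nonint: "\<And>k. k \<in> {1..q} \<Longrightarrow> mu k \<notin> \<int>"
    and mu_diff: "\<And>k h. k \<in> {1..q} \<Longrightarrow> h \<in> {1..q} \<Longrightarrow> k \<noteq> h \<Longrightarrow> mu k - mu h \<notin> \<int>"
    and lam_mu: "\<And>i k h. i \<in> {1..p} \<Longrightarrow> k \<in> {1..r i} \<Longrightarrow> h \<in> {1..q} \<Longrightarrow> lam i k - mu h \<notin> \<int>"
    and rho1_nonint: "rho1 \<notin> \<int>"
    and rho1_lam: "\<And>i k. i \<in> {1..p} \<Longrightarrow> k \<in> {1..r i} \<Longrightarrow> rho1 - lam i k \<notin> \<int>"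
    and rho1_mu: "\<And>k. k \<in> {1..q} \<Longrightarrow> rho1 - mu k \<notin> \<int>"
    (* implicit in the uniqueness of the solutions at t (p + 1) and in Gamma (mu k - rho1 - mu q) *)
    and exponent_nonint: "\<And>k. k \<in> {1..<q} \<Longrightarrow> rho1 + mu q - mu k \<notin> \<int>"
    (* arguments and sectors *)
    and theta_arg: "\<And>i. i \<in> {1..p} \<Longrightarrow> is_Arg (t i - t (p + 1)) (\<theta> i)"
    and theta_mono: "\<And>i j. 1 \<le> i \<Longrightarrow> i < j \<Longrightarrow> j \<le> p + 1 \<Longrightarrow> \<theta> i < \<theta> j"
    and theta_last: "\<theta> (p + 1) < \<theta> 1 + 2 * pi"
    and theta_0: "\<theta> 0 = \<theta> (p + 1) - 2 * pi"
    and delta: "0 < \<delta>" "\<And>i. i \<le> p \<Longrightarrow> \<delta> < \<theta> (i + 1) - \<theta> i"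
    and S_all: "S_all = (\<Union>i\<in>{1..p}. S_plus (t (p + 1)) \<theta> \<delta> i \<union> S_minus (t (p + 1)) \<theta> \<delta> i)"
    (* the local solutions of the system (x I - TT) dU/dx = AA U *)
    and Ut: "\<And>i k h. i \<in> {1..p} \<Longrightarrow> k \<in> {1..r i} \<Longrightarrow> h \<in> {1..l i k} \<Longrightarrow>
          local_solution N TT AA (S_plus (t (p + 1)) \<theta> \<delta> i \<union> S_minus (t (p + 1)) \<theta> \<delta> i)
            (t i) (\<theta> i - pi) (lam i k) (eps N (offset nn i + offset (l i) k + h)) (Ut i k h)"
    and Up: "\<And>k h. k \<in> {1..<q} \<Longrightarrow> h \<in> {1..m k} \<Longrightarrow>
          local_solution N TT AA S_all
            (t (p + 1)) (\<theta> 0) (rho1 + mu q - mu k) (eps N (n + offset m k + h)) (Up k h)"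
    (* the underlying system with rho = 0 and its connection coefficients *)
    and T': "T' = scalar_blocks (t_und eta0 (t (p + 1)) t) nn p"
    and Pcut: "Pcut = cut_plane p eta0 (t_und eta0 (t (p + 1)) t) (- \<theta> (p + 1))"
    and wt: "\<And>i k h. i \<in> {1..p} \<Longrightarrow> k \<in> {1..r i} \<Longrightarrow> h \<in> {1..l i k} \<Longrightarrow>
          local_solution n T' A Pcut
            (t_und eta0 (t (p + 1)) t i) (- \<theta> i - pi) (lam i k)
            (eps n (offset nn i + offset (l i) k + h)) (wt i k h)"
    and winf: "\<And>k h. k \<in> {1..q} \<Longrightarrow> h \<in> {1..m k} \<Longrightarrow>
          local_solution_inf n T' A Pcut
            eta0 (- \<theta> (p + 1)) (mu k) (P *\<^sub>v eps n (offset m k + h)) (winf k h)"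
    and c: "\<And>i k h \<zeta> j. i \<in> {1..p} \<Longrightarrow> k \<in> {1..r i} \<Longrightarrow> h \<in> {1..l i k} \<Longrightarrow> \<zeta> \<in> Pcut \<Longrightarrow> j < n \<Longrightarrow>
          vec_index (wt i k h \<zeta>) j =
            (\<Sum>k' = 1..q. \<Sum>h' = 1..m k'. c k' h' i k h * vec_index (winf k' h' \<zeta>) j)"
    (* the coefficients of the connection formula; s = 1 for S_plus, s = -1 for S_minus *)
    and C: "\<And>s k' h' i k h. C s k' h' i k h =
          exp (of_real (s * pi) * \<i> * lam i k)
          * cpow_arg (t i - t (p + 1)) (\<theta> i) (2 * lam i k - rho1 - mu q)
          * (Gamma (mu k' + 1) * Gamma (mu k' - rho1 - mu q))
          / (Gamma (mu k' - rho1) * Gamma (mu k' - mu q))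
          * c k' h' i k h"
    and ikh: "i \<in> {1..p}" "k \<in> {1..r i}" "h \<in> {1..l i k}"
  shows
    "(\<exists>H. hol_near N (t (p + 1)) H \<and>
        (\<forall>x \<in> S_plus (t (p + 1)) \<theta> \<delta> i. \<forall>j<N.
           vec_index (Ut i k h x) j =
             (\<Sum>k' = 1..q - 1. \<Sum>h' = 1..m k'. C 1 k' h' i k h * vec_index (Up k' h' x) j)
             + vec_index (H x) j)) \<and>
     (\<exists>H. hol_near N (t (p + 1)) H \<and>
        (\<forall>x \<in> S_minus (t (p + 1)) \<theta> \<delta> i. \<forall>j<N.
           vec_index (Ut i k h x) j =
             (\<Sum>k' = 1..q - 1. \<Sum>h' = 1..m k'. C (-1) k' h' i k h * vec_index (Up k' h' x) j)
             + vec_index (H x) j))"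
proof -
  define c0 where "c0 = t (p + 1)"
  \<comment> \<open>The reduced system keeps \<open>nv\<close> of the n lower rows;
    \<open>mh\<close> and \<open>tb\<close> list the diagonals of P^(-1) A P and of T row by
    row.\<close>
  define nv where "nv = n - m q"
  define mh where "mh = (\<lambda>j. mu (blk m j))"
  define tb where "tb = (\<lambda>j. t (blk nn j))"
  have mq: "m q \<le> n" using offset_le_total[of q q m] q m_sum by simp
  have N': "N = n + nv" using mq by (simp add: N nv_def)
  have Tc: "T \<in> carrier_mat n n" unfolding T by (rule scalar_blocks_carrier[of t nn p, folded n])
  have Ti: "T $$ (x, y) = (if x = y then tb x else 0)" if "x < n" "y < n" for x y
    unfolding T tb_def by (rule scalar_blocks_index[of x nn p y t, folded n, OF that])
  have T'c: "T' \<in> carrier_mat n n" unfolding T' by (rule scalar_blocks_carrier[of _ nn p, folded n])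
  have T'i: "T' $$ (x, y) = (if x = y then t_und eta0 c0 t (blk nn x) else 0)" if "x < n" "y < n" for x y
    unfolding T' c0_def by (rule scalar_blocks_index[of x nn p y, folded n, OF that])
  define Dg where "Dg = scalar_blocks mu m q"
  have Dgc: "Dg \<in> carrier_mat n n" using scalar_blocks_carrier[of mu m q] m_sum by (simp add: Dg_def)
  have Dgi: "Dg $$ (x, y) = (if x = y then mh x else 0)" if "x < n" "y < n" for x y
    unfolding Dg_def mh_def by (rule scalar_blocks_index[of x m q y mu, unfolded m_sum, OF that])
  have conj: "Pinv * A * P = Dg" using A_conj by (simp add: Dg_def)
  have TTc: "TT \<in> carrier_mat N N" unfolding TT red_T_def N'
    by (rule four_block_carrier_mat[OF Tc]) (simp add: nv_def)
  have TTi: "TT $$ (x, y) = (if x = y then if x < n then tb x else c0 else 0)" if "x < N" "y < N" for x y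
    unfolding TT red_T_def c0_def by (subst index_mat_four_block) (use Tc mq that in \<open>auto simp: N' nv_def Ti\<close>)
  define D1 where "D1 = Dg - rho1 \<cdot>\<^sub>m 1\<^sub>m n"
  define D2 where "D2 = Dg - rho2 \<cdot>\<^sub>m 1\<^sub>m n"
  have D1: "D1 \<in> carrier_mat n n" "\<And>x y. x < n \<Longrightarrow> y < n \<Longrightarrow> D1 $$ (x, y) = (if x = y then mh x - rho1 else 0)"
    using Dgc by (auto simp: D1_def Dgi)
  have D2: "D2 \<in> carrier_mat n n" "\<And>x y. x < n \<Longrightarrow> y < n \<Longrightarrow> D2 $$ (x, y) = (if x = y then mh x - rho2 else 0)"
    using Dgc by (auto simp: D2_def Dgi)
  have Ec: "D1 * D2 \<in> carrier_mat n n" using D1 D2 by simp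
  have Ei: "(D1 * D2) $$ (x, y) = (if x = y then (mh x - rho1) * (mh x - rho2) else 0)" if "x < n" "y < n" for x y
    using diag_mult_index[OF D1(1) D2(1) that] D1(2) D2(2) that by simp
  define X where "X = - (D1 * D2 * Pinv)"
  have Xc: "X \<in> carrier_mat n n" unfolding X_def using Ec Pinv(1) by simp
  have Xi: "X $$ (x, y) = - ((mh x - rho1) * (mh x - rho2) * Pinv $$ (x, y))" if "x < n" "y < n" for x y
  proof -
    have "(D1 * D2 * Pinv) $$ (x, y) = (D1 * D2) $$ (x, x) * Pinv $$ (x, y)"
      by (rule diag_mult_index[OF Ec Pinv(1) that]) (use Ei that in simp)
    moreover have "X $$ (x, y) = - ((D1 * D2 * Pinv) $$ (x, y))" unfolding X_def
      by (rule index_uminus_mat(1)) (use Ec Pinv(1) that in auto)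
    ultimately show ?thesis using Ei[OF that(1) that(1)] by simp
  qed
  define Y2 where "Y2 = (rho1 + rho2) \<cdot>\<^sub>m 1\<^sub>m n - Dg"
  have Y2: "Y2 \<in> carrier_mat n n" "\<And>x y. x < n \<Longrightarrow> y < n \<Longrightarrow> Y2 $$ (x, y) = (if x = y then rho1 + rho2 - mh x else 0)"
    using Dgc by (auto simp: Y2_def Dgi)
  have AAe: "AA = Matrix.mat N N (\<lambda>(a, b). four_block_mat A P X Y2 $$ (0 + a, 0 + b))"
    unfolding AA red_matrix_def leading_block_def diag_block_at_def ext_matrix_def conj X_def Y2_def D1_def D2_def N ..
  have AAc: "AA \<in> carrier_mat N N" unfolding AAe by simp
  have AAi: "AA $$ (x, y) = (if x < n then if y < n then A $$ (x, y) else P $$ (x, y - n)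
      else if y < n then X $$ (x - n, y) else Y2 $$ (x - n, y - n))" if "x < N" "y < N" for x y
  proof -
    have "AA $$ (x, y) = four_block_mat A P X Y2 $$ (x, y)" unfolding AAe using that by simp
    also have "\<dots> = (if x < n then if y < n then A $$ (x, y) else P $$ (x, y - n)
      else if y < n then X $$ (x - n, y) else Y2 $$ (x - n, y - n))"
      by (subst index_mat_four_block) (use A P Xc Y2(1) that mq in \<open>auto simp: N' nv_def\<close>)
    finally show ?thesis .
  qed
  have PP: "P * Pinv = 1\<^sub>m n" "Pinv * P = 1\<^sub>m n" using Pinv P by (simp_all add: inverts_mat_def)
  have PPi: "(\<Sum>a<n. P $$ (x, a) * Pinv $$ (a, y)) = (if x = y then 1 else 0)" if "x < n" "y < n" for x y
    using mult_index[OF P Pinv(1) that] PP(1) that by simp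
  have PiP: "(\<Sum>a<n. Pinv $$ (x, a) * P $$ (a, y)) = (if x = y then 1 else 0)" if "x < n" "y < n" for x y
    using mult_index[OF Pinv(1) P that] PP(2) that by simp
  \<comment> \<open>Multiplying the conjugation by P^(-1) from the right gives P^(-1) A = D P^(-1),
    so the rows of P^(-1) are left eigenvectors of A.\<close>
  have PA: "Pinv * A = Dg * Pinv"
  proof -
    have PAc: "Pinv * A \<in> carrier_mat n n" using Pinv(1) A by simp
    have "Dg * Pinv = Pinv * A * (P * Pinv)" unfolding conj[symmetric] by (rule assoc_mult_mat[OF PAc P Pinv(1)])
    then show ?thesis using right_mult_one_mat[OF PAc] by (simp add: PP)
  qed
  have Pia: "(\<Sum>a<n. Pinv $$ (x, a) * A $$ (a, y)) = mh x * Pinv $$ (x, y)" if "x < n" "y < n" for x y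
  proof -
    have "(Dg * Pinv) $$ (x, y) = Dg $$ (x, x) * Pinv $$ (x, y)"
      by (rule diag_mult_index[OF Dgc Pinv(1) that]) (use Dgi that in simp)
    then show ?thesis using mult_index[OF Pinv(1) A that] PA Dgi that by simp
  qed
  have bm: "blk m j \<in> {1..q}" if "j < n" for j using blk_bounds(1)[of j m q] that m_sum by simp
  have bn: "blk nn j \<in> {1..p}" if "j < n" for j using blk_bounds(1)[of j nn p] that n by simp
  define \<tau> where "\<tau> = t i - c0"
  define lam0 where "lam0 = lam i k"
  \<comment> \<open>The logarithm of \<tau> with the prescribed argument, so that every power of
    \<tau> is exp (a L).\<close>
  define L where "L = of_real (ln (cmod \<tau>)) + \<i> * of_real (\<theta> i)"
  have td: "t b - c0 \<noteq> 0" if "b \<in> {1..p}" for b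
  proof
    assume "t b - c0 = 0"
    then have "t b = t (p + 1)" by (simp add: c0_def)
    then have "b = p + 1" by (rule inj_onD[OF t_inj]) (use that in auto)
    then show False using that by simp
  qed
  have t0: "\<tau> \<noteq> 0" unfolding \<tau>_def by (rule td[OF ikh(1)])
  have ta: "is_Arg \<tau> (\<theta> i)" unfolding \<tau>_def c0_def by (rule theta_arg[OF ikh(1)])
  \<comment> \<open>In the coordinate y the singular point of row j is 1 / \<kappa> j, and
    \<open>t i\<close> has become 1.\<close>
  define \<kappa> where "\<kappa> = (\<lambda>j. \<tau> / (tb j - c0))"
  have tbd: "tb j - c0 \<noteq> 0" if "j < n" for j unfolding tb_def by (rule td[OF bn[OF that]])
  have \<kappa>1: "blk nn j = i" if "j < n" "\<kappa> j = 1" for j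
  proof -
    have "tb j = t i" using that tbd[OF that(1)] by (simp add: \<kappa>_def \<tau>_def field_simps)
    then show ?thesis unfolding tb_def by (rule inj_onD[OF t_inj]) (use bn[OF that(1)] ikh(1) in auto)
  qed
  have Ablk: "A $$ (x, y) = (if x = y then lam i (blk (l i) (x - offset nn i)) else 0) \<and> blk (l i) (x - offset nn i) \<in> {1..r i}"
    if "x < n" "y < n" "blk nn x = i" "blk nn y = i" for x y
  proof -
    have x: "offset nn i \<le> x" "x < offset nn i + nn i" using blk_bounds(2,3)[of x nn p] that n by auto
    have y: "offset nn i \<le> y" "y < offset nn i + nn i" using blk_bounds(2,3)[of y nn p] that n by auto
    have xs: "x - offset nn i < nn i" and ys: "y - offset nn i < nn i" using x y by auto
    have "A $$ (x, y) = diag_block_at A (offset nn i) (nn i) $$ (x - offset nn i, y - offset nn i)"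
      using x y xs ys by (simp add: diag_block_at_def)
    also have "\<dots> = (if x - offset nn i = y - offset nn i then lam i (blk (l i) (x - offset nn i)) else 0)"
      unfolding A_diag[OF ikh(1)] by (rule scalar_blocks_index[of _ "l i" "r i", unfolded l_sum[OF ikh(1)], OF xs ys])
    also have "(x - offset nn i = y - offset nn i) = (x = y)" using x y by auto
    finally have "A $$ (x, y) = (if x = y then lam i (blk (l i) (x - offset nn i)) else 0)" .
    moreover have "blk (l i) (x - offset nn i) \<in> {1..r i}" by (rule blk_bounds(1)) (use xs l_sum[OF ikh(1)] in simp)
    ultimately show ?thesis by (rule conjI)
  qed
  have \<theta>b: "\<theta> 0 < \<theta> b \<and> \<theta> b < \<theta> (p + 1)" if "b \<in> {1..p}" for b
  proof -
    have "\<theta> 1 \<le> \<theta> b" using theta_mono[of 1 b] that by (cases "b = 1") auto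
    moreover have "\<theta> b < \<theta> (p + 1)" by (rule theta_mono) (use that in auto)
    ultimately show ?thesis using theta_0 theta_last by linarith
  qed
  define IJ where "IJ = offset nn i + offset (l i) k + h"
  \<comment> \<open>Both sectors are instances of one statement, with \<sigma> = 1 or -1. The last
    assumption keeps all directions strictly between \<theta> 0 and \<theta> (p + 1) and away from
    every \<theta> b, which keeps the corresponding values of \<zeta> off the cuts.\<close>
  have key: "\<exists>H. hol_near N c0 H \<and> (\<forall>x\<in>Sig. \<forall>j<N. vec_index (Ut i k h x) j =
      (\<Sum>k' = 1..q - 1. \<Sum>h' = 1..m k'. C \<sigma> k' h' i k h * vec_index (Up k' h' x) j) + vec_index (H x) j)"
    if \<sigma>: "\<sigma> = 1 \<or> \<sigma> = - 1" and \<beta>: "0 < \<beta>" "\<beta> \<le> pi" and Sig: "Sig = (\<lambda>y. c0 + \<tau> * y) ` wedge \<sigma> \<beta>"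
      and sub: "Sig \<subseteq> S_plus (t (p + 1)) \<theta> \<delta> i \<union> S_minus (t (p + 1)) \<theta> \<delta> i" "Sig \<subseteq> S_all"
      and rng: "\<And>\<psi>. 0 < \<psi> \<Longrightarrow> \<psi> < \<beta> \<Longrightarrow> \<theta> 0 < \<theta> i + \<sigma> * \<psi> \<and> \<theta> i + \<sigma> * \<psi> < \<theta> (p + 1) \<and> (\<forall>b\<in>{1..p}. \<theta> b \<noteq> \<theta> i + \<sigma> * \<psi>)"
    for \<sigma> \<beta> Sig
  proof -
    define Sg where "Sg = wedge \<sigma> \<beta>"
    have slit: "slit Sg" unfolding Sg_def by (rule wedge_slit[OF \<sigma> \<beta>])
    interpret sl: slit Sg by (rule slit)
    have xin: "c0 + \<tau> * y \<in> Sig" if "y \<in> Sg" for y using that by (auto simp: Sig Sg_def)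
    have y0: "y \<noteq> 0" "1 - y \<noteq> 0" if "y \<in> Sg" for y using sl.slits(3,4)[OF that] by auto
    have imy: "0 < \<sigma> * Im y" if "y \<in> Sg" for y using that by (simp add: Sg_def wedge_def)
    have ay: "\<theta> 0 < \<theta> i + Arg y \<and> \<theta> i + Arg y < \<theta> (p + 1) \<and> (\<forall>b\<in>{1..p}. \<theta> b \<noteq> \<theta> i + Arg y)" if y: "y \<in> Sg" for y
    proof -
      obtain r' \<psi> where r: "0 < r'" "0 < \<psi>" "\<psi> < \<beta>" "y = rcis r' (\<sigma> * \<psi>)" using y unfolding Sg_def wedge_iff[OF \<sigma> \<beta>] by blast
      have "Arg y = \<sigma> * \<psi>" unfolding r(4) by (rule Arg_rcis_wedge[OF \<sigma> r(1,2)]) (use r(3) \<beta> in linarith)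
      then show ?thesis using rng[OF r(2,3)] by simp
    qed
    have aty: "is_Arg (\<tau> * y) (\<theta> i + Arg y)" if "y \<in> Sg" for y by (rule is_Arg_mult[OF ta is_Arg_Arg[OF y0(1)[OF that]]])
    define zeta where "zeta = (\<lambda>y. eta0 + inverse (\<tau> * y))"
    \<comment> \<open>Seen from \<open>eta0\<close>, the nonzero points of a cut have argument -
      \<theta> b or - \<theta> (p + 1), while \<open>zeta y\<close> has argument - (\<theta> i + Arg
      y). All these lie within less than 2\<pi> of each other, so equality of points would force
      equality of arguments.\<close>
    have zin: "zeta y \<in> Pcut" if y: "y \<in> Sg" for y
    proof -
      note a = ay[OF y]
      have ty: "\<tau> * y \<noteq> 0" using t0 y0(1)[OF y] by simp
      have ia: "is_Arg (inverse (\<tau> * y)) (- (\<theta> i + Arg y))" by (rule is_Arg_inverse[OF aty[OF y]])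
      have 1: "zeta y \<notin> closed_segment eta0 (t_und eta0 (t (p + 1)) t b)" if b: "b \<in> {1..p}" for b
      proof
        assume "zeta y \<in> closed_segment eta0 (t_und eta0 (t (p + 1)) t b)"
        then obtain u where u: "0 \<le> u" "zeta y = (1 - u) *\<^sub>R eta0 + u *\<^sub>R t_und eta0 (t (p + 1)) t b" unfolding in_segment by blast
        have "(1 - u) *\<^sub>R eta0 + u *\<^sub>R t_und eta0 (t (p + 1)) t b = eta0 + of_real u * inverse (t b - c0)"
          by (simp add: t_und_def c0_def scaleR_conv_of_real divide_inverse algebra_simps)
        then have e: "inverse (\<tau> * y) = of_real u * inverse (t b - c0)" using u(2) by (simp add: zeta_def)
        have u0: "u \<noteq> 0"
        proof
          assume "u = 0"
          then have "inverse (\<tau> * y) = 0" using e by simp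
          then show False using ty by simp
        qed
        have "is_Arg (of_real u) 0" using u(1) by (simp add: is_Arg_def)
        from is_Arg_mult[OF this is_Arg_inverse[OF theta_arg[OF b]]]
        have ib: "is_Arg (of_real u * inverse (t b - c0)) (- \<theta> b)" by (simp add: c0_def)
        have "- (\<theta> i + Arg y) = - \<theta> b"
        proof (rule is_Arg_eqI[OF ia ib[folded e]])
          show "\<bar>- (\<theta> i + Arg y) - - \<theta> b\<bar> < 2 * pi" using a \<theta>b[OF b] theta_0 by linarith
          show "inverse (\<tau> * y) \<noteq> 0" using ty by simp
        qed
        then have "\<theta> b = \<theta> i + Arg y" by linarith
        then show False using a b by blast
      qed
      have 2: "zeta y \<noteq> eta0 + rcis s (- \<theta> (p + 1))" if s: "0 \<le> s" for s
      proof
        assume "zeta y = eta0 + rcis s (- \<theta> (p + 1))"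
        then have e: "inverse (\<tau> * y) = rcis s (- \<theta> (p + 1))" by (simp add: zeta_def)
        have ib: "is_Arg (rcis s (- \<theta> (p + 1))) (- \<theta> (p + 1))" using s by (simp add: is_Arg_def rcis_def cis_conv_exp norm_mult)
        have "- (\<theta> i + Arg y) = - \<theta> (p + 1)"
        proof (rule is_Arg_eqI[OF ia ib[folded e]])
          show "\<bar>- (\<theta> i + Arg y) - - \<theta> (p + 1)\<bar> < 2 * pi" using a theta_0 by linarith
          show "inverse (\<tau> * y) \<noteq> 0" using ty by simp
        qed
        then show False using a by simp
      qed
      show ?thesis unfolding Pcut cut_plane_def using 1 2 by blast
    qed
    have argU: "arg_from (\<theta> 0) (\<tau> * y) = \<theta> i + Arg y" if "y \<in> Sg" for y
      by (rule arg_from_eqI[OF aty[OF that]]) (use ay[OF that] theta_0 t0 y0(1)[OF that] in \<open>auto\<close>)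
    have powU: "cpow_arg (\<tau> * y) (arg_from (\<theta> 0) (\<tau> * y)) a = exp (a * L) * y powr a" if "y \<in> Sg" for y a
      unfolding argU[OF that] L_def by (rule cpow_arg_mult[OF t0 y0(1)[OF that]])
    \<comment> \<open>Since x - t_i = - \<tau> (1 - y), the prescribed branch gives -1 the argument
      \<sigma> \<pi>. This is the source of the exponential factor with the double sign in the
      formula.\<close>
    have m1: "is_Arg (- 1) (\<sigma> * pi)" using \<sigma> by (auto simp: is_Arg_def exp_minus)
    have mt: "is_Arg (- \<tau>) (\<theta> i + \<sigma> * pi)" using is_Arg_mult[OF ta m1] by simp
    have xt: "c0 + \<tau> * y - t i = - \<tau> * (1 - y)" for y by (simp add: \<tau>_def algebra_simps)
    have argW: "arg_from (\<theta> i - pi) (- \<tau> * (1 - y)) = \<theta> i + \<sigma> * pi + Arg (1 - y)" if "y \<in> Sg" for y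
    proof (rule arg_from_eqI[OF is_Arg_mult[OF mt is_Arg_Arg[OF y0(2)[OF that]]]])
      note b = Arg_one_minus(1,2)[OF \<sigma> imy[OF that]]
      show "\<theta> i - pi \<le> \<theta> i + \<sigma> * pi + Arg (1 - y)" "\<theta> i + \<sigma> * pi + Arg (1 - y) < \<theta> i - pi + 2 * pi" using \<sigma> b by auto
      show "- \<tau> * (1 - y) \<noteq> 0" using t0 y0(2)[OF that] by simp
    qed
    have powW: "cpow_arg (- \<tau> * (1 - y)) (arg_from (\<theta> i - pi) (- \<tau> * (1 - y))) a = exp (a * (L + \<i> * of_real (\<sigma> * pi))) * (1 - y) powr a" if "y \<in> Sg" for y a
    proof -
      have "- \<tau> \<noteq> 0" using t0 by simp
      from cpow_arg_mult[OF this y0(2)[OF that], of "\<theta> i + \<sigma> * pi" a] show ?thesis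
        unfolding argW[OF that] by (simp add: L_def distrib_left add_ac)
    qed
    have argI: "arg_from (- \<theta> (p + 1)) (inverse (\<tau> * y)) = - (\<theta> i + Arg y)" if "y \<in> Sg" for y
      by (rule arg_from_eqI[OF is_Arg_inverse[OF aty[OF that]]]) (use ay[OF that] theta_0 t0 y0(1)[OF that] in \<open>auto\<close>)
    have inv: "cpow_arg (inverse (\<tau> * y)) (- (\<theta> i + Arg y)) a = exp (- a * L) * y powr (- a)" if "y \<in> Sg" for y a
    proof -
      have "cpow_arg (inverse (\<tau> * y)) (- (\<theta> i + Arg y)) a = cpow_arg (\<tau> * y) (\<theta> i + Arg y) (- a)"
        unfolding cpow_arg_def norm_inverse using t0 y0(1)[OF that] by (simp add: ln_inverse algebra_simps del: norm_mult)
      also have "\<dots> = exp (- a * L) * y powr (- a)" unfolding L_def by (rule cpow_arg_mult[OF t0 y0(1)[OF that]])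
      finally show ?thesis .
    qed
    have powI: "cpow_arg (inverse (\<tau> * y)) (arg_from (- \<theta> (p + 1)) (inverse (\<tau> * y))) a = exp (- a * L) * y powr (- a)" if "y \<in> Sg" for y a
      unfolding argI[OF that] by (rule inv[OF that])
    have zt: "zeta y - t_und eta0 c0 t i = (1 - y) * inverse (\<tau> * y)" if "y \<in> Sg" for y
      using t0 y0(1)[OF that] by (simp add: zeta_def t_und_def \<tau>_def[symmetric] field_simps)
    have argT: "arg_from (- \<theta> i - pi) ((1 - y) * inverse (\<tau> * y)) = Arg (1 - y) + - (\<theta> i + Arg y)" if "y \<in> Sg" for y
    proof (rule arg_from_eqI[OF is_Arg_mult[OF is_Arg_Arg[OF y0(2)[OF that]] is_Arg_inverse[OF aty[OF that]]]])
      note b = Arg_one_minus(3)[OF \<sigma> imy[OF that]]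
      show "- \<theta> i - pi \<le> Arg (1 - y) + - (\<theta> i + Arg y)" "Arg (1 - y) + - (\<theta> i + Arg y) < - \<theta> i - pi + 2 * pi" using b by linarith+
      show "(1 - y) * inverse (\<tau> * y) \<noteq> 0" using t0 y0[OF that] by simp
    qed
    have powT: "cpow_arg ((1 - y) * inverse (\<tau> * y)) (arg_from (- \<theta> i - pi) ((1 - y) * inverse (\<tau> * y))) a =
      (1 - y) powr a * (exp (- a * L) * y powr (- a))" if "y \<in> Sg" for y a
    proof -
      have "cpow_arg ((1 - y) * inverse (\<tau> * y)) (Arg (1 - y) + - (\<theta> i + Arg y)) a =
        cpow_arg (1 - y) (Arg (1 - y)) a * cpow_arg (inverse (\<tau> * y)) (- (\<theta> i + Arg y)) a"
        by (rule cpow_arg_times) (use t0 y0[OF that] in simp_all)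
      also have "cpow_arg (1 - y) (Arg (1 - y)) a = (1 - y) powr a" using y0(2)[OF that] by (simp add: cpow_arg_def powr_def Ln_cart)
      finally show ?thesis unfolding argT[OF that] inv[OF that] .
    qed
    \<comment> \<open>Under x = c0 + \<tau> y the factor \<tau> of the chain rule cancels against
      the one in x - T, so the matrix on the right is unchanged.\<close>
    have aff: "((\<lambda>y. vec_index (V (c0 + \<tau> * y)) j) has_field_derivative deriv (\<lambda>y. vec_index (V (c0 + \<tau> * y)) j) y) (at y)"
      "(y - (if j < n then 1 / \<kappa> j else 0)) * deriv (\<lambda>y. vec_index (V (c0 + \<tau> * y)) j) y = (\<Sum>a<N. AA $$ (j, a) * vec_index (V (c0 + \<tau> * y)) a)"
      if V: "solves_on N TT AA Q V" "Sig \<subseteq> Q" and y: "y \<in> Sg" and j: "j < N" for V Q y j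
    proof -
      have x: "c0 + \<tau> * y \<in> Q" using xin[OF y] V(2) by blast
      note s = solves_on_component[OF V(1) TTc AAc _ x j]
      have off: "\<And>a b. a < N \<Longrightarrow> b < N \<Longrightarrow> a \<noteq> b \<Longrightarrow> TT $$ (a, b) = 0" by (simp add: TTi)
      define D where "D = deriv (\<lambda>x. vec_index (V x) j) (c0 + \<tau> * y)"
      have "((\<lambda>y. c0 + \<tau> * y) has_field_derivative \<tau>) (at y)"
        by (rule DERIV_cong[OF DERIV_add[OF DERIV_const DERIV_cmult[OF DERIV_ident]]]) simp
      from DERIV_chain2[OF s(1)[OF off] this]
      have d: "((\<lambda>y. vec_index (V (c0 + \<tau> * y)) j) has_field_derivative D * \<tau>) (at y)" unfolding D_def .
      note dd = DERIV_imp_deriv[OF d]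
      show "((\<lambda>y. vec_index (V (c0 + \<tau> * y)) j) has_field_derivative deriv (\<lambda>y. vec_index (V (c0 + \<tau> * y)) j) y) (at y)" unfolding dd by (rule d)
      have "(y - (if j < n then 1 / \<kappa> j else 0)) * (D * \<tau>) = (c0 + \<tau> * y - TT $$ (j, j)) * D"
        using t0 tbd[of j] j by (auto simp: TTi \<kappa>_def field_simps)
      also have "\<dots> = (\<Sum>a<N. AA $$ (j, a) * vec_index (V (c0 + \<tau> * y)) a)" unfolding D_def by (rule s(2)[OF off])
      finally show "(y - (if j < n then 1 / \<kappa> j else 0)) * deriv (\<lambda>y. vec_index (V (c0 + \<tau> * y)) j) y = (\<Sum>a<N. AA $$ (j, a) * vec_index (V (c0 + \<tau> * y)) a)"
        unfolding dd .
    qed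
    \<comment> \<open>Since \<zeta> - t'_i = (1 - y) / (\<tau> y), the germ of the underlying
      solution at y = 1 carries the factor exp (- lam0 L). \<open>E\<close> removes it, and the
      leading vector becomes a unit vector.\<close>
    define E where "E = exp (lam0 * L)"
    define w where "w = (\<lambda>j y. E * vec_index (wt i k h (zeta y)) j)"
    have wsol: "solves_on n T' A Pcut (wt i k h)"
      and wexp: "has_expansion n Pcut (wt i k h) (\<lambda>x. cpow_arg (x - t_und eta0 c0 t i) (arg_from (- \<theta> i - pi) (x - t_und eta0 c0 t i)) lam0)
        (\<lambda>x. x - t_und eta0 c0 t i) (eps n IJ)"
      using wt[OF ikh] unfolding local_solution_def IJ_def lam0_def c0_def by blast+
    have offT': "\<And>a b. a < n \<Longrightarrow> b < n \<Longrightarrow> a \<noteq> b \<Longrightarrow> T' $$ (a, b) = 0" by (simp add: T'i)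
    define Dw where "Dw = (\<lambda>j y. deriv (\<lambda>z. vec_index (wt i k h z) j) (zeta y))"
    have dw: "(w j has_field_derivative E * (Dw j y * - (inverse (\<tau> * y) * inverse y))) (at y)" if j: "j < n" and y: "y \<in> Sg" for j y
    proof -
      have ty: "\<tau> * y \<noteq> 0" using t0 y0(1)[OF y] by simp
      have "((\<lambda>y. inverse (\<tau> * y)) has_field_derivative - (inverse (\<tau> * y) * \<tau> * inverse (\<tau> * y))) (at y)"
        by (rule DERIV_inverse'[where f = "\<lambda>y. \<tau> * y" and x = y, OF _ ty]) (rule DERIV_cong[OF DERIV_cmult[OF DERIV_ident]], simp)
      then have "(zeta has_field_derivative - (inverse (\<tau> * y) * inverse y)) (at y)" unfolding zeta_def
        by (intro DERIV_cong[OF DERIV_add[OF DERIV_const]]) (use t0 y0(1)[OF y] in \<open>auto simp: field_simps\<close>)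
      from DERIV_cmult[OF DERIV_chain2[OF solves_on_component(1)[OF wsol T'c A offT' zin[OF y] j] this], of E]
      show ?thesis unfolding w_def Dw_def .
    qed
    have w_hol: "w j holomorphic_on Sg" if "j < n" for j
      unfolding holomorphic_on_open[OF sl.S(1)] using dw[OF that] by blast
    have w_ode: "(\<Sum>a<n. A $$ (j, a) * w a y) + y * deriv (w j) y = \<kappa> j * y * (y * deriv (w j) y)" if j: "j < n" and y: "y \<in> Sg" for j y
    proof -
      have d: "deriv (w j) y = E * (Dw j y * - (inverse (\<tau> * y) * inverse y))" by (rule DERIV_imp_deriv[OF dw[OF j y]])
      have "(\<Sum>a<n. A $$ (j, a) * w a y) = E * (\<Sum>a<n. A $$ (j, a) * vec_index (wt i k h (zeta y)) a)"
        unfolding w_def sum_distrib_left by (rule sum.cong[OF refl]) (rule mult.left_commute)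
      also have "(\<Sum>a<n. A $$ (j, a) * vec_index (wt i k h (zeta y)) a) = (zeta y - T' $$ (j, j)) * Dw j y"
        unfolding Dw_def by (rule solves_on_component(2)[OF wsol T'c A offT' zin[OF y] j, symmetric])
      also have "T' $$ (j, j) = eta0 + 1 / (tb j - c0)" using j by (simp add: T'i t_und_def tb_def)
      finally have s: "(\<Sum>a<n. A $$ (j, a) * w a y) = E * ((inverse (\<tau> * y) - 1 / (tb j - c0)) * Dw j y)" by (simp add: zeta_def)
      show ?thesis unfolding s d \<kappa>_def using t0 y0(1)[OF y] tbd[OF j] by (simp add: field_simps)
    qed
    have E0: "E * exp (- lam0 * L) = 1" by (simp add: E_def exp_minus)
    have "\<exists>g. germ1 Sg lam0 g (w j) \<and> fps_nth g 0 = vec_index (eps n IJ) j" if j: "j < n" for j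
    proof -
      obtain \<phi> g r' where p: "\<phi> has_fps_expansion g" "fps_nth g 0 = vec_index (eps n IJ) j" "0 < r'"
        "\<forall>x\<in>Pcut. cmod (x - t_und eta0 c0 t i) < r' \<longrightarrow> vec_index (wt i k h x) j =
           cpow_arg (x - t_und eta0 c0 t i) (arg_from (- \<theta> i - pi) (x - t_und eta0 c0 t i)) lam0 * \<phi> (x - t_und eta0 c0 t i)"
        using has_expansion_component[OF wexp j] by blast
      have "\<exists>g'. germ1 Sg lam0 g' (w j) \<and> fps_nth g' 0 = 1 * fps_nth g 0"
      proof (rule sl.germ1_of_expansion[where ch = "\<lambda>u. u * inverse (\<tau> * (1 - u))" and e = "- lam0", OF p(1,3)])
        show "(\<lambda>u. u * inverse (\<tau> * (1 - u))) analytic_on {0}" by (intro analytic_intros) (use t0 in auto)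
        fix y assume y: "y \<in> Sg" and sm: "cmod ((1 - y) * inverse (\<tau> * (1 - (1 - y)))) < r'"
        have e: "(1 - y) * inverse (\<tau> * (1 - (1 - y))) = (1 - y) * inverse (\<tau> * y)" by simp
        have "vec_index (wt i k h (zeta y)) j = ((1 - y) powr lam0 * (exp (- lam0 * L) * y powr (- lam0))) * \<phi> ((1 - y) * inverse (\<tau> * y))"
          using p(4)[rule_format, OF zin[OF y]] sm unfolding zt[OF y] powT[OF y] e by blast
        then have "w j y = (E * exp (- lam0 * L)) * ((1 - y) powr lam0 * (y powr (- lam0) * \<phi> ((1 - y) * inverse (\<tau> * y))))"
          unfolding w_def by (simp only: mult_ac)
        then show "w j y = (1 - y) powr lam0 * (1 * (y powr (- lam0) * \<phi> ((1 - y) * inverse (\<tau> * (1 - (1 - y))))))"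
          unfolding E0 e by simp
      qed simp
      then show ?thesis using p(2) by simp
    qed
    then obtain gw where gw: "\<And>j. j < n \<Longrightarrow> germ1 Sg lam0 (gw j) (w j)" "\<And>j. j < n \<Longrightarrow> fps_nth (gw j) 0 = vec_index (eps n IJ) j" by metis
    \<comment> \<open>The leading coefficient of y^(- mu k') in w: the expansion at infinity is in
      powers of 1 / (\<zeta> - eta0) = \<tau> y, so the exponent mu k' leaves the power - mu k' of
      \<tau> as a constant.\<close>
    define cc where "cc = (\<lambda>j k'. \<Sum>h' = 1..m k'. E * c k' h' i k h * (exp (- mu k' * L) * vec_index (P *\<^sub>v eps n (offset m k' + h')) j))"
    have w0: "\<exists>H. (\<forall>k'\<in>{1..q}. H k' analytic_on {0} \<and> H k' 0 = cc j k') \<and>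
        (\<forall>\<^sub>F y in at 0 within Sg. w j y = (\<Sum>k'\<in>{1..q}. y powr (- mu k') * H k' y))" if j: "j < n" for j
    proof -
      have "\<exists>\<phi> g r. \<phi> has_fps_expansion g \<and> fps_nth g 0 = vec_index (P *\<^sub>v eps n (offset m k' + h')) j \<and> 0 < r \<and>
        (\<forall>y\<in>Sg. cmod (\<tau> * y) < r \<longrightarrow> vec_index (winf k' h' (zeta y)) j = y powr (- mu k') * (exp (- mu k' * L) * \<phi> (\<tau> * y)))"
        if kh: "k' \<in> {1..q}" "h' \<in> {1..m k'}" for k' h'
      proof -
        have "has_expansion n Pcut (winf k' h') (\<lambda>x. cpow_arg (x - eta0) (arg_from (- \<theta> (p + 1)) (x - eta0)) (mu k'))
          (\<lambda>x. inverse (x - eta0)) (P *\<^sub>v eps n (offset m k' + h'))"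
          using winf[OF kh] unfolding local_solution_inf_def by blast
        from has_expansion_component[OF this j] obtain \<phi> g r' where p: "\<phi> has_fps_expansion g"
          "fps_nth g 0 = vec_index (P *\<^sub>v eps n (offset m k' + h')) j" "0 < r'"
          "\<forall>x\<in>Pcut. cmod (inverse (x - eta0)) < r' \<longrightarrow> vec_index (winf k' h' x) j =
            cpow_arg (x - eta0) (arg_from (- \<theta> (p + 1)) (x - eta0)) (mu k') * \<phi> (inverse (x - eta0))" by blast
        have ze: "zeta y - eta0 = inverse (\<tau> * y)" for y by (simp add: zeta_def)
        have "vec_index (winf k' h' (zeta y)) j = y powr (- mu k') * (exp (- mu k' * L) * \<phi> (\<tau> * y))" if y: "y \<in> Sg" "cmod (\<tau> * y) < r'" for y
        proof -
          have "vec_index (winf k' h' (zeta y)) j = (exp (- mu k' * L) * y powr (- mu k')) * \<phi> (\<tau> * y)"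
            using p(4)[rule_format, OF zin[OF y(1)]] y(2) unfolding ze powI[OF y(1)] inverse_inverse_eq by blast
          then show ?thesis by (simp only: mult_ac)
        qed
        with p(1-3) show ?thesis by (intro exI[of _ \<phi>] exI[of _ g] exI[of _ r']) simp
      qed
      from sl.germ0_of_expansions[where K = "{1..q}" and m = m and d = "\<lambda>k' h'. vec_index (P *\<^sub>v eps n (offset m k' + h')) j" and \<tau> = \<tau>
          and V = "\<lambda>k' h' y. vec_index (winf k' h' (zeta y)) j" and e = "\<lambda>k'. - mu k'" and b = "\<lambda>k'. exp (- mu k' * L)"
          and x = "\<lambda>k' h'. E * c k' h' i k h", OF finite_atLeastAtMost this]
      obtain H where H: "\<forall>k'\<in>{1..q}. H k' analytic_on {0} \<and> H k' 0 = cc j k'"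
        "\<forall>\<^sub>F y in at 0 within Sg. (\<Sum>k'\<in>{1..q}. \<Sum>h' = 1..m k'. E * c k' h' i k h * vec_index (winf k' h' (zeta y)) j) = (\<Sum>k'\<in>{1..q}. y powr (- mu k') * H k' y)"
        unfolding cc_def by blast
      have "\<forall>\<^sub>F y in at 0 within Sg. w j y = (\<Sum>k'\<in>{1..q}. y powr (- mu k') * H k' y)"
        using H(2) sl.eventually_at_S
      proof eventually_elim
        case (elim y)
        have "w j y = (\<Sum>k'\<in>{1..q}. \<Sum>h' = 1..m k'. E * c k' h' i k h * vec_index (winf k' h' (zeta y)) j)"
          unfolding w_def c[OF ikh zin[OF elim(2)] j] sum_distrib_left by (simp only: mult.assoc)
        then show ?case using elim(1) by simp
      qed
      with H(1) show ?thesis by (intro exI[of _ H] conjI)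
    qed
    have lam0: "lam0 \<notin> \<int>" "lam0 - rho1 \<notin> \<int>"
    proof -
      show "lam0 \<notin> \<int>" unfolding lam0_def by (rule lam_nonint[OF ikh(1,2)])
      have "- (rho1 - lam0) \<notin> \<int>" using rho1_lam[OF ikh(1,2)] by (simp only: minus_in_Ints_iff lam0_def not_False_eq_True)
      then show "lam0 - rho1 \<notin> \<int>" by simp
    qed
    interpret O: okubo Sg n nv q "\<lambda>x y. A $$ (x, y)" "\<lambda>x y. P $$ (x, y)" "\<lambda>x y. Pinv $$ (x, y)" mh \<kappa> mu rho1 rho2 lam0 w gw cc
    proof (intro okubo.intro okubo_axioms.intro)
      show "mh j \<notin> \<int>" if "j < n" for j unfolding mh_def by (rule mu_nonint[OF bm[OF that]])
      show "mh j = rho2" if "nv \<le> j" "j < n" for j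
      proof -
        \<comment> \<open>The last block of P^(-1) A P occupies exactly the indices from nv
          on.\<close>
        have "offset m q + m q = n" using offset_Suc[OF q, of m] offset_total[of m q] m_sum by simp
        then have "offset m q = nv" by (simp add: nv_def)
        then have "blk m j = q" using that q mq by (intro blk_eqI) (auto simp: nv_def)
        then show ?thesis by (simp add: mh_def rho2)
      qed
      show "\<kappa> j \<noteq> 0" if "j < n" for j using t0 tbd[OF that] by (simp add: \<kappa>_def)
      show "rho1 + rho2 - mu k' \<notin> \<int>" if "k' \<in> {1..<q}" for k' unfolding rho2 by (rule exponent_nonint[OF that])
    qed (fact slit PPi Pia q rho2 lam0 rho1_nonint mu_nonint rho1_mu mu_diff w_hol gw(1) w0 w_ode | simp add: nv_def)+
    have OT: "O.T j = (if j < n then 1 / \<kappa> j else 0)" for j by (simp add: O.T_def)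
    have OM: "AA $$ (j, a) = O.M j a" if "j < n + nv" "a < n + nv" for j a
      using that mq Xi[of "j - n" a] Y2(2)[of "j - n" "a - n"] AAi[of j a] unfolding O.M_def by (auto simp: N' nv_def simp del: minus_diff_eq)
    \<comment> \<open>The same normalisation for the given solution: on its branch (x - t_i)^lam0
      carries the factor exp (lam0 (L + \<i> \<sigma> \<pi>)), which \<open>K0\<close>
      cancels.\<close>
    define K0 where "K0 = exp (- lam0 * L - lam0 * (\<i> * of_real (\<sigma> * pi)))"
    have K0: "K0 \<noteq> 0" by (simp add: K0_def)
    define W where "W = (\<lambda>j y. K0 * vec_index (Ut i k h (c0 + \<tau> * y)) j)"
    define Y where "Y = (\<lambda>j y. \<Sum>k'\<in>{1..<q}. \<Sum>h' = 1..m k'. (K0 * C \<sigma> k' h' i k h) * vec_index (Up k' h' (c0 + \<tau> * y)) j)"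
    have Usol: "solves_on N TT AA (S_plus (t (p + 1)) \<theta> \<delta> i \<union> S_minus (t (p + 1)) \<theta> \<delta> i) (Ut i k h)"
      and Uexp: "has_expansion N (S_plus (t (p + 1)) \<theta> \<delta> i \<union> S_minus (t (p + 1)) \<theta> \<delta> i) (Ut i k h)
        (\<lambda>x. cpow_arg (x - t i) (arg_from (\<theta> i - pi) (x - t i)) lam0) (\<lambda>x. x - t i) (eps N IJ)"
      using Ut[OF ikh] unfolding local_solution_def IJ_def lam0_def by blast+
    have Psol: "solves_on N TT AA S_all (Up k' h')" if "k' \<in> {1..<q}" "h' \<in> {1..m k'}" for k' h'
      using Up[OF that] unfolding local_solution_def by blast
    have dW: "(W j has_field_derivative K0 * deriv (\<lambda>y. vec_index (Ut i k h (c0 + \<tau> * y)) j) y) (at y)" if "j < n + nv" "y \<in> Sg" for j y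
      unfolding W_def by (rule DERIV_cmult[OF aff(1)[OF Usol sub(1) that(2)]]) (use that N' in simp)
    have dY: "(Y j has_field_derivative (\<Sum>k'\<in>{1..<q}. \<Sum>h' = 1..m k'. (K0 * C \<sigma> k' h' i k h) * deriv (\<lambda>y. vec_index (Up k' h' (c0 + \<tau> * y)) j) y)) (at y)"
      if j: "j < n + nv" and y: "y \<in> Sg" for j y
      unfolding Y_def by (intro DERIV_sum DERIV_cmult aff(1)[OF Psol sub(2) y]) (use j N' in simp_all)
    have W_hol: "W j holomorphic_on Sg" if "j < n + nv" for j
      unfolding holomorphic_on_open[OF sl.S(1)] using dW[OF that] by blast
    have Y_hol: "Y j holomorphic_on Sg" if "j < n + nv" for j
      unfolding holomorphic_on_open[OF sl.S(1)] using dY[OF that] by blast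
    have W_ode: "(y - O.T j) * deriv (W j) y = (\<Sum>a<n + nv. O.M j a * W a y)" if j: "j < n + nv" and y: "y \<in> Sg" for j y
    proof -
      have "j < N" using j N' by simp
      from aff(2)[OF Usol sub(1) y this]
      have "(y - O.T j) * deriv (W j) y = K0 * (\<Sum>a<N. AA $$ (j, a) * vec_index (Ut i k h (c0 + \<tau> * y)) a)"
        unfolding DERIV_imp_deriv[OF dW[OF j y]] OT by (simp add: mult.left_commute)
      also have "\<dots> = (\<Sum>a<n + nv. O.M j a * W a y)" unfolding sum_distrib_left N'
        by (rule sum.cong[OF refl]) (simp add: OM[OF j] W_def)
      finally show ?thesis .
    qed
    have Y_ode: "(y - O.T j) * deriv (Y j) y = (\<Sum>a<n + nv. O.M j a * Y a y)" if j: "j < n + nv" and y: "y \<in> Sg" for j y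
    proof -
      have jN: "j < N" using j N' by simp
      have "(y - O.T j) * deriv (Y j) y = (\<Sum>k'\<in>{1..<q}. \<Sum>h' = 1..m k'. (K0 * C \<sigma> k' h' i k h) * (\<Sum>a<N. AA $$ (j, a) * vec_index (Up k' h' (c0 + \<tau> * y)) a))"
        unfolding DERIV_imp_deriv[OF dY[OF j y]] OT sum_distrib_left[of "y - _"]
      proof (intro sum.cong refl)
        fix k' h' assume "k' \<in> {1..<q}" "h' \<in> {1..m k'}"
        from aff(2)[OF Psol[OF this] sub(2) y jN]
        show "(y - (if j < n then 1 / \<kappa> j else 0)) * (K0 * C \<sigma> k' h' i k h * deriv (\<lambda>y. vec_index (Up k' h' (c0 + \<tau> * y)) j) y) =
          K0 * C \<sigma> k' h' i k h * (\<Sum>a<N. AA $$ (j, a) * vec_index (Up k' h' (c0 + \<tau> * y)) a)"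
          by (simp only: mult.left_commute[of "y - _"])
      qed
      also have "\<dots> = (\<Sum>k'\<in>{1..<q}. \<Sum>h' = 1..m k'. \<Sum>a<N. O.M j a * ((K0 * C \<sigma> k' h' i k h) * vec_index (Up k' h' (c0 + \<tau> * y)) a))"
        unfolding sum_distrib_left by (intro sum.cong refl) (use N' in \<open>simp add: OM[OF j] mult.left_commute\<close>)
      also have "\<dots> = (\<Sum>k'\<in>{1..<q}. \<Sum>a<N. \<Sum>h' = 1..m k'. O.M j a * ((K0 * C \<sigma> k' h' i k h) * vec_index (Up k' h' (c0 + \<tau> * y)) a))"
        by (rule sum.cong[OF refl], rule sum.swap)
      also have "\<dots> = (\<Sum>a<N. \<Sum>k'\<in>{1..<q}. \<Sum>h' = 1..m k'. O.M j a * ((K0 * C \<sigma> k' h' i k h) * vec_index (Up k' h' (c0 + \<tau> * y)) a))"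
        by (rule sum.swap)
      also have "\<dots> = (\<Sum>a<n + nv. O.M j a * Y a y)" unfolding Y_def sum_distrib_left N' ..
      finally show ?thesis .
    qed
    have "\<exists>g. germ1 Sg lam0 g (W j) \<and> fps_nth g 0 = vec_index (eps N IJ) j" if j: "j < n + nv" for j
    proof -
      have jN: "j < N" using j N' by simp
      obtain \<phi> g r' where p: "\<phi> has_fps_expansion g" "fps_nth g 0 = vec_index (eps N IJ) j" "0 < r'"
        "\<forall>x\<in>S_plus (t (p + 1)) \<theta> \<delta> i \<union> S_minus (t (p + 1)) \<theta> \<delta> i. cmod (x - t i) < r' \<longrightarrow> vec_index (Ut i k h x) j =
           cpow_arg (x - t i) (arg_from (\<theta> i - pi) (x - t i)) lam0 * \<phi> (x - t i)"
        using has_expansion_component[OF Uexp jN] by blast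
      have "\<exists>g'. germ1 Sg lam0 g' (W j) \<and> fps_nth g' 0 = 1 * fps_nth g 0"
      proof (rule sl.germ1_of_expansion[where ch = "\<lambda>u. - \<tau> * u" and e = 0, OF p(1,3)])
        show "(\<lambda>u. - \<tau> * u) analytic_on {0}" by (intro analytic_intros)
        fix y assume y: "y \<in> Sg" and sm: "cmod (- \<tau> * (1 - y)) < r'"
        have "c0 + \<tau> * y \<in> S_plus (t (p + 1)) \<theta> \<delta> i \<union> S_minus (t (p + 1)) \<theta> \<delta> i" using xin[OF y] sub(1) by blast
        from p(4)[rule_format, OF this] sm
        have "vec_index (Ut i k h (c0 + \<tau> * y)) j = (exp (lam0 * (L + \<i> * of_real (\<sigma> * pi))) * (1 - y) powr lam0) * \<phi> (- \<tau> * (1 - y))"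
          unfolding xt powW[OF y] by blast
        then have "W j y = (K0 * exp (lam0 * (L + \<i> * of_real (\<sigma> * pi)))) * ((1 - y) powr lam0 * \<phi> (- \<tau> * (1 - y)))"
          unfolding W_def by (simp only: mult_ac)
        moreover have "K0 * exp (lam0 * (L + \<i> * of_real (\<sigma> * pi))) = 1" unfolding K0_def exp_add[symmetric] by (simp add: algebra_simps)
        ultimately show "W j y = (1 - y) powr lam0 * (1 * (y powr 0 * \<phi> (- \<tau> * (1 - y))))" using y0(1)[OF y] by simp
      qed simp
      then show ?thesis using p(2) by simp
    qed
    then obtain GW where GW: "\<And>j. j < n + nv \<Longrightarrow> germ1 Sg lam0 (GW j) (W j)" "\<And>j. j < n + nv \<Longrightarrow> fps_nth (GW j) 0 = vec_index (eps N IJ) j" by metis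
    define dYl where "dYl = (\<lambda>j k'. \<Sum>h' = 1..m k'. K0 * C \<sigma> k' h' i k h * (exp ((rho1 + rho2 - mu k') * L) * vec_index (eps N (n + offset m k' + h')) j))"
    have Y0: "germ0 Sg {1..<q} (\<lambda>k'. rho1 + rho2 - mu k') (dYl j) (Y j)" if j: "j < n + nv" for j
    proof -
      have jN: "j < N" using j N' by simp
      have "\<exists>\<phi> g r. \<phi> has_fps_expansion g \<and> fps_nth g 0 = vec_index (eps N (n + offset m k' + h')) j \<and> 0 < r \<and>
        (\<forall>y\<in>Sg. cmod (\<tau> * y) < r \<longrightarrow> vec_index (Up k' h' (c0 + \<tau> * y)) j = y powr (rho1 + rho2 - mu k') * (exp ((rho1 + rho2 - mu k') * L) * \<phi> (\<tau> * y)))"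
        if kh: "k' \<in> {1..<q}" "h' \<in> {1..m k'}" for k' h'
      proof -
        have "has_expansion N S_all (Up k' h') (\<lambda>x. cpow_arg (x - c0) (arg_from (\<theta> 0) (x - c0)) (rho1 + rho2 - mu k'))
          (\<lambda>x. x - c0) (eps N (n + offset m k' + h'))"
          using Up[OF kh] unfolding local_solution_def c0_def rho2 by blast
        from has_expansion_component[OF this jN] obtain \<phi> g r' where p: "\<phi> has_fps_expansion g"
          "fps_nth g 0 = vec_index (eps N (n + offset m k' + h')) j" "0 < r'"
          "\<forall>x\<in>S_all. cmod (x - c0) < r' \<longrightarrow> vec_index (Up k' h' x) j =
            cpow_arg (x - c0) (arg_from (\<theta> 0) (x - c0)) (rho1 + rho2 - mu k') * \<phi> (x - c0)" by blast
        have ze: "c0 + \<tau> * y - c0 = \<tau> * y" for y by simp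
        have "vec_index (Up k' h' (c0 + \<tau> * y)) j = y powr (rho1 + rho2 - mu k') * (exp ((rho1 + rho2 - mu k') * L) * \<phi> (\<tau> * y))"
          if y: "y \<in> Sg" "cmod (\<tau> * y) < r'" for y
        proof -
          have "c0 + \<tau> * y \<in> S_all" using xin[OF y(1)] sub(2) by blast
          from p(4)[rule_format, OF this] y(2)
          have "vec_index (Up k' h' (c0 + \<tau> * y)) j = (exp ((rho1 + rho2 - mu k') * L) * y powr (rho1 + rho2 - mu k')) * \<phi> (\<tau> * y)"
            unfolding ze powU[OF y(1)] by blast
          then show ?thesis by (simp only: mult_ac)
        qed
        with p(1-3) show ?thesis by (intro exI[of _ \<phi>] exI[of _ g] exI[of _ r']) simp
      qed
      from sl.germ0_of_expansions[where K = "{1..<q}" and m = m and d = "\<lambda>k' h'. vec_index (eps N (n + offset m k' + h')) j" and \<tau> = \<tau>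
          and V = "\<lambda>k' h' y. vec_index (Up k' h' (c0 + \<tau> * y)) j" and e = "\<lambda>k'. rho1 + rho2 - mu k'" and b = "\<lambda>k'. exp ((rho1 + rho2 - mu k') * L)"
          and x = "\<lambda>k' h'. K0 * C \<sigma> k' h' i k h", OF finite_atLeastLessThan this]
      obtain H where H: "\<forall>k'\<in>{1..<q}. H k' analytic_on {0} \<and> H k' 0 = dYl j k'"
        "\<forall>\<^sub>F y in at 0 within Sg. Y j y = (\<Sum>k'\<in>{1..<q}. y powr (rho1 + rho2 - mu k') * H k' y)"
        unfolding dYl_def Y_def by blast
      then show ?thesis unfolding germ0_def by (intro exI[of _ H] exI[of _ "\<lambda>y. 0"]) simp
    qed
    \<comment> \<open>The projection by \<open>Pinv\<close> undoes the factor \<open>P\<close> in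
      the vectors at infinity, so each solution there contributes to exactly one row. What remains
      is a comparison of powers of \<tau>.\<close>
    have lead: "dYl (n + j) k' = O.Gfac k' * (\<Sum>a<n. Pinv $$ (j, a) * cc a k')" if j: "j < nv" and k': "k' \<in> {1..<q}" for j k'
    proof -
      have jn: "j < n" using j by (simp add: nv_def)
      have k'': "k' \<in> {1..q}" using k' by simp
      have "(\<Sum>a<n. Pinv $$ (j, a) * cc a k') =
         (\<Sum>h' = 1..m k'. E * c k' h' i k h * exp (- mu k' * L) * (\<Sum>a<n. Pinv $$ (j, a) * vec_index (P *\<^sub>v eps n (offset m k' + h')) a))"
        unfolding cc_def sum_distrib_left by (subst sum.swap) (intro sum.cong refl, simp only: mult_ac)
      \<comment> \<open>\<open>eps\<close> counts from 1 and rows are counted from 0, whence the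
        subtraction of 1, which is safe because h' is at least 1.\<close>
      also have "\<dots> = (\<Sum>h' = 1..m k'. E * c k' h' i k h * exp (- mu k' * L) * (if j = offset m k' + h' - 1 then 1 else 0))"
      proof (intro sum.cong refl arg_cong2[of _ _ _ _ times])
        fix h' assume h': "h' \<in> {1..m k'}"
        have b: "offset m k' + h' - 1 < n" using offset_le_total[OF k'', of m] h' m_sum by auto
        have "vec_index (P *\<^sub>v eps n (offset m k' + h')) a = P $$ (a, offset m k' + h' - 1)" if "a < n" for a
        proof -
          have "vec_index (P *\<^sub>v eps n (offset m k' + h')) a = row P a \<bullet> unit_vec n (offset m k' + h' - 1)"
            using P that by (simp add: eps_def)
          also have "\<dots> = vec_index (row P a) (offset m k' + h' - 1)" by (rule scalar_prod_right_unit[OF b])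
          finally show ?thesis using P that b by simp
        qed
        then show "(\<Sum>a<n. Pinv $$ (j, a) * vec_index (P *\<^sub>v eps n (offset m k' + h')) a) = (if j = offset m k' + h' - 1 then 1 else 0)"
          using PiP[OF jn b] by simp
      qed
      finally have s: "(\<Sum>a<n. Pinv $$ (j, a) * cc a k') =
         (\<Sum>h' = 1..m k'. E * c k' h' i k h * exp (- mu k' * L) * (if j = offset m k' + h' - 1 then 1 else 0))" .
      show ?thesis unfolding s dYl_def sum_distrib_left
      proof (intro sum.cong refl)
        fix h' assume h': "h' \<in> {1..m k'}"
        have ep: "vec_index (eps N (n + offset m k' + h')) (n + j) = (if j = offset m k' + h' - 1 then 1 else 0)"
          using j h' N' by (auto simp: eps_def unit_vec_def)
        have cp: "cpow_arg (t i - t (p + 1)) (\<theta> i) (2 * lam i k - rho1 - mu q) = exp ((2 * lam0 - rho1 - rho2) * L)"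
          by (simp add: cpow_arg_def L_def \<tau>_def c0_def lam0_def rho2)
        \<comment> \<open>The exponents of \<tau> are - lam0 from \<open>K0\<close>, 2 lam0 - rho1 -
          rho2 from the formula and rho1 + rho2 - mu k' from the local solution. Their sum is lam0 -
          mu k', the exponent on the other side, and the phases with \<sigma> cancel.\<close>
        have ex: "K0 * (exp (of_real (\<sigma> * pi) * \<i> * lam0) * exp ((2 * lam0 - rho1 - rho2) * L)) * exp ((rho1 + rho2 - mu k') * L) = E * exp (- mu k' * L)"
          unfolding K0_def E_def exp_add[symmetric] by (rule arg_cong[of _ _ exp]) (simp add: algebra_simps)
        have Cx: "C \<sigma> k' h' i k h = (exp (of_real (\<sigma> * pi) * \<i> * lam0) * exp ((2 * lam0 - rho1 - rho2) * L)) * O.Gfac k' * c k' h' i k h"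
          unfolding C cp O.Gfac_def by (simp add: lam0_def rho2 rGamma_inverse_Gamma divide_inverse mult_ac)
        have "K0 * C \<sigma> k' h' i k h * exp ((rho1 + rho2 - mu k') * L) =
          (K0 * (exp (of_real (\<sigma> * pi) * \<i> * lam0) * exp ((2 * lam0 - rho1 - rho2) * L)) * exp ((rho1 + rho2 - mu k') * L)) * O.Gfac k' * c k' h' i k h"
          unfolding Cx by (simp only: mult_ac)
        also have "\<dots> = O.Gfac k' * (E * c k' h' i k h * exp (- mu k' * L))" unfolding ex by (simp only: mult_ac)
        finally have fin: "K0 * C \<sigma> k' h' i k h * exp ((rho1 + rho2 - mu k') * L) = O.Gfac k' * (E * c k' h' i k h * exp (- mu k' * L))" .
        show "K0 * C \<sigma> k' h' i k h * (exp ((rho1 + rho2 - mu k') * L) * vec_index (eps N (n + offset m k' + h')) (n + j)) =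
          O.Gfac k' * (E * c k' h' i k h * exp (- mu k' * L) * (if j = offset m k' + h' - 1 then 1 else 0))"
          unfolding ep mult.assoc[symmetric] using fin by simp
      qed
    qed
    have "\<exists>r. r analytic_on {0} \<and> (\<forall>\<^sub>F y in at 0 within Sg. W j y - Y j y = r y)" if j: "j < N" for j
    proof (rule O.connection[where GW = GW and dY = dYl])
      show "fps_nth (GW j) 0 = fps_nth (gw j) 0" if "j < n" "\<kappa> j = 1" for j
        using GW(2)[of j] gw(2)[OF that(1)] that(1) N' by (simp add: eps_def unit_vec_def)
      show "A $$ (j, a) = 0" if "j < n" "a < n" "\<kappa> j = 1" "\<kappa> a = 1" "a \<noteq> j" for j a
        using Ablk[OF that(1,2) \<kappa>1[OF that(1,3)] \<kappa>1[OF that(2,4)]] that(5) by simp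
      show "A $$ (j, j) = lam0 \<or> lam0 - A $$ (j, j) \<notin> \<int>" if "j < n" "\<kappa> j = 1" for j
        using Ablk[OF that(1,1) \<kappa>1[OF that] \<kappa>1[OF that]] lam_diff[OF ikh(1,2)] unfolding lam0_def by metis
      show "mh j = mu k' \<or> mh j - mu k' \<notin> \<int>" if "j < n" "k' \<in> {1..q}" for j k'
        using mu_diff[OF bm[OF that(1)] that(2)] unfolding mh_def by metis
    qed (fact W_hol GW(1) W_ode Y_hol Y0 Y_ode lead | use j N' in simp)+
    then obtain rr where rr: "\<And>j. j < N \<Longrightarrow> rr j analytic_on {0}" "\<And>j. j < N \<Longrightarrow> \<forall>\<^sub>F y in at 0 within Sg. W j y - Y j y = rr j y" by metis
    have "\<forall>\<^sub>F y in at 0 within Sg. \<forall>j\<in>{..<N}. W j y - Y j y = rr j y"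
      using rr(2) by (intro eventually_ball_finite) auto
    then obtain e1 where e1: "0 < e1" "\<And>y. y \<in> Sg \<Longrightarrow> y \<noteq> 0 \<Longrightarrow> dist y 0 < e1 \<Longrightarrow> \<forall>j\<in>{..<N}. W j y - Y j y = rr j y"
      unfolding eventually_at by blast
    have "\<exists>e>0. rr j holomorphic_on ball 0 e" if "j < N" for j using rr(1)[OF that] by (simp add: analytic_on_def)
    then obtain es where es: "\<And>j. j < N \<Longrightarrow> 0 < es j" "\<And>j. j < N \<Longrightarrow> rr j holomorphic_on ball 0 (es j)" by metis
    \<comment> \<open>One radius for all N analytic remainders, which also does not exceed the
      radius \<open>e1\<close> within which the N identities hold.\<close>
    define e2 where "e2 = Min (insert e1 (es ` {..<N}))"
    have e2: "0 < e2" "e2 \<le> e1" "\<And>j. j < N \<Longrightarrow> e2 \<le> es j" using e1(1) es(1) by (auto simp: e2_def Min_gr_iff)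
    define R where "R = cmod \<tau> * e2"
    have R0: "0 < R" using e2(1) t0 by (simp add: R_def)
    have inR: "(x - c0) / \<tau> \<in> ball 0 e2" if "x \<in> ball c0 R" for x
      using that t0 by (simp add: R_def dist_norm norm_divide norm_minus_commute divide_less_eq mult.commute)
    define Z where "Z = (\<lambda>x j. \<Sum>k' = 1..q - 1. \<Sum>h' = 1..m k'. C \<sigma> k' h' i k h * vec_index (Up k' h' x) j)"
    have YZ: "Y j y = K0 * Z (c0 + \<tau> * y) j" for j y
    proof -
      have "{1..<q} = {1..q - 1}" using q by auto
      then show ?thesis unfolding Y_def Z_def by (simp add: sum_distrib_left mult.assoc)
    qed
    \<comment> \<open>Near c0 the remainder is the analytic function just found. Outside the disc it
      is declared to be the difference itself, so that the formula holds on the whole sector while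
      holomorphy is asserted only near c0.\<close>
    define H where "H = (\<lambda>x. Matrix.vec N (\<lambda>j. if x \<in> ball c0 R then rr j ((x - c0) / \<tau>) / K0 else vec_index (Ut i k h x) j - Z x j))"
    have Hh: "(\<lambda>x. vec_index (H x) j) holomorphic_on ball c0 R" if j: "j < N" for j
    proof -
      have "rr j holomorphic_on ball 0 e2" by (rule holomorphic_on_subset[OF es(2)[OF j]]) (use e2(3)[OF j] in auto)
      then have "(rr j \<circ> (\<lambda>x. (x - c0) / \<tau>)) holomorphic_on ball c0 R"
        by (intro holomorphic_on_compose_gen[of _ _ _ "ball 0 e2"] holomorphic_intros) (use t0 inR in auto)
      then have "(\<lambda>x. (rr j \<circ> (\<lambda>x. (x - c0) / \<tau>)) x / K0) holomorphic_on ball c0 R" using K0 by (intro holomorphic_on_divide holomorphic_on_const)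
      then show ?thesis by (rule holomorphic_transform) (simp add: H_def j)
    qed
    have "vec_index (Ut i k h x) j = Z x j + vec_index (H x) j" if x: "x \<in> Sig" and j: "j < N" for x j
    proof (cases "x \<in> ball c0 R")
      case True
      obtain y where y: "y \<in> Sg" "x = c0 + \<tau> * y" using x by (auto simp: Sig Sg_def)
      have yx: "(x - c0) / \<tau> = y" using t0 by (simp add: y(2))
      have "dist y 0 < e1" using inR[OF True] e2(2) unfolding yx by (simp add: dist_norm)
      from e1(2)[OF y(1) y0(1)[OF y(1)] this] j have "W j y - Y j y = rr j y" by blast
      then have "K0 * (vec_index (Ut i k h x) j - Z x j) = rr j y" unfolding W_def YZ y(2) by (simp add: right_diff_distrib)
      then have "vec_index (Ut i k h x) j - Z x j = rr j y / K0" using K0 by (simp add: field_simps)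
      then show ?thesis using True j unfolding H_def yx by (simp add: algebra_simps)
    next
      case False
      then show ?thesis using j by (simp add: H_def)
    qed
    moreover have "hol_near N c0 H" unfolding hol_near_def using Hh R0 by (auto simp: H_def[symmetric]) (simp add: H_def)
    ultimately show ?thesis unfolding Z_def by (intro exI[of _ H] conjI ballI allI impI)
  qed
  have i1: "1 \<le> i" "i \<le> p" using ikh(1) by auto
  have d1: "\<delta> < \<theta> (i + 1) - \<theta> i" by (rule delta(2)[OF i1(2)])
  have d2: "\<delta> < \<theta> i - \<theta> (i - 1)" using delta(2)[of "i - 1"] i1 by simp
  have ip1: "\<theta> (i + 1) \<le> \<theta> (p + 1)" using theta_mono[of "i + 1" "p + 1"] i1 by (cases "i = p") auto
  have im1: "\<theta> 0 \<le> \<theta> (i - 1)"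
  proof (cases "i = 1")
    case False
    then have "i - 1 \<in> {1..p}" using i1 unfolding atLeastAtMost_iff by linarith
    from \<theta>b[OF this] show ?thesis by simp
  qed simp
  have up: "\<theta> (i + 1) \<le> \<theta> b" if "i < b" "b \<in> {1..p}" for b using theta_mono[of "i + 1" b] that by (cases "b = i + 1") auto
  have dn: "\<theta> b \<le> \<theta> (i - 1)" if b: "b < i" "b \<in> {1..p}" for b
  proof (cases "b = i - 1")
    case False
    then have "b < i - 1" "1 \<le> b" "i - 1 \<le> p + 1" using b i1 by auto
    then show ?thesis using theta_mono[of b "i - 1"] by simp
  qed simp
  \<comment> \<open>The opening angles stay below the distance to the neighbouring ray, by the
    margin \<delta>, and do not exceed \<pi>. Hence no other singular direction is met and the
    half-plane description of the sector applies.\<close>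
  define \<beta>1 where "\<beta>1 = min (\<theta> (i + 1) - \<delta>) (\<theta> i + pi) - \<theta> i"
  define \<beta>2 where "\<beta>2 = \<theta> i - max (\<theta> (i - 1) + \<delta>) (\<theta> i - pi)"
  have b1: "0 < \<beta>1" "\<beta>1 \<le> pi" "\<beta>1 < \<theta> (i + 1) - \<theta> i" using d1 delta(1) by (auto simp: \<beta>1_def)
  have b2: "0 < \<beta>2" "\<beta>2 \<le> pi" "\<beta>2 < \<theta> i - \<theta> (i - 1)" using d2 delta(1) by (auto simp: \<beta>2_def)
  have sp: "S_plus (t (p + 1)) \<theta> \<delta> i = (\<lambda>y. c0 + \<tau> * y) ` wedge 1 \<beta>1"
    unfolding S_plus_def c0_def[symmetric] using sector_wedge_plus[OF ta t0 b1(1,2), of c0] by (simp add: \<beta>1_def)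
  have sm: "S_minus (t (p + 1)) \<theta> \<delta> i = (\<lambda>y. c0 + \<tau> * y) ` wedge (- 1) \<beta>2"
    unfolding S_minus_def c0_def[symmetric] using sector_wedge_minus[OF ta t0 b2(1,2), of c0] by (simp add: \<beta>2_def)
  have "\<exists>H. hol_near N c0 H \<and> (\<forall>x\<in>S_plus (t (p + 1)) \<theta> \<delta> i. \<forall>j<N. vec_index (Ut i k h x) j =
      (\<Sum>k' = 1..q - 1. \<Sum>h' = 1..m k'. C 1 k' h' i k h * vec_index (Up k' h' x) j) + vec_index (H x) j)"
  proof (rule key[OF _ b1(1,2) sp])
    fix \<psi> :: real assume ps: "0 < \<psi>" "\<psi> < \<beta>1"
    have "\<theta> b \<noteq> \<theta> i + 1 * \<psi>" if b: "b \<in> {1..p}" for b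
    proof (cases "i < b")
      case True
      then show ?thesis using up[OF True b] ps b1 by linarith
    next
      case False
      then have "\<theta> b \<le> \<theta> i" using theta_mono[of b i] b i1 by (cases "b = i") auto
      then show ?thesis using ps by linarith
    qed
    then show "\<theta> 0 < \<theta> i + 1 * \<psi> \<and> \<theta> i + 1 * \<psi> < \<theta> (p + 1) \<and> (\<forall>b\<in>{1..p}. \<theta> b \<noteq> \<theta> i + 1 * \<psi>)"
      using \<theta>b[OF ikh(1)] ps b1 ip1 by auto
  qed (use ikh(1) S_all in auto)
  moreover have "\<exists>H. hol_near N c0 H \<and> (\<forall>x\<in>S_minus (t (p + 1)) \<theta> \<delta> i. \<forall>j<N. vec_index (Ut i k h x) j =
      (\<Sum>k' = 1..q - 1. \<Sum>h' = 1..m k'. C (- 1) k' h' i k h * vec_index (Up k' h' x) j) + vec_index (H x) j)"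
  proof (rule key[OF _ b2(1,2) sm])
    fix \<psi> :: real assume ps: "0 < \<psi>" "\<psi> < \<beta>2"
    have "\<theta> b \<noteq> \<theta> i + - 1 * \<psi>" if b: "b \<in> {1..p}" for b
    proof (cases "b < i")
      case True
      then show ?thesis using dn[OF True b] ps b2 by linarith
    next
      case False
      then have "\<theta> i \<le> \<theta> b" using theta_mono[of i b] b i1 by (cases "b = i") auto
      then show ?thesis using ps by linarith
    qed
    then show "\<theta> 0 < \<theta> i + - 1 * \<psi> \<and> \<theta> i + - 1 * \<psi> < \<theta> (p + 1) \<and> (\<forall>b\<in>{1..p}. \<theta> b \<noteq> \<theta> i + - 1 * \<psi>)"
      using \<theta>b[OF ikh(1)] ps b2 im1 by auto
  qed (use ikh(1) S_all in auto)
  ultimately show ?thesis unfolding c0_def by (rule conjI)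
qed

end
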